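(* Let $n$ be a positive odd integer, let $p_2,\dots,p_n$ be positive odd integers, and let $P=P(-1,p_2,\dots,p_n)$ be the corresponding pretzel knot (of odd type). Then $$u^{\Delta}(P)=-\frac14\sum_{i=2}^{n}p_i+\frac14\sum_{2\le i<j\le n}p_ip_j+\frac18(n-1)\quad\bigl(=a_2(P)\bigr),$$ where $u^{\Delta}(P)$ is the $\Delta$-unknotting number of $P$ and $a_2(P)$ is the second coefficient of its Conway polynomial.
   Context: A $\Delta$-move is a local move on knot diagrams. Inside a disk, the diagram consists of three arcs, each pair crossing exactly once, bounding a small triangle, with cyclic over/under information (arc 1 passes over arc 2, arc 2 over arc 3, arc 3 over arc 1, up to relabelling). The move replaces this by the diagram with the same endpoints obtained by pushing one arc across the crossing of the other two (so the triangle is reversed, as in a Reidemeister III move), keeping the over/under information of each pair. Diagrams may also be changed by ambient isotopy (Reidemeister moves). Any two knots are related by finitely many $\Delta$-moves (Murakami–Nakanishi). The $\Delta$-Gordian distance $d_G^{\Delta}(K,K')$ is the minimum number of $\Delta$-moves needed to deform $K$ into $K'$, and the $\Delta$-unknotting number is $u^{\Delta}(K)=d_G^{\Delta}(K,O)$, with $O$ the trivial knot. The Conway polynomial $\nabla_L(z)$ is defined by $\nabla_O=1$ and $\nabla_{L_+}-\nabla_{L_-}=z\nabla_{L_0}$; for a knot $K$, $a_2(K)$ is the coefficient of $z^2$. The pretzel link $P(p_1,\dots,p_n)$ is obtained from $n$ vertical two-strand twisted columns (twisted bands) placed side by side, the $i$-th having $|p_i|$ half-twists (crossings) with handedness given by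 the sign of $p_i$, by joining adjacent columns cyclically at the top and at the bottom in the standard way. It is a knot iff exactly one $p_i$ is even, or all $p_i$ are odd and $n$ is odd; in the latter case it is called of odd type. Knots are not distinguished from their mirror images ($u^\Delta$ and $a_2$ are invariant under mirror image). *)

theory Defs
  imports Complex_Main "HOL-Computational_Algebra.Polynomial"
begin

section \<open>Unoriented link diagrams\<close>

text \<open>
  A planar link diagram in Morse position with respect to the height function is recorded, from bottom
  to top, as a list of layers. A layer \<open>(i, g)\<close> consists of one elementary piece \<open>g\<close> with
  \<open>i\<close> vertical strands on its left; the vertical strands on its right are left implicit.
  In \<open>Cross b\<close> the strand running from bottom left to top right is the upper one iff \<open>b\<close> holds.
\<close>

datatype gen = Cup | Cap | Cross bool

type_synonym layer = "nat \<times> gen"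
type_synonym diagram = "layer list"

fun ins :: "gen \<Rightarrow> nat" where
  "ins Cup = 0"
| "ins Cap = 2"
| "ins (Cross b) = 2"

fun outs :: "gen \<Rightarrow> nat" where
  "outs Cup = 2"
| "outs Cap = 0"
| "outs (Cross b) = 2"

fun tangle :: "nat \<Rightarrow> diagram \<Rightarrow> nat \<Rightarrow> bool" where
  "tangle n [] m \<longleftrightarrow> n = m"
| "tangle n ((i, g) # D) m \<longleftrightarrow> i + ins g \<le> n \<and> tangle (n - ins g + outs g) D m"

definition link_diagram :: "diagram \<Rightarrow> bool" where
  "link_diagram D \<longleftrightarrow> tangle 0 D 0"

definition trivial_knot :: diagram where
  "trivial_knot = [(0, Cup), (0, Cap)]"


section \<open>Isotopy and delta moves\<close>

text \<open>
  The generating local moves for ambient isotopy of diagrams in Morse position. The first five rules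
  are planar isotopies (exchange of the heights of two distant pieces, cancellation of a minimum
  with a maximum) and sliding a strand across a minimum or a maximum; these, together with
  the remaining rules, generate all planar isotopies and Reidemeister moves, in every position.
  In \<open>reidemeister3\<close> the Booleans \<open>a\<close>, \<open>b\<close>, \<open>c\<close> record the over/under information of the pairs
  (first, second), (first, third), (second, third) of strands, counted from the left at the bottom.
  It is cyclic exactly if \<open>a = c\<close> and \<open>b \<noteq> a\<close>.
\<close>

inductive isotopy_rule :: "diagram \<Rightarrow> diagram \<Rightarrow> bool" where
  exchange: "isotopy_rule [(i, g), (i + outs g + k, h)] [(i + ins g + k, h), (i, g)]"
| zigzag_left: "isotopy_rule [(i, Cup), (i + 1, Cap)] []"
| zigzag_right: "isotopy_rule [(i + 1, Cup), (i, Cap)] []"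
| slide_cup: "isotopy_rule [(i, Cup), (i + 1, Cross b)] [(i + 1, Cup), (i, Cross (\<not> b))]"
| slide_cap: "isotopy_rule [(i + 1, Cross b), (i, Cap)] [(i, Cross (\<not> b)), (i + 1, Cap)]"
| reidemeister1_cup: "isotopy_rule [(i, Cup), (i, Cross b)] [(i, Cup)]"
| reidemeister1_cap: "isotopy_rule [(i, Cross b), (i, Cap)] [(i, Cap)]"
| reidemeister2: "isotopy_rule [(i, Cross b), (i, Cross (\<not> b))] []"
| reidemeister3: "\<not> (a = c \<and> b \<noteq> a) \<Longrightarrow>
    isotopy_rule [(i, Cross a), (i + 1, Cross b), (i, Cross c)]
                 [(i + 1, Cross c), (i, Cross b), (i + 1, Cross a)]"

text \<open>
  The delta move is the same reversal of a triangle in the cyclic case; up to planar isotopy the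
  three arcs of the triangle may be taken to run upwards.
\<close>

inductive delta_rule :: "diagram \<Rightarrow> diagram \<Rightarrow> bool" where
  delta: "a = c \<Longrightarrow> b \<noteq> a \<Longrightarrow>
    delta_rule [(i, Cross a), (i + 1, Cross b), (i, Cross c)]
               [(i + 1, Cross c), (i, Cross b), (i + 1, Cross a)]"

definition local_change :: "(diagram \<Rightarrow> diagram \<Rightarrow> bool) \<Rightarrow> diagram \<Rightarrow> diagram \<Rightarrow> bool" where
  "local_change R D D' \<longleftrightarrow> link_diagram D \<and> link_diagram D' \<and>
     (\<exists>u l r v. D = u @ l @ v \<and> D' = u @ r @ v \<and> (R l r \<or> R r l))"

definition isotopic :: "diagram \<Rightarrow> diagram \<Rightarrow> bool" where
  "isotopic = (local_change isotopy_rule)\<^sup>*\<^sup>*"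

definition delta_move :: "diagram \<Rightarrow> diagram \<Rightarrow> bool" where
  "delta_move = local_change delta_rule"

definition delta_related :: "nat \<Rightarrow> diagram \<Rightarrow> diagram \<Rightarrow> bool" where
  "delta_related n = isotopic OO ((delta_move OO isotopic) ^^ n)"

definition delta_gordian_distance :: "diagram \<Rightarrow> diagram \<Rightarrow> nat" where
  "delta_gordian_distance D D' = (LEAST n. delta_related n D D')"

definition delta_unknotting_number :: "diagram \<Rightarrow> nat" where
  "delta_unknotting_number D = delta_gordian_distance D trivial_knot"


section \<open>Oriented link diagrams\<close>

text \<open>
  The directions of the strands at a given height are listed from left to right, \<open>True\<close> meaning
  upwards. In an oriented diagram every layer is preceded by the directions just below it.
\<close>

type_synonym oriented_diagram = "(bool list \<times> layer) list"

inductive flow :: "gen \<Rightarrow> bool list \<Rightarrow> bool list \<Rightarrow> bool" where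
  "flow Cup [] [a, \<not> a]"
| "flow Cap [a, \<not> a] []"
| "flow (Cross b) [a, c] [c, a]"

fun oriented_tangle :: "bool list \<Rightarrow> oriented_diagram \<Rightarrow> bool list \<Rightarrow> bool" where
  "oriented_tangle s [] t \<longleftrightarrow> s = t"
| "oriented_tangle s ((s', i, g) # E) t \<longleftrightarrow> s' = s \<and>
     (\<exists>x p q y. s = x @ p @ y \<and> length x = i \<and> flow g p q \<and> oriented_tangle (x @ q @ y) E t)"

definition orientation_of :: "oriented_diagram \<Rightarrow> diagram \<Rightarrow> bool" where
  "orientation_of E D \<longleftrightarrow> oriented_tangle [] E [] \<and> map snd E = D"

definition oriented_isotopy_step :: "oriented_diagram \<Rightarrow> oriented_diagram \<Rightarrow> bool" where
  "oriented_isotopy_step E E' \<longleftrightarrow> (\<exists>u l r v s t. E = u @ l @ v \<and> E' = u @ r @ v \<and>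
     oriented_tangle [] u s \<and> oriented_tangle s l t \<and> oriented_tangle s r t \<and> oriented_tangle t v [] \<and>
     (isotopy_rule (map snd l) (map snd r) \<or> isotopy_rule (map snd r) (map snd l)))"


section \<open>The Conway polynomial\<close>

text \<open>
  \<open>skein_local s t l\<^sub>+ l\<^sub>- l\<^sub>0\<close>: a positive crossing, a negative crossing and their oriented smoothing,
  all with directions \<open>s\<close> below and \<open>t\<close> above. If exactly one of the two strands
  runs downwards, the sign of the crossing is reversed and the smoothing is a maximum below a minimum.
\<close>

inductive skein_local :: "bool list \<Rightarrow> bool list \<Rightarrow>
    oriented_diagram \<Rightarrow> oriented_diagram \<Rightarrow> oriented_diagram \<Rightarrow> bool" where
  parallel: "s = x @ [a, a] @ y \<Longrightarrow> i = length x \<Longrightarrow>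
    skein_local s s [(s, i, Cross True)] [(s, i, Cross False)] []"
| antiparallel: "s = x @ [a, \<not> a] @ y \<Longrightarrow> t = x @ [\<not> a, a] @ y \<Longrightarrow> i = length x \<Longrightarrow>
    skein_local s t [(s, i, Cross False)] [(s, i, Cross True)] [(s, i, Cap), (x @ y, i, Cup)]"

definition skein_triple :: "oriented_diagram \<Rightarrow> oriented_diagram \<Rightarrow> oriented_diagram \<Rightarrow> bool" where
  "skein_triple Ep Em E0 \<longleftrightarrow> (\<exists>u v s t lp lm l0.
     oriented_tangle [] u s \<and> skein_local s t lp lm l0 \<and> oriented_tangle t v [] \<and>
     Ep = u @ lp @ v \<and> Em = u @ lm @ v \<and> E0 = u @ l0 @ v)"

text \<open>
  All values forced by the normalisation, isotopy invariance and the skein relation; \<open>[:0, 1:]\<close> is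
  the variable of the polynomial. The last rule is needed to reach split links.
\<close>

inductive has_conway :: "oriented_diagram \<Rightarrow> int poly \<Rightarrow> bool" where
  trivial: "orientation_of E trivial_knot \<Longrightarrow> has_conway E 1"
| isotopy: "has_conway E P \<Longrightarrow> oriented_isotopy_step E E' \<Longrightarrow> has_conway E' P"
| skein_plus: "skein_triple Ep Em E0 \<Longrightarrow> has_conway Em P \<Longrightarrow> has_conway E0 Q \<Longrightarrow>
    has_conway Ep (P + [:0, 1:] * Q)"
| skein_minus: "skein_triple Ep Em E0 \<Longrightarrow> has_conway Ep P \<Longrightarrow> has_conway E0 Q \<Longrightarrow>
    has_conway Em (P - [:0, 1:] * Q)"
| skein_zero: "skein_triple Ep Em E0 \<Longrightarrow> has_conway Ep P \<Longrightarrow> has_conway Em Q \<Longrightarrow>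
    P - Q = [:0, 1:] * R \<Longrightarrow> has_conway E0 R"

definition conway :: "oriented_diagram \<Rightarrow> int poly" where
  "conway E = (THE P. has_conway E P)"

text \<open>The Conway polynomial of a knot does not depend on the orientation chosen.\<close>

definition a2 :: "diagram \<Rightarrow> int" where
  "a2 D = coeff (conway (SOME E. orientation_of E D)) 2"


section \<open>Pretzel links\<close>

text \<open>
  Column \<open>k\<close> (counted from 0) occupies the strands \<open>2 * k\<close> and \<open>2 * k + 1\<close>. The outermost minimum and
  maximum join the first column to the last one. The opposite choice of handedness for
  positive entries yields the mirror image.
\<close>

definition pretzel :: "int list \<Rightarrow> diagram" where
  "pretzel ps =
     [(0, Cup)] @ map (\<lambda>k. (2 * k + 1, Cup)) [0..<length ps - 1] @
     concat (map (\<lambda>k. replicate (nat \<bar>ps ! k\<bar>) (2 * k, Cross (ps ! k > 0))) [0..<length ps]) @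
     rev (map (\<lambda>k. (2 * k + 1, Cap)) [0..<length ps - 1]) @ [(0, Cap)]"

end

theory Submission
  imports Defs "HOL-Computational_Algebra.Formal_Power_Series" "HOL-Library.Multiset"
begin

text \<open>
  Lower bound: put \<open>A = exp h\<close> in the Kauffman bracket of a knot diagram and let \<open>J\<close> be the quadratic
  coefficient in \<open>h\<close> of its logarithm. Isotopies multiply the bracket by powers of \<open>- A\<^sup>3\<close>, which does
  not affect \<open>J\<close>. A delta move changes \<open>J\<close> by at most 48: the difference of the brackets of the two
  triangles is a factor vanishing to second order at \<open>h = 0\<close> times the difference of two smoothings,
  whose values at \<open>A = 1\<close> are signed powers of 2.
  Resolving columns one at a time gives \<open>J\<close> of a pretzel knot.

  Upper bound: in a pretzel knot with columns \<open>p, p\<^sub>2, \<dots>, p\<^sub>n\<close> a full twist of the first column is removed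
  by passing a strand around all other columns, at a cost of \<open>(p\<^sub>2 + \<dots> + p\<^sub>n) / 2\<close> delta moves.
  Columns are reduced in this way to \<open>1\<close> or \<open>-1\<close> and cancelled in pairs; the total cost is the lower bound.

  Conway polynomial: that \<open>has_conway\<close> assigns at most one value is shown by the state sums of the
  \<open>sl\<^sub>N\<close> R-matrices. With \<open>a = q^N\<close>, divided by their value at the unknot, they are Laurent polynomials in \<open>a\<close>
  which take the value \<open>P(q - 1 / q)\<close> at \<open>a = 1\<close>, and a Laurent polynomial is determined
  by its values at the points \<open>q^N\<close>. The coefficients themselves follow from the skein relation in a
  column, whose smoothing deletes the column.
\<close>

section \<open>Moves between tangles\<close>

text \<open>On knots \<open>J\<close> is \<open>2 - 48 * a2\<close>: the second derivative of the
  Jones polynomial at 1 is \<open>- 6 * a2\<close>, and \<open>A = exp h\<close> puts its variable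
  at \<open>exp (- 4 h)\<close>. The lower bound is thus the absolute value of \<open>a2\<close>;
  the bracket is used for it because it needs no orientation. The constant 48 is 16 * 6 / 2: the
  factor in the difference of two triangles starts with \<open>- 16 h^2\<close>, the two smoothings
  of a triangle in a knot differ by at most 6 at \<open>A = 1\<close>, and the bracket of a knot is
  2 or -2 there.

  \<open>a2\<close> is defined through \<open>THE\<close>, so nothing can be said about it before
  the forced values are known to be unique, and for this a genuine model of the Conway polynomial is
  required. In the R-matrix family this model would be \<open>a = 1\<close>, that is
  \<open>N = 0\<close>; but then there are no labels, and the division by the value of the unknot
  becomes 0 / 0. This is the reason for treating all \<open>N\<close> together and
  interpolating.\<close>

fun ok :: "nat \<Rightarrow> diagram \<Rightarrow> bool" where
  "ok n [] \<longleftrightarrow> True"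
| "ok n ((i, Cup) # D) \<longleftrightarrow> i \<le> n \<and> ok (n + 2) D"
| "ok n ((i, Cap) # D) \<longleftrightarrow> i + 2 \<le> n \<and> ok (n - 2) D"
| "ok n ((i, Cross b) # D) \<longleftrightarrow> i + 2 \<le> n \<and> ok n D"

fun out :: "nat \<Rightarrow> diagram \<Rightarrow> nat" where
  "out n [] = n"
| "out n ((i, Cup) # D) = out (n + 2) D"
| "out n ((i, Cap) # D) = out (n - 2) D"
| "out n ((i, Cross b) # D) = out n D"

lemma tangle_iff: "tangle n D m \<longleftrightarrow> ok n D \<and> out n D = m"
proof (induction n D rule: ok.induct)
  case (4 n i b D)
  have "n - 2 + 2 = n" if "i + 2 \<le> n" using that by simp
  with 4 show ?case by (auto simp del: add_2_eq_Suc')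
qed auto

lemma ok_append [simp]: "ok n (D @ E) \<longleftrightarrow> ok n D \<and> ok (out n D) E"
  by (induction n D rule: ok.induct) auto

lemma out_append [simp]: "out n (D @ E) = out (out n D) E"
  by (induction n D rule: ok.induct) auto

text \<open>Strands to the right of all pieces are implicit, so adding \<open>w\<close> of them
  changes only the count. Room on the left requires the shift \<open>sh\<close>.\<close>

lemma ok_widen: "ok n D \<Longrightarrow> ok (n + w) D \<and> out (n + w) D = out n D + w"
proof (induction n D rule: ok.induct)
  case (2 n i D)
  then show ?case by (auto simp: algebra_simps)
next
  case (3 n i D)
  then show ?case by (auto simp: algebra_simps)
qed auto

definition sh :: "nat \<Rightarrow> diagram \<Rightarrow> diagram" where
  "sh k D = map (\<lambda>(i, g). (i + k, g)) D"

lemma sh_simps [simp]: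
  "sh k [] = []" "sh k ((i, g) # D) = (i + k, g) # sh k D" "sh k (D @ E) = sh k D @ sh k E"
  "sh j (sh k D) = sh (k + j) D" "sh 0 D = D" "sh k D = [] \<longleftrightarrow> D = []"
  by (auto simp: sh_def map_idI)

lemma ok_sh [simp]: "ok (n + j) (sh j D) \<longleftrightarrow> ok n D"
  and out_sh: "ok n D \<Longrightarrow> out (n + j) (sh j D) = out n D + j"
proof (induction n D rule: ok.induct)
  case (3 n i D)
  { case 1 then show ?case using 3 by (cases "i + 2 \<le> n") auto }
  { case 2 then show ?case using 3 by (cases "i + 2 \<le> n") auto }
next
  case (2 n i D)
  { case 1 then show ?case using 2(1) by (auto simp: algebra_simps) }
  { case 2 then show ?case using 2 \<open>ok (n + 2) D \<Longrightarrow> out (n + 2 + j) (sh j D) = out (n + 2) D + j\<close>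
      by (auto simp: algebra_simps) }
qed auto

lemma ok_sh': "j \<le> n \<Longrightarrow> ok n (sh j D) \<longleftrightarrow> ok (n - j) D"
  using ok_sh[of "n - j" j D] by simp

lemma out_sh': "j \<le> n \<Longrightarrow> ok (n - j) D \<Longrightarrow> out n (sh j D) = out (n - j) D + j"
  using out_sh[of "n - j" D j] by simp

lemma isotopy_rule_sh:
  assumes "isotopy_rule l r" shows "isotopy_rule (sh j l) (sh j r)"
  using assms
proof cases
  case (exchange i g k h)
  then show ?thesis using isotopy_rule.exchange[of "i + j" g k h] by (simp add: algebra_simps)
next
  case (zigzag_left i)
  then show ?thesis using isotopy_rule.zigzag_left[of "i + j"] by (simp add: algebra_simps)
next
  case (zigzag_right i)
  then show ?thesis using isotopy_rule.zigzag_right[of "i + j"] by (simp add: algebra_simps)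
next
  case (slide_cup i b)
  then show ?thesis using isotopy_rule.slide_cup[of "i + j" b] by (simp add: algebra_simps)
next
  case (slide_cap i b)
  then show ?thesis using isotopy_rule.slide_cap[of "i + j" b] by (simp add: algebra_simps)
next
  case (reidemeister1_cup i b)
  then show ?thesis using isotopy_rule.reidemeister1_cup[of "i + j" b] by (simp add: algebra_simps)
next
  case (reidemeister1_cap i b)
  then show ?thesis using isotopy_rule.reidemeister1_cap[of "i + j" b] by (simp add: algebra_simps)
next
  case (reidemeister2 i b)
  then show ?thesis using isotopy_rule.reidemeister2[of "i + j" b] by (simp add: algebra_simps)
next
  case (reidemeister3 a c b i)
  then show ?thesis using isotopy_rule.reidemeister3[of a c b "i + j"] by (simp add: algebra_simps)
qed

lemma delta_rule_sh:
  assumes "delta_rule l r" shows "delta_rule (sh j l) (sh j r)"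
  using assms
proof cases
  case (delta a c b i)
  then show ?thesis using delta_rule.delta[of a c b "i + j"] by (simp add: algebra_simps)
qed

definition tangle_change :: "(diagram \<Rightarrow> diagram \<Rightarrow> bool) \<Rightarrow> nat \<Rightarrow> diagram \<Rightarrow> diagram \<Rightarrow> bool" where
  "tangle_change R n D D' \<longleftrightarrow> ok n D \<and> ok n D' \<and> out n D = out n D' \<and>
     (\<exists>u l r v. D = u @ l @ v \<and> D' = u @ r @ v \<and> (R l r \<or> R r l))"

text \<open>In \<open>moves n k D E\<close> the tangles start from \<open>n\<close> strands, and \<open>k\<close> counts the delta moves.\<close>

inductive moves :: "nat \<Rightarrow> nat \<Rightarrow> diagram \<Rightarrow> diagram \<Rightarrow> bool" for n where
  moves_refl: "ok n D \<Longrightarrow> moves n 0 D D"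
| moves_iso: "moves n k D E \<Longrightarrow> tangle_change isotopy_rule n E F \<Longrightarrow> moves n k D F"
| moves_delta: "moves n k D E \<Longrightarrow> tangle_change delta_rule n E F \<Longrightarrow> moves n (Suc k) D F"

lemma moves_ok: "moves n k D E \<Longrightarrow> ok n D \<and> ok n E \<and> out n D = out n E"
  by (induction rule: moves.induct) (auto simp: tangle_change_def)

lemmas moves_ok1 = moves_ok[THEN conjunct1]
  and moves_ok2 = moves_ok[THEN conjunct2, THEN conjunct1]
  and moves_out = moves_ok[THEN conjunct2, THEN conjunct2]

lemma moves_trans: "moves n j D E \<Longrightarrow> moves n k E F \<Longrightarrow> moves n (j + k) D F"
proof (rotate_tac, induction rule: moves.induct)
  case (moves_iso k D E F)
  then show ?case by (blast intro: moves.moves_iso)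
next
  case (moves_delta k D E F)
  then show ?case using moves.moves_delta by fastforce
qed auto

lemma moves_trans0 [trans]:
  "moves n 0 D E \<Longrightarrow> moves n k E F \<Longrightarrow> moves n k D F"
  "moves n k D E \<Longrightarrow> moves n 0 E F \<Longrightarrow> moves n k D F"
  using moves_trans by fastforce+

lemma tangle_change_sym: "tangle_change R n D E \<Longrightarrow> tangle_change R n E D"
  unfolding tangle_change_def by metis

lemma moves_isotopic1: "tangle_change isotopy_rule n D E \<Longrightarrow> moves n 0 D E"
  by (rule moves_iso[OF moves_refl]) (auto simp: tangle_change_def)

lemma moves_delta1: "tangle_change delta_rule n D E \<Longrightarrow> moves n 1 D E"
  using moves_delta[OF moves_refl] by (auto simp: tangle_change_def)

lemma moves_sym: "moves n k D E \<Longrightarrow> moves n k E D"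
proof (induction rule: moves.induct)
  case (moves_iso k D E F)
  then show ?case using moves_trans0(1)[OF moves_isotopic1[OF tangle_change_sym]] by blast
next
  case (moves_delta k D E F)
  then show ?case using moves_trans[OF moves_delta1[OF tangle_change_sym]] by fastforce
qed (rule moves_refl)

lemma tangle_change_context:
  assumes R: "\<And>l r. R l r \<Longrightarrow> R (sh j l) (sh j r)"
    and "tangle_change R m D E" "ok n u" "m + j \<le> out n u" "ok n (u @ sh j D @ v)"
  shows "tangle_change R n (u @ sh j D @ v) (u @ sh j E @ v)"
proof -
  obtain u' l r v' where *: "D = u' @ l @ v'" "E = u' @ r @ v'" "R l r \<or> R r l"
    using assms(2) by (auto simp: tangle_change_def)
  define w where "w = out n u - (m + j)"
  have w: "out n u = (m + w) + j" using assms(4) by (simp add: w_def)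
  have D: "ok m D" "ok m E" "out m D = out m E" using assms(2) by (auto simp: tangle_change_def)
  have D': "ok (m + w) D" "ok (m + w) E" "out (m + w) D = out (m + w) E"
    using D ok_widen by auto
  have "ok (out n u) (sh j D)" "ok (out n u) (sh j E)" "out (out n u) (sh j D) = out (out n u) (sh j E)"
    using D' unfolding w by (auto simp: out_sh)
  moreover have "u @ sh j D @ v = (u @ sh j u') @ sh j l @ (sh j v' @ v)"
    "u @ sh j E @ v = (u @ sh j u') @ sh j r @ (sh j v' @ v)" by (auto simp: *)
  ultimately show ?thesis using assms(3,5) *(3) R unfolding tangle_change_def
    by (metis ok_append out_append)
qed

text \<open>Locality: \<open>sh j\<close> makes room on the left and \<open>ok_widen\<close> on the
  right, so an identity is proved once on the fewest strands and then used anywhere in a larger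
  diagram.\<close>

lemma moves_context:
  assumes "moves m k D E" "ok n u" "m + j \<le> out n u" "ok n (u @ sh j D @ v)"
  shows "moves n k (u @ sh j D @ v) (u @ sh j E @ v)"
  using assms
proof (induction rule: moves.induct)
  case (moves_refl D)
  then show ?case by (intro moves.moves_refl)
next
  case (moves_iso k D E F)
  then have 1: "moves n k (u @ sh j D @ v) (u @ sh j E @ v)" by blast
  then show ?case
    using moves.moves_iso[OF 1 tangle_change_context[OF isotopy_rule_sh moves_iso.hyps(2)]]
      moves_ok[OF 1] moves_iso.prems by blast
next
  case (moves_delta k D E F)
  then have 1: "moves n k (u @ sh j D @ v) (u @ sh j E @ v)" by blast
  then show ?case
    using moves.moves_delta[OF 1 tangle_change_context[OF delta_rule_sh moves_delta.hyps(2)]]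
      moves_ok[OF 1] moves_delta.prems by blast
qed

text \<open>Source and target enter through equations, so that once \<open>u\<close>,
  \<open>v\<close> and \<open>j\<close> are named the regrouping of concatenated lists is left to
  \<open>simp\<close>. The long chains below consist of this rule.\<close>

lemma moves_subst:
  assumes "moves m k D E" "X = u @ sh j D @ v" "Y = u @ sh j E @ v" "m + j \<le> out n u" "ok n X"
  shows "moves n k X Y"
  using moves_context[OF assms(1), of n u j v] assms(2-) by auto

lemma moves_subst_rev:
  assumes "moves m k D E" "X = u @ sh j E @ v" "Y = u @ sh j D @ v" "m + j \<le> out n u" "ok n X"
  shows "moves n k X Y"
  using moves_subst[OF moves_sym[OF assms(1)] assms(2-)] .

lemma tangle_change_rule:
  assumes "R l r" "ok n l" "ok n r" "out n l = out n r" shows "tangle_change R n l r"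
proof -
  have "l = [] @ l @ []" "r = [] @ r @ []" by auto
  with assms show ?thesis unfolding tangle_change_def by blast
qed

lemmas isotopy_rule_moves = moves_isotopic1[OF tangle_change_rule[of isotopy_rule]]
lemmas delta_rule_moves = moves_delta1[OF tangle_change_rule[of delta_rule]]

lemma local_change_tangle_change:
  "local_change R D E \<longleftrightarrow> tangle_change R 0 D E \<and> link_diagram D \<and> link_diagram E"
  by (auto simp: local_change_def tangle_change_def link_diagram_def tangle_iff)

lemma moves_delta_related:
  assumes "moves 0 k D E" "link_diagram D" shows "delta_related k D E"
  using assms
proof (induction rule: moves.induct)
  case (moves_refl D)
  then show ?case by (auto simp: delta_related_def isotopic_def)
next
  case (moves_iso k D E F)
  then have "link_diagram E" "link_diagram F"
    using moves_ok[OF moves_iso.hyps(1)] by (auto simp: link_diagram_def tangle_iff tangle_change_def)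
  then have EF: "local_change isotopy_rule E F"
    using moves_iso.hyps(2) by (simp add: local_change_tangle_change)
  have DE: "delta_related k D E" using moves_iso by blast
  \<comment> \<open>For \<open>k = 0\<close> there is only the leading isotopy; otherwise the last
    isotopy belongs to the last factor of the relational power. The new step extends whichever comes
    last.\<close>
  show ?case
  proof (cases k)
    case 0
    then show ?thesis using DE EF unfolding delta_related_def isotopic_def
      by (auto intro: rtranclp.rtrancl_into_rtrancl)
  next
    case (Suc j)
    then show ?thesis using DE EF unfolding delta_related_def isotopic_def
      by (force intro: rtranclp.rtrancl_into_rtrancl simp: relpowp.simps)
  qed
next
  case (moves_delta k D E F)
  then have "link_diagram E" "link_diagram F"
    using moves_ok[OF moves_delta.hyps(1)] by (auto simp: link_diagram_def tangle_iff tangle_change_def)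
  then have "delta_move E F"
    using moves_delta.hyps(2) by (simp add: local_change_tangle_change delta_move_def)
  moreover have "isotopic F F" by (simp add: isotopic_def)
  moreover have DE: "delta_related k D E" using moves_delta by blast
  ultimately show ?case unfolding delta_related_def
    by (auto simp: relcompp.simps)
qed

section \<open>Exchanging the heights of tangles lying side by side\<close>

lemma exchange_moves:
  assumes "ok n [(i, g), (i + outs g + k, h)]"
  shows "moves n 0 [(i, g), (i + outs g + k, h)] [(i + ins g + k, h), (i, g)]"
  by (rule isotopy_rule_moves[OF isotopy_rule.exchange])
    (cases g; cases h; use assms in auto)+

text \<open>The piece \<open>g\<close> is pulled down through the layers of \<open>D\<close>, the
  topmost first. Its gap \<open>k\<close> to the right edge of \<open>D\<close> stays constant while
  its position follows the width of \<open>D\<close>.\<close>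

lemma exchange_left:
  assumes "ok w D" "w + k + ins g \<le> n"
  shows "moves n 0 (D @ [(out w D + k, g)]) ((w + k, g) # D)"
  using assms
proof (induction D arbitrary: w n)
  case Nil
  then show ?case by (cases g) (auto intro: moves_refl)
next
  case (Cons jh D)
  obtain j h where [simp]: "jh = (j, h)" by fastforce
  define w1 where "w1 = w - ins h + outs h"
  define n1 where "n1 = n - ins h + outs h"
  have jw: "j + ins h \<le> w" using Cons.prems(1) by (cases h) auto
  have nw: "w \<le> n" using Cons.prems(2) by simp
  have "Suc (Suc (x - 2)) = x" if "w \<le> x" "Suc (Suc j) \<le> w" for x using that by simp
  note e = this[OF order_refl] this[OF nw]
  have o: "out w (jh # D) = out w1 D" using jw by (cases h) (auto simp: w1_def e)
  have o': "out n [jh] = n1" using jw by (cases h) (auto simp: n1_def e)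
  have "ok w1 D" using jw Cons.prems(1) by (cases h) (auto simp: w1_def e)
  with jw have j: "j + ins h \<le> w" "ok w1 D" by auto
  have n: "w1 + k + ins g \<le> n1" using Cons.prems j by (auto simp: w1_def n1_def)
  have 1: "moves n1 0 (D @ [(out w1 D + k, g)]) ((w1 + k, g) # D)" by (rule Cons.IH[OF j(2) n])
  have ok1: "ok n [jh]" using j Cons.prems by (cases h) auto
  have "moves n 0 ([jh] @ sh 0 (D @ [(out w1 D + k, g)]) @ []) ([jh] @ sh 0 ((w1 + k, g) # D) @ [])"
  proof (rule moves_context[OF 1 ok1])
    show "ok n ([jh] @ sh 0 (D @ [(out w1 D + k, g)]) @ [])"
      using ok1 moves_ok1[OF 1] by (simp only: ok_append append_Nil2 sh_simps o' add_0_right simp_thms)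
  qed (simp only: o' add_0_right order_refl)
  then have 2: "moves n 0 (jh # D @ [(out w (jh # D) + k, g)]) (jh # (w1 + k, g) # D)"
    unfolding o by simp
  define d where "d = w1 + k - (j + outs h)"
  have d: "w1 + k = j + outs h + d" using j by (simp add: d_def w1_def)
  have d': "w + k = j + ins h + d" using d j by (auto simp: w1_def)
  have 3: "moves n 0 [(j, h), (j + outs h + d, g)] [(j + ins h + d, g), (j, h)]"
    by (rule exchange_moves) (use n d j Cons.prems in \<open>cases g; cases h; auto simp: n1_def e\<close>)
  have "moves n 0 ([] @ sh 0 [(j, h), (j + outs h + d, g)] @ D) ([] @ sh 0 [(j + ins h + d, g), (j, h)] @ D)"
    by (rule moves_context[OF 3]) (use moves_ok2[OF 2] d in auto)
  then have "moves n 0 (jh # (w1 + k, g) # D) ((w + k, g) # jh # D)" by (simp add: d d')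
  with 2 show ?case by (metis moves_trans0(1) append_Cons)
qed

text \<open>Iterates \<open>exchange_left\<close> over the pieces of \<open>E\<close>, the lowest
  first. From the left there are \<open>w\<close> strands for \<open>D\<close>, then
  \<open>k\<close> idle ones, then those of \<open>E\<close>.\<close>

lemma exchange_lists:
  assumes "ok w D" "w + k \<le> n" "ok (n - (w + k)) E"
  shows "moves n 0 (D @ sh (out w D + k) E) (sh (w + k) E @ D)"
  using assms(2,3)
proof (induction E arbitrary: n)
  case Nil
  then show ?case using ok_widen[OF assms(1), of "n - w"] by (auto intro: moves_refl)
next
  case (Cons jh E)
  obtain j h where [simp]: "jh = (j, h)" by fastforce
  have j: "w + (k + j) + ins h \<le> n" using Cons.prems by (cases h) auto
  have 1: "moves n 0 (D @ [(out w D + (k + j), h)]) ((w + (k + j), h) # D)"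
    by (rule exchange_left[OF assms(1) j])
  define n1 where "n1 = n - ins h + outs h"
  have n1: "out n [(w + (k + j), h)] = n1" using j by (cases h) (auto simp: n1_def)
  have "n1 - (w + k) = n - (w + k) - ins h + outs h" using j by (simp add: n1_def)
  then have n1': "w + k \<le> n1" "ok (n1 - (w + k)) E"
    using Cons.prems j by (simp add: n1_def, cases h) (auto simp: Suc_diff_Suc)
  have 2: "moves n1 0 (D @ sh (out w D + k) E) (sh (w + k) E @ D)" by (rule Cons.IH[OF n1'])
  have okE: "ok (out n1 D) (sh (out w D + k) E)" using moves_ok1[OF 2] by simp
  have "out n (D @ [(out w D + (k + j), h)]) = out n1 D"
    using moves_out[OF 1] n1 by (metis out_append append_Cons append_Nil)
  then have "ok n ((D @ [(out w D + (k + j), h)]) @ sh (out w D + k) E)"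
    unfolding ok_append[of n "D @ _"] using okE moves_ok1[OF 1] by (simp del: out_append ok_append)
  then have "moves n 0 ([] @ sh 0 (D @ [(out w D + (k + j), h)]) @ sh (out w D + k) E)
      ([] @ sh 0 ((w + (k + j), h) # D) @ sh (out w D + k) E)"
    by (intro moves_context[OF 1]) auto
  also have "moves n 0 \<dots> ([(w + (k + j), h)] @ sh 0 (sh (w + k) E @ D) @ [])"
  proof -
    have 3: "ok n [(w + (k + j), h)]" using j by (cases h) auto
    then have "ok n ([(w + (k + j), h)] @ sh 0 (D @ sh (out w D + k) E) @ [])"
      using n1 moves_ok1[OF 2] by (simp only: ok_append append_Nil2 sh_simps add_0_right simp_thms)
    from moves_context[OF 2 3 _ this] show ?thesis using n1 by (simp only: sh_simps) simp
  qed
  finally show ?case by (simp add: ac_simps)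
qed

section \<open>Powers of one crossing\<close>

definition pw :: "nat \<Rightarrow> int \<Rightarrow> diagram" where
  "pw i k = replicate (nat \<bar>k\<bar>) (i, Cross (k > 0))"

lemma sh_pw [simp]: "sh j (pw i k) = pw (i + j) k"
  by (simp add: pw_def sh_def)

lemma ok_replicate_Cross: "ok n (replicate k (i, Cross b)) \<longleftrightarrow> k = 0 \<or> i + 2 \<le> n"
  by (induction k) auto

lemma out_replicate_Cross: "out n (replicate k (i, Cross b)) = n"
  by (induction k) auto

lemma ok_pw [simp]: "ok n (pw i k) \<longleftrightarrow> k = 0 \<or> i + 2 \<le> n"
  by (auto simp: pw_def ok_replicate_Cross)

lemma out_pw [simp]: "out n (pw i k) = n"
  by (simp add: pw_def out_replicate_Cross)

lemma pw_0 [simp]: "pw i 0 = []" by (simp add: pw_def)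

lemma pw_sgn: "pw i 1 = [(i, Cross True)]" "pw i (-1) = [(i, Cross False)]"
  "pw i (if b then 1 else -1) = [(i, Cross b)]"
  by (auto simp: pw_def)

lemma pw_Cons:
  assumes "i + 2 \<le> n" "e = (if b then 1 else -1)"
  shows "moves n 0 ((i, Cross b) # pw i k) (pw i (e + k))"
proof (cases "k = 0 \<or> (k > 0) = b")
  case True
  then have "nat \<bar>e + k\<bar> = Suc (nat \<bar>k\<bar>)" "(e + k > 0) = b" "k = 0 \<or> (k > 0) = b"
    using assms(2) by (auto split: if_splits)
  then have "(i, Cross b) # pw i k = pw i (e + k)" by (auto simp: pw_def)
  then show ?thesis using assms(1) by (auto intro!: moves_refl)
next
  case False
  then have "nat \<bar>k\<bar> = Suc (nat \<bar>e + k\<bar>)" "(k > 0) = (\<not> b)" "e + k = 0 \<or> (e + k > 0) = (\<not> b)"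
    using assms(2) by (auto split: if_splits)
  then have "pw i k = (i, Cross (\<not> b)) # pw i (e + k)" by (auto simp: pw_def)
  moreover have "moves n 0 [(i, Cross b), (i, Cross (\<not> b))] []"
    by (rule isotopy_rule_moves[OF isotopy_rule.reidemeister2]) (use assms in auto)
  then have "moves n 0 ([] @ sh 0 [(i, Cross b), (i, Cross (\<not> b))] @ pw i (e + k)) ([] @ sh 0 [] @ pw i (e + k))"
    by (rule moves_context) (use assms in auto)
  ultimately show ?thesis by simp
qed

text \<open>Exponents of equal sign concatenate and those of opposite sign cancel by Reidemeister
  II, one crossing at a time through \<open>pw_Cons\<close>. Up to isotopy \<open>pw i\<close> is a
  homomorphism from the integers to braids.\<close>

lemma pw_add:
  assumes "i + 2 \<le> n" shows "moves n 0 (pw i a @ pw i b) (pw i (a + b))"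
proof -
  have "moves n 0 (replicate m (i, Cross c) @ pw i b) (pw i ((if c then int m else - int m) + b))" for m c
  proof (induction m)
    case 0
    then show ?case using assms by (auto intro: moves_refl)
  next
    case (Suc m)
    have "moves n 0 ([(i, Cross c)] @ sh 0 (replicate m (i, Cross c) @ pw i b) @ [])
        ([(i, Cross c)] @ sh 0 (pw i ((if c then int m else - int m) + b)) @ [])"
      by (rule moves_context[OF Suc]) (use assms in \<open>auto simp: ok_replicate_Cross out_replicate_Cross\<close>)
    also have "moves n 0 \<dots> (pw i ((if c then 1 else -1) + ((if c then int m else - int m) + b)))"
      using pw_Cons[OF assms refl] by simp
    also have "(if c then 1 else -1) + ((if c then int m else - int m) + b)
        = (if c then int (Suc m) else - int (Suc m)) + b" by simp
    finally show ?case by (simp only: replicate_Suc append_Cons append_Nil append_Nil2 sh_simps)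
  qed
  moreover have "(if a > 0 then int (nat \<bar>a\<bar>) else - int (nat \<bar>a\<bar>)) = a" by simp
  ultimately show ?thesis by (metis pw_def)
qed

section \<open>Pretzel tangles\<close>

lemma pwA: "c = a + b \<Longrightarrow> moves 2 0 (pw 0 a @ pw 0 b) (pw 0 c)"
  using pw_add[of 0 2 a b] by simp

section \<open>Slides, curls and braid relations for signed crossings\<close>

lemma slide_cup_pw: "e = 1 \<or> e = -1 \<Longrightarrow> moves 1 0 ([(0, Cup)] @ pw 1 e) ([(1, Cup)] @ pw 0 (-e))"
  using isotopy_rule_moves[OF isotopy_rule.slide_cup[of 0 True], of 1]
    isotopy_rule_moves[OF isotopy_rule.slide_cup[of 0 False], of 1]
  by (auto simp: pw_sgn)

lemma slide_cap_pw: "e = 1 \<or> e = -1 \<Longrightarrow> moves 3 0 (pw 1 e @ [(0, Cap)]) (pw 0 (-e) @ [(1, Cap)])"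
  using isotopy_rule_moves[OF isotopy_rule.slide_cap[of 0 True], of 3]
    isotopy_rule_moves[OF isotopy_rule.slide_cap[of 0 False], of 3]
  by (auto simp: pw_sgn)

lemma r1_cup_pw1: "e = 1 \<or> e = -1 \<Longrightarrow> moves 0 0 ([(0, Cup)] @ pw 0 e) [(0, Cup)]"
  using isotopy_rule_moves[OF isotopy_rule.reidemeister1_cup[of 0 True], of 0]
    isotopy_rule_moves[OF isotopy_rule.reidemeister1_cup[of 0 False], of 0]
  by (auto simp: pw_sgn)

lemma r1_cap_pw1: "e = 1 \<or> e = -1 \<Longrightarrow> moves 2 0 (pw 0 e @ [(0, Cap)]) [(0, Cap)]"
  using isotopy_rule_moves[OF isotopy_rule.reidemeister1_cap[of 0 True], of 2]
    isotopy_rule_moves[OF isotopy_rule.reidemeister1_cap[of 0 False], of 2]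
  by (auto simp: pw_sgn)

lemma zigzag1: "moves 1 0 ([(0, Cup)] @ [(1, Cap)]) []"
  using isotopy_rule_moves[OF isotopy_rule.zigzag_left[of 0], of 1] by simp

lemma zigzag2: "moves 1 0 ([(1, Cup)] @ [(0, Cap)]) []"
  using isotopy_rule_moves[OF isotopy_rule.zigzag_right[of 0], of 1] by simp

lemma r3_pw: "e = 1 \<or> e = -1 \<Longrightarrow> f = 1 \<or> f = -1 \<Longrightarrow>
    moves 3 0 (pw 0 f @ pw 1 e @ pw 0 e) (pw 1 e @ pw 0 e @ pw 1 f)"
  using isotopy_rule_moves[OF isotopy_rule.reidemeister3[of "f = 1" "e = 1" "e = 1" 0], of 3]
  by (auto simp: pw_sgn)

lemma delta_pw: "e = 1 \<or> e = -1 \<Longrightarrow>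
    moves 3 1 (pw 0 e @ pw 1 (-e) @ pw 0 e) (pw 1 e @ pw 0 (-e) @ pw 1 e)"
  using delta_rule_moves[OF delta_rule.delta[of "e = 1" "e = 1" "e \<noteq> 1" 0], of 3]
  by (auto simp: pw_sgn)

lemma conj_pw1:
  assumes e: "e = 1 \<or> e = -1" and f: "f = 1 \<or> f = -1"
  shows "moves 3 0 (pw 0 e @ pw 1 f @ pw 0 (-e)) (pw 1 (-e) @ pw 0 f @ pw 1 e)"
proof -
  have "moves 3 0 (pw 0 e @ pw 1 f @ pw 0 (-e)) (pw 1 (-e) @ pw 1 e @ pw 0 e @ pw 1 f @ pw 0 (-e))"
    by (rule moves_subst_rev[OF pwA[of 0 "-e" e], where u = "[]" and v = "pw 0 e @ pw 1 f @ pw 0 (-e)" and j = 1]) (simp_all, (simp_all add: eval_nat_numeral)?)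
  also have "moves 3 0 \<dots> (pw 1 (-e) @ pw 0 f @ pw 1 e @ pw 0 e @ pw 0 (-e))"
    by (rule moves_subst_rev[OF r3_pw[OF e f], where u = "pw 1 (-e)" and v = "pw 0 (-e)" and j = 0]) (simp_all, (simp_all add: eval_nat_numeral)?)
  also have "moves 3 0 \<dots> (pw 1 (-e) @ pw 0 f @ pw 1 e)"
    by (rule moves_subst[OF pwA[of 0 "e" "-e"], where u = "pw 1 (-e) @ pw 0 f @ pw 1 e" and v = "[]" and j = 0]) (simp_all, (simp_all add: eval_nat_numeral)?)
  finally show ?thesis by simp
qed

lemma conj_pw_step:
  assumes e: "e = 1 \<or> e = -1" and f: "f = 1 \<or> f = -1"
    and IH: "moves 3 0 (pw 0 e @ pw 1 k @ pw 0 (-e)) (pw 1 (-e) @ pw 0 k @ pw 1 e)"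
  shows "moves 3 0 (pw 0 e @ pw 1 (k+f) @ pw 0 (-e)) (pw 1 (-e) @ pw 0 (k+f) @ pw 1 e)"
proof -
  have "moves 3 0 (pw 0 e @ pw 1 (k+f) @ pw 0 (-e)) (pw 0 e @ pw 1 k @ pw 1 f @ pw 0 (-e))"
    by (rule moves_subst_rev[OF pwA[of "k+f" k f], where u = "pw 0 e" and v = "pw 0 (-e)" and j = 1]) (simp_all, (simp_all add: eval_nat_numeral)?)
  also have "moves 3 0 \<dots> (pw 0 e @ pw 1 k @ pw 0 (-e) @ pw 0 e @ pw 1 f @ pw 0 (-e))"
    by (rule moves_subst_rev[OF pwA[of 0 "-e" e], where u = "pw 0 e @ pw 1 k" and v = "pw 1 f @ pw 0 (-e)" and j = 0]) (simp_all, (simp_all add: eval_nat_numeral)?)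
  also have "moves 3 0 \<dots> (pw 1 (-e) @ pw 0 k @ pw 1 e @ pw 0 e @ pw 1 f @ pw 0 (-e))"
    by (rule moves_subst[OF IH, where u = "[]" and v = "pw 0 e @ pw 1 f @ pw 0 (-e)" and j = 0]) (simp_all, (simp_all add: eval_nat_numeral)?)
  also have "moves 3 0 \<dots> (pw 1 (-e) @ pw 0 k @ pw 1 e @ pw 1 (-e) @ pw 0 f @ pw 1 e)"
    by (rule moves_subst[OF conj_pw1[OF e f], where u = "pw 1 (-e) @ pw 0 k @ pw 1 e" and v = "[]" and j = 0]) (simp_all, (simp_all add: eval_nat_numeral)?)
  also have "moves 3 0 \<dots> (pw 1 (-e) @ pw 0 k @ pw 0 f @ pw 1 e)"
    by (rule moves_subst[OF pwA[of 0 e "-e"], where u = "pw 1 (-e) @ pw 0 k" and v = "pw 0 f @ pw 1 e" and j = 1]) (simp_all, (simp_all add: eval_nat_numeral)?)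
  also have "moves 3 0 \<dots> (pw 1 (-e) @ pw 0 (k+f) @ pw 1 e)"
    by (rule moves_subst[OF pwA[of "k+f" k f], where u = "pw 1 (-e)" and v = "pw 1 e" and j = 0]) (simp_all, (simp_all add: eval_nat_numeral)?)
  finally show ?thesis by simp
qed

text \<open>In terms of braid generators: s1^e s2^k s1^-e = s2^-e s1^k s2^e. For k = 1 and k = -1
  this is the braid relation \<open>r3_pw\<close> with inverses moved across, and conjugation is
  multiplicative in k.\<close>

lemma conj_pw:
  assumes e: "e = 1 \<or> e = -1"
  shows "moves 3 0 (pw 0 e @ pw 1 k @ pw 0 (-e)) (pw 1 (-e) @ pw 0 k @ pw 1 e)"
proof (induction k rule: int_induct[of _ 0])
  case base
  have "moves 3 0 (pw 0 e @ pw 0 (-e)) []" using pw_add[of 0 3 e "-e"] by simp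
  also have "moves 3 0 [] (pw 1 (-e) @ pw 1 e)" using moves_sym[OF pw_add[of 1 3 "-e" e]] by simp
  finally show ?case by simp
next
  case (step1 i)
  then show ?case using conj_pw_step[OF e, of 1 i] by simp
next
  case (step2 i)
  then show ?case using conj_pw_step[OF e, of "-1" i] by simp
qed

lemma uminus_sign: "e = 1 \<or> e = -1 \<Longrightarrow> -e = 1 \<or> -e = (-1::int)" by auto

text \<open>A strand that crosses two others on the same side is not affected by the twists between
  these, so the half twists slide through it.\<close>

lemma pass_pw:
  assumes e: "e = 1 \<or> e = -1"
  shows "moves 3 0 (pw 0 e @ pw 1 e @ pw 0 k) (pw 1 k @ pw 0 e @ pw 1 e)"
proof -
  have "moves 3 0 (pw 0 e @ pw 1 e @ pw 0 k) (pw 0 e @ pw 1 e @ pw 0 k @ pw 1 (-e) @ pw 1 e)"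
    by (rule moves_subst_rev[OF pwA[of 0 "-e" e], where u = "pw 0 e @ pw 1 e @ pw 0 k" and v = "[]" and j = 1]) (simp_all, (simp_all add: eval_nat_numeral)?)
  also have "moves 3 0 \<dots> (pw 0 e @ pw 0 (-e) @ pw 1 k @ pw 0 e @ pw 1 e)"
    by (rule moves_subst_rev[OF conj_pw[OF uminus_sign[OF e]], where u = "pw 0 e" and v = "pw 1 e" and j = 0]) (simp_all, (simp_all add: eval_nat_numeral)?)
  also have "moves 3 0 \<dots> (pw 1 k @ pw 0 e @ pw 1 e)"
    by (rule moves_subst[OF pwA[of 0 e "-e"], where u = "[]" and v = "pw 1 k @ pw 0 e @ pw 1 e" and j = 0]) (simp_all, (simp_all add: eval_nat_numeral)?)
  finally show ?thesis by simp
qed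

lemma pass_pw2:
  assumes e: "e = 1 \<or> e = -1"
  shows "moves 3 0 (pw 1 e @ pw 0 e @ pw 1 k) (pw 0 k @ pw 1 e @ pw 0 e)"
proof -
  have "moves 3 0 (pw 1 e @ pw 0 e @ pw 1 k) (pw 1 e @ pw 0 e @ pw 1 k @ pw 0 (-e) @ pw 0 e)"
    by (rule moves_subst_rev[OF pwA[of 0 "-e" e], where u = "pw 1 e @ pw 0 e @ pw 1 k" and v = "[]" and j = 0]) (simp_all, (simp_all add: eval_nat_numeral)?)
  also have "moves 3 0 \<dots> (pw 1 e @ pw 1 (-e) @ pw 0 k @ pw 1 e @ pw 0 e)"
    by (rule moves_subst[OF conj_pw[OF e], where u = "pw 1 e" and v = "pw 0 e" and j = 0]) (simp_all, (simp_all add: eval_nat_numeral)?)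
  also have "moves 3 0 \<dots> (pw 0 k @ pw 1 e @ pw 0 e)"
    by (rule moves_subst[OF pwA[of 0 e "-e"], where u = "[]" and v = "pw 0 k @ pw 1 e @ pw 0 e" and j = 1]) (simp_all, (simp_all add: eval_nat_numeral)?)
  finally show ?thesis by simp
qed

text \<open>A strand linked with the near leg of a minimum is pulled round the bottom and is then
  linked with the far leg. The legs run in opposite directions, so the exponent of the full twist
  changes its sign.\<close>

lemma cup_slide2:
  shows "moves 1 0 ([(1, Cup)] @ pw 0 1 @ pw 1 2 @ pw 0 (-1)) ([(1, Cup)] @ pw 0 (-2))"
proof -
  have "moves 1 0 ([(1, Cup)] @ pw 0 1 @ pw 1 2 @ pw 0 (-1)) ([(0, Cup)] @ pw 1 (-1) @ pw 1 2 @ pw 0 (-1))"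
    by (rule moves_subst_rev[OF slide_cup_pw[of "-1"], where u = "[]" and v = "pw 1 2 @ pw 0 (-1)" and j = 0]) (simp_all, (simp_all add: eval_nat_numeral)?)
  also have "moves 1 0 \<dots> ([(0, Cup)] @ pw 1 1 @ pw 0 (-1))"
    by (rule moves_subst[OF pwA[of 1 "-1" 2], where u = "[(0, Cup)]" and v = "pw 0 (-1)" and j = 1]) (simp_all, (simp_all add: eval_nat_numeral)?)
  also have "moves 1 0 \<dots> ([(1, Cup)] @ pw 0 (-1) @ pw 0 (-1))"
    by (rule moves_subst[OF slide_cup_pw[of 1], where u = "[]" and v = "pw 0 (-1)" and j = 0]) (simp_all, (simp_all add: eval_nat_numeral)?)
  also have "moves 1 0 \<dots> ([(1, Cup)] @ pw 0 (-2))"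
    by (rule moves_subst[OF pwA[of "-2" "-1" "-1"], where u = "[(1, Cup)]" and v = "[]" and j = 0]) (simp_all, (simp_all add: eval_nat_numeral)?)
  finally show ?thesis by simp
qed

lemma cap_slide2:
  shows "moves 3 0 (pw 0 1 @ pw 1 (-2) @ pw 0 (-1) @ [(1, Cap)]) (pw 0 2 @ [(1, Cap)])"
proof -
  have "moves 3 0 (pw 0 1 @ pw 1 (-2) @ pw 0 (-1) @ [(1, Cap)]) (pw 0 1 @ pw 1 (-2) @ pw 1 1 @ [(0, Cap)])"
    by (rule moves_subst_rev[OF slide_cap_pw[of 1], where u = "pw 0 1 @ pw 1 (-2)" and v = "[]" and j = 0]) (simp_all, (simp_all add: eval_nat_numeral)?)
  also have "moves 3 0 \<dots> (pw 0 1 @ pw 1 (-1) @ [(0, Cap)])"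
    by (rule moves_subst[OF pwA[of "-1" "-2" 1], where u = "pw 0 1" and v = "[(0, Cap)]" and j = 1]) (simp_all, (simp_all add: eval_nat_numeral)?)
  also have "moves 3 0 \<dots> (pw 0 1 @ pw 0 1 @ [(1, Cap)])"
    by (rule moves_subst[OF slide_cap_pw[of "-1"], where u = "pw 0 1" and v = "[]" and j = 0]) (simp_all, (simp_all add: eval_nat_numeral)?)
  also have "moves 3 0 \<dots> (pw 0 2 @ [(1, Cap)])"
    by (rule moves_subst[OF pwA[of 2 1 1], where u = "[]" and v = "[(1, Cap)]" and j = 0]) (simp_all, (simp_all add: eval_nat_numeral)?)
  finally show ?thesis by simp
qed

text \<open>A strand passing both legs of a maximum on the same side can be pulled off over its
  top.\<close>

lemma cap_pass:
  assumes e: "e = 1 \<or> e = -1"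
  shows "moves 3 0 (pw 1 e @ pw 0 e @ [(1, Cap)]) ([(0, Cap)])"
proof -
  have "moves 3 0 (pw 1 e @ pw 0 e @ [(1, Cap)]) (pw 1 e @ pw 1 (-e) @ [(0, Cap)])"
    by (rule moves_subst_rev[OF slide_cap_pw[OF uminus_sign[OF e]], where u = "pw 1 e" and v = "[]" and j = 0]) (simp_all, (simp_all add: eval_nat_numeral)?)
  also have "moves 3 0 \<dots> ([(0, Cap)])"
    by (rule moves_subst[OF pwA[of 0 e "-e"], where u = "[]" and v = "[(0, Cap)]" and j = 1]) (simp_all, (simp_all add: eval_nat_numeral)?)
  finally show ?thesis by simp
qed

lemma cap_pass2:
  assumes e: "e = 1 \<or> e = -1"
  shows "moves 3 0 (pw 0 e @ pw 1 e @ [(0, Cap)]) ([(1, Cap)])"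
proof -
  have "moves 3 0 (pw 0 e @ pw 1 e @ [(0, Cap)]) (pw 0 e @ pw 0 (-e) @ [(1, Cap)])"
    by (rule moves_subst[OF slide_cap_pw[OF e], where u = "pw 0 e" and v = "[]" and j = 0]) (simp_all, (simp_all add: eval_nat_numeral)?)
  also have "moves 3 0 \<dots> ([(1, Cap)])"
    by (rule moves_subst[OF pwA[of 0 e "-e"], where u = "[]" and v = "[(1, Cap)]" and j = 0]) (simp_all, (simp_all add: eval_nat_numeral)?)
  finally show ?thesis by simp
qed

lemma r1_cap_pw2:
  shows "moves 2 0 (pw 0 2 @ [(0, Cap)]) ([(0, Cap)])"
proof -
  have "moves 2 0 (pw 0 2 @ [(0, Cap)]) (pw 0 1 @ pw 0 1 @ [(0, Cap)])"
    by (rule moves_subst_rev[OF pwA[of 2 1 1], where u = "[]" and v = "[(0, Cap)]" and j = 0]) (simp_all, (simp_all add: eval_nat_numeral)?)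
  also have "moves 2 0 \<dots> (pw 0 1 @ [(0, Cap)])"
    by (rule moves_subst[OF r1_cap_pw1[of 1], where u = "pw 0 1" and v = "[]" and j = 0]) (simp_all, (simp_all add: eval_nat_numeral)?)
  also have "moves 2 0 \<dots> ([(0, Cap)])"
    by (rule moves_subst[OF r1_cap_pw1[of 1], where u = "[]" and v = "[]" and j = 0]) (simp_all, (simp_all add: eval_nat_numeral)?)
  finally show ?thesis by simp
qed

section \<open>Passing full twists through each other by delta moves\<close>

text \<open>All delta moves of the upper bound come from here. In pure braid terms, the full twists
  of strands 1, 2 and of strands 0, 1 commute up to a Borromean tangle, which one delta move
  undoes.\<close>

lemma delta_sq:
  shows "moves 3 1 (pw 1 2 @ pw 0 (-2)) (pw 0 (-2) @ pw 1 2)"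
proof -
  have "moves 3 0 (pw 1 2 @ pw 0 (-2)) (pw 1 1 @ pw 1 1 @ pw 0 (-2))"
    by (rule moves_subst_rev[OF pwA[of 2 1 1], where u = "[]" and v = "pw 0 (-2)" and j = 1]) (simp_all, (simp_all add: eval_nat_numeral)?)
  also have "moves 3 0 \<dots> (pw 1 1 @ pw 1 1 @ pw 0 (-1) @ pw 0 (-1))"
    by (rule moves_subst_rev[OF pwA[of "-2" "-1" "-1"], where u = "pw 1 1 @ pw 1 1" and v = "[]" and j = 0]) (simp_all, (simp_all add: eval_nat_numeral)?)
  \<comment> \<open>The inserted cancelling pair completes the cyclic triangle
    \<open>pw 1 1 @ pw 0 (-1) @ pw 1 1\<close> on which the delta move acts.\<close>
  also have "moves 3 0 \<dots> (pw 1 1 @ pw 1 1 @ pw 0 (-1) @ pw 1 1 @ pw 1 (-1) @ pw 0 (-1))"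
    by (rule moves_subst_rev[OF pwA[of 0 1 "-1"], where u = "pw 1 1 @ pw 1 1 @ pw 0 (-1)" and v = "pw 0 (-1)" and j = 1]) (simp_all, (simp_all add: eval_nat_numeral)?)
  also have "moves 3 1 \<dots> (pw 1 1 @ pw 0 1 @ pw 1 (-1) @ pw 0 1 @ pw 1 (-1) @ pw 0 (-1))"
    by (rule moves_subst_rev[OF delta_pw[of 1], where u = "pw 1 1" and v = "pw 1 (-1) @ pw 0 (-1)" and j = 0]) (simp_all, (simp_all add: eval_nat_numeral)?)
  also have "moves 3 0 \<dots> (pw 1 1 @ pw 0 1 @ pw 1 (-1) @ pw 1 (-1) @ pw 0 (-1) @ pw 1 1)"
    by (rule moves_subst[OF conj_pw[of 1 "-1"], where u = "pw 1 1 @ pw 0 1 @ pw 1 (-1)" and v = "[]" and j = 0]) (simp_all, (simp_all add: eval_nat_numeral)?)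
  also have "moves 3 0 \<dots> (pw 1 1 @ pw 0 1 @ pw 1 (-2) @ pw 0 (-1) @ pw 1 1)"
    by (rule moves_subst[OF pwA[of "-2" "-1" "-1"], where u = "pw 1 1 @ pw 0 1" and v = "pw 0 (-1) @ pw 1 1" and j = 1]) (simp_all, (simp_all add: eval_nat_numeral)?)
  also have "moves 3 0 \<dots> (pw 1 1 @ pw 1 (-1) @ pw 0 (-2) @ pw 1 1 @ pw 1 1)"
    by (rule moves_subst[OF conj_pw[of 1 "-2"], where u = "pw 1 1" and v = "pw 1 1" and j = 0]) (simp_all, (simp_all add: eval_nat_numeral)?)
  also have "moves 3 0 \<dots> (pw 0 (-2) @ pw 1 1 @ pw 1 1)"
    by (rule moves_subst[OF pwA[of 0 1 "-1"], where u = "[]" and v = "pw 0 (-2) @ pw 1 1 @ pw 1 1" and j = 1]) (simp_all, (simp_all add: eval_nat_numeral)?)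
  also have "moves 3 0 \<dots> (pw 0 (-2) @ pw 1 2)"
    by (rule moves_subst[OF pwA[of 2 1 1], where u = "pw 0 (-2)" and v = "[]" and j = 1]) (simp_all, (simp_all add: eval_nat_numeral)?)
  finally show ?thesis by simp
qed

lemma delta_sq2:
  shows "moves 3 1 (pw 0 2 @ pw 1 2) (pw 1 2 @ pw 0 2)"
proof -
  have "moves 3 0 (pw 0 2 @ pw 1 2) (pw 0 2 @ pw 1 2 @ pw 0 (-2) @ pw 0 2)"
    by (rule moves_subst_rev[OF pwA[of 0 "-2" 2], where u = "pw 0 2 @ pw 1 2" and v = "[]" and j = 0]) (simp_all, (simp_all add: eval_nat_numeral)?)
  also have "moves 3 1 \<dots> (pw 0 2 @ pw 0 (-2) @ pw 1 2 @ pw 0 2)"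
    by (rule moves_subst[OF delta_sq, where u = "pw 0 2" and v = "pw 0 2" and j = 0]) (simp_all, (simp_all add: eval_nat_numeral)?)
  also have "moves 3 0 \<dots> (pw 1 2 @ pw 0 2)"
    by (rule moves_subst[OF pwA[of 0 2 "-2"], where u = "[]" and v = "pw 1 2 @ pw 0 2" and j = 0]) (simp_all, (simp_all add: eval_nat_numeral)?)
  finally show ?thesis by simp
qed

lemma hook1_base:
  shows "moves 3 0 (pw 1 (-1) @ pw 0 (-2)) (pw 0 1 @ pw 1 (-2) @ pw 0 (-1) @ pw 1 (-1))"
proof -
  have "moves 3 0 (pw 1 (-1) @ pw 0 (-2)) (pw 1 (-1) @ pw 0 (-2) @ pw 1 1 @ pw 1 (-1))"
    by (rule moves_subst_rev[OF pwA[of 0 1 "-1"], where u = "pw 1 (-1) @ pw 0 (-2)" and v = "[]" and j = 1]) (simp_all, (simp_all add: eval_nat_numeral)?)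
  also have "moves 3 0 \<dots> (pw 0 1 @ pw 1 (-2) @ pw 0 (-1) @ pw 1 (-1))"
    by (rule moves_subst_rev[OF conj_pw[of 1 "-2"], where u = "[]" and v = "pw 1 (-1)" and j = 0]) (simp_all, (simp_all add: eval_nat_numeral)?)
  finally show ?thesis by simp
qed

lemma hook1_step:
  assumes IH: "moves 3 k (pw 1 p @ pw 0 (-2)) (pw 0 1 @ pw 1 (-2) @ pw 0 (-1) @ pw 1 p)"
  shows "moves 3 (Suc k) (pw 1 (p+2) @ pw 0 (-2)) (pw 0 1 @ pw 1 (-2) @ pw 0 (-1) @ pw 1 (p+2))"
proof -
  have "moves 3 0 (pw 1 (p+2) @ pw 0 (-2)) (pw 1 2 @ pw 1 p @ pw 0 (-2))"
    by (rule moves_subst_rev[OF pwA[of "p+2" 2 p], where u = "[]" and v = "pw 0 (-2)" and j = 1]) (simp_all, (simp_all add: eval_nat_numeral)?)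
  also have "moves 3 k \<dots> (pw 1 2 @ pw 0 1 @ pw 1 (-2) @ pw 0 (-1) @ pw 1 p)"
    by (rule moves_subst[OF IH, where u = "pw 1 2" and v = "[]" and j = 0]) (simp_all, (simp_all add: eval_nat_numeral)?)
  also have "moves 3 0 \<dots> (pw 1 2 @ pw 1 (-1) @ pw 0 (-2) @ pw 1 1 @ pw 1 p)"
    by (rule moves_subst[OF conj_pw[of 1 "-2"], where u = "pw 1 2" and v = "pw 1 p" and j = 0]) (simp_all, (simp_all add: eval_nat_numeral)?)
  also have "moves 3 0 \<dots> (pw 1 1 @ pw 0 (-2) @ pw 1 1 @ pw 1 p)"
    by (rule moves_subst[OF pwA[of 1 2 "-1"], where u = "[]" and v = "pw 0 (-2) @ pw 1 1 @ pw 1 p" and j = 1]) (simp_all, (simp_all add: eval_nat_numeral)?)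
  also have "moves 3 0 \<dots> (pw 1 1 @ pw 0 (-2) @ pw 1 (p+1))"
    by (rule moves_subst[OF pwA[of "p+1" 1 p], where u = "pw 1 1 @ pw 0 (-2)" and v = "[]" and j = 1]) (simp_all, (simp_all add: eval_nat_numeral)?)
  also have "moves 3 0 \<dots> (pw 1 (-1) @ pw 1 2 @ pw 0 (-2) @ pw 1 (p+1))"
    by (rule moves_subst_rev[OF pwA[of 1 "-1" 2], where u = "[]" and v = "pw 0 (-2) @ pw 1 (p+1)" and j = 1]) (simp_all, (simp_all add: eval_nat_numeral)?)
  also have "moves 3 1 \<dots> (pw 1 (-1) @ pw 0 (-2) @ pw 1 2 @ pw 1 (p+1))"
    by (rule moves_subst[OF delta_sq, where u = "pw 1 (-1)" and v = "pw 1 (p+1)" and j = 0]) (simp_all, (simp_all add: eval_nat_numeral)?)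
  also (moves_trans) have "moves 3 0 \<dots> (pw 1 (-1) @ pw 0 (-2) @ pw 1 (p+3))"
    by (rule moves_subst[OF pwA[of "p+3" 2 "p+1"], where u = "pw 1 (-1) @ pw 0 (-2)" and v = "[]" and j = 1]) (simp_all, (simp_all add: eval_nat_numeral)?)
  also have "moves 3 0 \<dots> (pw 1 (-1) @ pw 0 (-2) @ pw 1 1 @ pw 1 (p+2))"
    by (rule moves_subst_rev[OF pwA[of "p+3" 1 "p+2"], where u = "pw 1 (-1) @ pw 0 (-2)" and v = "[]" and j = 1]) (simp_all, (simp_all add: eval_nat_numeral)?)
  also have "moves 3 0 \<dots> (pw 0 1 @ pw 1 (-2) @ pw 0 (-1) @ pw 1 (p+2))"
    by (rule moves_subst_rev[OF conj_pw[of 1 "-2"], where u = "[]" and v = "pw 1 (p+2)" and j = 0]) (simp_all, (simp_all add: eval_nat_numeral)?)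
  finally show ?thesis by simp
qed

text \<open>Strand 0 is linked with the upper left end of an odd column. The column exchanges its
  two strands, so below it the link sits at the right strand. This is free for the column -1, and
  each further full twist is passed by one delta move: \<open>(p + 1) / 2\<close> moves for
  \<open>p = 2 * k - 1\<close>.\<close>

lemma hook1: "moves 3 k (pw 1 (2 * int k - 1) @ pw 0 (-2))
    (pw 0 1 @ pw 1 (-2) @ pw 0 (-1) @ pw 1 (2 * int k - 1))"
proof (induction k)
  case 0
  then show ?case using hook1_base by simp
next
  case (Suc k)
  have "2 * int k - 1 + 2 = 2 * int (Suc k) - 1" by simp
  then show ?case using hook1_step[OF Suc] by metis
qed

lemma hook2_base:
  shows "moves 3 0 (pw 0 2 @ pw 1 1) (pw 1 1 @ pw 0 1 @ pw 1 2 @ pw 0 (-1))"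
proof -
  have "moves 3 0 (pw 0 2 @ pw 1 1) (pw 1 1 @ pw 1 (-1) @ pw 0 2 @ pw 1 1)"
    by (rule moves_subst_rev[OF pwA[of 0 1 "-1"], where u = "[]" and v = "pw 0 2 @ pw 1 1" and j = 1]) (simp_all, (simp_all add: eval_nat_numeral)?)
  also have "moves 3 0 \<dots> (pw 1 1 @ pw 0 1 @ pw 1 2 @ pw 0 (-1))"
    by (rule moves_subst_rev[OF conj_pw[of 1 2], where u = "pw 1 1" and v = "[]" and j = 0]) (simp_all, (simp_all add: eval_nat_numeral)?)
  finally show ?thesis by simp
qed

lemma hook2_step:
  assumes IH: "moves 3 k (pw 0 2 @ pw 1 p) (pw 1 p @ pw 0 1 @ pw 1 2 @ pw 0 (-1))"
  shows "moves 3 (Suc k) (pw 0 2 @ pw 1 (p+2)) (pw 1 (p+2) @ pw 0 1 @ pw 1 2 @ pw 0 (-1))"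
proof -
  have "moves 3 0 (pw 0 2 @ pw 1 (p+2)) (pw 0 2 @ pw 1 2 @ pw 1 p)"
    by (rule moves_subst_rev[OF pwA[of "p+2" 2 p], where u = "pw 0 2" and v = "[]" and j = 1]) (simp_all, (simp_all add: eval_nat_numeral)?)
  also have "moves 3 1 \<dots> (pw 1 2 @ pw 0 2 @ pw 1 p)"
    by (rule moves_subst[OF delta_sq2, where u = "[]" and v = "pw 1 p" and j = 0]) (simp_all, (simp_all add: eval_nat_numeral)?)
  also have "moves 3 k \<dots> (pw 1 2 @ pw 1 p @ pw 0 1 @ pw 1 2 @ pw 0 (-1))"
    by (rule moves_subst[OF IH, where u = "pw 1 2" and v = "[]" and j = 0]) (simp_all, (simp_all add: eval_nat_numeral)?)
  also (moves_trans) have "moves 3 0 \<dots> (pw 1 (p+2) @ pw 0 1 @ pw 1 2 @ pw 0 (-1))"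
    by (rule moves_subst[OF pwA[of "p+2" 2 p], where u = "[]" and v = "pw 0 1 @ pw 1 2 @ pw 0 (-1)" and j = 1]) (simp_all, (simp_all add: eval_nat_numeral)?)
  finally show ?thesis by simp
qed

text \<open>The upward counterpart of \<open>hook1\<close>, for a link of opposite sign. Here the
  column 1 is free and \<open>q = 2 * k + 1\<close> costs \<open>(q - 1) / 2\<close> moves, so the
  shifts by 1/2 cancel over two neighbouring columns.\<close>

lemma hook2: "moves 3 k (pw 0 2 @ pw 1 (2 * int k + 1))
    (pw 1 (2 * int k + 1) @ pw 0 1 @ pw 1 2 @ pw 0 (-1))"
proof (induction k)
  case 0
  then show ?case using hook2_base by simp
next
  case (Suc k)
  have "2 * int k + 1 + 2 = 2 * int (Suc k) + 1" by simp
  then show ?case using hook2_step[OF Suc] by metis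
qed

text \<open>\<open>T ps\<close> is what remains of the pretzel link between its outermost minimum and maximum, up to isotopy.\<close>

fun T :: "int list \<Rightarrow> diagram" where
  "T [] = [(0, Cap), (0, Cup)]"
| "T (p # ps) = [(1, Cup)] @ pw 0 p @ sh 2 (T ps) @ [(1, Cap)]"

lemma ok_T: "2 \<le> n \<Longrightarrow> ok n (T ps) \<and> out n (T ps) = n"
proof (induction ps arbitrary: n)
  case Nil
  then show ?case by (auto simp: numeral_2_eq_2)
next
  case (Cons p ps)
  then show ?case using ok_sh'[of 2 "n + 2" "T ps"] out_sh'[of 2 "n + 2" "T ps"] by auto
qed

lemma ok_sh_T [simp]: "j + 2 \<le> n \<Longrightarrow> ok n (sh j (T ps))"
  and out_sh_T [simp]: "j + 2 \<le> n \<Longrightarrow> out n (sh j (T ps)) = n"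
  using ok_T[of "n - j" ps] by (auto simp: ok_sh' out_sh')

lemma ok_T' [simp]: "2 \<le> n \<Longrightarrow> ok n (T ps)" and out_T [simp]: "2 \<le> n \<Longrightarrow> out n (T ps) = n"
  using ok_T by auto

declare T.simps(2) [simp del]

text \<open>A finger of strand 0 follows a strand of the pretzel tangle: down column
  \<open>p\<close>, round the minimum, up column \<open>q\<close>, round the maximum and on through
  the rest. Where it merely crosses other strands it lies over them, which costs nothing.\<close>

lemma finger_step:
  assumes h1: "moves 3 a (pw 1 p @ pw 0 (-2)) (pw 0 1 @ pw 1 (-2) @ pw 0 (-1) @ pw 1 p)"
    and h2: "moves 3 b (pw 0 2 @ pw 1 q) (pw 1 q @ pw 0 1 @ pw 1 2 @ pw 0 (-1))"
    and IH: "moves 3 c (sh 1 (T qs) @ pw 0 (-2)) (sh 1 (T qs) @ pw 0 1 @ pw 1 2 @ pw 0 (-1))"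
  shows "moves 3 (a + b + c) ([(2, Cup)] @ pw 1 p @ [(4, Cup)] @ pw 3 q @ sh 5 (T qs) @ [(4, Cap)] @ [(2, Cap)] @ pw 0 (-2)) ([(2, Cup)] @ pw 1 p @ [(4, Cup)] @ pw 3 q @ sh 5 (T qs) @ [(4, Cap)] @ [(2, Cap)] @ pw 0 1 @ pw 1 2 @ pw 0 (-1))"
proof -
  have "moves 3 0 ([(2, Cup)] @ pw 1 p @ [(4, Cup)] @ pw 3 q @ sh 5 (T qs) @ [(4, Cap)] @ [(2, Cap)] @ pw 0 (-2)) ([(2, Cup)] @ pw 1 p @ pw 0 (-2) @ [(4, Cup)] @ pw 3 q @ sh 5 (T qs) @ [(4, Cap)] @ [(2, Cap)])"
    by (rule moves_subst_rev[OF exchange_lists[of 2 "pw 0 (-2)" 0 5 "[(2, Cup)] @ pw 1 q @ sh 3 (T qs) @ [(2, Cap), (0, Cap)]"], where u = "[(2, Cup)] @ pw 1 p" and v = "[]" and j = 0]) (simp_all, (simp_all add: eval_nat_numeral)?)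
  \<comment> \<open>Down column \<open>p\<close>: the link now sits at the left leg of the
    minimum.\<close>
  also have "moves 3 a \<dots> ([(2, Cup)] @ pw 0 1 @ pw 1 (-2) @ pw 0 (-1) @ pw 1 p @ [(4, Cup)] @ pw 3 q @ sh 5 (T qs) @ [(4, Cap)] @ [(2, Cap)])"
    by (rule moves_subst[OF h1, where u = "[(2, Cup)]" and v = "[(4, Cup)] @ pw 3 q @ sh 5 (T qs) @ [(4, Cap)] @ [(2, Cap)]" and j = 0]) (simp_all, (simp_all add: eval_nat_numeral)?)
  also have "moves 3 0 \<dots> (pw 0 1 @ [(2, Cup)] @ pw 1 (-2) @ pw 0 (-1) @ pw 1 p @ [(4, Cup)] @ pw 3 q @ sh 5 (T qs) @ [(4, Cap)] @ [(2, Cap)])"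
    by (rule moves_subst_rev[OF exchange_lists[of 2 "pw 0 1" 0 3 "[(0, Cup)]"], where u = "[]" and v = "pw 1 (-2) @ pw 0 (-1) @ pw 1 p @ [(4, Cup)] @ pw 3 q @ sh 5 (T qs) @ [(4, Cap)] @ [(2, Cap)]" and j = 0]) (simp_all, (simp_all add: eval_nat_numeral)?)
  \<comment> \<open>Round the minimum to its right leg, which leads into column
    \<open>q\<close>.\<close>
  also have "moves 3 0 \<dots> (pw 0 1 @ [(2, Cup)] @ pw 1 1 @ pw 2 2 @ pw 1 (-1) @ pw 0 (-1) @ pw 1 p @ [(4, Cup)] @ pw 3 q @ sh 5 (T qs) @ [(4, Cap)] @ [(2, Cap)])"
    by (rule moves_subst_rev[OF cup_slide2, where u = "pw 0 1" and v = "pw 0 (-1) @ pw 1 p @ [(4, Cup)] @ pw 3 q @ sh 5 (T qs) @ [(4, Cap)] @ [(2, Cap)]" and j = 1]) (simp_all, (simp_all add: eval_nat_numeral)?)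
  also have "moves 3 0 \<dots> ([(2, Cup)] @ pw 0 1 @ pw 1 1 @ pw 2 2 @ pw 1 (-1) @ pw 0 (-1) @ pw 1 p @ [(4, Cup)] @ pw 3 q @ sh 5 (T qs) @ [(4, Cap)] @ [(2, Cap)])"
    by (rule moves_subst[OF exchange_lists[of 2 "pw 0 1" 0 3 "[(0, Cup)]"], where u = "[]" and v = "pw 1 1 @ pw 2 2 @ pw 1 (-1) @ pw 0 (-1) @ pw 1 p @ [(4, Cup)] @ pw 3 q @ sh 5 (T qs) @ [(4, Cap)] @ [(2, Cap)]" and j = 0]) (simp_all, (simp_all add: eval_nat_numeral)?)
  \<comment> \<open>The finger lies over both strands of column \<open>p\<close>, so it can be
    raised past this column.\<close>
  also have "moves 3 0 \<dots> ([(2, Cup)] @ pw 0 1 @ pw 1 1 @ pw 2 2 @ pw 0 p @ pw 1 (-1) @ pw 0 (-1) @ [(4, Cup)] @ pw 3 q @ sh 5 (T qs) @ [(4, Cap)] @ [(2, Cap)])"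
    by (rule moves_subst[OF pass_pw2[of "-1" p], where u = "[(2, Cup)] @ pw 0 1 @ pw 1 1 @ pw 2 2" and v = "[(4, Cup)] @ pw 3 q @ sh 5 (T qs) @ [(4, Cap)] @ [(2, Cap)]" and j = 0]) (simp_all, (simp_all add: eval_nat_numeral)?)
  also have "moves 3 0 \<dots> ([(2, Cup)] @ pw 0 1 @ pw 1 1 @ pw 0 p @ pw 2 2 @ pw 1 (-1) @ pw 0 (-1) @ [(4, Cup)] @ pw 3 q @ sh 5 (T qs) @ [(4, Cap)] @ [(2, Cap)])"
    by (rule moves_subst_rev[OF exchange_lists[of 2 "pw 0 p" 0 4 "pw 0 2"], where u = "[(2, Cup)] @ pw 0 1 @ pw 1 1" and v = "pw 1 (-1) @ pw 0 (-1) @ [(4, Cup)] @ pw 3 q @ sh 5 (T qs) @ [(4, Cap)] @ [(2, Cap)]" and j = 0]) (simp_all, (simp_all add: eval_nat_numeral)?)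
  also have "moves 3 0 \<dots> ([(2, Cup)] @ pw 1 p @ pw 0 1 @ pw 1 1 @ pw 2 2 @ pw 1 (-1) @ pw 0 (-1) @ [(4, Cup)] @ pw 3 q @ sh 5 (T qs) @ [(4, Cap)] @ [(2, Cap)])"
    by (rule moves_subst[OF pass_pw[of 1 p], where u = "[(2, Cup)]" and v = "pw 2 2 @ pw 1 (-1) @ pw 0 (-1) @ [(4, Cup)] @ pw 3 q @ sh 5 (T qs) @ [(4, Cap)] @ [(2, Cap)]" and j = 0]) (simp_all, (simp_all add: eval_nat_numeral)?)
  also have "moves 3 0 \<dots> ([(2, Cup)] @ pw 1 p @ [(4, Cup)] @ pw 0 1 @ pw 1 1 @ pw 2 2 @ pw 1 (-1) @ pw 0 (-1) @ pw 3 q @ sh 5 (T qs) @ [(4, Cap)] @ [(2, Cap)])"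
    by (rule moves_subst[OF exchange_lists[of 4 "pw 0 1 @ pw 1 1 @ pw 2 2 @ pw 1 (-1) @ pw 0 (-1)" 0 5 "[(0, Cup)]"], where u = "[(2, Cup)] @ pw 1 p" and v = "pw 3 q @ sh 5 (T qs) @ [(4, Cap)] @ [(2, Cap)]" and j = 0]) (simp_all, (simp_all add: eval_nat_numeral)?)
  also have "moves 3 0 \<dots> ([(2, Cup)] @ pw 1 p @ [(4, Cup)] @ pw 0 1 @ pw 1 1 @ pw 2 2 @ pw 3 q @ pw 1 (-1) @ pw 0 (-1) @ sh 5 (T qs) @ [(4, Cap)] @ [(2, Cap)])"
    by (rule moves_subst[OF exchange_lists[of 3 "pw 1 (-1) @ pw 0 (-1)" 0 5 "pw 0 q"], where u = "[(2, Cup)] @ pw 1 p @ [(4, Cup)] @ pw 0 1 @ pw 1 1 @ pw 2 2" and v = "sh 5 (T qs) @ [(4, Cap)] @ [(2, Cap)]" and j = 0]) (simp_all, (simp_all add: eval_nat_numeral)?)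
  \<comment> \<open>Up column \<open>q\<close>: the link reaches its right upper end, a leg of the
    maximum that joins \<open>q\<close> to the rest.\<close>
  also have "moves 3 b \<dots> ([(2, Cup)] @ pw 1 p @ [(4, Cup)] @ pw 0 1 @ pw 1 1 @ pw 3 q @ pw 2 1 @ pw 3 2 @ pw 2 (-1) @ pw 1 (-1) @ pw 0 (-1) @ sh 5 (T qs) @ [(4, Cap)] @ [(2, Cap)])"
    by (rule moves_subst[OF h2, where u = "[(2, Cup)] @ pw 1 p @ [(4, Cup)] @ pw 0 1 @ pw 1 1" and v = "pw 1 (-1) @ pw 0 (-1) @ sh 5 (T qs) @ [(4, Cap)] @ [(2, Cap)]" and j = 2]) (simp_all, (simp_all add: eval_nat_numeral)?)
  also (moves_trans) have "moves 3 0 \<dots> ([(2, Cup)] @ pw 1 p @ [(4, Cup)] @ pw 3 q @ pw 0 1 @ pw 1 1 @ pw 2 1 @ pw 3 2 @ pw 2 (-1) @ pw 1 (-1) @ pw 0 (-1) @ sh 5 (T qs) @ [(4, Cap)] @ [(2, Cap)])"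
    by (rule moves_subst[OF exchange_lists[of 3 "pw 0 1 @ pw 1 1" 0 5 "pw 0 q"], where u = "[(2, Cup)] @ pw 1 p @ [(4, Cup)]" and v = "pw 2 1 @ pw 3 2 @ pw 2 (-1) @ pw 1 (-1) @ pw 0 (-1) @ sh 5 (T qs) @ [(4, Cap)] @ [(2, Cap)]" and j = 0]) (simp_all, (simp_all add: eval_nat_numeral)?)
  also have "moves 3 0 \<dots> ([(2, Cup)] @ pw 1 p @ [(4, Cup)] @ pw 3 q @ sh 5 (T qs) @ pw 0 1 @ pw 1 1 @ pw 2 1 @ pw 3 2 @ pw 2 (-1) @ pw 1 (-1) @ pw 0 (-1) @ [(4, Cap)] @ [(2, Cap)])"
    by (rule moves_subst[OF exchange_lists[of 5 "pw 0 1 @ pw 1 1 @ pw 2 1 @ pw 3 2 @ pw 2 (-1) @ pw 1 (-1) @ pw 0 (-1)" 0 7 "T qs"], where u = "[(2, Cup)] @ pw 1 p @ [(4, Cup)] @ pw 3 q" and v = "[(4, Cap)] @ [(2, Cap)]" and j = 0]) (simp_all, (simp_all add: eval_nat_numeral)?)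
  also have "moves 3 0 \<dots> ([(2, Cup)] @ pw 1 p @ [(4, Cup)] @ pw 3 q @ sh 5 (T qs) @ pw 0 1 @ pw 1 1 @ pw 2 1 @ pw 3 2 @ [(4, Cap)] @ pw 2 (-1) @ pw 1 (-1) @ pw 0 (-1) @ [(2, Cap)])"
    by (rule moves_subst[OF exchange_lists[of 4 "pw 2 (-1) @ pw 1 (-1) @ pw 0 (-1)" 0 7 "[(0, Cap)]"], where u = "[(2, Cup)] @ pw 1 p @ [(4, Cup)] @ pw 3 q @ sh 5 (T qs) @ pw 0 1 @ pw 1 1 @ pw 2 1 @ pw 3 2" and v = "[(2, Cap)]" and j = 0]) (simp_all, (simp_all add: eval_nat_numeral)?)
  \<comment> \<open>Round this maximum to the left upper end of \<open>T qs\<close>, where the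
    induction hypothesis takes over.\<close>
  also have "moves 3 0 \<dots> ([(2, Cup)] @ pw 1 p @ [(4, Cup)] @ pw 3 q @ sh 5 (T qs) @ pw 0 1 @ pw 1 1 @ pw 2 1 @ pw 3 1 @ pw 4 (-2) @ pw 3 (-1) @ [(4, Cap)] @ pw 2 (-1) @ pw 1 (-1) @ pw 0 (-1) @ [(2, Cap)])"
    by (rule moves_subst_rev[OF cap_slide2, where u = "[(2, Cup)] @ pw 1 p @ [(4, Cup)] @ pw 3 q @ sh 5 (T qs) @ pw 0 1 @ pw 1 1 @ pw 2 1" and v = "pw 2 (-1) @ pw 1 (-1) @ pw 0 (-1) @ [(2, Cap)]" and j = 3]) (simp_all, (simp_all add: eval_nat_numeral)?)
  also have "moves 3 0 \<dots> ([(2, Cup)] @ pw 1 p @ [(4, Cup)] @ pw 3 q @ pw 0 1 @ pw 1 1 @ pw 2 1 @ pw 3 1 @ sh 5 (T qs) @ pw 4 (-2) @ pw 3 (-1) @ [(4, Cap)] @ pw 2 (-1) @ pw 1 (-1) @ pw 0 (-1) @ [(2, Cap)])"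
    by (rule moves_subst_rev[OF exchange_lists[of 5 "pw 0 1 @ pw 1 1 @ pw 2 1 @ pw 3 1" 0 7 "T qs"], where u = "[(2, Cup)] @ pw 1 p @ [(4, Cup)] @ pw 3 q" and v = "pw 4 (-2) @ pw 3 (-1) @ [(4, Cap)] @ pw 2 (-1) @ pw 1 (-1) @ pw 0 (-1) @ [(2, Cap)]" and j = 0]) (simp_all, (simp_all add: eval_nat_numeral)?)
  also have "moves 3 c \<dots> ([(2, Cup)] @ pw 1 p @ [(4, Cup)] @ pw 3 q @ pw 0 1 @ pw 1 1 @ pw 2 1 @ pw 3 1 @ sh 5 (T qs) @ pw 4 1 @ pw 5 2 @ pw 4 (-1) @ pw 3 (-1) @ [(4, Cap)] @ pw 2 (-1) @ pw 1 (-1) @ pw 0 (-1) @ [(2, Cap)])"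
    by (rule moves_subst[OF IH, where u = "[(2, Cup)] @ pw 1 p @ [(4, Cup)] @ pw 3 q @ pw 0 1 @ pw 1 1 @ pw 2 1 @ pw 3 1" and v = "pw 3 (-1) @ [(4, Cap)] @ pw 2 (-1) @ pw 1 (-1) @ pw 0 (-1) @ [(2, Cap)]" and j = 4]) (simp_all, (simp_all add: eval_nat_numeral)?)
  also (moves_trans) have "moves 3 0 \<dots> ([(2, Cup)] @ pw 1 p @ [(4, Cup)] @ pw 3 q @ sh 5 (T qs) @ pw 0 1 @ pw 1 1 @ pw 2 1 @ pw 3 1 @ pw 4 1 @ pw 5 2 @ pw 4 (-1) @ pw 3 (-1) @ [(4, Cap)] @ pw 2 (-1) @ pw 1 (-1) @ pw 0 (-1) @ [(2, Cap)])"
    by (rule moves_subst[OF exchange_lists[of 5 "pw 0 1 @ pw 1 1 @ pw 2 1 @ pw 3 1" 0 7 "T qs"], where u = "[(2, Cup)] @ pw 1 p @ [(4, Cup)] @ pw 3 q" and v = "pw 4 1 @ pw 5 2 @ pw 4 (-1) @ pw 3 (-1) @ [(4, Cap)] @ pw 2 (-1) @ pw 1 (-1) @ pw 0 (-1) @ [(2, Cap)]" and j = 0]) (simp_all, (simp_all add: eval_nat_numeral)?)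
  \<comment> \<open>What remains is to pull the finger off the two maxima.\<close>
  also have "moves 3 0 \<dots> ([(2, Cup)] @ pw 1 p @ [(4, Cup)] @ pw 3 q @ sh 5 (T qs) @ pw 0 1 @ pw 1 1 @ pw 2 1 @ pw 3 1 @ pw 4 1 @ pw 5 2 @ [(3, Cap)] @ pw 2 (-1) @ pw 1 (-1) @ pw 0 (-1) @ [(2, Cap)])"
    by (rule moves_subst[OF cap_pass[of "-1"], where u = "[(2, Cup)] @ pw 1 p @ [(4, Cup)] @ pw 3 q @ sh 5 (T qs) @ pw 0 1 @ pw 1 1 @ pw 2 1 @ pw 3 1 @ pw 4 1 @ pw 5 2" and v = "pw 2 (-1) @ pw 1 (-1) @ pw 0 (-1) @ [(2, Cap)]" and j = 3]) (simp_all, (simp_all add: eval_nat_numeral)?)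
  also have "moves 3 0 \<dots> ([(2, Cup)] @ pw 1 p @ [(4, Cup)] @ pw 3 q @ sh 5 (T qs) @ pw 0 1 @ pw 1 1 @ pw 2 1 @ pw 3 1 @ pw 4 1 @ [(3, Cap)] @ pw 3 2 @ pw 2 (-1) @ pw 1 (-1) @ pw 0 (-1) @ [(2, Cap)])"
    by (rule moves_subst_rev[OF exchange_lists[of 5 "[(3, Cap)]" 0 7 "pw 0 2"], where u = "[(2, Cup)] @ pw 1 p @ [(4, Cup)] @ pw 3 q @ sh 5 (T qs) @ pw 0 1 @ pw 1 1 @ pw 2 1 @ pw 3 1 @ pw 4 1" and v = "pw 2 (-1) @ pw 1 (-1) @ pw 0 (-1) @ [(2, Cap)]" and j = 0]) (simp_all, (simp_all add: eval_nat_numeral)?)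
  also have "moves 3 0 \<dots> ([(2, Cup)] @ pw 1 p @ [(4, Cup)] @ pw 3 q @ sh 5 (T qs) @ pw 0 1 @ pw 1 1 @ pw 2 1 @ [(4, Cap)] @ pw 3 2 @ pw 2 (-1) @ pw 1 (-1) @ pw 0 (-1) @ [(2, Cap)])"
    by (rule moves_subst[OF cap_pass2[of 1], where u = "[(2, Cup)] @ pw 1 p @ [(4, Cup)] @ pw 3 q @ sh 5 (T qs) @ pw 0 1 @ pw 1 1 @ pw 2 1" and v = "pw 3 2 @ pw 2 (-1) @ pw 1 (-1) @ pw 0 (-1) @ [(2, Cap)]" and j = 3]) (simp_all, (simp_all add: eval_nat_numeral)?)
  also have "moves 3 0 \<dots> ([(2, Cup)] @ pw 1 p @ [(4, Cup)] @ pw 3 q @ sh 5 (T qs) @ [(4, Cap)] @ pw 0 1 @ pw 1 1 @ pw 2 1 @ pw 3 2 @ pw 2 (-1) @ pw 1 (-1) @ pw 0 (-1) @ [(2, Cap)])"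
    by (rule moves_subst[OF exchange_lists[of 4 "pw 0 1 @ pw 1 1 @ pw 2 1" 0 7 "[(0, Cap)]"], where u = "[(2, Cup)] @ pw 1 p @ [(4, Cup)] @ pw 3 q @ sh 5 (T qs)" and v = "pw 3 2 @ pw 2 (-1) @ pw 1 (-1) @ pw 0 (-1) @ [(2, Cap)]" and j = 0]) (simp_all, (simp_all add: eval_nat_numeral)?)
  also have "moves 3 0 \<dots> ([(2, Cup)] @ pw 1 p @ [(4, Cup)] @ pw 3 q @ sh 5 (T qs) @ [(4, Cap)] @ pw 0 1 @ pw 1 1 @ pw 2 1 @ pw 3 2 @ pw 2 (-1) @ pw 1 (-1) @ [(2, Cap)] @ pw 0 (-1))"
    by (rule moves_subst[OF exchange_lists[of 2 "pw 0 (-1)" 0 5 "[(0, Cap)]"], where u = "[(2, Cup)] @ pw 1 p @ [(4, Cup)] @ pw 3 q @ sh 5 (T qs) @ [(4, Cap)] @ pw 0 1 @ pw 1 1 @ pw 2 1 @ pw 3 2 @ pw 2 (-1) @ pw 1 (-1)" and v = "[]" and j = 0]) (simp_all, (simp_all add: eval_nat_numeral)?)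
  also have "moves 3 0 \<dots> ([(2, Cup)] @ pw 1 p @ [(4, Cup)] @ pw 3 q @ sh 5 (T qs) @ [(4, Cap)] @ pw 0 1 @ pw 1 1 @ pw 2 1 @ pw 3 2 @ [(1, Cap)] @ pw 0 (-1))"
    by (rule moves_subst[OF cap_pass[of "-1"], where u = "[(2, Cup)] @ pw 1 p @ [(4, Cup)] @ pw 3 q @ sh 5 (T qs) @ [(4, Cap)] @ pw 0 1 @ pw 1 1 @ pw 2 1 @ pw 3 2" and v = "pw 0 (-1)" and j = 1]) (simp_all, (simp_all add: eval_nat_numeral)?)
  also have "moves 3 0 \<dots> ([(2, Cup)] @ pw 1 p @ [(4, Cup)] @ pw 3 q @ sh 5 (T qs) @ [(4, Cap)] @ pw 0 1 @ pw 1 1 @ pw 2 1 @ [(1, Cap)] @ pw 1 2 @ pw 0 (-1))"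
    by (rule moves_subst_rev[OF exchange_lists[of 3 "[(1, Cap)]" 0 5 "pw 0 2"], where u = "[(2, Cup)] @ pw 1 p @ [(4, Cup)] @ pw 3 q @ sh 5 (T qs) @ [(4, Cap)] @ pw 0 1 @ pw 1 1 @ pw 2 1" and v = "pw 0 (-1)" and j = 0]) (simp_all, (simp_all add: eval_nat_numeral)?)
  also have "moves 3 0 \<dots> ([(2, Cup)] @ pw 1 p @ [(4, Cup)] @ pw 3 q @ sh 5 (T qs) @ [(4, Cap)] @ pw 0 1 @ [(2, Cap)] @ pw 1 2 @ pw 0 (-1))"
    by (rule moves_subst[OF cap_pass2[of 1], where u = "[(2, Cup)] @ pw 1 p @ [(4, Cup)] @ pw 3 q @ sh 5 (T qs) @ [(4, Cap)] @ pw 0 1" and v = "pw 1 2 @ pw 0 (-1)" and j = 1]) (simp_all, (simp_all add: eval_nat_numeral)?)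
  also have "moves 3 0 \<dots> ([(2, Cup)] @ pw 1 p @ [(4, Cup)] @ pw 3 q @ sh 5 (T qs) @ [(4, Cap)] @ [(2, Cap)] @ pw 0 1 @ pw 1 2 @ pw 0 (-1))"
    by (rule moves_subst[OF exchange_lists[of 2 "pw 0 1" 0 5 "[(0, Cap)]"], where u = "[(2, Cup)] @ pw 1 p @ [(4, Cup)] @ pw 3 q @ sh 5 (T qs) @ [(4, Cap)]" and v = "pw 1 2 @ pw 0 (-1)" and j = 0]) (simp_all, (simp_all add: eval_nat_numeral)?)
  finally show ?thesis by simp
qed

text \<open>The bounds make the costs \<open>(p + 1) / 2\<close> and \<open>(q - 1) / 2\<close> of
  \<open>hook1\<close> and \<open>hook2\<close> natural numbers. Columns come in pairs because the
  finger goes down one and up the next.\<close>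

fun fingerable :: "int list \<Rightarrow> bool" where
  "fingerable [] \<longleftrightarrow> True"
| "fingerable [p] \<longleftrightarrow> False"
| "fingerable (p # q # qs) \<longleftrightarrow> odd p \<and> p \<ge> -1 \<and> odd q \<and> q \<ge> 1 \<and> fingerable qs"

lemma finger:
  assumes "fingerable ps"
  shows "\<exists>k. 2 * int k = sum_list ps \<and>
    moves 3 k (sh 1 (T ps) @ pw 0 (-2)) (sh 1 (T ps) @ pw 0 1 @ pw 1 2 @ pw 0 (-1))"
  using assms
proof (induction ps rule: fingerable.induct)
  case 1
  have "moves 3 0 ([(1, Cap)] @ sh 0 ([(1, Cup)] @ pw 0 1 @ pw 1 2 @ pw 0 (-1)) @ [])
      ([(1, Cap)] @ sh 0 ([(1, Cup)] @ pw 0 (-2)) @ [])"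
    by (rule moves_context[OF cup_slide2]) simp_all
  from moves_sym[OF this] show ?case by (auto simp: numeral_2_eq_2)
next
  case (3 p q qs)
  then obtain c where c: "2 * int c = sum_list qs"
    "moves 3 c (sh 1 (T qs) @ pw 0 (-2)) (sh 1 (T qs) @ pw 0 1 @ pw 1 2 @ pw 0 (-1))" by auto
  define a b where "a = nat ((p + 1) div 2)" and "b = nat ((q - 1) div 2)"
  have ab: "p = 2 * int a - 1" "q = 2 * int b + 1" using 3(2) by (auto simp: a_def b_def elim!: oddE)
  have "moves 3 (a + b + c) (sh 1 (T (p # q # qs)) @ pw 0 (-2))
      (sh 1 (T (p # q # qs)) @ pw 0 1 @ pw 1 2 @ pw 0 (-1))"
    using finger_step[OF hook1[of a] hook2[of b] c(2)] by (simp add: T.simps(2) ab eval_nat_numeral)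
  moreover have "2 * int (a + b + c) = sum_list (p # q # qs)" using c ab by simp
  ultimately show ?case by blast
qed simp

section \<open>Untwisting, cancelling and rotating columns\<close>

definition W :: "int list \<Rightarrow> diagram" where
  "W ps = [(0, Cup)] @ T ps @ [(0, Cap)]"

lemma ok_W [simp]: "ok 0 (W ps)" "out 0 (W ps) = 0"
  by (simp_all add: W_def)

text \<open>Seen from the other side of the inner maximum, a full twist on top of the first column
  links its left strand with the left end of \<open>T ps\<close>. The finger carries this link to
  the right end of \<open>T ps\<close>, where it becomes two curls at the outer maximum.\<close>

lemma untwist:
  assumes F: "moves 3 k (sh 1 (T ps) @ pw 0 (-2)) (sh 1 (T ps) @ pw 0 1 @ pw 1 2 @ pw 0 (-1))"
  shows "moves 0 k ([(0, Cup)] @ [(1, Cup)] @ pw 0 (p+2) @ sh 2 (T ps) @ [(1, Cap)] @ [(0, Cap)]) ([(0, Cup)] @ [(1, Cup)] @ pw 0 p @ sh 2 (T ps) @ [(1, Cap)] @ [(0, Cap)])"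
proof -
  have "moves 0 0 ([(0, Cup)] @ [(1, Cup)] @ pw 0 (p+2) @ sh 2 (T ps) @ [(1, Cap)] @ [(0, Cap)]) ([(0, Cup)] @ [(1, Cup)] @ pw 0 p @ pw 0 2 @ sh 2 (T ps) @ [(1, Cap)] @ [(0, Cap)])"
    by (rule moves_subst_rev[OF pwA[of "p+2" p 2], where u = "[(0, Cup)] @ [(1, Cup)]" and v = "sh 2 (T ps) @ [(1, Cap)] @ [(0, Cap)]" and j = 0]) (simp_all, (simp_all add: eval_nat_numeral)?)
  also have "moves 0 0 \<dots> ([(0, Cup)] @ [(1, Cup)] @ pw 0 p @ sh 2 (T ps) @ pw 0 2 @ [(1, Cap)] @ [(0, Cap)])"
    by (rule moves_subst[OF exchange_lists[of 2 "pw 0 2" 0 4 "T ps"], where u = "[(0, Cup)] @ [(1, Cup)] @ pw 0 p" and v = "[(1, Cap)] @ [(0, Cap)]" and j = 0]) (simp_all, (simp_all add: eval_nat_numeral)?)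
  also have "moves 0 0 \<dots> ([(0, Cup)] @ [(1, Cup)] @ pw 0 p @ sh 2 (T ps) @ pw 0 1 @ pw 1 (-2) @ pw 0 (-1) @ [(1, Cap)] @ [(0, Cap)])"
    by (rule moves_subst_rev[OF cap_slide2, where u = "[(0, Cup)] @ [(1, Cup)] @ pw 0 p @ sh 2 (T ps)" and v = "[(0, Cap)]" and j = 0]) (simp_all, (simp_all add: eval_nat_numeral)?)
  also have "moves 0 0 \<dots> ([(0, Cup)] @ [(1, Cup)] @ pw 0 p @ pw 0 1 @ sh 2 (T ps) @ pw 1 (-2) @ pw 0 (-1) @ [(1, Cap)] @ [(0, Cap)])"
    by (rule moves_subst_rev[OF exchange_lists[of 2 "pw 0 1" 0 4 "T ps"], where u = "[(0, Cup)] @ [(1, Cup)] @ pw 0 p" and v = "pw 1 (-2) @ pw 0 (-1) @ [(1, Cap)] @ [(0, Cap)]" and j = 0]) (simp_all, (simp_all add: eval_nat_numeral)?)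
  also have "moves 0 k \<dots> ([(0, Cup)] @ [(1, Cup)] @ pw 0 p @ pw 0 1 @ sh 2 (T ps) @ pw 1 1 @ pw 2 2 @ pw 1 (-1) @ pw 0 (-1) @ [(1, Cap)] @ [(0, Cap)])"
    by (rule moves_subst[OF F, where u = "[(0, Cup)] @ [(1, Cup)] @ pw 0 p @ pw 0 1" and v = "pw 0 (-1) @ [(1, Cap)] @ [(0, Cap)]" and j = 1]) (simp_all, (simp_all add: eval_nat_numeral)?)
  also have "moves 0 0 \<dots> ([(0, Cup)] @ [(1, Cup)] @ pw 0 p @ sh 2 (T ps) @ pw 0 1 @ pw 1 1 @ pw 2 2 @ pw 1 (-1) @ pw 0 (-1) @ [(1, Cap)] @ [(0, Cap)])"
    by (rule moves_subst[OF exchange_lists[of 2 "pw 0 1" 0 4 "T ps"], where u = "[(0, Cup)] @ [(1, Cup)] @ pw 0 p" and v = "pw 1 1 @ pw 2 2 @ pw 1 (-1) @ pw 0 (-1) @ [(1, Cap)] @ [(0, Cap)]" and j = 0]) (simp_all, (simp_all add: eval_nat_numeral)?)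
  also have "moves 0 0 \<dots> ([(0, Cup)] @ [(1, Cup)] @ pw 0 p @ sh 2 (T ps) @ pw 0 1 @ pw 1 1 @ pw 2 2 @ [(0, Cap)] @ [(0, Cap)])"
    by (rule moves_subst[OF cap_pass[of "-1"], where u = "[(0, Cup)] @ [(1, Cup)] @ pw 0 p @ sh 2 (T ps) @ pw 0 1 @ pw 1 1 @ pw 2 2" and v = "[(0, Cap)]" and j = 0]) (simp_all, (simp_all add: eval_nat_numeral)?)
  also have "moves 0 0 \<dots> ([(0, Cup)] @ [(1, Cup)] @ pw 0 p @ sh 2 (T ps) @ pw 0 1 @ pw 1 1 @ [(0, Cap)] @ pw 0 2 @ [(0, Cap)])"
    by (rule moves_subst_rev[OF exchange_lists[of 2 "[(0, Cap)]" 0 4 "pw 0 2"], where u = "[(0, Cup)] @ [(1, Cup)] @ pw 0 p @ sh 2 (T ps) @ pw 0 1 @ pw 1 1" and v = "[(0, Cap)]" and j = 0]) (simp_all, (simp_all add: eval_nat_numeral)?)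
  also have "moves 0 0 \<dots> ([(0, Cup)] @ [(1, Cup)] @ pw 0 p @ sh 2 (T ps) @ pw 0 1 @ pw 1 1 @ [(0, Cap)] @ [(0, Cap)])"
    by (rule moves_subst[OF r1_cap_pw2, where u = "[(0, Cup)] @ [(1, Cup)] @ pw 0 p @ sh 2 (T ps) @ pw 0 1 @ pw 1 1 @ [(0, Cap)]" and v = "[]" and j = 0]) (simp_all, (simp_all add: eval_nat_numeral)?)
  also have "moves 0 0 \<dots> ([(0, Cup)] @ [(1, Cup)] @ pw 0 p @ sh 2 (T ps) @ [(1, Cap)] @ [(0, Cap)])"
    by (rule moves_subst[OF cap_pass2[of 1], where u = "[(0, Cup)] @ [(1, Cup)] @ pw 0 p @ sh 2 (T ps)" and v = "[(0, Cap)]" and j = 0]) (simp_all, (simp_all add: eval_nat_numeral)?)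
  finally show ?thesis by simp
qed

lemma untwist_first:
  assumes "fingerable ps" "2 * int k = sum_list ps"
  shows "moves 0 (m * k) (W ((p + 2 * int m) # ps)) (W (p # ps))"
proof (induction m)
  case 0
  then show ?case by (auto intro: moves_refl)
next
  case (Suc m)
  obtain k' where "2 * int k' = sum_list ps" and
    F: "moves 3 k' (sh 1 (T ps) @ pw 0 (-2)) (sh 1 (T ps) @ pw 0 1 @ pw 1 2 @ pw 0 (-1))"
    using finger[OF assms(1)] by blast
  with assms(2) have [simp]: "k' = k" by simp
  have "moves 0 k (W ((p + 2 * int m + 2) # ps)) (W ((p + 2 * int m) # ps))"
    using untwist[OF F, of "p + 2 * int m"] by (simp add: W_def T.simps(2))
  from moves_trans[OF this Suc] show ?case by (simp add: algebra_simps)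
qed

text \<open>The first crossing slides round the minimum between the two columns. Both crossings then
  belong to one strand passing the maximum between them on the same side, and it is pulled
  off.\<close>

lemma cancel_columns:
  assumes e: "e = 1 \<or> e = -1"
  shows "moves 2 0 ([(1, Cup)] @ pw 0 e @ [(3, Cup)] @ pw 2 (-e) @ sh 4 (T ps) @ [(3, Cap)] @ [(1, Cap)]) (sh 0 (T ps))"
proof -
  have "moves 2 0 ([(1, Cup)] @ pw 0 e @ [(3, Cup)] @ pw 2 (-e) @ sh 4 (T ps) @ [(3, Cap)] @ [(1, Cap)]) ([(1, Cup)] @ [(3, Cup)] @ pw 0 e @ pw 2 (-e) @ sh 4 (T ps) @ [(3, Cap)] @ [(1, Cap)])"
    by (rule moves_subst[OF exchange_lists[of 2 "pw 0 e" 1 4 "[(0, Cup)]"], where u = "[(1, Cup)]" and v = "pw 2 (-e) @ sh 4 (T ps) @ [(3, Cap)] @ [(1, Cap)]" and j = 0]) (simp_all, (simp_all add: eval_nat_numeral)?)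
  also have "moves 2 0 \<dots> ([(1, Cup)] @ [(1, Cup)] @ pw 0 e @ pw 2 (-e) @ sh 4 (T ps) @ [(3, Cap)] @ [(1, Cap)])"
    by (rule moves_subst[OF exchange_lists[of 1 "[(1, Cup)]" 0 2 "[(0, Cup)]"], where u = "[]" and v = "pw 0 e @ pw 2 (-e) @ sh 4 (T ps) @ [(3, Cap)] @ [(1, Cap)]" and j = 0]) (simp_all, (simp_all add: eval_nat_numeral)?)
  also have "moves 2 0 \<dots> ([(1, Cup)] @ [(1, Cup)] @ pw 0 e @ pw 2 (-e) @ sh 4 (T ps) @ [(1, Cap)] @ [(1, Cap)])"
    by (rule moves_subst_rev[OF exchange_lists[of 3 "[(1, Cap)]" 0 6 "[(0, Cap)]"], where u = "[(1, Cup)] @ [(1, Cup)] @ pw 0 e @ pw 2 (-e) @ sh 4 (T ps)" and v = "[]" and j = 0]) (simp_all, (simp_all add: eval_nat_numeral)?)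
  also have "moves 2 0 \<dots> ([(1, Cup)] @ [(1, Cup)] @ pw 0 e @ pw 2 (-e) @ [(1, Cap)] @ sh 2 (T ps) @ [(1, Cap)])"
    by (rule moves_subst_rev[OF exchange_lists[of 3 "[(1, Cap)]" 1 6 "T ps"], where u = "[(1, Cup)] @ [(1, Cup)] @ pw 0 e @ pw 2 (-e)" and v = "[(1, Cap)]" and j = 0]) (simp_all, (simp_all add: eval_nat_numeral)?)
  also have "moves 2 0 \<dots> ([(1, Cup)] @ [(0, Cup)] @ pw 1 (-e) @ pw 2 (-e) @ [(1, Cap)] @ sh 2 (T ps) @ [(1, Cap)])"
    by (rule moves_subst_rev[OF slide_cup_pw[OF uminus_sign[OF e]], where u = "[(1, Cup)]" and v = "pw 2 (-e) @ [(1, Cap)] @ sh 2 (T ps) @ [(1, Cap)]" and j = 0]) (simp_all, (simp_all add: eval_nat_numeral)?)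
  also have "moves 2 0 \<dots> ([(1, Cup)] @ [(0, Cup)] @ [(2, Cap)] @ sh 2 (T ps) @ [(1, Cap)])"
    by (rule moves_subst[OF cap_pass2[OF uminus_sign[OF e]], where u = "[(1, Cup)] @ [(0, Cup)]" and v = "sh 2 (T ps) @ [(1, Cap)]" and j = 1]) (simp_all, (simp_all add: eval_nat_numeral)?)
  also have "moves 2 0 \<dots> ([(1, Cup)] @ [(0, Cap)] @ [(0, Cup)] @ sh 2 (T ps) @ [(1, Cap)])"
    by (rule moves_subst[OF exchange_lists[of 0 "[(0, Cup)]" 0 2 "[(0, Cap)]"], where u = "[(1, Cup)]" and v = "sh 2 (T ps) @ [(1, Cap)]" and j = 0]) (simp_all, (simp_all add: eval_nat_numeral)?)
  also have "moves 2 0 \<dots> ([(0, Cup)] @ sh 2 (T ps) @ [(1, Cap)])"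
    by (rule moves_subst[OF zigzag2, where u = "[]" and v = "[(0, Cup)] @ sh 2 (T ps) @ [(1, Cap)]" and j = 0]) (simp_all, (simp_all add: eval_nat_numeral)?)
  also have "moves 2 0 \<dots> (sh 0 (T ps) @ [(0, Cup)] @ [(1, Cap)])"
    by (rule moves_subst[OF exchange_lists[of 0 "[(0, Cup)]" 0 2 "T ps"], where u = "[]" and v = "[(1, Cap)]" and j = 0]) (simp_all, (simp_all add: eval_nat_numeral)?)
  also have "moves 2 0 \<dots> (sh 0 (T ps))"
    by (rule moves_subst[OF zigzag1, where u = "sh 0 (T ps)" and v = "[]" and j = 0]) (simp_all, (simp_all add: eval_nat_numeral)?)
  finally show ?thesis by simp
qed

lemma T_cancel:
  assumes "e = 1 \<or> e = -1" shows "moves 2 0 (T (e # -e # ps)) (T ps)"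
  using cancel_columns[OF assms, of ps] by (simp add: T.simps(2) eval_nat_numeral)

lemma T_single0:
  shows "moves 2 0 ([(1, Cup)] @ pw 0 c @ [(2, Cap)] @ [(2, Cup)] @ [(1, Cap)]) (pw 0 c)"
proof -
  have "moves 2 0 ([(1, Cup)] @ pw 0 c @ [(2, Cap)] @ [(2, Cup)] @ [(1, Cap)]) ([(1, Cup)] @ pw 0 c @ [(2, Cap)])"
    by (rule moves_subst[OF zigzag2, where u = "[(1, Cup)] @ pw 0 c @ [(2, Cap)]" and v = "[]" and j = 1]) (simp_all, (simp_all add: eval_nat_numeral)?)
  also have "moves 2 0 \<dots> ([(1, Cup)] @ [(2, Cap)] @ pw 0 c)"
    by (rule moves_subst[OF exchange_lists[of 2 "pw 0 c" 0 4 "[(0, Cap)]"], where u = "[(1, Cup)]" and v = "[]" and j = 0]) (simp_all, (simp_all add: eval_nat_numeral)?)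
  also have "moves 2 0 \<dots> (pw 0 c)"
    by (rule moves_subst[OF zigzag1, where u = "[]" and v = "pw 0 c" and j = 1]) (simp_all, (simp_all add: eval_nat_numeral)?)
  finally show ?thesis by simp
qed

lemma T_single1:
  shows "moves 2 0 ([(1, Cup)] @ [(0, Cap)] @ [(0, Cup)] @ pw 2 c @ [(1, Cap)]) (pw 0 c)"
proof -
  have "moves 2 0 ([(1, Cup)] @ [(0, Cap)] @ [(0, Cup)] @ pw 2 c @ [(1, Cap)]) ([(0, Cup)] @ pw 2 c @ [(1, Cap)])"
    by (rule moves_subst[OF zigzag2, where u = "[]" and v = "[(0, Cup)] @ pw 2 c @ [(1, Cap)]" and j = 0]) (simp_all, (simp_all add: eval_nat_numeral)?)
  also have "moves 2 0 \<dots> (pw 0 c @ [(0, Cup)] @ [(1, Cap)])"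
    by (rule moves_subst[OF exchange_lists[of 0 "[(0, Cup)]" 0 2 "pw 0 c"], where u = "[]" and v = "[(1, Cap)]" and j = 0]) (simp_all, (simp_all add: eval_nat_numeral)?)
  also have "moves 2 0 \<dots> (pw 0 c)"
    by (rule moves_subst[OF zigzag1, where u = "pw 0 c" and v = "[]" and j = 0]) (simp_all, (simp_all add: eval_nat_numeral)?)
  finally show ?thesis by simp
qed

lemma T_single: "moves 2 0 (T [c]) (pw 0 c)"
  using T_single0[of c] by (simp add: T.simps(2) eval_nat_numeral)

lemma T_snoc_step:
  assumes IH: "moves 2 0 (T (ps @ [c])) ([(1, Cup)] @ T ps @ pw 2 c @ [(1, Cap)])"
  shows "moves 2 0 ([(1, Cup)] @ pw 0 q @ sh 2 (T (ps@[c])) @ [(1, Cap)]) ([(1, Cup)] @ [(1, Cup)] @ pw 0 q @ sh 2 (T ps) @ [(1, Cap)] @ pw 2 c @ [(1, Cap)])"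
proof -
  have "moves 2 0 ([(1, Cup)] @ pw 0 q @ sh 2 (T (ps@[c])) @ [(1, Cap)]) ([(1, Cup)] @ pw 0 q @ [(3, Cup)] @ sh 2 (T ps) @ pw 4 c @ [(3, Cap)] @ [(1, Cap)])"
    by (rule moves_subst[OF IH, where u = "[(1, Cup)] @ pw 0 q" and v = "[(1, Cap)]" and j = 2]) (simp_all, (simp_all add: eval_nat_numeral)?)
  also have "moves 2 0 \<dots> ([(1, Cup)] @ [(3, Cup)] @ pw 0 q @ sh 2 (T ps) @ pw 4 c @ [(3, Cap)] @ [(1, Cap)])"
    by (rule moves_subst[OF exchange_lists[of 2 "pw 0 q" 1 4 "[(0, Cup)]"], where u = "[(1, Cup)]" and v = "sh 2 (T ps) @ pw 4 c @ [(3, Cap)] @ [(1, Cap)]" and j = 0]) (simp_all, (simp_all add: eval_nat_numeral)?)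
  also have "moves 2 0 \<dots> ([(1, Cup)] @ [(1, Cup)] @ pw 0 q @ sh 2 (T ps) @ pw 4 c @ [(3, Cap)] @ [(1, Cap)])"
    by (rule moves_subst[OF exchange_lists[of 1 "[(1, Cup)]" 0 2 "[(0, Cup)]"], where u = "[]" and v = "pw 0 q @ sh 2 (T ps) @ pw 4 c @ [(3, Cap)] @ [(1, Cap)]" and j = 0]) (simp_all, (simp_all add: eval_nat_numeral)?)
  also have "moves 2 0 \<dots> ([(1, Cup)] @ [(1, Cup)] @ pw 0 q @ sh 2 (T ps) @ pw 4 c @ [(1, Cap)] @ [(1, Cap)])"
    by (rule moves_subst_rev[OF exchange_lists[of 3 "[(1, Cap)]" 0 6 "[(0, Cap)]"], where u = "[(1, Cup)] @ [(1, Cup)] @ pw 0 q @ sh 2 (T ps) @ pw 4 c" and v = "[]" and j = 0]) (simp_all, (simp_all add: eval_nat_numeral)?)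
  also have "moves 2 0 \<dots> ([(1, Cup)] @ [(1, Cup)] @ pw 0 q @ sh 2 (T ps) @ [(1, Cap)] @ pw 2 c @ [(1, Cap)])"
    by (rule moves_subst_rev[OF exchange_lists[of 3 "[(1, Cap)]" 1 6 "pw 0 c"], where u = "[(1, Cup)] @ [(1, Cup)] @ pw 0 q @ sh 2 (T ps)" and v = "[(1, Cap)]" and j = 0]) (simp_all, (simp_all add: eval_nat_numeral)?)
  finally show ?thesis by simp
qed

text \<open>\<open>T\<close> recurses on the first column; for a rotation the last one has to be
  exposed as well. The inductive step only exchanges heights.\<close>

lemma T_snoc: "moves 2 0 (T (ps @ [c])) ([(1, Cup)] @ T ps @ pw 2 c @ [(1, Cap)])"
proof (induction ps)
  case Nil
  show ?case using moves_trans0(1)[OF T_single moves_sym[OF T_single1[of c]]] by simp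
next
  case (Cons q ps)
  show ?case using T_snoc_step[OF Cons, of q] by (simp add: T.simps(2))
qed

section \<open>A strand passing over a tangle\<close>

definition over :: "nat \<Rightarrow> diagram" where
  "over w = map (\<lambda>i. (i, Cross True)) [0..<w]"

lemma over_add: "over (a + b) = over a @ sh a (over b)"
proof -
  have "[0..<a + b] = [0..<a] @ map (\<lambda>i. i + a) [0..<b]"
    using upt_add_eq_append[of 0 a b] map_add_upt[of a b] by (simp add: add.commute)
  then show ?thesis by (simp add: over_def sh_def)
qed

lemma over_0 [simp]: "over 0 = []" and over_2: "over 2 = pw 0 1 @ pw 1 1"
  by (simp_all add: over_def pw_sgn numeral_2_eq_2)

lemmas over_2' = over_2[unfolded numeral_2_eq_2]

lemma ok_over: "w + 1 \<le> n \<Longrightarrow> ok n (over w) \<and> out n (over w) = n"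
  by (induction w) (auto simp: over_def)

lemma over_gen0: "moves (ins g + 1) 0 ([(1, g)] @ over (outs g)) (over (ins g) @ [(0, g)])"
proof (cases g)
  case Cup
  have "moves 1 0 ([] @ sh 0 ([(1, Cup)] @ pw 0 1) @ pw 1 1) ([] @ sh 0 ([(0, Cup)] @ pw 1 (-1)) @ pw 1 1)"
    by (rule moves_subst_rev[OF slide_cup_pw[of "-1"], where u = "[]" and j = 0 and v = "pw 1 1"]) simp_all
  also have "moves 1 0 \<dots> ([(0, Cup)] @ sh 1 (pw 0 0) @ [])"
    using moves_context[OF pwA[of 0 "-1" 1], of 1 "[(0, Cup)]" 1 "[]"] by simp
  finally show ?thesis by (simp add: Cup over_2)
next
  case Cap
  show ?thesis using moves_sym[OF cap_pass2[of 1]] by (simp add: Cap over_2' eval_nat_numeral)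
next
  case (Cross b)
  show ?thesis using moves_sym[OF pass_pw[of 1 "if b then 1 else -1"]]
    by (simp add: Cross over_2' eval_nat_numeral pw_sgn(3) split del: if_split)
qed

lemma over_gen:
  assumes "i + ins g \<le> n"
  shows "moves (n + 1) 0 ([(i + 1, g)] @ over (n - ins g + outs g)) (over n @ [(i, g)])"
proof -
  define r where "r = n - i - ins g"
  have n: "n = i + (ins g + r)" and n': "n - ins g + outs g = i + (outs g + r)"
    using assms by (auto simp: r_def)
  define R where "R = sh (i + outs g) (over r)"
  have g: "ok (n + 1) [(i + 1, g)]" "out (n + 1) [(i + 1, g)] = n - ins g + outs g + 1"
    using assms by (cases g; simp)+
  have X0: "ok (n + 1) ([(i + 1, g)] @ over (n - ins g + outs g))"
    unfolding ok_append g using ok_over g(1) by simp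
  have X0_eq: "[(i + 1, g)] @ over (n - ins g + outs g) = ([(i + 1, g)] @ over i) @ sh i (over (outs g)) @ R"
    unfolding n' over_add[of i] over_add[of "outs g"] R_def by (simp add: add.commute)
  have "moves (n + 1) 0 (over i @ sh (out (i + 1) (over i) + 0) [(0, g)]) (sh (i + 1 + 0) [(0, g)] @ over i)"
    by (rule exchange_lists) (use ok_over[of i "i + 1"] assms in \<open>cases g; auto\<close>)+
  then have e1: "moves (n + 1) 0 ([(i + 1, g)] @ over i) (over i @ [(i + 1, g)])"
    using ok_over[of i "i + 1"] by (auto intro: moves_sym)
  have m1: "moves (n + 1) 0 ([(i + 1, g)] @ over (n - ins g + outs g))
      (over i @ [(i + 1, g)] @ sh i (over (outs g)) @ R)" (is "moves _ _ _ ?X1")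
    by (rule moves_subst[OF e1, where u = "[]" and j = 0 and v = "sh i (over (outs g)) @ R"])
      (use X0 X0_eq in simp_all)
  have m2: "moves (n + 1) 0 ?X1 (over i @ sh i (over (ins g)) @ [(i, g)] @ R)" (is "moves _ _ _ ?X2")
    by (rule moves_subst[OF over_gen0[of g], where u = "over i" and j = i and v = R])
      (use ok_over[of i "n + 1"] n moves_ok2[OF m1] in simp_all)
  have g': "ok (i + ins g) [(i, g)]" "out (i + ins g) [(i, g)] = i + outs g" by (cases g; simp)+
  have e2: "moves (n + 1) 0 ([(i, g)] @ sh (out (i + ins g) [(i, g)] + 0) (over r)) (sh (i + ins g + 0) (over r) @ [(i, g)])"
    by (rule exchange_lists) (use g' n ok_over[of r] in \<open>simp_all\<close>)
  have m3: "moves (n + 1) 0 ?X2 (over n @ [(i, g)])"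
    by (rule moves_subst[OF e2, where u = "over i @ sh i (over (ins g))" and j = 0 and v = "[]"])
      (use n ok_over[of "i + ins g" "n + 1"] moves_ok2[OF m2] g' in \<open>simp_all add: over_add[of i] over_add[of "ins g"] R_def add.commute[of _ i]\<close>)
  from m1 m2 m3 show ?thesis by (blast intro: moves_trans0)
qed

text \<open>A strand lying above the plane of a tangle can be swept across it. For single pieces
  this is \<open>over_gen0\<close>, and height exchanges take care of the strands beside the
  piece.\<close>

lemma over_tangle:
  assumes "ok w D" shows "moves (w + 1) 0 (sh 1 D @ over (out w D)) (over w @ D)"
  using assms
proof (induction D arbitrary: w)
  case Nil
  then show ?case using ok_over by (auto intro: moves_refl)
next
  case (Cons x D)
  obtain i g where [simp]: "x = (i, g)" by fastforce
  define w1 where "w1 = w - ins g + outs g"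
  have i: "i + ins g \<le> w" using Cons.prems by (cases g) auto
  have g: "out w [(i, g)] = w1" "ok w [(i, g)]" using i by (cases g; simp add: w1_def)+
  have "ok w ([(i, g)] @ D)" using Cons.prems by simp
  then have D: "ok w1 D" unfolding ok_append g by simp
  have o: "out w ((i, g) # D) = out w1 D" using g out_append[of w "[(i, g)]" D] by simp
  have g': "out (w + 1) [(i + 1, g)] = w1 + 1" "ok (w + 1) [(i + 1, g)]"
    using out_sh[OF g(2), of 1] ok_sh[of w 1 "[(i, g)]"] g by simp_all
  have "ok (w + 1) ([(i + 1, g)] @ sh 0 (sh 1 D @ over (out w1 D)) @ [])"
    unfolding ok_append g' using moves_ok1[OF Cons.IH[OF D]] g'(2) by simp
  then have "moves (w + 1) 0 ([(i + 1, g)] @ sh 0 (sh 1 D @ over (out w1 D)) @ []) ([(i + 1, g)] @ sh 0 (over w1 @ D) @ [])"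
    by (intro moves_context[OF Cons.IH[OF D]]) (use g' in auto)
  moreover have "moves (w + 1) 0 (([] @ sh 0 ([(i + 1, g)] @ over w1) @ D)) (([] @ sh 0 (over w @ [(i, g)]) @ D))"
    using over_gen[OF i] moves_ok2[OF calculation] by (intro moves_context) (auto simp: w1_def)
  ultimately show ?case using moves_trans0(1)[of "w + 1" "sh 1 (x # D) @ over (out w (x # D))"]
    by (simp add: o)
qed

lemma over_T: "moves 3 0 (sh 1 (T ps) @ pw 0 1 @ pw 1 1) (pw 0 1 @ pw 1 1 @ T ps)"
  using over_tangle[of 2 "T ps"] by (simp add: over_2' eval_nat_numeral)

lemma nested_cups:
  assumes e: "e = 1 \<or> e = -1"
  shows "moves 0 0 ([(0, Cup)] @ [(1, Cup)] @ pw 0 e) ([(0, Cup)] @ [(1, Cup)] @ pw 2 e)"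
proof -
  have "moves 0 0 ([(0, Cup)] @ [(1, Cup)] @ pw 0 e) ([(0, Cup)] @ [(0, Cup)] @ pw 1 (-e))"
    by (rule moves_subst_rev[OF slide_cup_pw[OF uminus_sign[OF e]], where u = "[(0, Cup)]" and v = "[]" and j = 0]) (simp_all, (simp_all add: eval_nat_numeral)?)
  also have "moves 0 0 \<dots> ([(0, Cup)] @ [(2, Cup)] @ pw 1 (-e))"
    by (rule moves_subst_rev[OF exchange_lists[of 0 "[(0, Cup)]" 0 0 "[(0, Cup)]"], where u = "[]" and v = "pw 1 (-e)" and j = 0]) (simp_all, (simp_all add: eval_nat_numeral)?)
  also have "moves 0 0 \<dots> ([(0, Cup)] @ [(1, Cup)] @ pw 2 e)"
    by (rule moves_subst_rev[OF slide_cup_pw[OF e], where u = "[(0, Cup)]" and v = "[]" and j = 1]) (simp_all, (simp_all add: eval_nat_numeral)?)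
  finally show ?thesis by simp
qed

lemma nested_caps:
  assumes e: "e = 1 \<or> e = -1"
  shows "moves 4 0 (pw 0 e @ [(1, Cap)] @ [(0, Cap)]) (pw 2 e @ [(1, Cap)] @ [(0, Cap)])"
proof -
  have "moves 4 0 (pw 0 e @ [(1, Cap)] @ [(0, Cap)]) (pw 1 (-e) @ [(0, Cap)] @ [(0, Cap)])"
    by (rule moves_subst_rev[OF slide_cap_pw[OF uminus_sign[OF e]], where u = "[]" and v = "[(0, Cap)]" and j = 0]) (simp_all, (simp_all add: eval_nat_numeral)?)
  also have "moves 4 0 \<dots> (pw 1 (-e) @ [(2, Cap)] @ [(0, Cap)])"
    by (rule moves_subst[OF exchange_lists[of 2 "[(0, Cap)]" 0 4 "[(0, Cap)]"], where u = "pw 1 (-e)" and v = "[]" and j = 0]) (simp_all, (simp_all add: eval_nat_numeral)?)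
  also have "moves 4 0 \<dots> (pw 2 e @ [(1, Cap)] @ [(0, Cap)])"
    by (rule moves_subst_rev[OF slide_cap_pw[OF e], where u = "[]" and v = "[(0, Cap)]" and j = 1]) (simp_all, (simp_all add: eval_nat_numeral)?)
  finally show ?thesis by simp
qed

text \<open>The two nested arcs bound a band. Crossing its left pair of ends over the right pair
  flips the band, and after straightening only a full twist of the right pair is left.
  \<open>twist_caps\<close> leaves the opposite twist at the top.\<close>

lemma twist_cups:
  shows "moves 0 0 ([(0, Cup)] @ [(1, Cup)] @ pw 1 1 @ pw 2 1 @ pw 0 1 @ pw 1 1) ([(0, Cup)] @ [(1, Cup)] @ pw 2 (-2))"
proof -
  have "moves 0 0 ([(0, Cup)] @ [(1, Cup)] @ pw 1 1 @ pw 2 1 @ pw 0 1 @ pw 1 1) ([(0, Cup)] @ [(1, Cup)] @ pw 2 1 @ pw 0 1 @ pw 1 1)"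
    by (rule moves_subst[OF r1_cup_pw1[of 1], where u = "[(0, Cup)]" and v = "pw 2 1 @ pw 0 1 @ pw 1 1" and j = 1]) (simp_all, (simp_all add: eval_nat_numeral)?)
  also have "moves 0 0 \<dots> ([(0, Cup)] @ [(2, Cup)] @ pw 1 (-1) @ pw 0 1 @ pw 1 1)"
    by (rule moves_subst[OF slide_cup_pw[of 1], where u = "[(0, Cup)]" and v = "pw 0 1 @ pw 1 1" and j = 1]) (simp_all, (simp_all add: eval_nat_numeral)?)
  also have "moves 0 0 \<dots> ([(0, Cup)] @ [(2, Cup)] @ pw 0 1 @ pw 1 1 @ pw 0 (-1))"
    by (rule moves_subst_rev[OF conj_pw[of 1 1], where u = "[(0, Cup)] @ [(2, Cup)]" and v = "[]" and j = 0]) (simp_all, (simp_all add: eval_nat_numeral)?)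
  also have "moves 0 0 \<dots> ([(0, Cup)] @ pw 0 1 @ [(2, Cup)] @ pw 1 1 @ pw 0 (-1))"
    by (rule moves_subst_rev[OF exchange_lists[of 2 "pw 0 1" 0 2 "[(0, Cup)]"], where u = "[(0, Cup)]" and v = "pw 1 1 @ pw 0 (-1)" and j = 0]) (simp_all, (simp_all add: eval_nat_numeral)?)
  also have "moves 0 0 \<dots> ([(0, Cup)] @ [(2, Cup)] @ pw 1 1 @ pw 0 (-1))"
    by (rule moves_subst[OF r1_cup_pw1[of 1], where u = "[]" and v = "[(2, Cup)] @ pw 1 1 @ pw 0 (-1)" and j = 0]) (simp_all, (simp_all add: eval_nat_numeral)?)
  also have "moves 0 0 \<dots> ([(0, Cup)] @ [(1, Cup)] @ pw 2 (-1) @ pw 0 (-1))"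
    by (rule moves_subst_rev[OF slide_cup_pw[of "-1"], where u = "[(0, Cup)]" and v = "pw 0 (-1)" and j = 1]) (simp_all, (simp_all add: eval_nat_numeral)?)
  also have "moves 0 0 \<dots> ([(0, Cup)] @ [(1, Cup)] @ pw 0 (-1) @ pw 2 (-1))"
    by (rule moves_subst_rev[OF exchange_lists[of 2 "pw 0 (-1)" 0 4 "pw 0 (-1)"], where u = "[(0, Cup)] @ [(1, Cup)]" and v = "[]" and j = 0]) (simp_all, (simp_all add: eval_nat_numeral)?)
  also have "moves 0 0 \<dots> ([(0, Cup)] @ [(1, Cup)] @ pw 2 (-1) @ pw 2 (-1))"
    by (rule moves_subst[OF nested_cups[of "-1"], where u = "[]" and v = "pw 2 (-1)" and j = 0]) (simp_all, (simp_all add: eval_nat_numeral)?)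
  also have "moves 0 0 \<dots> ([(0, Cup)] @ [(1, Cup)] @ pw 2 (-2))"
    by (rule moves_subst[OF pwA[of "-2" "-1" "-1"], where u = "[(0, Cup)] @ [(1, Cup)]" and v = "[]" and j = 2]) (simp_all, (simp_all add: eval_nat_numeral)?)
  finally show ?thesis by simp
qed

lemma twist_caps:
  shows "moves 4 0 (pw 1 (-1) @ pw 0 (-1) @ pw 2 (-1) @ pw 1 (-1) @ [(1, Cap)] @ [(0, Cap)]) (pw 2 2 @ [(1, Cap)] @ [(0, Cap)])"
proof -
  have "moves 4 0 (pw 1 (-1) @ pw 0 (-1) @ pw 2 (-1) @ pw 1 (-1) @ [(1, Cap)] @ [(0, Cap)]) (pw 1 (-1) @ pw 0 (-1) @ pw 2 (-1) @ [(1, Cap)] @ [(0, Cap)])"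
    by (rule moves_subst[OF r1_cap_pw1[of "-1"], where u = "pw 1 (-1) @ pw 0 (-1) @ pw 2 (-1)" and v = "[(0, Cap)]" and j = 1]) (simp_all, (simp_all add: eval_nat_numeral)?)
  also have "moves 4 0 \<dots> (pw 1 (-1) @ pw 0 (-1) @ pw 1 1 @ [(2, Cap)] @ [(0, Cap)])"
    by (rule moves_subst[OF slide_cap_pw[of "-1"], where u = "pw 1 (-1) @ pw 0 (-1)" and v = "[(0, Cap)]" and j = 1]) (simp_all, (simp_all add: eval_nat_numeral)?)
  also have "moves 4 0 \<dots> (pw 0 1 @ pw 1 (-1) @ pw 0 (-1) @ [(2, Cap)] @ [(0, Cap)])"
    by (rule moves_subst_rev[OF conj_pw[of 1 "-1"], where u = "[]" and v = "[(2, Cap)] @ [(0, Cap)]" and j = 0]) (simp_all, (simp_all add: eval_nat_numeral)?)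
  also have "moves 4 0 \<dots> (pw 0 1 @ pw 1 (-1) @ [(2, Cap)] @ pw 0 (-1) @ [(0, Cap)])"
    by (rule moves_subst[OF exchange_lists[of 2 "pw 0 (-1)" 0 4 "[(0, Cap)]"], where u = "pw 0 1 @ pw 1 (-1)" and v = "[(0, Cap)]" and j = 0]) (simp_all, (simp_all add: eval_nat_numeral)?)
  also have "moves 4 0 \<dots> (pw 0 1 @ pw 1 (-1) @ [(2, Cap)] @ [(0, Cap)])"
    by (rule moves_subst[OF r1_cap_pw1[of "-1"], where u = "pw 0 1 @ pw 1 (-1) @ [(2, Cap)]" and v = "[]" and j = 0]) (simp_all, (simp_all add: eval_nat_numeral)?)
  also have "moves 4 0 \<dots> (pw 0 1 @ pw 2 1 @ [(1, Cap)] @ [(0, Cap)])"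
    by (rule moves_subst_rev[OF slide_cap_pw[of 1], where u = "pw 0 1" and v = "[(0, Cap)]" and j = 1]) (simp_all, (simp_all add: eval_nat_numeral)?)
  also have "moves 4 0 \<dots> (pw 2 1 @ pw 0 1 @ [(1, Cap)] @ [(0, Cap)])"
    by (rule moves_subst[OF exchange_lists[of 2 "pw 0 1" 0 4 "pw 0 1"], where u = "[]" and v = "[(1, Cap)] @ [(0, Cap)]" and j = 0]) (simp_all, (simp_all add: eval_nat_numeral)?)
  also have "moves 4 0 \<dots> (pw 2 1 @ pw 2 1 @ [(1, Cap)] @ [(0, Cap)])"
    by (rule moves_subst[OF nested_caps[of 1], where u = "pw 2 1" and v = "[]" and j = 0]) (simp_all, (simp_all add: eval_nat_numeral)?)
  also have "moves 4 0 \<dots> (pw 2 2 @ [(1, Cap)] @ [(0, Cap)])"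
    by (rule moves_subst[OF pwA[of 2 1 1], where u = "[]" and v = "[(1, Cap)] @ [(0, Cap)]" and j = 2]) (simp_all, (simp_all add: eval_nat_numeral)?)
  finally show ?thesis by simp
qed

text \<open>The first column is carried as a band over all of \<open>T ps\<close>: a crossing of the
  two bands is created together with its inverse above \<open>T ps\<close>, and the lower one is
  pulled down past \<open>T ps\<close>. The nested minima and maxima turn the two into full twists
  -2 and 2 of the right band, which cancel.\<close>

lemma rotate0:
  shows "moves 0 0 ([(0, Cup)] @ [(1, Cup)] @ pw 0 c @ sh 2 (T ps) @ [(1, Cap)] @ [(0, Cap)]) ([(0, Cup)] @ [(1, Cup)] @ sh 0 (T ps) @ pw 2 c @ [(1, Cap)] @ [(0, Cap)])"
proof -
  have "moves 0 0 ([(0, Cup)] @ [(1, Cup)] @ pw 0 c @ sh 2 (T ps) @ [(1, Cap)] @ [(0, Cap)]) ([(0, Cup)] @ [(1, Cup)] @ pw 0 c @ sh 2 (T ps) @ pw 1 1 @ pw 1 (-1) @ [(1, Cap)] @ [(0, Cap)])"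
    by (rule moves_subst_rev[OF pwA[of 0 1 "-1"], where u = "[(0, Cup)] @ [(1, Cup)] @ pw 0 c @ sh 2 (T ps)" and v = "[(1, Cap)] @ [(0, Cap)]" and j = 1]) (simp_all, (simp_all add: eval_nat_numeral)?)
  also have "moves 0 0 \<dots> ([(0, Cup)] @ [(1, Cup)] @ pw 0 c @ sh 2 (T ps) @ pw 1 1 @ pw 2 1 @ pw 2 (-1) @ pw 1 (-1) @ [(1, Cap)] @ [(0, Cap)])"
    by (rule moves_subst_rev[OF pwA[of 0 1 "-1"], where u = "[(0, Cup)] @ [(1, Cup)] @ pw 0 c @ sh 2 (T ps) @ pw 1 1" and v = "pw 1 (-1) @ [(1, Cap)] @ [(0, Cap)]" and j = 2]) (simp_all, (simp_all add: eval_nat_numeral)?)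
  also have "moves 0 0 \<dots> ([(0, Cup)] @ [(1, Cup)] @ pw 0 c @ sh 2 (T ps) @ pw 1 1 @ pw 2 1 @ pw 0 1 @ pw 0 (-1) @ pw 2 (-1) @ pw 1 (-1) @ [(1, Cap)] @ [(0, Cap)])"
    by (rule moves_subst_rev[OF pwA[of 0 1 "-1"], where u = "[(0, Cup)] @ [(1, Cup)] @ pw 0 c @ sh 2 (T ps) @ pw 1 1 @ pw 2 1" and v = "pw 2 (-1) @ pw 1 (-1) @ [(1, Cap)] @ [(0, Cap)]" and j = 0]) (simp_all, (simp_all add: eval_nat_numeral)?)
  also have "moves 0 0 \<dots> ([(0, Cup)] @ [(1, Cup)] @ pw 0 c @ sh 2 (T ps) @ pw 1 1 @ pw 2 1 @ pw 0 1 @ pw 1 1 @ pw 1 (-1) @ pw 0 (-1) @ pw 2 (-1) @ pw 1 (-1) @ [(1, Cap)] @ [(0, Cap)])"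
    by (rule moves_subst_rev[OF pwA[of 0 1 "-1"], where u = "[(0, Cup)] @ [(1, Cup)] @ pw 0 c @ sh 2 (T ps) @ pw 1 1 @ pw 2 1 @ pw 0 1" and v = "pw 0 (-1) @ pw 2 (-1) @ pw 1 (-1) @ [(1, Cap)] @ [(0, Cap)]" and j = 1]) (simp_all, (simp_all add: eval_nat_numeral)?)
  also have "moves 0 0 \<dots> ([(0, Cup)] @ [(1, Cup)] @ pw 0 c @ pw 1 1 @ pw 2 1 @ sh 1 (T ps) @ pw 0 1 @ pw 1 1 @ pw 1 (-1) @ pw 0 (-1) @ pw 2 (-1) @ pw 1 (-1) @ [(1, Cap)] @ [(0, Cap)])"
    by (rule moves_subst[OF over_T, where u = "[(0, Cup)] @ [(1, Cup)] @ pw 0 c" and v = "pw 0 1 @ pw 1 1 @ pw 1 (-1) @ pw 0 (-1) @ pw 2 (-1) @ pw 1 (-1) @ [(1, Cap)] @ [(0, Cap)]" and j = 1]) (simp_all, (simp_all add: eval_nat_numeral)?)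
  also have "moves 0 0 \<dots> ([(0, Cup)] @ [(1, Cup)] @ pw 0 c @ pw 1 1 @ pw 2 1 @ pw 0 1 @ pw 1 1 @ sh 0 (T ps) @ pw 1 (-1) @ pw 0 (-1) @ pw 2 (-1) @ pw 1 (-1) @ [(1, Cap)] @ [(0, Cap)])"
    by (rule moves_subst[OF over_T, where u = "[(0, Cup)] @ [(1, Cup)] @ pw 0 c @ pw 1 1 @ pw 2 1" and v = "pw 1 (-1) @ pw 0 (-1) @ pw 2 (-1) @ pw 1 (-1) @ [(1, Cap)] @ [(0, Cap)]" and j = 0]) (simp_all, (simp_all add: eval_nat_numeral)?)
  also have "moves 0 0 \<dots> ([(0, Cup)] @ [(1, Cup)] @ pw 0 c @ pw 1 1 @ pw 0 1 @ pw 2 1 @ pw 1 1 @ sh 0 (T ps) @ pw 1 (-1) @ pw 0 (-1) @ pw 2 (-1) @ pw 1 (-1) @ [(1, Cap)] @ [(0, Cap)])"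
    by (rule moves_subst_rev[OF exchange_lists[of 2 "pw 0 1" 0 4 "pw 0 1"], where u = "[(0, Cup)] @ [(1, Cup)] @ pw 0 c @ pw 1 1" and v = "pw 1 1 @ sh 0 (T ps) @ pw 1 (-1) @ pw 0 (-1) @ pw 2 (-1) @ pw 1 (-1) @ [(1, Cap)] @ [(0, Cap)]" and j = 0]) (simp_all, (simp_all add: eval_nat_numeral)?)
  also have "moves 0 0 \<dots> ([(0, Cup)] @ [(1, Cup)] @ pw 1 1 @ pw 0 1 @ pw 1 c @ pw 2 1 @ pw 1 1 @ sh 0 (T ps) @ pw 1 (-1) @ pw 0 (-1) @ pw 2 (-1) @ pw 1 (-1) @ [(1, Cap)] @ [(0, Cap)])"
    by (rule moves_subst_rev[OF pass_pw2[of 1 c], where u = "[(0, Cup)] @ [(1, Cup)]" and v = "pw 2 1 @ pw 1 1 @ sh 0 (T ps) @ pw 1 (-1) @ pw 0 (-1) @ pw 2 (-1) @ pw 1 (-1) @ [(1, Cap)] @ [(0, Cap)]" and j = 0]) (simp_all, (simp_all add: eval_nat_numeral)?)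
  also have "moves 0 0 \<dots> ([(0, Cup)] @ [(1, Cup)] @ pw 1 1 @ pw 0 1 @ pw 2 1 @ pw 1 1 @ pw 2 c @ sh 0 (T ps) @ pw 1 (-1) @ pw 0 (-1) @ pw 2 (-1) @ pw 1 (-1) @ [(1, Cap)] @ [(0, Cap)])"
    by (rule moves_subst_rev[OF pass_pw2[of 1 c], where u = "[(0, Cup)] @ [(1, Cup)] @ pw 1 1 @ pw 0 1" and v = "sh 0 (T ps) @ pw 1 (-1) @ pw 0 (-1) @ pw 2 (-1) @ pw 1 (-1) @ [(1, Cap)] @ [(0, Cap)]" and j = 1]) (simp_all, (simp_all add: eval_nat_numeral)?)
  also have "moves 0 0 \<dots> ([(0, Cup)] @ [(1, Cup)] @ pw 1 1 @ pw 2 1 @ pw 0 1 @ pw 1 1 @ pw 2 c @ sh 0 (T ps) @ pw 1 (-1) @ pw 0 (-1) @ pw 2 (-1) @ pw 1 (-1) @ [(1, Cap)] @ [(0, Cap)])"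
    by (rule moves_subst[OF exchange_lists[of 2 "pw 0 1" 0 4 "pw 0 1"], where u = "[(0, Cup)] @ [(1, Cup)] @ pw 1 1" and v = "pw 1 1 @ pw 2 c @ sh 0 (T ps) @ pw 1 (-1) @ pw 0 (-1) @ pw 2 (-1) @ pw 1 (-1) @ [(1, Cap)] @ [(0, Cap)]" and j = 0]) (simp_all, (simp_all add: eval_nat_numeral)?)
  also have "moves 0 0 \<dots> ([(0, Cup)] @ [(1, Cup)] @ pw 2 (-2) @ pw 2 c @ sh 0 (T ps) @ pw 1 (-1) @ pw 0 (-1) @ pw 2 (-1) @ pw 1 (-1) @ [(1, Cap)] @ [(0, Cap)])"
    by (rule moves_subst[OF twist_cups, where u = "[]" and v = "pw 2 c @ sh 0 (T ps) @ pw 1 (-1) @ pw 0 (-1) @ pw 2 (-1) @ pw 1 (-1) @ [(1, Cap)] @ [(0, Cap)]" and j = 0]) (simp_all, (simp_all add: eval_nat_numeral)?)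
  also have "moves 0 0 \<dots> ([(0, Cup)] @ [(1, Cup)] @ pw 2 (-2) @ pw 2 c @ sh 0 (T ps) @ pw 2 2 @ [(1, Cap)] @ [(0, Cap)])"
    by (rule moves_subst[OF twist_caps, where u = "[(0, Cup)] @ [(1, Cup)] @ pw 2 (-2) @ pw 2 c @ sh 0 (T ps)" and v = "[]" and j = 0]) (simp_all, (simp_all add: eval_nat_numeral)?)
  also have "moves 0 0 \<dots> ([(0, Cup)] @ [(1, Cup)] @ pw 2 (-2) @ pw 2 c @ pw 2 2 @ sh 0 (T ps) @ [(1, Cap)] @ [(0, Cap)])"
    by (rule moves_subst[OF exchange_lists[of 2 "T ps" 0 4 "pw 0 2"], where u = "[(0, Cup)] @ [(1, Cup)] @ pw 2 (-2) @ pw 2 c" and v = "[(1, Cap)] @ [(0, Cap)]" and j = 0]) (simp_all, (simp_all add: eval_nat_numeral)?)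
  also have "moves 0 0 \<dots> ([(0, Cup)] @ [(1, Cup)] @ pw 2 (c-2) @ pw 2 2 @ sh 0 (T ps) @ [(1, Cap)] @ [(0, Cap)])"
    by (rule moves_subst[OF pwA[of "c-2" "-2" c], where u = "[(0, Cup)] @ [(1, Cup)]" and v = "pw 2 2 @ sh 0 (T ps) @ [(1, Cap)] @ [(0, Cap)]" and j = 2]) (simp_all, (simp_all add: eval_nat_numeral)?)
  also have "moves 0 0 \<dots> ([(0, Cup)] @ [(1, Cup)] @ pw 2 c @ sh 0 (T ps) @ [(1, Cap)] @ [(0, Cap)])"
    by (rule moves_subst[OF pwA[of c "c-2" 2], where u = "[(0, Cup)] @ [(1, Cup)]" and v = "sh 0 (T ps) @ [(1, Cap)] @ [(0, Cap)]" and j = 2]) (simp_all, (simp_all add: eval_nat_numeral)?)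
  also have "moves 0 0 \<dots> ([(0, Cup)] @ [(1, Cup)] @ sh 0 (T ps) @ pw 2 c @ [(1, Cap)] @ [(0, Cap)])"
    by (rule moves_subst_rev[OF exchange_lists[of 2 "T ps" 0 4 "pw 0 c"], where u = "[(0, Cup)] @ [(1, Cup)]" and v = "[(1, Cap)] @ [(0, Cap)]" and j = 0]) (simp_all, (simp_all add: eval_nat_numeral)?)
  finally show ?thesis by simp
qed

lemma W_rotate: "moves 0 0 (W (ps @ [c])) (W (c # ps))"
proof -
  have "moves 0 0 ([(0, Cup)] @ sh 0 (T (ps @ [c])) @ [(0, Cap)])
      ([(0, Cup)] @ sh 0 ([(1, Cup)] @ T ps @ pw 2 c @ [(1, Cap)]) @ [(0, Cap)])"
    by (rule moves_context[OF T_snoc]) simp_all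
  also have "moves 0 0 \<dots> (W (c # ps))"
    using moves_sym[OF rotate0[of c ps]] by (simp add: W_def T.simps(2))
  finally show ?thesis by (simp add: W_def)
qed

section \<open>From the pretzel diagram to the recursive tangle\<close>

definition cups :: "nat \<Rightarrow> diagram" where
  "cups n = map (\<lambda>k. (2 * k + 1, Cup)) [0..<n]"

definition caps :: "nat \<Rightarrow> diagram" where
  "caps n = rev (map (\<lambda>k. (2 * k + 1, Cap)) [0..<n])"

definition columns :: "int list \<Rightarrow> diagram" where
  "columns ps = concat (map (\<lambda>k. pw (2 * k) (ps ! k)) [0..<length ps])"

lemma upt_Cons: "[0..<Suc n] = 0 # map Suc [0..<n]"
  using map_Suc_upt[of 0 n] by (simp add: upt_conv_Cons del: upt_Suc)

lemma cups_Suc: "cups (Suc n) = [(1, Cup)] @ sh 2 (cups n)"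
  unfolding cups_def upt_Cons by (simp add: sh_def o_def algebra_simps)

lemma caps_Suc: "caps (Suc n) = sh 2 (caps n) @ [(1, Cap)]"
  unfolding caps_def upt_Cons by (simp add: sh_def o_def algebra_simps rev_map)

lemma columns_Cons: "columns (q # ps) = pw 0 q @ sh 2 (columns ps)"
proof -
  have "sh 2 (concat xss) = concat (map (sh 2) xss)" for xss by (induction xss) auto
  then show ?thesis unfolding columns_def length_Cons upt_Cons by (simp add: o_def)
qed

lemma columns_step:
  assumes IH: "moves 2 0 (C @ D) (T ps)" and C: "ok 2 C"
  shows "moves 2 0 ([(1, Cup)] @ sh 2 C @ pw 0 q @ sh 2 D @ [(1, Cap)]) ([(1, Cup)] @ pw 0 q @ sh 2 (T ps) @ [(1, Cap)])"
proof -
  have o: "out (out 2 C) D = 2" "ok (out 2 C) D" using moves_out[OF IH] moves_ok1[OF IH] by simp_all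
  have "moves 2 0 ([(1, Cup)] @ sh 2 C @ pw 0 q @ sh 2 D @ [(1, Cap)]) ([(1, Cup)] @ pw 0 q @ sh 2 C @ sh 2 D @ [(1, Cap)])"
    by (rule moves_subst_rev[OF exchange_lists[of 2 "pw 0 q" 0 4 C], where u = "[(1, Cup)]" and v = "sh 2 D @ [(1, Cap)]" and j = 0]) (simp_all add: C o out_sh' ok_sh', (simp_all add: eval_nat_numeral)?)
  also have "moves 2 0 \<dots> ([(1, Cup)] @ pw 0 q @ sh 2 (T ps) @ [(1, Cap)])"
    by (rule moves_subst[OF IH, where u = "[(1, Cup)] @ pw 0 q" and v = "[(1, Cap)]" and j = 2]) (simp_all add: C o out_sh' ok_sh', (simp_all add: eval_nat_numeral)?)
  finally show ?thesis by simp
qed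

text \<open>\<open>pretzel\<close> lists all minima, then all columns, then all maxima, whereas
  \<open>T\<close> nests them. The two differ by height exchanges and by the zigzags of
  \<open>T_single\<close> at the innermost column.\<close>

lemma columns_T:
  assumes "ps \<noteq> []"
  shows "moves 2 0 (cups (length ps - 1) @ columns ps @ caps (length ps - 1)) (T ps)"
  using assms
proof (induction ps rule: list_nonempty_induct)
  case (single p)
  have "moves 2 0 (pw 0 p) (T [p])" by (rule moves_sym[OF T_single])
  then show ?case by (simp add: cups_def caps_def columns_def)
next
  case (cons p ps)
  from cons(1) obtain m where m: "length ps = Suc m" by (cases ps) auto
  have "ok 2 (cups m)" using moves_ok1[OF cons(2)] by (simp add: m)
  with columns_step[OF cons(2), of p] show ?case
    by (simp add: m cups_Suc caps_Suc columns_Cons T.simps(2))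
qed

lemma pretzel_W:
  assumes "ps \<noteq> []" shows "moves 0 0 (pretzel ps) (W ps)"
proof -
  have "pretzel ps = [(0, Cup)] @ sh 0 (cups (length ps - 1) @ columns ps @ caps (length ps - 1)) @ [(0, Cap)]"
    by (simp add: pretzel_def cups_def caps_def columns_def pw_def)
  also have "moves 0 0 \<dots> ([(0, Cup)] @ sh 0 (T ps) @ [(0, Cap)])"
    by (rule moves_context[OF columns_T[OF assms]]) (use moves_ok[OF columns_T[OF assms]] in \<open>auto simp: numeral_2_eq_2\<close>)
  finally show ?thesis by (simp add: W_def)
qed

section \<open>The length of the unknotting sequence\<close>

fun e2 :: "int list \<Rightarrow> int" where
  "e2 [] = 0"
| "e2 (p # ps) = p * sum_list ps + e2 ps"

lemma e2_snoc: "e2 (ps @ [r]) = e2 ps + r * sum_list ps"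
  by (induction ps) (auto simp: algebra_simps)

lemma fingerable_pos:
  "even (length ps) \<Longrightarrow> (\<And>p. p \<in> set ps \<Longrightarrow> odd p \<and> p > 0) \<Longrightarrow> fingerable ps"
  by (induction ps rule: fingerable.induct) force+

lemma fingerable_Cons:
  assumes "odd (length ps)" "\<And>p. p \<in> set ps \<Longrightarrow> odd p \<and> p > 0"
  shows "fingerable (-1 # ps)"
proof (cases ps)
  case (Cons p qs)
  then show ?thesis using assms fingerable_pos[of qs] by force
qed (use assms in simp)

lemma W_single:
  assumes "e = 1 \<or> e = -1" shows "moves 0 0 (W [e]) trivial_knot"
proof -
  have "moves 0 0 ([(0, Cup)] @ sh 0 (T [e]) @ [(0, Cap)]) ([(0, Cup)] @ sh 0 (pw 0 e) @ [(0, Cap)])"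
    by (rule moves_context[OF T_single]) simp_all
  also have "moves 0 0 \<dots> ([] @ sh 0 [(0, Cup)] @ [(0, Cap)])"
    by (rule moves_subst[OF r1_cup_pw1[OF assms], where u = "[]" and j = 0 and v = "[(0, Cap)]"]) simp_all
  finally show ?thesis by (simp add: W_def trivial_knot_def)
qed

lemma W_cancel: "e = 1 \<or> e = -1 \<Longrightarrow> moves 0 0 (W (e # -e # ps)) (W ps)"
  using moves_context[OF T_cancel, of e 0 "[(0, Cup)]" 0 ps "[(0, Cap)]"] by (simp add: W_def)

lemma sum_list_parity: "(\<And>p. p \<in> set ps \<Longrightarrow> odd (p::int)) \<Longrightarrow> even (sum_list ps) = even (length ps)"
  by (induction ps) auto

text \<open>Each round removes the last column \<open>r\<close> and the first positive column
  \<open>p\<close>; let \<open>s\<close> be the sum of the others. Rotated to the front,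
  \<open>r\<close> loses \<open>(r - 1) / 2\<close> full twists at cost
  \<open>(p + s - 1) / 2\<close> each and becomes 1, which cancels -1. Then \<open>p\<close> loses
  \<open>(p + 1) / 2\<close> full twists at cost \<open>s / 2\<close> each and becomes the new
  -1.\<close>

lemma unknotting_sequence:
  assumes "even (length ps)" "\<And>p. p \<in> set ps \<Longrightarrow> odd p \<and> p > 0"
  shows "\<exists>k. 8 * int k = 2 * (e2 ps - sum_list ps) + int (length ps) \<and>
    moves 0 k (W (-1 # ps)) trivial_knot"
  using assms
proof (induction "length ps" arbitrary: ps rule: less_induct)
  case less
  show ?case
  proof (cases ps)
    case Nil
    then show ?thesis using W_single[of "-1"] by auto
  next
    case (Cons p ps')
    with less.prems(1) have "ps' \<noteq> []" by auto
    then obtain qs r where ps': "ps' = qs @ [r]" by (metis rev_exhaust)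
    have ps: "ps = p # qs @ [r]" by (simp add: Cons ps')
    have qs: "even (length qs)" "\<And>p. p \<in> set qs \<Longrightarrow> odd p \<and> p > 0"
      and pr: "odd p" "p > 0" "odd r" "r > 0"
      using less.prems by (auto simp: ps)
    define s where "s = sum_list qs"
    have s: "even s" "s \<ge> 0"
      using sum_list_parity[of qs] qs sum_list_nonneg[of qs] by (fastforce simp: s_def)+
    define a where "a = nat ((r - 1) div 2)"
    define b where "b = nat ((p + s - 1) div 2)"
    define c where "c = nat ((p + 1) div 2)"
    define d where "d = nat (s div 2)"
    have a: "r = 1 + 2 * int a" using pr by (auto simp: a_def elim!: oddE)
    have b: "p + s = 1 + 2 * int b" using pr s by (auto simp: b_def elim!: oddE evenE)
    have c: "p = -1 + 2 * int c" using pr by (auto simp: c_def elim!: oddE)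
    have d: "s = 2 * int d" using s by (auto simp: d_def elim!: evenE)
    obtain k where k: "8 * int k = 2 * (e2 qs - sum_list qs) + int (length qs)"
      "moves 0 k (W (-1 # qs)) trivial_knot"
      using less.hyps[of qs] qs ps by auto
    have "moves 0 0 (W (-1 # ps)) (W (r # -1 # p # qs))"
      using W_rotate[of "-1 # p # qs" r] by (simp add: ps)
    also have "moves 0 (a * b) \<dots> (W (1 # -1 # p # qs))"
      using untwist_first[of "-1 # p # qs" b a 1] fingerable_Cons[of "p # qs"] qs pr b
      by (force simp: a s_def)
    also have "moves 0 0 \<dots> (W (p # qs))" using W_cancel[of 1] by simp
    finally have 1: "moves 0 (a * b) (W (-1 # ps)) (W (p # qs))" .
    have "moves 0 (c * d) (W (p # qs)) (W (-1 # qs))"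
      using untwist_first[of qs d c "-1"] fingerable_pos[OF qs] d by (simp add: c s_def)
    from moves_trans[OF moves_trans[OF 1 this] k(2)]
    have "moves 0 (a * b + c * d + k) (W (-1 # ps)) trivial_knot" .
    moreover have "8 * int (a * b + c * d + k) = 2 * (e2 ps - sum_list ps) + int (length ps)"
    proof -
      have "r - 1 = 2 * int a" "p + s - 1 = 2 * int b" "p + 1 = 2 * int c" using a b c by simp_all
      then have "(r - 1) * (p + s - 1) = 4 * int (a * b)" "(p + 1) * s = 4 * int (c * d)"
        using d by simp_all
      then have "8 * int (a * b + c * d + k)
          = 2 * ((r - 1) * (p + s - 1)) + 2 * ((p + 1) * s) + 2 * (e2 qs - s) + int (length qs)"
        using k(1) by (simp add: s_def)
      also have "\<dots> = 2 * (e2 ps - sum_list ps) + int (length ps)"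
        by (simp add: ps e2_snoc s_def algebra_simps)
      finally show ?thesis .
    qed
    ultimately show ?thesis by blast
  qed
qed

section \<open>State sums\<close>

definition words :: "'l set \<Rightarrow> nat \<Rightarrow> 'l list set" where
  "words L m = {w. set w \<subseteq> L \<and> length w = m}"

lemma words_0 [simp]: "words L 0 = {[]}"
  by (auto simp: words_def)

lemma sum_words_Suc: "sum f (words L (Suc m)) = (\<Sum>x\<in>L. \<Sum>w\<in>words L m. f (x # w))"
proof -
  have "words L (Suc m) = (\<lambda>(x, w). x # w) ` (L \<times> words L m)"
    by (force simp: words_def length_Suc_conv image_iff)
  moreover have "inj_on (\<lambda>(x, w). x # w) (L \<times> words L m)" by (auto simp: inj_on_def)
  ultimately show ?thesis by (simp add: sum.reindex sum.cartesian_product case_prod_unfold o_def)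
qed

lemma sum_words_2: "sum f (words L 2) = (\<Sum>x\<in>L. \<Sum>y\<in>L. f [x, y])"
  by (simp add: numeral_2_eq_2 sum_words_Suc)

text \<open>The weight \<open>w \<tau> \<rho>\<close> belongs to the labels \<open>\<tau>\<close> below and \<open>\<rho>\<close> above the piece.\<close>

type_synonym ('l, 'r) piece = "('l list \<Rightarrow> 'l list \<Rightarrow> 'r) \<times> nat \<times> nat \<times> nat"

text \<open>States are pushed upwards: \<open>f\<close> depends on the labels below the piece, the
  result on those above. The label set is a parameter because two labels serve the bracket and
  \<open>N\<close> labels the R-matrix.\<close>

definition apply_piece :: "'l set \<Rightarrow> ('l, 'r::comm_ring_1) piece \<Rightarrow> ('l list \<Rightarrow> 'r) \<Rightarrow> 'l list \<Rightarrow> 'r" where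
  "apply_piece L = (\<lambda>(w, i, m, n) f s.
     \<Sum>t\<in>words L m. w t (take n (drop i s)) * f (take i s @ t @ drop (i + n) s))"

lemma apply_piece_append:
  "length x = i \<Longrightarrow> length r = n \<Longrightarrow>
    apply_piece L (w, i, m, n) f (x @ r @ y) = (\<Sum>t\<in>words L m. w t r * f (x @ t @ y))"
  by (auto simp: apply_piece_def)

fun pieces_ok :: "nat \<Rightarrow> ('l, 'r) piece list \<Rightarrow> bool" where
  "pieces_ok k [] \<longleftrightarrow> True"
| "pieces_ok k ((w, i, m, n) # D) \<longleftrightarrow> i + m \<le> k \<and> pieces_ok (k - m + n) D"

fun pieces_out :: "nat \<Rightarrow> ('l, 'r) piece list \<Rightarrow> nat" where
  "pieces_out k [] = k"
| "pieces_out k ((w, i, m, n) # D) = pieces_out (k - m + n) D"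

fun state_sum :: "'l set \<Rightarrow> ('l, 'r::comm_ring_1) piece list \<Rightarrow> ('l list \<Rightarrow> 'r) \<Rightarrow> 'l list \<Rightarrow> 'r" where
  "state_sum L [] f = f"
| "state_sum L (p # D) f = state_sum L D (apply_piece L p f)"

lemma state_sum_append: "state_sum L (D @ E) f = state_sum L E (state_sum L D f)"
  by (induction D arbitrary: f) auto

lemma pieces_ok_append: "pieces_ok k (D @ E) \<longleftrightarrow> pieces_ok k D \<and> pieces_ok (pieces_out k D) E"
  by (induction k D rule: pieces_ok.induct) auto

lemma pieces_out_append: "pieces_out k (D @ E) = pieces_out (pieces_out k D) E"
  by (induction k D rule: pieces_ok.induct) auto

lemma split_list3:
  assumes "i + n \<le> length s"
  obtains x r y where "s = x @ r @ y" "length x = i" "length r = n"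
proof
  show "s = take i s @ take n (drop i s) @ drop (i + n) s"
    by (metis add.commute append_take_drop_id drop_drop)
qed (use assms in auto)

lemma apply_piece_cong:
  assumes "\<And>t. t \<in> words L k \<Longrightarrow> f t = g t" "i + m \<le> k" "s \<in> words L (k - m + n)"
  shows "apply_piece L (w, i, m, n) f s = apply_piece L (w, i, m, n) g s"
proof -
  have "i + n \<le> length s" using assms(2,3) by (auto simp: words_def)
  then obtain x r y where s: "s = x @ r @ y" "length x = i" "length r = n" by (rule split_list3)
  have "f (x @ t @ y) = g (x @ t @ y)" if "t \<in> words L m" for t
    using assms(2,3) s that by (intro assms(1)) (auto simp: words_def)
  then show ?thesis by (simp add: s apply_piece_append)
qed

lemma state_sum_cong:
  assumes "\<And>t. t \<in> words L k \<Longrightarrow> f t = g t" "pieces_ok k D" "s \<in> words L (pieces_out k D)"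
  shows "state_sum L D f s = state_sum L D g s"
  using assms
proof (induction k D arbitrary: f g rule: pieces_ok.induct)
  case (2 k w i m n D)
  have ok: "i + m \<le> k" "pieces_ok (k - m + n) D" using 2(3) by (simp_all only: pieces_ok.simps)
  show ?case unfolding state_sum.simps
    by (rule 2(1)[OF apply_piece_cong[OF 2(2) ok(1)] ok(2)]) (use 2(4) in \<open>simp_all only: pieces_out.simps\<close>)
qed simp

definition shift_piece :: "nat \<Rightarrow> ('l, 'r) piece \<Rightarrow> ('l, 'r) piece" where
  "shift_piece j = (\<lambda>(w, i, m, n). (w, i + j, m, n))"

lemma apply_shift_piece:
  assumes "length x = j" "i + n \<le> length s"
  shows "apply_piece L (shift_piece j (w, i, m, n)) f (x @ s @ y)
    = apply_piece L (w, i, m, n) (\<lambda>t. f (x @ t @ y)) s"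
proof -
  obtain x' r y' where s: "s = x' @ r @ y'" "length x' = i" "length r = n"
    using split_list3[OF assms(2)] .
  have "apply_piece L (w, i + j, m, n) f ((x @ x') @ r @ (y' @ y))
      = (\<Sum>t\<in>words L m. w t r * f ((x @ x') @ t @ (y' @ y)))"
    by (rule apply_piece_append) (use assms s in auto)
  then show ?thesis by (simp add: s apply_piece_append shift_piece_def)
qed

lemma state_sum_shift:
  assumes "pieces_ok k D" "length x = j" "s \<in> words L (pieces_out k D)"
  shows "state_sum L (map (shift_piece j) D) f (x @ s @ y) = state_sum L D (\<lambda>t. f (x @ t @ y)) s"
  using assms
proof (induction k D arbitrary: f rule: pieces_ok.induct)
  case (2 k w i m n D)
  have ok: "i + m \<le> k" "pieces_ok (k - m + n) D" using 2(2) by (simp_all only: pieces_ok.simps)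
  have s: "s \<in> words L (pieces_out (k - m + n) D)" using 2(4) by (simp only: pieces_out.simps)
  have "state_sum L (map (shift_piece j) ((w, i, m, n) # D)) f (x @ s @ y)
      = state_sum L D (\<lambda>t. apply_piece L (shift_piece j (w, i, m, n)) f (x @ t @ y)) s"
    unfolding list.map state_sum.simps by (rule 2(1)[OF ok(2) 2(3) s])
  also have "\<dots> = state_sum L D (\<lambda>t. apply_piece L (w, i, m, n) (\<lambda>t. f (x @ t @ y)) t) s"
  proof (rule state_sum_cong[where k = "k - m + n"])
    fix t assume "t \<in> words L (k - m + n)"
    then have "i + n \<le> length t" using ok(1) by (auto simp: words_def)
    then show "apply_piece L (shift_piece j (w, i, m, n)) f (x @ t @ y)
        = apply_piece L (w, i, m, n) (\<lambda>t. f (x @ t @ y)) t"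
      by (rule apply_shift_piece[OF 2(3)])
  qed (use ok s in simp_all)
  finally show ?case by simp
qed simp

lemma apply_piece_lin:
  "apply_piece L p (\<lambda>t. a * f t + b * g t) s = a * apply_piece L p f s + b * apply_piece L p g s"
  by (cases p) (simp add: apply_piece_def sum.distrib sum_distrib_left algebra_simps)

lemma state_sum_lin:
  "state_sum L D (\<lambda>t. a * f t + b * g t) s = a * state_sum L D f s + b * state_sum L D g s"
proof (induction D arbitrary: f g)
  case (Cons p D)
  have "apply_piece L p (\<lambda>t. a * f t + b * g t) = (\<lambda>t. a * apply_piece L p f t + b * apply_piece L p g t)"
    by (rule ext) (rule apply_piece_lin)
  then show ?case using Cons by simp
qed simp

lemma state_sum_scale: "state_sum L D (\<lambda>t. a * f t) s = a * state_sum L D f s"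
  using state_sum_lin[of L D a f 0 f s] by simp

text \<open>The two pieces act on disjoint segments of the labels, so this is an exchange of two
  finite sums.\<close>

lemma apply_piece_exchange:
  assumes "i + ng + k + nh \<le> length s"
  shows "apply_piece L (wh, i + ng + k, mh, nh) (apply_piece L (wg, i, mg, ng) f) s
    = apply_piece L (wg, i, mg, ng) (apply_piece L (wh, i + mg + k, mh, nh) f) s"
proof -
  obtain x1 rh y where 1: "s = x1 @ rh @ y" "length x1 = i + ng + k" "length rh = nh"
    using split_list3[OF assms] .
  obtain x rg z where 2: "x1 = x @ rg @ z" "length x = i" "length rg = ng"
    using split_list3[of i ng x1] 1 by auto
  have z: "length z = k" using 1 2 by simp
  have "apply_piece L (wh, i + ng + k, mh, nh) (apply_piece L (wg, i, mg, ng) f) s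
      = (\<Sum>t\<in>words L mh. wh t rh * apply_piece L (wg, i, mg, ng) f (x @ rg @ (z @ t @ y)))"
    using apply_piece_append[OF 1(2,3)] by (simp add: 1(1) 2)
  also have "\<dots> = (\<Sum>t\<in>words L mh. \<Sum>u\<in>words L mg. wh t rh * (wg u rg * f (x @ u @ z @ t @ y)))"
    using 2 by (simp only: apply_piece_append sum_distrib_left)
  also have "\<dots> = (\<Sum>u\<in>words L mg. wg u rg * (\<Sum>t\<in>words L mh. wh t rh * f ((x @ u @ z) @ t @ y)))"
    by (subst sum.swap) (simp add: sum_distrib_left algebra_simps)
  also have "\<dots> = (\<Sum>u\<in>words L mg. wg u rg * apply_piece L (wh, i + mg + k, mh, nh) f ((x @ u @ z) @ rh @ y))"
    by (intro sum.cong refl arg_cong2[where f = "(*)"] apply_piece_append[symmetric])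
      (use 1 2 z in \<open>auto simp: words_def\<close>)
  also have "\<dots> = apply_piece L (wg, i, mg, ng) (apply_piece L (wh, i + mg + k, mh, nh) f) s"
    using 2 by (simp add: apply_piece_append 1)
  finally show ?thesis .
qed

section \<open>The Kauffman bracket\<close>

text \<open>With \<open>bcap\<close> this is the Temperley-Lieb representation on tensor powers of a
  plane, normalised so that zigzags are the identity and a circle has the value
  \<open>- A^2 - B^2\<close>. Keeping \<open>B\<close> as a parameter with \<open>A * B = 1\<close>
  avoids inverses in the ring.\<close>

definition bcup :: "'r::idom \<Rightarrow> 'r \<Rightarrow> bool list \<Rightarrow> 'r" where
  "bcup A B r = (if r = [False, True] then A else if r = [True, False] then - B else 0)"

definition bcap :: "'r::idom \<Rightarrow> 'r \<Rightarrow> bool list \<Rightarrow> 'r" where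
  "bcap A B t = (if t = [False, True] then - A else if t = [True, False] then B else 0)"

fun bweight :: "'r::idom \<Rightarrow> 'r \<Rightarrow> gen \<Rightarrow> bool list \<Rightarrow> bool list \<Rightarrow> 'r" where
  "bweight A B Cup t r = bcup A B r"
| "bweight A B Cap t r = bcap A B t"
| "bweight A B (Cross b) t r =
    (if b then A else B) * of_bool (t = r) + (if b then B else A) * (bcap A B t * bcup A B r)"

definition bpiece :: "'r::idom \<Rightarrow> 'r \<Rightarrow> layer \<Rightarrow> (bool, 'r) piece" where
  "bpiece A B = (\<lambda>(i, g). (bweight A B g, i, ins g, outs g))"

definition bsum :: "'r::idom \<Rightarrow> 'r \<Rightarrow> diagram \<Rightarrow> (bool list \<Rightarrow> 'r) \<Rightarrow> bool list \<Rightarrow> 'r" where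
  "bsum A B D = state_sum UNIV (map (bpiece A B) D)"

definition bracket :: "'r::idom \<Rightarrow> 'r \<Rightarrow> diagram \<Rightarrow> 'r" where
  "bracket A B D = bsum A B D (\<lambda>s. of_bool (s = [])) []"

lemma bpiece_shift: "map (bpiece A B) (sh j D) = map (shift_piece j) (map (bpiece A B) D)"
  by (auto simp: sh_def bpiece_def shift_piece_def)

lemma bpieces_ok: "ok n D \<Longrightarrow> pieces_ok n (map (bpiece A B) D) \<and> pieces_out n (map (bpiece A B) D) = out n D"
proof (induction n D rule: ok.induct)
  case (4 n i b D)
  have "i + 2 \<le> n" using 4(2) by simp
  then have e: "Suc (Suc (n - 2)) = n" by linarith
  show ?case using 4 by (simp add: bpiece_def e)
qed (auto simp: bpiece_def)

lemma bsum_append: "bsum A B (D @ E) f = bsum A B E (bsum A B D f)"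
  by (simp add: bsum_def state_sum_append)

lemma bsum_Nil [simp]: "bsum A B [] f = f" by (simp add: bsum_def)

lemma bsum_lin: "bsum A B D (\<lambda>t. a * f t + b * g t) s = a * bsum A B D f s + b * bsum A B D g s"
  by (simp add: bsum_def state_sum_lin)

lemma bsum_scale: "bsum A B D (\<lambda>t. a * f t) s = a * bsum A B D f s"
  by (simp add: bsum_def state_sum_scale)

lemma bsum_cong:
  assumes "\<And>t. length t = k \<Longrightarrow> f t = g t" "ok k D" "length s = out k D"
  shows "bsum A B D f s = bsum A B D g s"
  unfolding bsum_def
  by (rule state_sum_cong[where k = k]) (use assms bpieces_ok[OF assms(2), of A B] in \<open>auto simp: words_def\<close>)

lemma bsum_shift:
  assumes "ok k D" "length x = j" "length s = out k D"
  shows "bsum A B (sh j D) f (x @ s @ y) = bsum A B D (\<lambda>t. f (x @ t @ y)) s"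
  unfolding bsum_def bpiece_shift
  by (rule state_sum_shift[where k = k]) (use assms bpieces_ok[OF assms(1), of A B] in \<open>auto simp: words_def\<close>)

lemma bsum_Cons: "bsum A B (l # D) f = bsum A B D (apply_piece UNIV (bpiece A B l) f)"
  by (simp add: bsum_def)

lemma sum_bool_words_2: "sum f (words UNIV 2) = f [False, False] + f [False, True] + f [True, False] + f [True, True]"
  for f :: "bool list \<Rightarrow> 'r::comm_monoid_add"
  by (simp add: sum_words_2 UNIV_bool ac_simps)

text \<open>The closed form shows that at \<open>A = B = 1\<close> the entry
  \<open>A - B ^ 3\<close> vanishes and a crossing only swaps two labels.\<close>

lemma apply_cross:
  fixes A B :: "'r::idom"
  assumes "length x = i" "A * B = 1"
  shows "apply_piece UNIV (bpiece A B (i, Cross True)) f (x @ [p, q] @ y) =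
      (if p = q then A * f (x @ [p, q] @ y)
       else if q then B * f (x @ [True, False] @ y)
       else B * f (x @ [False, True] @ y) + (A - B ^ 3) * f (x @ [True, False] @ y))"
    "apply_piece UNIV (bpiece A B (i, Cross False)) f (x @ [p, q] @ y) =
      (if p = q then B * f (x @ [p, q] @ y)
       else if q then A * f (x @ [True, False] @ y) + (B - A ^ 3) * f (x @ [False, True] @ y)
       else A * f (x @ [False, True] @ y))"
proof -
  have *: "apply_piece UNIV (bpiece A B (i, Cross b)) f (x @ [p, q] @ y) =
      (\<Sum>t\<in>words UNIV 2. bweight A B (Cross b) t [p, q] * f (x @ t @ y))" for b
    by (simp add: bpiece_def apply_piece_append[OF assms(1), of "[p, q]" 2, simplified])
  show "apply_piece UNIV (bpiece A B (i, Cross True)) f (x @ [p, q] @ y) =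
      (if p = q then A * f (x @ [p, q] @ y)
       else if q then B * f (x @ [True, False] @ y)
       else B * f (x @ [False, True] @ y) + (A - B ^ 3) * f (x @ [True, False] @ y))"
    unfolding * sum_bool_words_2 using assms(2)
    by (cases p; cases q; simp add: bcup_def bcap_def power3_eq_cube; algebra?)
  show "apply_piece UNIV (bpiece A B (i, Cross False)) f (x @ [p, q] @ y) =
      (if p = q then B * f (x @ [p, q] @ y)
       else if q then A * f (x @ [True, False] @ y) + (B - A ^ 3) * f (x @ [False, True] @ y)
       else A * f (x @ [False, True] @ y))"
    unfolding * sum_bool_words_2 using assms(2)
    by (cases p; cases q; simp add: bcup_def bcap_def power3_eq_cube; algebra?)
qed

lemma apply_cup:
  assumes "length x = i"
  shows "apply_piece UNIV (bpiece A B (i, Cup)) f (x @ [p, q] @ y) = bcup A B [p, q] * f (x @ y)"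
  by (simp add: bpiece_def apply_piece_append[OF assms, of "[p, q]" 2, simplified])

lemma apply_cap:
  assumes "length x = i"
  shows "apply_piece UNIV (bpiece A B (i, Cap)) f (x @ y) = B * f (x @ [True, False] @ y) - A * f (x @ [False, True] @ y)"
  by (simp add: bpiece_def apply_piece_append[OF assms, of "[]" 0, simplified] sum_bool_words_2 bcap_def)

lemmas apply_cross0 = apply_cross[of "[]" 0, simplified]
  and apply_cup0 = apply_cup[of "[]" 0, simplified]
  and apply_cap0 = apply_cap[of "[]" 0, simplified]

lemmas apply_cross1 = apply_cross[of "[a]" 1 for a, simplified]
  and apply_cup1 = apply_cup[of "[a]" 1 for a, simplified]
  and apply_cap1 = apply_cap[of "[a]" 1 for a, simplified]

lemmas apply_local = apply_cross0 apply_cross1 apply_cup0 apply_cup1 apply_cap0 apply_cap1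

lemma length_1: "length s = Suc 0 \<longleftrightarrow> (\<exists>a. s = [a])"
  and length_2: "length s = Suc (Suc 0) \<longleftrightarrow> (\<exists>a b. s = [a, b])"
  and length_3: "length s = Suc (Suc (Suc 0)) \<longleftrightarrow> (\<exists>a b c. s = [a, b, c])"
  by (auto simp: length_Suc_conv)

lemma AB_simps:
  fixes A B :: "'r::idom" assumes "A * B = 1"
  shows "A * (B * c) = c" "B * (A * c) = c" "B * A = 1"
proof -
  show "B * A = 1" using assms by (simp add: mult.commute)
  with assms show "A * (B * c) = c" "B * (A * c) = c" by (simp_all flip: mult.assoc)
qed

lemma bsum_zigzag:
  fixes A B :: "'r::idom" assumes "A * B = 1" "length s = 1"
  shows "bsum A B [(0, Cup), (1, Cap)] f s = f s" "bsum A B [(1, Cup), (0, Cap)] f s = f s"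
proof -
  obtain a where s: "s = [a]" using assms by (auto simp: length_1)
  show "bsum A B [(0, Cup), (1, Cap)] f s = f s" using assms(1)
    by (cases a; simp add: power3_eq_cube AB_simps[OF assms(1)] algebra_simps s bsum_Cons apply_local bcup_def)
  show "bsum A B [(1, Cup), (0, Cap)] f s = f s" using assms(1)
    by (cases a; simp add: power3_eq_cube AB_simps[OF assms(1)] algebra_simps s bsum_Cons apply_local bcup_def)
qed

lemma bsum_slide_cup:
  fixes A B :: "'r::idom" assumes AB: "A * B = 1" and "length s = 3"
  shows "bsum A B [(0, Cup), (1, Cross b)] f s = bsum A B [(1, Cup), (0, Cross (\<not> b))] f s"
proof -
  obtain a c d where s: "s = [a, c, d]" using assms by (auto simp: length_3 numeral_3_eq_3)
  show ?thesis using AB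
    by (cases a; cases c; cases d; cases b; simp add: power3_eq_cube AB_simps[OF assms(1)] algebra_simps s bsum_Cons apply_local bcup_def)
qed

lemma bsum_slide_cap:
  fixes A B :: "'r::idom" assumes AB: "A * B = 1" and "length s = 1"
  shows "bsum A B [(1, Cross b), (0, Cap)] f s = bsum A B [(0, Cross (\<not> b)), (1, Cap)] f s"
proof -
  obtain a where s: "s = [a]" using assms by (auto simp: length_1)
  show ?thesis using AB
    by (cases a; cases b; simp add: power3_eq_cube AB_simps[OF assms(1)] algebra_simps s bsum_Cons apply_local)
qed

lemma bsum_r1_cup:
  fixes A B :: "'r::idom" assumes AB: "A * B = 1" and "length s = 2"
  shows "bsum A B [(0, Cup), (0, Cross b)] f s = - ((if b then B else A) ^ 3) * bsum A B [(0, Cup)] f s"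
proof -
  obtain a c where s: "s = [a, c]" using assms by (auto simp: length_2 numeral_2_eq_2)
  show ?thesis using AB
    by (cases a; cases b; cases c; simp add: power3_eq_cube AB_simps[OF assms(1)] algebra_simps s bsum_Cons apply_local bcup_def power3_eq_cube)
qed

lemma bsum_r1_cap:
  fixes A B :: "'r::idom" assumes AB: "A * B = 1" and "length s = 0"
  shows "bsum A B [(0, Cross b), (0, Cap)] f s = - ((if b then B else A) ^ 3) * bsum A B [(0, Cap)] f s"
proof -
  have s: "s = []" using assms by simp
  show ?thesis using AB
    by (cases b; simp add: power3_eq_cube AB_simps[OF assms(1)] algebra_simps s bsum_Cons apply_local power3_eq_cube)
qed

lemma bsum_r2:
  fixes A B :: "'r::idom" assumes AB: "A * B = 1" and "length s = 2"
  shows "bsum A B [(0, Cross b), (0, Cross (\<not> b))] f s = f s"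
proof -
  obtain a c where s: "s = [a, c]" using assms by (auto simp: length_2 numeral_2_eq_2)
  show ?thesis using AB
    by (cases a; cases b; cases c; simp add: power3_eq_cube AB_simps[OF assms(1)] algebra_simps s bsum_Cons apply_local power3_eq_cube)
qed

lemma bsum_r3:
  fixes A B :: "'r::idom" assumes AB: "A * B = 1" and "length s = 3" "\<not> (a = c \<and> b \<noteq> a)"
  shows "bsum A B [(0, Cross a), (1, Cross b), (0, Cross c)] f s
    = bsum A B [(1, Cross c), (0, Cross b), (1, Cross a)] f s"
proof -
  obtain p q r where s: "s = [p, q, r]" using assms by (auto simp: length_3 numeral_3_eq_3)
  show ?thesis using AB assms(3)
    by (cases p; cases q; cases r; cases a; cases b; cases c; simp add: power3_eq_cube AB_simps[OF assms(1)] algebra_simps s bsum_Cons apply_local power3_eq_cube)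
qed

text \<open>At \<open>A = B = 1\<close> a crossing exchanges two labels, so the state vector of a tangle without
  bottom ends is, up to a factor, a product of antisymmetric forms over the pairs of joined ends.\<close>

definition om :: "bool \<Rightarrow> bool \<Rightarrow> int" where
  "om x y = (if x = y then 0 else if y then 1 else - 1)"

definition pairing :: "(nat \<times> nat) list \<Rightarrow> bool list \<Rightarrow> int" where
  "pairing M s = (\<Prod>(a, b)\<leftarrow>M. om (s ! a) (s ! b))"

definition ends :: "(nat \<times> nat) list \<Rightarrow> nat multiset" where
  "ends M = mset (map fst M) + mset (map snd M)"

lemma pairing_simps [simp]: "pairing [] s = 1" "pairing ((a, b) # M) s = om (s ! a) (s ! b) * pairing M s"
  by (simp_all add: pairing_def)

lemma ends_simps [simp]: "ends [] = {#}" "ends ((a, b) # M) = {#a, b#} + ends M"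
  by (simp_all add: ends_def)

definition unit_int :: "int \<Rightarrow> bool" where "unit_int e \<longleftrightarrow> e = 1 \<or> e = -1"

text \<open>Reordering the product and the antisymmetry of \<open>om\<close> bring a chosen end to
  the front, at the price of a sign.\<close>

lemma pull_end:
  assumes "i \<in># ends M"
  shows "\<exists>a M' e. unit_int e \<and> (\<forall>s. pairing M s = e * pairing ((i, a) # M') s) \<and> ends M = ends ((i, a) # M')"
  using assms
proof (induction M)
  case (Cons p M)
  obtain x y where p: "p = (x, y)" by fastforce
  consider "i = x" | "i = y" | "i \<in># ends M" using Cons.prems by (auto simp: p)
  then show ?case
  proof cases
    case 1
    then show ?thesis by (intro exI[of _ y] exI[of _ M] exI[of _ 1]) (auto simp: p unit_int_def)
  next
    case 2
    then show ?thesis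
      by (intro exI[of _ x] exI[of _ M] exI[of _ "-1"]) (auto simp: p unit_int_def om_def)
  next
    case 3
    then obtain a M' e where "unit_int e" "\<forall>s. pairing M s = e * pairing ((i, a) # M') s"
      "ends M = ends ((i, a) # M')" using Cons.IH by blast
    then show ?thesis
      by (intro exI[of _ a] exI[of _ "(x, y) # M'"] exI[of _ e]) (auto simp: p)
  qed
qed simp

text \<open>Equality of multisets makes \<open>M\<close> a perfect matching of the ends
  \<open>0, ..., n - 1\<close>. The exponent \<open>k\<close> counts the circles closed so
  far.\<close>

definition matching_state :: "nat \<Rightarrow> (bool list \<Rightarrow> int) \<Rightarrow> nat \<Rightarrow> bool" where
  "matching_state n g k \<longleftrightarrow> (\<exists>M e. unit_int e \<and> ends M = mset_set {..<n} \<and>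
     (\<forall>s. length s = n \<longrightarrow> g s = e * 2 ^ k * pairing M s))"

text \<open>New position of strand \<open>j\<close> when two strands are inserted at
  \<open>i\<close>: it serves a minimum read upwards and a maximum read downwards.\<close>

definition up :: "nat \<Rightarrow> nat \<Rightarrow> nat" where "up i j = (if j < i then j else j + 2)"

lemma inj_up: "inj (up i)" by (auto simp: inj_def up_def split: if_splits)

lemma range_up: "up i ` {..<n} = {..<n + 2} - {i, i + 1}" if "i \<le> n"
proof -
  have "j \<in> up i ` {..<n}" if "j < n + 2" "j \<noteq> i" "j \<noteq> i + 1" for j
    using that \<open>i \<le> n\<close> by (cases "j < i") (force simp: up_def image_iff intro: bexI[of _ "j - 2"])+
  then show ?thesis using that by (auto simp: up_def split: if_splits)
qed

lemma nth_remove_up: "length s = n + 2 \<Longrightarrow> i \<le> n \<Longrightarrow> j < n \<Longrightarrow> (take i s @ drop (i + 2) s) ! j = s ! up i j"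
  by (auto simp: nth_append up_def)

lemma nth_insert_up: "i \<le> length s \<Longrightarrow> j < length s \<Longrightarrow> (take i s @ [p, q] @ drop i s) ! up i j = s ! j"
  by (auto simp: nth_append up_def nth_Cons')

lemma pairing_map:
  "(\<And>a. a \<in># ends M \<Longrightarrow> t ! h a = s ! a) \<Longrightarrow> pairing (map (map_prod h h) M) t = pairing M s"
  by (induction M) (auto simp: pairing_def map_prod_def)

lemma ends_map: "ends (map (map_prod h h) M) = image_mset h (ends M)"
  by (induction M) auto

lemma ends_bound: "ends M = mset_set {..<n} \<Longrightarrow> a \<in># ends M \<longleftrightarrow> a < n"
  by simp

lemma matching_state_cup:
  assumes "matching_state n g k" "i \<le> n"
  shows "matching_state (n + 2) (\<lambda>s. om (s ! i) (s ! (i + 1)) * g (take i s @ drop (i + 2) s)) k"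
proof -
  obtain M e where M: "unit_int e" "ends M = mset_set {..<n}"
    "\<And>s. length s = n \<Longrightarrow> g s = e * 2 ^ k * pairing M s"
    using assms(1) by (auto simp: matching_state_def)
  have "mset_set ({..<n + 2} - {i, i + 1}) = image_mset (up i) (mset_set {..<n})"
    using image_mset_mset_set[of "up i" "{..<n}"] inj_up range_up[OF assms(2)] by (metis inj_on_subset subset_UNIV)
  moreover have "mset_set {..<n + 2} = {#i, i + 1#} + mset_set ({..<n + 2} - {i, i + 1})"
  proof -
    have "{..<n + 2} = insert i (insert (i + 1) ({..<n + 2} - {i, i + 1}))" using assms(2) by auto
    moreover have "mset_set (insert i (insert (i + 1) ({..<n + 2} - {i, i + 1})))
        = {#i, i + 1#} + mset_set ({..<n + 2} - {i, i + 1})" by simp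
    ultimately show ?thesis by metis
  qed
  ultimately have "ends ((i, i + 1) # map (map_prod (up i) (up i)) M) = mset_set {..<n + 2}"
    by (simp add: ends_map M(2))
  moreover have "om (s ! i) (s ! (i + 1)) * g (take i s @ drop (i + 2) s)
      = e * 2 ^ k * pairing ((i, i + 1) # map (map_prod (up i) (up i)) M) s" if "length s = n + 2" for s
  proof -
    have "pairing (map (map_prod (up i) (up i)) M) s = pairing M (take i s @ drop (i + 2) s)"
      by (rule pairing_map) (use nth_remove_up[OF that assms(2)] ends_bound[OF M(2)] in auto)
    then show ?thesis using M(3)[of "take i s @ drop (i + 2) s"] that assms(2) by simp
  qed
  ultimately show ?thesis unfolding matching_state_def using M(1) by blast
qed

lemma nth_replace2:
  assumes "i + 2 \<le> length s"
  shows "(take i s @ [p, q] @ drop (i + 2) s) ! j = (if j = i then p else if j = i + 1 then q else s ! j)"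
proof -
  consider "j < i" | "j = i" | "j = i + 1" | m where "j = i + 2 + m"
    by (metis Suc_eq_plus1 add_2_eq_Suc' le_Suc_ex less_Suc_eq linorder_not_less)
  then show ?thesis using assms by cases (auto simp: nth_append)
qed

lemma matching_state_cross:
  assumes "matching_state n g k" "i + 2 \<le> n"
  shows "matching_state n (\<lambda>s. g (take i s @ [s ! (i + 1), s ! i] @ drop (i + 2) s)) k"
proof -
  obtain M e where M: "unit_int e" "ends M = mset_set {..<n}"
    "\<And>s. length s = n \<Longrightarrow> g s = e * 2 ^ k * pairing M s"
    using assms(1) by (auto simp: matching_state_def)
  define h where "h j = (if j = i then i + 1 else if j = i + 1 then i else j)" for j
  have "bij_betw h {..<n} {..<n}"
    by (rule bij_betw_byWitness[where f' = h]) (use assms(2) in \<open>auto simp: h_def\<close>)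
  then have "image_mset h (mset_set {..<n}) = mset_set {..<n}"
    using image_mset_mset_set[of h "{..<n}"] by (auto simp: bij_betw_def)
  then have "ends (map (map_prod h h) M) = mset_set {..<n}" by (simp add: ends_map M(2))
  moreover have "g (take i s @ [s ! (i + 1), s ! i] @ drop (i + 2) s) = e * 2 ^ k * pairing (map (map_prod h h) M) s"
    if "length s = n" for s
  proof -
    have "pairing (map (map_prod h h) M) s = pairing M (take i s @ [s ! (i + 1), s ! i] @ drop (i + 2) s)"
      by (rule pairing_map) (use nth_replace2[of i s] that assms(2) in \<open>auto simp: h_def\<close>)
    then show ?thesis using M(3)[of "take i s @ [s ! (i + 1), s ! i] @ drop (i + 2) s"] that assms(2) by simp
  qed
  ultimately show ?thesis unfolding matching_state_def using M(1) by blast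
qed

lemma unit_int_mult: "unit_int a \<Longrightarrow> unit_int b \<Longrightarrow> unit_int (a * b)"
  by (auto simp: unit_int_def)

lemma up_image_mset:
  assumes "{#i, i + 1#} + X = mset_set {..<n + 2}" "i \<le> n"
  shows "X = mset_set (up i ` {..<n})"
proof -
  have "{..<n + 2} = insert i (insert (i + 1) ({..<n + 2} - {i, i + 1}))" using assms(2) by auto
  moreover have "mset_set (insert i (insert (i + 1) ({..<n + 2} - {i, i + 1})))
      = {#i, i + 1#} + mset_set ({..<n + 2} - {i, i + 1})" by simp
  ultimately have "{#i, i + 1#} + X = {#i, i + 1#} + mset_set ({..<n + 2} - {i, i + 1})"
    using assms(1) by metis
  then show ?thesis using range_up[OF assms(2)] by (metis add_left_cancel)
qed

text \<open>A maximum contracts the ends \<open>i\<close> and \<open>i + 1\<close>. If they are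
  matched with each other, a circle closes and contributes 2; otherwise the arcs leading to
  \<open>a\<close> and \<open>b\<close> merge. When no ends remain the first case must have
  occurred, whence \<open>k' \<ge> 1\<close>.\<close>

lemma matching_state_cap:
  assumes "matching_state (n + 2) g k" "i \<le> n"
  shows "\<exists>k'. (n = 0 \<longrightarrow> k' \<ge> 1) \<and> matching_state n
    (\<lambda>s. g (take i s @ [True, False] @ drop i s) - g (take i s @ [False, True] @ drop i s)) k'"
proof -
  obtain M e where M: "unit_int e" "ends M = mset_set {..<n + 2}"
    "\<And>s. length s = n + 2 \<Longrightarrow> g s = e * 2 ^ k * pairing M s"
    using assms(1) by (auto simp: matching_state_def)
  define dn where "dn j = (if j < i then j else j - 2)" for j
  have dn: "dn (up i j) = j" for j by (simp add: dn_def up_def)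
  have nth_up: "s ! dn a = (take i s @ [p, q] @ drop i s) ! a" if "a \<in> up i ` {..<n}" "length s = n" for a p q s
    using nth_insert_up[of i s _ p q] that assms(2) dn by auto
  have pull_back: "pairing N (take i s @ [p, q] @ drop i s) = pairing (map (map_prod dn dn) N) s"
      and ends_back: "ends (map (map_prod dn dn) N) = mset_set {..<n}"
    if N: "ends N = mset_set (up i ` {..<n})" and s: "length s = n" for N p q s
  proof -
    have "s ! dn a = (take i s @ [p, q] @ drop i s) ! a" if "a \<in># ends N" for a
      using nth_up[of a s] that N s by simp
    then show "pairing N (take i s @ [p, q] @ drop i s) = pairing (map (map_prod dn dn) N) s"
      by (intro pairing_map[symmetric])
    have "mset_set (up i ` {..<n}) = image_mset (up i) (mset_set {..<n})"
      by (rule image_mset_mset_set[symmetric]) (metis inj_up inj_on_subset subset_UNIV)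
    then show "ends (map (map_prod dn dn) N) = mset_set {..<n}"
      by (simp add: ends_map N multiset.map_comp o_def dn)
  qed
  have "i + 1 \<in># ends M" using M(2) assms(2) by simp
  then obtain b M1 e1 where 1: "unit_int e1" "\<And>s. pairing M s = e1 * pairing ((i + 1, b) # M1) s"
    "ends M = ends ((i + 1, b) # M1)" using pull_end by blast
  show ?thesis
  proof (cases "b = i")
    case True
    have "{#i, i + 1#} + ends M1 = mset_set {..<n + 2}" using 1(3) M(2) True by simp
    from up_image_mset[OF this assms(2)] have N: "ends M1 = mset_set (up i ` {..<n})" .
    have "g (take i s @ [True, False] @ drop i s) - g (take i s @ [False, True] @ drop i s)
       = (e * e1) * 2 ^ (k + 1) * pairing (map (map_prod dn dn) M1) s" if "length s = n" for s
    proof -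
      have "(take i s @ [p, q] @ drop i s) ! i = p" "(take i s @ [p, q] @ drop i s) ! (i + 1) = q" for p q
        using that assms(2) by (auto simp: nth_append)
      then show ?thesis using that assms(2)
        by (simp add: M(3) 1(2) True pull_back[OF N that, simplified] om_def)
    qed
    then have "matching_state n
      (\<lambda>s. g (take i s @ [True, False] @ drop i s) - g (take i s @ [False, True] @ drop i s)) (k + 1)"
      unfolding matching_state_def using unit_int_mult[OF M(1) 1(1)] ends_back[OF N, of "replicate n True"]
      by (intro exI[of _ "map (map_prod dn dn) M1"] exI[of _ "e * e1"]) auto
    then show ?thesis by (intro exI[of _ "k + 1"]) simp
  next
    case False
    have "i \<in># ends ((i + 1, b) # M1)" unfolding 1(3)[symmetric] M(2) using assms(2) by simp
    then have "i \<in># ends M1" using False by auto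
    then obtain a M2 e2 where 2: "unit_int e2" "\<And>s. pairing M1 s = e2 * pairing ((i, a) # M2) s"
      "ends M1 = ends ((i, a) # M2)" using pull_end by blast
    have "{#i, i + 1#} + ends ((a, b) # M2) = mset_set {..<n + 2}"
      using 1(3) 2(3) M(2) by (simp add: ac_simps)
    from up_image_mset[OF this assms(2)] have N: "ends ((a, b) # M2) = mset_set (up i ` {..<n})" .
    have "g (take i s @ [True, False] @ drop i s) - g (take i s @ [False, True] @ drop i s)
       = (- e * e1 * e2) * 2 ^ k * pairing (map (map_prod dn dn) ((a, b) # M2)) s" if "length s = n" for s
    proof -
      have nth: "(take i s @ [p, q] @ drop i s) ! i = p" "(take i s @ [p, q] @ drop i s) ! (i + 1) = q" for p q
        using that assms(2) by (auto simp: nth_append)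
      have "a \<in> set_mset (ends ((a, b) # M2))" "b \<in> set_mset (ends ((a, b) # M2))"
        "set_mset (ends M2) \<subseteq> set_mset (ends ((a, b) # M2))" by auto
      then have mem: "a \<in> up i ` {..<n}" "b \<in> up i ` {..<n}" "\<And>c. c \<in># ends M2 \<Longrightarrow> c \<in> up i ` {..<n}"
        unfolding N by auto
      note ab' = mem(1,2)[THEN nth_up[OF _ that], symmetric]
      have P: "pairing M2 (take i s @ [True, False] @ drop i s) = pairing (map (map_prod dn dn) M2) s"
        "pairing M2 (take i s @ [False, True] @ drop i s) = pairing (map (map_prod dn dn) M2) s"
        by (rule pairing_map[symmetric], rule nth_up[OF mem(3) that], assumption)+
      show ?thesis using that assms(2)
        by (simp add: M(3) 1(2) 2(2) nth[simplified] ab'[simplified] P[simplified]) (auto simp: om_def)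
    qed
    then have "matching_state n
      (\<lambda>s. g (take i s @ [True, False] @ drop i s) - g (take i s @ [False, True] @ drop i s)) k"
      unfolding matching_state_def
      using unit_int_mult[OF unit_int_mult[OF unit_int_mult[OF _ M(1)] 1(1)] 2(1), of "-1"]
        ends_back[OF N, of "replicate n True"]
      by (intro exI[of _ "map (map_prod dn dn) ((a, b) # M2)"] exI[of _ "- e * e1 * e2"])
        (auto simp: unit_int_def)
    moreover have "n \<noteq> 0" using N by (intro notI) simp
    ultimately show ?thesis by blast
  qed
qed

lemma matching_state_cong:
  "matching_state n g k \<Longrightarrow> (\<And>s. length s = n \<Longrightarrow> g s = h s) \<Longrightarrow> matching_state n h k"
  unfolding matching_state_def by metis

lemma apply_layer_matching_state:
  assumes "matching_state n g k" "ok n [(i, c)]"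
  shows "\<exists>k'. (out n [(i, c)] = 0 \<longrightarrow> k' \<ge> 1) \<and>
    matching_state (out n [(i, c)]) (apply_piece UNIV (bpiece 1 1 (i, c)) g) k'"
proof (cases c)
  case Cup
  then have i: "i \<le> n" using assms(2) by simp
  have "matching_state (n + 2) (apply_piece UNIV (bpiece 1 1 (i, c)) g) k"
  proof (rule matching_state_cong[OF matching_state_cup[OF assms(1) i]])
    fix s :: "bool list" assume s: "length s = n + 2"
    then have "i + 2 \<le> length s" using i by simp
    then obtain x r y where "s = x @ r @ y" "length x = i" "length r = 2" by (rule split_list3)
    moreover from this obtain p q where "r = [p, q]" by (auto simp: length_2 numeral_2_eq_2)
    ultimately show "om (s ! i) (s ! (i + 1)) * g (take i s @ drop (i + 2) s)
        = apply_piece UNIV (bpiece 1 1 (i, c)) g s"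
      using apply_cup[of x i 1 1 g p q y] by (auto simp: Cup nth_append bcup_def om_def)
  qed
  then show ?thesis by (intro exI[of _ k]) (simp add: Cup)
next
  case (Cross b)
  then have i: "i + 2 \<le> n" using assms(2) by simp
  have "matching_state n (apply_piece UNIV (bpiece 1 1 (i, c)) g) k"
  proof (rule matching_state_cong[OF matching_state_cross[OF assms(1) i]])
    fix s :: "bool list" assume s: "length s = n"
    then have "i + 2 \<le> length s" using i by simp
    then obtain x r y where "s = x @ r @ y" "length x = i" "length r = 2" by (rule split_list3)
    moreover from this obtain p q where "r = [p, q]" by (auto simp: length_2 numeral_2_eq_2)
    ultimately show "g (take i s @ [s ! (i + 1), s ! i] @ drop (i + 2) s)
        = apply_piece UNIV (bpiece 1 1 (i, c)) g s"
      using apply_cross[of x i 1 1 g p q y] by (cases b) (auto simp: Cross nth_append)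
  qed
  then show ?thesis using i by (intro exI[of _ k]) (simp add: Cross)
next
  case Cap
  then have i: "i + 2 \<le> n" using assms(2) by simp
  define m where "m = n - 2"
  have n: "n = m + 2" and im: "i \<le> m" using i by (auto simp: m_def)
  obtain k' where k': "m = 0 \<longrightarrow> k' \<ge> 1" "matching_state m
      (\<lambda>s. g (take i s @ [True, False] @ drop i s) - g (take i s @ [False, True] @ drop i s)) k'"
    using matching_state_cap[OF assms(1)[unfolded n] im] by blast
  have "matching_state m (apply_piece UNIV (bpiece 1 1 (i, c)) g) k'"
  proof (rule matching_state_cong[OF k'(2)])
    fix s :: "bool list" assume "length s = m"
    then show "g (take i s @ [True, False] @ drop i s) - g (take i s @ [False, True] @ drop i s)
        = apply_piece UNIV (bpiece 1 1 (i, c)) g s"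
      using apply_cap[of "take i s" i 1 1 g "drop i s"] im by (simp add: Cap)
  qed
  then show ?thesis using k'(1) by (intro exI[of _ k']) (simp add: Cap n)
qed

lemma bsum_matching_state:
  assumes "ok 0 D"
  shows "\<exists>k. (D \<noteq> [] \<longrightarrow> out 0 D = 0 \<longrightarrow> k \<ge> 1) \<and>
    matching_state (out 0 D) (bsum 1 1 D (\<lambda>s. of_bool (s = []))) k"
  using assms
proof (induction D rule: rev_induct)
  case Nil
  have "matching_state 0 (\<lambda>s. of_bool (s = [])) 0"
    unfolding matching_state_def by (intro exI[of _ "[]"] exI[of _ 1]) (auto simp: unit_int_def)
  then show ?case by auto
next
  case (snoc l D)
  obtain i c where l: "l = (i, c)" by fastforce
  from snoc obtain k where "matching_state (out 0 D) (bsum 1 1 D (\<lambda>s. of_bool (s = []))) k" by auto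
  from apply_layer_matching_state[OF this, of i c] snoc(2) show ?case
    by (simp add: l bsum_append bsum_Cons)
qed

text \<open>At \<open>A = 1\<close> crossings are mere transpositions, so only the number of
  components survives. It is the exponent, and it is positive for a nonempty diagram.\<close>

lemma bracket_one_power:
  assumes "link_diagram D" "D \<noteq> []"
  shows "\<exists>c\<ge>1. bracket 1 1 D = (2 ^ c :: int) \<or> bracket 1 1 D = - (2 ^ c :: int)"
proof -
  have D: "ok 0 D" "out 0 D = 0" using assms(1) by (auto simp: link_diagram_def tangle_iff)
  obtain k where "k \<ge> 1" "matching_state 0 (bsum 1 1 D (\<lambda>s. of_bool (s = []))) k"
    using bsum_matching_state[OF D(1)] D(2) assms(2) by auto
  then obtain M e where "unit_int e" "ends M = {#}" "bracket 1 1 D = e * 2 ^ k * pairing M []"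
    unfolding matching_state_def bracket_def by auto
  moreover from this have "M = []" by (simp add: ends_def)
  ultimately show ?thesis using \<open>k \<ge> 1\<close> by (auto simp: unit_int_def)
qed

lemma bsum_local:
  fixes A B :: "'r::idom"
  assumes "ok m l" "ok m r" "out m l = out m r" "m + i \<le> n" "length s = out n (sh i l)"
    "\<And>f s. length s = out m l \<Longrightarrow> bsum A B l f s = c * bsum A B r f s"
  shows "bsum A B (sh i l) f s = c * bsum A B (sh i r) f s"
proof -
  define w where "w = n - (m + i)"
  have n: "n = (m + w) + i" using assms(4) by (simp add: w_def)
  have "out n (sh i l) = out m l + w + i"
    unfolding n using ok_widen[OF assms(1), of w] by (simp add: out_sh)
  then have "i + out m l \<le> length s" using assms(5) by simp
  then obtain x t y where s: "s = x @ t @ y" "length x = i" "length t = out m l" by (rule split_list3)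
  then show ?thesis
    using bsum_shift[OF assms(1) s(2), of t A B f y] bsum_shift[OF assms(2) s(2), of t A B f y] assms(3,6)
    by simp
qed

lemma bsum_exchange:
  assumes "ok n [(i, g), (i + outs g + k, h)]" "length s = out n [(i, g), (i + outs g + k, h)]"
  shows "bsum A B [(i, g), (i + outs g + k, h)] f s = bsum A B [(i + ins g + k, h), (i, g)] f s"
proof -
  have "i + outs g + k + outs h \<le> length s" using assms by (cases g; cases h) auto
  from apply_piece_exchange[OF this] show ?thesis by (simp add: bsum_Cons bpiece_def)
qed

text \<open>The factors an isotopy rule can produce. Curls of both signs are included, so the set is
  closed under inverses.\<close>

definition curl_factors :: "'r::idom \<Rightarrow> 'r \<Rightarrow> 'r set" where
  "curl_factors A B = {1, - (A ^ 3), - (B ^ 3)}"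

lemma curl_factors_inverse:
  assumes "A * B = 1" "c \<in> curl_factors A B"
  shows "\<exists>d\<in>curl_factors A B. c * d = 1"
  using assms by (auto simp: curl_factors_def power_mult_distrib[symmetric] mult.commute)

lemma bsum_isotopy_rule:
  fixes A B :: "'r::idom"
  assumes "isotopy_rule l r" "A * B = 1" "ok n l" "ok n r"
  shows "\<exists>c\<in>curl_factors A B. \<forall>f s. length s = out n l \<longrightarrow> bsum A B l f s = c * bsum A B r f s"
  using assms(1)
proof cases
  case (exchange i g k h)
  then show ?thesis using bsum_exchange[of n i g k h] assms(3)
    by (intro bexI[of _ 1]) (auto simp: curl_factors_def)
next
  case (zigzag_left i)
  have "bsum A B (sh i [(0, Cup), (1, Cap)]) f s = 1 * bsum A B (sh i []) f s" if "length s = n" for f s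
    by (rule bsum_local[where m = 1 and n = n]) (use zigzag_left assms that bsum_zigzag in \<open>auto simp: numeral_2_eq_2 numeral_3_eq_3\<close>)
  then show ?thesis using zigzag_left assms(3) by (intro bexI[of _ 1]) (auto simp: curl_factors_def)
next
  case (zigzag_right i)
  have "bsum A B (sh i [(1, Cup), (0, Cap)]) f s = 1 * bsum A B (sh i []) f s" if "length s = n" for f s
    by (rule bsum_local[where m = 1 and n = n]) (use zigzag_right assms that bsum_zigzag in \<open>auto simp: numeral_2_eq_2 numeral_3_eq_3\<close>)
  then show ?thesis using zigzag_right assms(3) by (intro bexI[of _ 1]) (auto simp: curl_factors_def)
next
  case (slide_cup i b)
  have "bsum A B (sh i [(0, Cup), (1, Cross b)]) f s = 1 * bsum A B (sh i [(1, Cup), (0, Cross (\<not> b))]) f s"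
    if "length s = n + 2" for f s
    by (rule bsum_local[where m = 1 and n = n]) (use slide_cup assms that bsum_slide_cup in \<open>auto simp: numeral_2_eq_2 numeral_3_eq_3\<close>)
  then show ?thesis using slide_cup assms(3) by (intro bexI[of _ 1]) (auto simp: curl_factors_def)
next
  case (slide_cap i b)
  have "bsum A B (sh i [(1, Cross b), (0, Cap)]) f s = 1 * bsum A B (sh i [(0, Cross (\<not> b)), (1, Cap)]) f s"
    if "length s = n - 2" for f s
    by (rule bsum_local[where m = 3 and n = n]) (use slide_cap assms that bsum_slide_cap in \<open>auto simp: numeral_2_eq_2 numeral_3_eq_3\<close>)
  then show ?thesis using slide_cap assms(3) by (intro bexI[of _ 1]) (auto simp: curl_factors_def)
next
  case (reidemeister1_cup i b)
  have "bsum A B (sh i [(0, Cup), (0, Cross b)]) f s = - ((if b then B else A) ^ 3) * bsum A B (sh i [(0, Cup)]) f s"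
    if "length s = n + 2" for f s
  proof (rule bsum_local[where m = 0 and n = n])
    show "bsum A B [(0, Cup), (0, Cross b)] f s = - ((if b then B else A) ^ 3) * bsum A B [(0, Cup)] f s"
      if "length s = out 0 [(0, Cup), (0, Cross b)]" for f s
      by (rule bsum_r1_cup[OF assms(2)]) (use that in auto)
  qed (use reidemeister1_cup assms that in auto)
  then show ?thesis using reidemeister1_cup assms(3)
    by (intro bexI[of _ "- ((if b then B else A) ^ 3)"]) (auto simp: curl_factors_def)
next
  case (reidemeister1_cap i b)
  have "bsum A B (sh i [(0, Cross b), (0, Cap)]) f s = - ((if b then B else A) ^ 3) * bsum A B (sh i [(0, Cap)]) f s"
    if "length s = n - 2" for f s
  proof (rule bsum_local[where m = 2 and n = n])
    show "bsum A B [(0, Cross b), (0, Cap)] f s = - ((if b then B else A) ^ 3) * bsum A B [(0, Cap)] f s"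
      if "length s = out 2 [(0, Cross b), (0, Cap)]" for f s
      by (rule bsum_r1_cap[OF assms(2)]) (use that in auto)
  qed (use reidemeister1_cap assms that in auto)
  then show ?thesis using reidemeister1_cap assms(3)
    by (intro bexI[of _ "- ((if b then B else A) ^ 3)"]) (auto simp: curl_factors_def)
next
  case (reidemeister2 i b)
  have "bsum A B (sh i [(0, Cross b), (0, Cross (\<not> b))]) f s = 1 * bsum A B (sh i []) f s" if "length s = n" for f s
    by (rule bsum_local[where m = 2 and n = n]) (use reidemeister2 assms that bsum_r2 in \<open>auto simp: numeral_2_eq_2 numeral_3_eq_3\<close>)
  then show ?thesis using reidemeister2 assms(3) by (intro bexI[of _ 1]) (auto simp: curl_factors_def)
next
  case (reidemeister3 a c b i)
  have "bsum A B (sh i [(0, Cross a), (1, Cross b), (0, Cross c)]) f s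
      = 1 * bsum A B (sh i [(1, Cross c), (0, Cross b), (1, Cross a)]) f s" if "length s = n" for f s
  proof (rule bsum_local[where m = 3 and n = n])
    show "bsum A B [(0, Cross a), (1, Cross b), (0, Cross c)] f s
        = 1 * bsum A B [(1, Cross c), (0, Cross b), (1, Cross a)] f s"
      if "length s = out 3 [(0, Cross a), (1, Cross b), (0, Cross c)]" for f s
      using bsum_r3[OF assms(2) _ reidemeister3(3), of s f] that by simp
  qed (use reidemeister3 assms that in auto)
  then show ?thesis using reidemeister3 assms(3) by (intro bexI[of _ 1]) (auto simp: curl_factors_def)
qed

lemma bracket_context:
  assumes "ok 0 (u @ l @ v)" "out 0 (u @ l @ v) = 0"
    and "\<And>f s. length s = out (out 0 u) l \<Longrightarrow> bsum A B l f s = c * bsum A B r f s"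
  shows "bracket A B (u @ l @ v) = c * bracket A B (u @ r @ v)"
proof -
  define g where "g = bsum A B u (\<lambda>s. of_bool (s = []))"
  have "bracket A B (u @ l @ v) = bsum A B v (bsum A B l g) []"
    by (simp add: bracket_def bsum_append g_def)
  also have "\<dots> = bsum A B v (\<lambda>s. c * bsum A B r g s) []"
    by (rule bsum_cong[where k = "out (out 0 u) l"]) (use assms in auto)
  also have "\<dots> = c * bracket A B (u @ r @ v)"
    by (simp add: bracket_def bsum_append g_def bsum_scale)
  finally show ?thesis .
qed

lemma bracket_isotopy:
  assumes "tangle_change isotopy_rule 0 D E" "link_diagram D" "A * B = 1"
  shows "\<exists>c\<in>curl_factors A B. bracket A B D = c * bracket A B E"
proof -
  obtain u l r v where *: "D = u @ l @ v" "E = u @ r @ v" "isotopy_rule l r \<or> isotopy_rule r l"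
    and ok: "ok 0 D" "ok 0 E" "out 0 D = 0" "out 0 E = 0"
    using assms by (auto simp: tangle_change_def link_diagram_def tangle_iff)
  from *(3) show ?thesis
  proof
    assume R: "isotopy_rule l r"
    obtain c where c: "c \<in> curl_factors A B" "\<And>f s. length s = out (out 0 u) l \<Longrightarrow> bsum A B l f s = c * bsum A B r f s"
      using bsum_isotopy_rule[OF R assms(3), of "out 0 u"] ok * by auto
    then show ?thesis using bracket_context[of u l v A B c r] ok * by auto
  next
    assume R: "isotopy_rule r l"
    obtain c where c: "c \<in> curl_factors A B" "\<And>f s. length s = out (out 0 u) r \<Longrightarrow> bsum A B r f s = c * bsum A B l f s"
      using bsum_isotopy_rule[OF R assms(3), of "out 0 u"] ok * by auto
    then have "bracket A B E = c * bracket A B D" using bracket_context[of u r v A B c l] ok * by auto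
    moreover obtain d where "d \<in> curl_factors A B" "c * d = 1" using curl_factors_inverse[OF assms(3) c(1)] by blast
    ultimately show ?thesis by (intro bexI[of _ d]) (auto simp: mult.assoc[symmetric] mult.commute)
  qed
qed

section \<open>The bracket under delta moves\<close>

definition signed_power :: "int \<Rightarrow> bool" where
  "signed_power x \<longleftrightarrow> (\<exists>c\<ge>1. x = 2 ^ c \<or> x = - (2 ^ c))"

lemma signed_power_uminus: "signed_power (- x) \<longleftrightarrow> signed_power x"
  by (auto simp: signed_power_def)

lemma power2_cases: fixes c :: nat assumes "c \<ge> 1" shows "(2::int) ^ c = 2 \<or> (2::int) ^ c = 4 \<or> (\<exists>k>0. (2::int) ^ c = 8 * k)"
proof -
  consider "c = 1" | "c = 2" | "3 \<le> c" using assms by linarith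
  then show ?thesis
  proof cases
    case 3
    then obtain d where "c = 3 + d" using le_Suc_ex by blast
    then have "(2::int) ^ c = 8 * 2 ^ d" by (simp add: power_add)
    then show ?thesis by force
  qed auto
qed

lemma signed_power_cases:
  assumes "signed_power x"
  shows "x = 2 \<or> x = -2 \<or> x = 4 \<or> x = -4 \<or> (\<exists>k. k \<noteq> 0 \<and> x = 8 * k)"
proof -
  obtain c where c: "c \<ge> 1" "x = 2 ^ c \<or> x = - (2 ^ c)" using assms by (auto simp: signed_power_def)
  from power2_cases[OF c(1)] show ?thesis
  proof (elim disjE exE)
    fix k :: int assume "k > 0 \<and> 2 ^ c = 8 * k"
    then have "x = 8 * k \<and> k \<noteq> 0 \<or> x = 8 * (- k) \<and> - k \<noteq> 0" using c(2) by auto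
    then show ?thesis by blast
  qed (use c(2) in auto)
qed

lemma signed_power_sum2: "signed_power x \<Longrightarrow> signed_power (2 - x) \<Longrightarrow> x = 4 \<or> x = -2"
  by (drule signed_power_cases)+ (elim disjE exE conjE; presburger)

lemma signed_power_4: "signed_power x \<Longrightarrow> signed_power (x + 4) \<Longrightarrow> x = 4 \<or> x = -2 \<or> x = -8"
  by (drule signed_power_cases)+ (elim disjE exE conjE; presburger)

lemma signed_power_m2: "signed_power x \<Longrightarrow> signed_power (x - 2) \<Longrightarrow> x = 4 \<or> x = -2"
  by (drule signed_power_cases)+ (elim disjE exE conjE; presburger)

lemma not_signed_power_10: "\<not> signed_power (-10)"
  by (auto dest!: signed_power_cases) presburger

text \<open>The six ends of a triangle can be matched in 15 ways. Five matchings are planar and have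
  the values \<open>u\<close>, \<open>u1\<close>, \<open>u2\<close>, \<open>w\<close>,
  \<open>w'\<close>; the other ten values are sums of these, since a crossing is 1 + E at
  \<open>A = 1\<close>. All are signed powers of 2, and the sum of all five belongs to the knot
  itself.\<close>

lemma triangle_values2:
  assumes s: "u + u1 + u2 + w + w' = 2"
    and P: "signed_power u" "signed_power u1" "signed_power u2" "signed_power w" "signed_power w'"
    and Q: "signed_power (u + u1)" "signed_power (u + u2)" "signed_power (u + u1 + u2 + w)"
      "signed_power (u + u1 + u2 + w')" "signed_power (u1 + w)" "signed_power (u1 + w')"
      "signed_power (u2 + w)" "signed_power (u2 + w')" "signed_power (u1 + u2 + w + w')"
  shows "\<bar>u1 - u2\<bar> \<le> 6"
proof -
  have e: "u + u1 + u2 + w = 2 - w'" "u + u1 + u2 + w' = 2 - w" "u1 + u2 + w + w' = 2 - u"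
    using s by auto
  \<comment> \<open>Each of \<open>u\<close>, \<open>w\<close>, \<open>w'\<close> and its complement
    to 2 is a signed power of 2, which leaves only 4 and -2.\<close>
  have w: "w = 4 \<or> w = -2" "w' = 4 \<or> w' = -2" "u = 4 \<or> u = -2"
    using signed_power_sum2 P Q(3,4,9) unfolding e by blast+
  have u: "u1 = 4 \<or> u1 = -2 \<or> u1 = -8" "u2 = 4 \<or> u2 = -2 \<or> u2 = -8"
    using signed_power_4[of u1] signed_power_m2[of u1] signed_power_4[of u2] signed_power_m2[of u2] w P Q
    by (auto simp: add.commute)
  \<comment> \<open>A value -8 beside some -2 would produce the sum -10. Beside three values 4, the
    total forces the other value to be -2, at distance exactly 6.\<close>
  show ?thesis
    using w u s Q not_signed_power_10 by (elim disjE) simp_all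
qed

lemma triangle_values:
  assumes s: "\<bar>u + u1 + u2 + w + w'\<bar> = 2"
    and P: "signed_power u" "signed_power u1" "signed_power u2" "signed_power w" "signed_power w'"
    and Q: "signed_power (u + u1)" "signed_power (u + u2)" "signed_power (u + u1 + u2 + w)"
      "signed_power (u + u1 + u2 + w')" "signed_power (u1 + w)" "signed_power (u1 + w')"
      "signed_power (u2 + w)" "signed_power (u2 + w')" "signed_power (u1 + u2 + w + w')"
  shows "\<bar>u1 - u2\<bar> \<le> 6"
proof (cases "u + u1 + u2 + w + w' = 2")
  case True
  then show ?thesis using triangle_values2 P Q by blast
next
  case False
  have m: "signed_power (- x)" if "signed_power x" for x using that signed_power_uminus by simp
  have "\<bar>(- u1) - (- u2)\<bar> \<le> 6"
    by (rule triangle_values2[of "- u" "- u1" "- u2" "- w" "- w'"])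
      (use False s P[THEN m] Q[THEN m] in \<open>simp_all add: algebra_simps\<close>)
  then show ?thesis by simp
qed

text \<open>The rest of the state sum is linear, so a linear relation between tangles survives every
  closure. The list of pairs lets one lemma serve relations of any length.\<close>

lemma bracket_combination:
  assumes "\<And>a X. (a, X) \<in> set xs \<Longrightarrow> ok m X \<and> out m X = m"
    and "\<And>f s. length s = m \<Longrightarrow> (\<Sum>(a, X)\<leftarrow>xs. a * bsum A B X f s) = 0"
    and "ok 0 u" "i + m \<le> out 0 u" "ok (out 0 u) v" "out (out 0 u) v = 0"
  shows "(\<Sum>(a, X)\<leftarrow>xs. a * bracket A B (u @ sh i X @ v)) = 0"
proof -
  define g where "g = bsum A B u (\<lambda>s. of_bool (s = []))"
  have zero: "bsum A B v (\<lambda>t. 0) s = 0" for s using bsum_scale[of A B v 0 "\<lambda>t. 0" s] by simp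
  have "(\<Sum>(a, X)\<leftarrow>xs. a * bsum A B v (bsum A B (sh i X) g) s)
      = bsum A B v (\<lambda>t. \<Sum>(a, X)\<leftarrow>xs. a * bsum A B (sh i X) g t) s" for s
  proof (induction xs)
    case Nil
    then show ?case by (simp add: zero)
  next
    case (Cons p xs)
    then show ?case
      using bsum_lin[of A B v "fst p" "bsum A B (sh i (snd p)) g" 1 "\<lambda>t. \<Sum>(a, X)\<leftarrow>xs. a * bsum A B (sh i X) g t" s]
      by (simp add: case_prod_unfold)
  qed
  also have "bsum A B v (\<lambda>t. \<Sum>(a, X)\<leftarrow>xs. a * bsum A B (sh i X) g t) [] = bsum A B v (\<lambda>t. 0) []"
  proof (rule bsum_cong[where k = "out 0 u"])
    fix t :: "bool list" assume t: "length t = out 0 u"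
    then have "i + m \<le> length t" using assms(4) by simp
    then obtain x r y where r: "t = x @ r @ y" "length x = i" "length r = m" by (rule split_list3)
    have "bsum A B (sh i X) g t = bsum A B X (\<lambda>r. g (x @ r @ y)) r" if "(a, X) \<in> set xs" for a X
      using bsum_shift[of m X x i r A B g y] assms(1)[OF that] r by simp
    then have "(\<Sum>(a, X)\<leftarrow>xs. a * bsum A B (sh i X) g t)
        = (\<Sum>(a, X)\<leftarrow>xs. a * bsum A B X (\<lambda>r. g (x @ r @ y)) r)"
      by (intro arg_cong[where f = sum_list] map_cong refl) auto
    then show "(\<Sum>(a, X)\<leftarrow>xs. a * bsum A B (sh i X) g t) = 0" using assms(2)[OF r(3)] by simp
  qed (use assms in auto)
  finally show ?thesis by (simp add: bracket_def bsum_append g_def zero)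
qed

abbreviation "E0 \<equiv> [(0::nat, Cap), (0::nat, Cup)]"
abbreviation "E1 \<equiv> [(1::nat, Cap), (1::nat, Cup)]"

text \<open>In the Temperley-Lieb basis 1, E0, E1, E0 E1, E1 E0 both triangles have the same
  coefficients except that those of \<open>E0\<close> and \<open>E1\<close> are exchanged. For
  \<open>a\<close> these two are \<open>2 * B - B ^ 5\<close> and \<open>A ^ 3\<close>.\<close>

lemma bsum_delta:
  fixes A B :: "'r::idom" assumes AB: "A * B = 1" and "length s = 3"
  shows "bsum A B [(0, Cross a), (1, Cross (\<not> a)), (0, Cross a)] f s
    - bsum A B [(1, Cross a), (0, Cross (\<not> a)), (1, Cross a)] f s
    = (if a then 2 * B - B ^ 5 - A ^ 3 else 2 * A - A ^ 5 - B ^ 3) * (bsum A B E0 f s - bsum A B E1 f s)"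
proof -
  obtain p q r where s: "s = [p, q, r]" using assms by (auto simp: length_3 numeral_3_eq_3)
  have 5: "x ^ 5 = x * x * x * x * x" for x :: 'r by (simp add: eval_nat_numeral)
  show ?thesis using AB
    by (cases p; cases q; cases r; cases a; simp add: AB_simps[OF AB] algebra_simps 5 power3_eq_cube
        s bsum_Cons apply_local bcup_def)
qed

text \<open>State sums are polynomial in \<open>A\<close> and \<open>B\<close>, so they commute with
  ring homomorphisms. This is used for the constant coefficient of a power series and for the
  passage from integers to reals.\<close>

lemma bsum_hom:
  fixes h :: "'a::idom \<Rightarrow> 'b::idom"
  assumes add: "\<And>x y. h (x + y) = h x + h y" and mult: "\<And>x y. h (x * y) = h x * h y" and one: "h 1 = 1"
  shows "h (bsum A B D f s) = bsum (h A) (h B) D (\<lambda>t. h (f t)) s"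
proof -
  have zero: "h 0 = 0" by (metis add add.right_neutral add_left_cancel)
  have minus: "h (- x) = - h x" for x using add[of x "- x"] zero by (simp add: eq_neg_iff_add_eq_0 add.commute)
  have sum: "h (sum g S) = (\<Sum>x\<in>S. h (g x))" for g :: "bool list \<Rightarrow> 'a" and S
    by (induction S rule: infinite_finite_induct) (auto simp: zero add)
  have "h (bweight A B g t r) = bweight (h A) (h B) g t r" for g t r
    by (cases g) (auto simp: bcup_def bcap_def add mult minus zero one)
  then have step: "h (apply_piece UNIV (bpiece A B l) f s) = apply_piece UNIV (bpiece (h A) (h B) l) (\<lambda>t. h (f t)) s" for l f s
    by (cases l) (simp add: bpiece_def apply_piece_def sum mult)
  show ?thesis by (induction D arbitrary: f) (simp_all add: bsum_Cons step)
qed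

lemma bracket_hom:
  fixes h :: "'a::idom \<Rightarrow> 'b::idom"
  assumes "\<And>x y. h (x + y) = h x + h y" "\<And>x y. h (x * y) = h x * h y" "h 1 = 1"
  shows "h (bracket A B D) = bracket (h A) (h B) D"
proof -
  have "h 0 = 0" by (metis assms(1) add.right_neutral add_left_cancel)
  then have "(\<lambda>t. h (of_bool (t = []))) = (\<lambda>t::bool list. of_bool (t = []))" using assms(3) by (auto simp: of_bool_def)
  then show ?thesis unfolding bracket_def bsum_hom[of h, OF assms] by simp
qed

text \<open>The expansion of the bracket at \<open>A = exp h\<close>; only the coefficients of \<open>1, h, h^2\<close> matter.\<close>

definition jet :: "diagram \<Rightarrow> real fps" where
  "jet D = bracket (fps_exp 1) (fps_exp (-1)) D"

lemma fps_exp_inv: "fps_exp 1 * fps_exp (-1) = (1 :: real fps)"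
  using fps_exp_add_mult[of "1::real" "-1"] by simp

lemma jet_0: "fps_nth (jet D) 0 = of_int (bracket 1 1 D)"
proof -
  have "fps_nth (jet D) 0 = bracket (1::real) 1 D"
    using bracket_hom[of "\<lambda>x. fps_nth x 0" "fps_exp (1::real)" "fps_exp (-1)" D] by (simp add: jet_def)
  also have "\<dots> = of_int (bracket 1 1 D)"
    using bracket_hom[of "of_int :: int \<Rightarrow> real" 1 1 D] by simp
  finally show ?thesis .
qed

text \<open>The logarithm is avoided by dividing through the constant coefficient, which is 2 or -2
  and not 1 in the cases of interest.\<close>

definition J :: "real fps \<Rightarrow> real" where
  "J F = fps_nth F 2 / fps_nth F 0 - (fps_nth F 1 / fps_nth F 0)\<^sup>2 / 2"

lemma fps_mult_nth_012:
  "fps_nth (F * G) 0 = fps_nth F 0 * fps_nth G 0"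
  "fps_nth (F * G) 1 = fps_nth F 0 * fps_nth G 1 + fps_nth F 1 * fps_nth G 0"
  "fps_nth (F * G) 2 = fps_nth F 0 * fps_nth G 2 + fps_nth F 1 * fps_nth G 1 + fps_nth F 2 * fps_nth G 0"
  by (simp_all add: fps_mult_nth numeral_2_eq_2 algebra_simps)

lemma fps_exp_012: "fps_nth (fps_exp c) 0 = 1" "fps_nth (fps_exp c) 1 = c" "fps_nth (fps_exp c) 2 = c\<^sup>2 / (2::real)"
  by (simp_all add: numeral_2_eq_2)

text \<open>The factor adds the linear term \<open>c h\<close> to the logarithm, and the sign
  cancels in the quotients.\<close>

lemma J_exp: assumes "fps_nth F 0 \<noteq> 0" shows "J (- fps_exp c * F) = J F"
proof -
  have "fps_nth (- fps_exp c * F) 0 = - fps_nth F 0"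
    "fps_nth (- fps_exp c * F) 1 = - (fps_nth F 1 + c * fps_nth F 0)"
    "fps_nth (- fps_exp c * F) 2 = - (fps_nth F 2 + c * fps_nth F 1 + c\<^sup>2 / 2 * fps_nth F 0)"
    by (simp_all only: fps_neg_nth fps_mult_nth_012 fps_exp_012 mult_minus_left mult_1 ac_simps minus_add_distrib)
  with assms show ?thesis unfolding J_def by (simp add: field_simps power2_eq_square)
qed

lemma jet_isotopy:
  assumes "tangle_change isotopy_rule 0 D E" "link_diagram D" "fps_nth (jet E) 0 \<noteq> 0"
  shows "J (jet D) = J (jet E) \<and> \<bar>fps_nth (jet D) 0\<bar> = \<bar>fps_nth (jet E) 0\<bar>"
proof -
  obtain c where c: "c \<in> curl_factors (fps_exp 1) (fps_exp (-1))" "jet D = c * jet E"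
    using bracket_isotopy[OF assms(1,2) fps_exp_inv] unfolding jet_def by blast
  then have "c = 1 \<or> c = - fps_exp 3 \<or> c = - fps_exp (-3)"
    by (simp add: curl_factors_def fps_exp_power_mult)
  then show ?thesis using J_exp[OF assms(3)] by (auto simp: c(2))
qed

text \<open>Supplies the 15 values for \<open>triangle_values\<close>: \<open>rel\<close> turns each
  relation checked on labels into one between closures, and every closure is a link diagram covered
  by \<open>bracket_one_power\<close>. The relations \<open>r1\<close> to \<open>r10\<close> expand
  the crossings as 1 + E, whatever their signs.\<close>

lemma triangle_bound:
  assumes "ok 0 u" "i + 3 \<le> out 0 u" "ok (out 0 u) v" "out (out 0 u) v = 0"
    and D: "\<bar>bracket 1 1 (u @ sh i [(0, Cross a), (1, Cross b), (0, Cross c)] @ v)\<bar> = (2::int)"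
  shows "\<bar>bracket 1 1 (u @ sh i E0 @ v) - bracket 1 1 (u @ sh i E1 @ v)\<bar> \<le> (6::int)"
proof -
  define \<phi> where "\<phi> X = (bracket 1 1 (u @ sh i X @ v) :: int)" for X
  have "u \<noteq> []" using assms(2) by auto
  have P: "signed_power (\<phi> X)" if "ok 3 X" "out 3 X = 3" for X
  proof -
    define w where "w = out 0 u - (i + 3)"
    have w: "out 0 u = 3 + w + i" using assms(2) by (simp add: w_def)
    have "ok (out 0 u) (sh i X)" "out (out 0 u) (sh i X) = out 0 u"
      using ok_widen[OF that(1), of w] that(2) by (auto simp: w out_sh)
    then have "link_diagram (u @ sh i X @ v)" using assms by (simp add: link_diagram_def tangle_iff)
    then show ?thesis using bracket_one_power \<open>u \<noteq> []\<close> by (auto simp: \<phi>_def signed_power_def)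
  qed
  have rel: "(\<Sum>(a, X)\<leftarrow>xs. a * \<phi> X) = 0"
    if "\<And>a X. (a, X) \<in> set xs \<Longrightarrow> ok 3 X \<and> out 3 X = 3"
      "\<And>f s. length s = 3 \<Longrightarrow> (\<Sum>(a, X)\<leftarrow>xs. a * bsum 1 1 X f s) = (0::int)" for xs
    unfolding \<phi>_def by (rule bracket_combination[OF that assms(1-4)])
  have len: "length s = 3 \<Longrightarrow> (\<And>p q r. s = [p, q, r] \<Longrightarrow> thesis) \<Longrightarrow> thesis" for s :: "bool list" and thesis
    by (auto simp: length_3 numeral_3_eq_3)
  let ?x0 = "[(0, Cross a)]" and ?x1 = "[(1, Cross b)]"
  note s = bsum_Cons apply_local bcup_def
  have r1: "\<phi> ?x0 = \<phi> [] + \<phi> E0"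
  proof -
    have "(\<Sum>(a, X)\<leftarrow>[(1, ?x0), (-1, []), (-1, E0)]. a * \<phi> X) = 0"
      by (rule rel, force, erule len) (cases a; cases b; cases c; simp add: s)
    then show ?thesis by simp
  qed
  have r2: "\<phi> ?x1 = \<phi> [] + \<phi> E1"
  proof -
    have "(\<Sum>(a, X)\<leftarrow>[(1, ?x1), (-1, []), (-1, E1)]. a * \<phi> X) = 0"
      by (rule rel, force, erule len) (cases a; cases b; cases c; simp add: s)
    then show ?thesis by simp
  qed
  have r3: "\<phi> (?x0 @ ?x1) = \<phi> [] + \<phi> E0 + \<phi> E1 + \<phi> (E0 @ E1)"
  proof -
    have "(\<Sum>(a, X)\<leftarrow>[(1, (?x0 @ ?x1)), (-1, []), (-1, E0), (-1, E1), (-1, (E0 @ E1))]. a * \<phi> X) = 0"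
      by (rule rel, force, erule len) (cases a; cases b; cases c; simp add: s)
    then show ?thesis by simp
  qed
  have r4: "\<phi> (?x1 @ ?x0) = \<phi> [] + \<phi> E0 + \<phi> E1 + \<phi> (E1 @ E0)"
  proof -
    have "(\<Sum>(a, X)\<leftarrow>[(1, (?x1 @ ?x0)), (-1, []), (-1, E0), (-1, E1), (-1, (E1 @ E0))]. a * \<phi> X) = 0"
      by (rule rel, force, erule len) (cases a; cases b; cases c; simp add: s)
    then show ?thesis by simp
  qed
  have r5: "\<phi> [(0, Cross a), (1, Cross b), (0, Cross c)] = \<phi> [] + \<phi> E0 + \<phi> E1 + \<phi> (E0 @ E1) + \<phi> (E1 @ E0)"
  proof -
    have "(\<Sum>(a, X)\<leftarrow>[(1, [(0, Cross a), (1, Cross b), (0, Cross c)]), (-1, []), (-1, E0), (-1, E1), (-1, (E0 @ E1)), (-1, (E1 @ E0))]. a * \<phi> X) = 0"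
      by (rule rel, force, erule len) (cases a; cases b; cases c; simp add: s)
    then show ?thesis by simp
  qed
  have r6: "\<phi> (E0 @ ?x1) = \<phi> E0 + \<phi> (E0 @ E1)"
  proof -
    have "(\<Sum>(a, X)\<leftarrow>[(1, (E0 @ ?x1)), (-1, E0), (-1, (E0 @ E1))]. a * \<phi> X) = 0"
      by (rule rel, force, erule len) (cases a; cases b; cases c; simp add: s)
    then show ?thesis by simp
  qed
  have r7: "\<phi> (?x1 @ E0) = \<phi> E0 + \<phi> (E1 @ E0)"
  proof -
    have "(\<Sum>(a, X)\<leftarrow>[(1, (?x1 @ E0)), (-1, E0), (-1, (E1 @ E0))]. a * \<phi> X) = 0"
      by (rule rel, force, erule len) (cases a; cases b; cases c; simp add: s)
    then show ?thesis by simp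
  qed
  have r8: "\<phi> (?x0 @ E1) = \<phi> E1 + \<phi> (E0 @ E1)"
  proof -
    have "(\<Sum>(a, X)\<leftarrow>[(1, (?x0 @ E1)), (-1, E1), (-1, (E0 @ E1))]. a * \<phi> X) = 0"
      by (rule rel, force, erule len) (cases a; cases b; cases c; simp add: s)
    then show ?thesis by simp
  qed
  have r9: "\<phi> (E1 @ ?x0) = \<phi> E1 + \<phi> (E1 @ E0)"
  proof -
    have "(\<Sum>(a, X)\<leftarrow>[(1, (E1 @ ?x0)), (-1, E1), (-1, (E1 @ E0))]. a * \<phi> X) = 0"
      by (rule rel, force, erule len) (cases a; cases b; cases c; simp add: s)
    then show ?thesis by simp
  qed
  have r10: "\<phi> (?x0 @ E1 @ ?x0) = \<phi> E0 + \<phi> E1 + \<phi> (E0 @ E1) + \<phi> (E1 @ E0)"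
  proof -
    have "(\<Sum>(a, X)\<leftarrow>[(1, (?x0 @ E1 @ ?x0)), (-1, E0), (-1, E1), (-1, (E0 @ E1)), (-1, (E1 @ E0))]. a * \<phi> X) = 0"
      by (rule rel, force, erule len) (cases a; cases b; cases c; simp add: s)
    then show ?thesis by simp
  qed
  have D': "\<bar>\<phi> [] + \<phi> E0 + \<phi> E1 + \<phi> (E0 @ E1) + \<phi> (E1 @ E0)\<bar> = 2"
    using D r5 by (simp add: \<phi>_def)
  show ?thesis
    unfolding \<phi>_def[symmetric]
  proof (rule triangle_values[OF D'])
    show "signed_power (\<phi> [] + \<phi> E0)" unfolding r1[symmetric] by (rule P) auto
    show "signed_power (\<phi> [] + \<phi> E1)" unfolding r2[symmetric] by (rule P) auto
    show "signed_power (\<phi> [] + \<phi> E0 + \<phi> E1 + \<phi> (E0 @ E1))" unfolding r3[symmetric] by (rule P) auto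
    show "signed_power (\<phi> [] + \<phi> E0 + \<phi> E1 + \<phi> (E1 @ E0))" unfolding r4[symmetric] by (rule P) auto
    show "signed_power (\<phi> E0 + \<phi> (E0 @ E1))" unfolding r6[symmetric] by (rule P) auto
    show "signed_power (\<phi> E0 + \<phi> (E1 @ E0))" unfolding r7[symmetric] by (rule P) auto
    show "signed_power (\<phi> E1 + \<phi> (E0 @ E1))" unfolding r8[symmetric] by (rule P) auto
    show "signed_power (\<phi> E1 + \<phi> (E1 @ E0))" unfolding r9[symmetric] by (rule P) auto
    show "signed_power (\<phi> E0 + \<phi> E1 + \<phi> (E0 @ E1) + \<phi> (E1 @ E0))" unfolding r10[symmetric] by (rule P) auto
  qed (rule P; simp)+
qed

text \<open>The series is \<open>2 exp (-h) - exp (-5 h) - exp (3 h)\<close> or the same with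
  \<open>-h\<close> for \<open>h\<close>. Its coefficients come from 2 - 1 - 1 = 0, -2 + 5 - 3 = 0
  and (2 - 25 - 9) / 2 = -16.\<close>

lemma delta_coefficient:
  fixes C :: "real fps"
  assumes "C = (if a then 2 * fps_exp (-1) - fps_exp (-1) ^ 5 - fps_exp 1 ^ 3
    else 2 * fps_exp 1 - fps_exp 1 ^ 5 - fps_exp (-1) ^ 3)"
  shows "fps_nth C 0 = 0" "fps_nth C 1 = 0" "fps_nth C 2 = -16"
proof -
  obtain c d e :: real where C: "C = fps_exp c + fps_exp c - fps_exp d - fps_exp e"
    and cde: "c = -1 \<and> d = -5 \<and> e = 3 \<or> c = 1 \<and> d = 5 \<and> e = -3"
  proof (cases a)
    case True
    then show ?thesis using that[of "-1" "-5" 3] by (simp add: assms fps_exp_power_mult)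
  next
    case False
    then show ?thesis using that[of 1 5 "-3"] by (simp add: assms fps_exp_power_mult)
  qed
  show "fps_nth C 0 = 0" "fps_nth C 1 = 0" "fps_nth C 2 = -16"
    unfolding C fps_add_nth fps_sub_nth fps_exp_012 using cde by auto
qed

lemma jet_delta_rule:
  assumes "delta_rule l r" "link_diagram (u @ l @ v)"
  shows "fps_nth (jet (u @ r @ v)) 0 = fps_nth (jet (u @ l @ v)) 0 \<and>
    (\<bar>fps_nth (jet (u @ l @ v)) 0\<bar> = 2 \<longrightarrow> \<bar>J (jet (u @ l @ v)) - J (jet (u @ r @ v))\<bar> \<le> 48)"
proof -
  obtain i a where l: "l = sh i [(0, Cross a), (1, Cross (\<not> a)), (0, Cross a)]"
    and r: "r = sh i [(1, Cross a), (0, Cross (\<not> a)), (1, Cross a)]"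
    using assms(1)
  proof cases
    case (delta a c b i)
    then have e: "a = c" "b = (\<not> c)" by auto
    show ?thesis by (rule that[of i c]) (simp_all add: delta(1,2)[unfolded e])
  qed
  have ok: "ok 0 u" "i + 3 \<le> out 0 u" "ok (out 0 u) v" "out (out 0 u) v = 0"
    using assms(2) by (auto simp: link_diagram_def tangle_iff l)
  define C :: "real fps" where "C = (if a then 2 * fps_exp (-1) - fps_exp (-1) ^ 5 - fps_exp 1 ^ 3
    else 2 * fps_exp 1 - fps_exp 1 ^ 5 - fps_exp (-1) ^ 3)"
  define U where "U = jet (u @ sh i E0 @ v) - jet (u @ sh i E1 @ v)"
  have "(\<Sum>(a, X)\<leftarrow>[(1, [(0, Cross a), (1, Cross (\<not> a)), (0, Cross a)]),
      (-1, [(1, Cross a), (0, Cross (\<not> a)), (1, Cross a)]), (- C, E0), (C, E1)].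
      a * bracket (fps_exp 1) (fps_exp (-1)) (u @ sh i X @ v)) = 0"
  proof (rule bracket_combination[OF _ _ ok])
    fix f and s :: "bool list" assume "length s = 3"
    from bsum_delta[OF fps_exp_inv this, of a f, folded C_def]
    show "(\<Sum>(a, X)\<leftarrow>[(1, [(0, Cross a), (1, Cross (\<not> a)), (0, Cross a)]),
      (-1, [(1, Cross a), (0, Cross (\<not> a)), (1, Cross a)]), (- C, E0), (C, E1)].
      a * bsum (fps_exp 1) (fps_exp (-1)) X f s) = 0" by (simp add: algebra_simps)
  qed auto
  then have "jet (u @ l @ v) - jet (u @ r @ v) = C * U"
    by (simp add: jet_def l r U_def algebra_simps)
  then have e: "jet (u @ l @ v) = jet (u @ r @ v) + C * U" by (simp add: algebra_simps)
  have c: "fps_nth (jet (u @ l @ v)) 0 = fps_nth (jet (u @ r @ v)) 0"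
    "fps_nth (jet (u @ l @ v)) 1 = fps_nth (jet (u @ r @ v)) 1"
    "fps_nth (jet (u @ l @ v)) 2 = fps_nth (jet (u @ r @ v)) 2 - 16 * fps_nth U 0"
    unfolding e fps_add_nth fps_mult_nth_012 delta_coefficient[OF C_def] by simp_all
  have "\<bar>J (jet (u @ l @ v)) - J (jet (u @ r @ v))\<bar> \<le> 48" if 2: "\<bar>fps_nth (jet (u @ l @ v)) 0\<bar> = 2"
  proof -
    have "\<bar>real_of_int (bracket 1 1 (u @ l @ v))\<bar> = 2" using 2 by (simp add: jet_0)
    then have "\<bar>bracket 1 1 (u @ l @ v)\<bar> = (2::int)" by linarith
    from triangle_bound[OF ok this[unfolded l]]
    have U: "\<bar>fps_nth U 0\<bar> \<le> 6" by (simp add: U_def jet_0 flip: of_int_diff of_int_abs)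
    \<comment> \<open>The coefficients 0 and 1 agree, so the squared terms of \<open>J\<close>
      cancel. What is left is at most 16 * 6 / 2 = 48.\<close>
    have "J (jet (u @ l @ v)) - J (jet (u @ r @ v)) = - 16 * fps_nth U 0 / fps_nth (jet (u @ r @ v)) 0"
      unfolding J_def c by (simp add: diff_divide_distrib)
    moreover have "\<bar>- 16 * fps_nth U 0 / fps_nth (jet (u @ r @ v)) 0\<bar> = 8 * \<bar>fps_nth U 0\<bar>"
      using 2 by (simp add: abs_mult abs_divide c)
    ultimately show ?thesis using U by simp
  qed
  with c(1) show ?thesis by simp
qed

lemma jet_delta:
  assumes "tangle_change delta_rule 0 D E" "link_diagram D" "\<bar>fps_nth (jet D) 0\<bar> = 2"
  shows "\<bar>fps_nth (jet E) 0\<bar> = 2 \<and> \<bar>J (jet D) - J (jet E)\<bar> \<le> 48"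
proof -
  obtain u l r v where *: "D = u @ l @ v" "E = u @ r @ v" "delta_rule l r \<or> delta_rule r l"
    using assms(1) by (auto simp: tangle_change_def)
  have E: "link_diagram E" using assms(1,2) by (auto simp: tangle_change_def link_diagram_def tangle_iff)
  show ?thesis
    using *(3) jet_delta_rule[of l r u v] jet_delta_rule[of r l u v] assms(2,3) E unfolding *(1,2)
    by (auto simp: abs_minus_commute)
qed

lemma jet_isotopic:
  assumes "isotopic D E" "link_diagram D" "\<bar>fps_nth (jet D) 0\<bar> = 2"
  shows "link_diagram E \<and> \<bar>fps_nth (jet E) 0\<bar> = 2 \<and> J (jet D) = J (jet E)"
  using assms(1) unfolding isotopic_def
proof (induction rule: rtranclp_induct)
  case base
  then show ?case using assms by simp
next
  case (step E F)
  then have F: "tangle_change isotopy_rule 0 F E" "link_diagram F"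
    by (auto simp: local_change_tangle_change intro: tangle_change_sym)
  from jet_isotopy[OF F] step.IH F show ?case by auto
qed

lemma jet_delta_related:
  assumes "delta_related n D E" "link_diagram D" "\<bar>fps_nth (jet D) 0\<bar> = 2"
  shows "\<bar>J (jet D) - J (jet E)\<bar> \<le> 48 * real n"
proof -
  from assms(1) obtain D' where D': "isotopic D D'" "((delta_move OO isotopic) ^^ n) D' E"
    by (auto simp: delta_related_def)
  have "link_diagram E \<and> \<bar>fps_nth (jet E) 0\<bar> = 2 \<and> \<bar>J (jet D) - J (jet E)\<bar> \<le> 48 * real n"
    using D'(2)
  proof (induction n arbitrary: E)
    case 0
    then show ?case using jet_isotopic[OF D'(1) assms(2,3)] by simp
  next
    case (Suc n)
    then obtain F G where F: "((delta_move OO isotopic) ^^ n) D' F" "delta_move F G" "isotopic G E"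
      by auto
    have IH: "link_diagram F" "\<bar>fps_nth (jet F) 0\<bar> = 2" "\<bar>J (jet D) - J (jet F)\<bar> \<le> 48 * real n"
      using Suc.IH[OF F(1)] by auto
    have FG: "tangle_change delta_rule 0 F G" "link_diagram G"
      using F(2) by (auto simp: delta_move_def local_change_tangle_change)
    note G = jet_delta[OF FG(1) IH(1,2)]
    from jet_isotopic[OF F(3) FG(2)] G IH show ?case by (auto simp: algebra_simps)
  qed
  then show ?thesis by simp
qed

section \<open>The bracket of pretzel tangles, column by column\<close>

text \<open>The recursion over columns needs exact equalities, whereas invariance under isotopy
  would leave an undetermined curl factor.\<close>

lemma bsum_cup_commute:
  fixes A B :: "'r::idom"
  assumes "ok k D" "length s = i + 2 + out k D"
  shows "bsum A B ([(i, Cup)] @ sh (i + 2) D) f s = bsum A B (sh i D @ [(i, Cup)]) f s"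
proof -
  have "i + 2 \<le> length s" using assms(2) by simp
  then obtain x r y where s: "s = x @ r @ y" "length x = i" "length r = 2" by (rule split_list3)
  obtain p q where r: "r = [p, q]" using s(3) by (auto simp: length_2 numeral_2_eq_2)
  have y: "length y = out k D" using assms(2) s by simp
  have "bsum A B ([(i, Cup)] @ sh (i + 2) D) f s
      = bsum A B (sh (i + 2) D) (apply_piece UNIV (bpiece A B (i, Cup)) f) ((x @ r) @ y @ [])"
    by (simp add: s bsum_Cons)
  also have "\<dots> = bsum A B D (\<lambda>t. apply_piece UNIV (bpiece A B (i, Cup)) f (x @ [p, q] @ t)) y"
    using bsum_shift[OF assms(1), of "x @ r" "i + 2" y A B _ "[]"] s y by (simp add: r)
  also have "\<dots> = bcup A B [p, q] * bsum A B D (\<lambda>t. f (x @ t)) y"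
    using apply_cup[OF s(2), of A B f p q] by (simp add: bsum_scale)
  also have "bsum A B D (\<lambda>t. f (x @ t)) y = bsum A B (sh i D) f (x @ y)"
    using bsum_shift[OF assms(1) s(2) y, of A B f "[]"] by simp
  also have "bcup A B [p, q] * bsum A B (sh i D) f (x @ y) = bsum A B (sh i D @ [(i, Cup)]) f s"
    using apply_cup[OF s(2), of A B "bsum A B (sh i D) f" p q y] by (simp add: s r bsum_append bsum_Cons)
  finally show ?thesis .
qed

lemma bracket_resolve:
  fixes A B :: "'r::idom"
  assumes "ok 0 u" "i + 2 \<le> out 0 u" "ok (out 0 u) v" "out (out 0 u) v = 0" "A * B = 1"
  shows "bracket A B (u @ [(i, Cross b)] @ v) = (if b then A else B) * bracket A B (u @ v)
    + (if b then B else A) * bracket A B (u @ [(i, Cap), (i, Cup)] @ v)"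
proof -
  have "(\<Sum>(a, X)\<leftarrow>[(1, [(0, Cross b)]), (- (if b then A else B), []), (- (if b then B else A), E0)].
      a * bracket A B (u @ sh i X @ v)) = 0"
  proof (rule bracket_combination[where m = 2])
    fix f and s :: "bool list" assume "length s = 2"
    then obtain p q where s: "s = [p, q]" by (auto simp: length_2 numeral_2_eq_2)
    show "(\<Sum>(a, X)\<leftarrow>[(1, [(0, Cross b)]), (- (if b then A else B), []), (- (if b then B else A), E0)].
        a * bsum A B X f s) = 0"
      using assms(5) by (cases b; cases p; cases q;
        simp add: s bsum_Cons apply_local bcup_def AB_simps[OF assms(5)] algebra_simps power3_eq_cube)
  qed (use assms in auto)
  then show ?thesis by (cases b) (simp_all add: algebra_simps)
qed

lemma bracket_curl:
  fixes A B :: "'r::idom"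
  assumes "ok 0 u" "i \<le> out 0 u" "ok (out 0 u + 2) v" "out (out 0 u + 2) v = 0" "A * B = 1"
  shows "bracket A B (u @ [(i, Cup)] @ replicate k (i, Cross b) @ v)
    = (- ((if b then B else A) ^ 3)) ^ k * bracket A B (u @ [(i, Cup)] @ v)"
proof (induction k)
  case (Suc k)
  have v: "ok (out 0 u + 2) (replicate k (i, Cross b) @ v)" "out (out 0 u + 2) (replicate k (i, Cross b) @ v) = 0"
    using assms by (auto simp: ok_replicate_Cross out_replicate_Cross)
  have "bracket A B (u @ sh i [(0, Cup), (0, Cross b)] @ (replicate k (i, Cross b) @ v))
      = - ((if b then B else A) ^ 3) * bracket A B (u @ sh i [(0, Cup)] @ (replicate k (i, Cross b) @ v))"
  proof (rule bracket_context)
    fix f and s :: "bool list" assume l: "length s = out (out 0 u) (sh i [(0, Cup), (0, Cross b)])"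
    show "bsum A B (sh i [(0, Cup), (0, Cross b)]) f s
        = - ((if b then B else A) ^ 3) * bsum A B (sh i [(0, Cup)]) f s"
    proof (rule bsum_local[where m = 0, OF _ _ _ _ l])
      show "bsum A B [(0, Cup), (0, Cross b)] f s = - ((if b then B else A) ^ 3) * bsum A B [(0, Cup)] f s"
        if "length s = out 0 [(0, Cup), (0, Cross b)]" for f s
        by (rule bsum_r1_cup[OF assms(5)]) (use that in auto)
    qed (use assms in auto)
  qed (use assms v in auto)
  then show ?case using Suc.IH by simp
qed simp

definition loop :: "real fps" where "loop = - (fps_exp 2 + fps_exp (-2))"

lemma loop_012: "fps_nth loop 0 = -2" "fps_nth loop 1 = 0" "fps_nth loop 2 = -4"
  unfolding loop_def fps_neg_nth fps_add_nth fps_exp_012 by simp_all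

text \<open>A column is \<open>exp (p h)\<close> times the identity plus \<open>y\<close> times cap
  and cup. A minimum placed below it turns the twists into curls, which determines
  \<open>loop * y\<close> and describes \<open>y\<close> without a geometric sum.\<close>

lemma bracket_column:
  fixes p :: int
  shows "\<exists>y. loop * y = (if even p then 1 else -1) * fps_exp (- 3 * of_int p) - fps_exp (of_int p) \<and>
    (\<forall>u v i. ok 0 u \<longrightarrow> i + 2 \<le> out 0 u \<longrightarrow> ok (out 0 u) v \<longrightarrow> out (out 0 u) v = 0 \<longrightarrow>
      jet (u @ pw i p @ v) = fps_exp (of_int p) * jet (u @ v) + y * jet (u @ [(i, Cap), (i, Cup)] @ v))"
proof -
  define A :: "bool \<Rightarrow> real fps" where "A b = (if b then fps_exp 1 else fps_exp (-1))" for b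
  define P :: "bool \<Rightarrow> nat \<Rightarrow> int" where "P b k = (if b then int k else - int k)" for b k
  have main: "\<exists>y. loop * y = (if even k then 1 else -1) * fps_exp (- 3 * of_int (P b k)) - fps_exp (of_int (P b k)) \<and>
    (\<forall>u v i. ok 0 u \<longrightarrow> i + 2 \<le> out 0 u \<longrightarrow> ok (out 0 u) v \<longrightarrow> out (out 0 u) v = 0 \<longrightarrow>
      jet (u @ replicate k (i, Cross b) @ v) = fps_exp (of_int (P b k)) * jet (u @ v) + y * jet (u @ [(i, Cap), (i, Cup)] @ v))"
    for b k
  proof (induction k)
    case 0
    then show ?case by (intro exI[of _ 0]) (simp add: P_def)
  next
    case (Suc k)
    then obtain y where y: "loop * y = (if even k then 1 else -1) * fps_exp (- 3 * of_int (P b k)) - fps_exp (of_int (P b k))"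
      "\<And>u v i. ok 0 u \<Longrightarrow> i + 2 \<le> out 0 u \<Longrightarrow> ok (out 0 u) v \<Longrightarrow> out (out 0 u) v = 0 \<Longrightarrow>
      jet (u @ replicate k (i, Cross b) @ v) = fps_exp (of_int (P b k)) * jet (u @ v) + y * jet (u @ [(i, Cap), (i, Cup)] @ v)"
      by blast
    define e where "e = (if b then 1 else -1 :: real)"
    have A: "A b = fps_exp e" "A (\<not> b) = fps_exp (- e)" by (auto simp: A_def e_def)
    have Pk: "of_int (P b k) = real k * e" "of_int (P b (Suc k)) = real k * e + e" by (auto simp: P_def e_def algebra_simps)
    \<comment> \<open>The lowest crossing is resolved: one smoothing leaves the shorter column, the
      other turns the rest into \<open>k\<close> curls.\<close>
    define z where "z = A b * y + A (\<not> b) * (- (A (\<not> b) ^ 3)) ^ k"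
    have "jet (u @ replicate (Suc k) (i, Cross b) @ v) = fps_exp (of_int (P b (Suc k))) * jet (u @ v) + z * jet (u @ [(i, Cap), (i, Cup)] @ v)"
      if u: "ok 0 u" "i + 2 \<le> out 0 u" "ok (out 0 u) v" "out (out 0 u) v = 0" for u v i
    proof -
      let ?v = "replicate k (i, Cross b) @ v"
      have v: "ok (out 0 u) ?v" "out (out 0 u) ?v = 0"
        using u by (auto simp: ok_replicate_Cross out_replicate_Cross)
      have "jet (u @ [(i, Cross b)] @ ?v) = A b * jet (u @ ?v) + A (\<not> b) * jet (u @ [(i, Cap), (i, Cup)] @ ?v)"
        using bracket_resolve[OF u(1,2) v fps_exp_inv, of b] by (cases b) (auto simp: jet_def A_def)
      also have "jet (u @ ?v) = fps_exp (of_int (P b k)) * jet (u @ v) + y * jet (u @ [(i, Cap), (i, Cup)] @ v)"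
        using y(2)[OF u] .
      also have "jet (u @ [(i, Cap), (i, Cup)] @ ?v) = (- (A (\<not> b) ^ 3)) ^ k * jet (u @ [(i, Cap), (i, Cup)] @ v)"
      proof -
        have "Suc (Suc (out 0 u - 2)) = out 0 u" using u(2) by linarith
        then show ?thesis
          using bracket_curl[OF _ _ _ _ fps_exp_inv, of "u @ [(i, Cap)]" i v k b] u
          by (cases b) (auto simp: jet_def A_def)
      qed
      finally show ?thesis by (simp add: z_def A Pk fps_exp_add_mult algebra_simps)
    qed
    moreover have "loop * z = (if even (Suc k) then 1 else -1) * fps_exp (- 3 * of_int (P b (Suc k))) - fps_exp (of_int (P b (Suc k)))"
    proof -
      have l: "loop = - (fps_exp (2 * e) + fps_exp (- 2 * e))" by (auto simp: loop_def e_def)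
      have ek: "(- (fps_exp (- e) ^ 3)) ^ k = (if even k then 1 else -1) * fps_exp (- 3 * (real k * e))"
        by (simp add: fps_exp_power_mult uminus_power_if algebra_simps)
      have ey: "fps_exp e * (loop * y) = (if even k then 1 else -1) * fps_exp (e - 3 * (real k * e)) - fps_exp (real k * e + e)"
        unfolding y(1) Pk by (simp add: right_diff_distrib fps_exp_add_mult[symmetric] algebra_simps flip: fps_exp_add_mult)
      have le: "loop * fps_exp (- e) = - fps_exp e - fps_exp (- 3 * e)"
        unfolding l by (simp add: algebra_simps flip: fps_exp_add_mult)
      have "loop * z = fps_exp e * (loop * y) + (loop * fps_exp (- e)) * (- (fps_exp (- e) ^ 3)) ^ k"
        by (simp add: z_def A algebra_simps)
      also have "\<dots> = (if even (Suc k) then 1 else -1) * fps_exp (- 3 * of_int (P b (Suc k))) - fps_exp (of_int (P b (Suc k)))"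
        unfolding ek ey le Pk by (cases "even k") (simp_all add: algebra_simps flip: fps_exp_add_mult)
      finally show ?thesis .
    qed
    ultimately show ?case by blast
  qed
  have p: "P (p > 0) (nat \<bar>p\<bar>) = p" "even (nat \<bar>p\<bar>) = even p"
    by (auto simp: P_def even_nat_iff)
  from main[of "nat \<bar>p\<bar>" "p > 0"] show ?thesis unfolding p pw_def[symmetric] .
qed

lemma jet_local:
  assumes "ok 0 (u @ sh i l @ v)" "out 0 (u @ sh i l @ v) = 0" "m + i \<le> out 0 u"
    "ok m l" "ok m r" "out m l = out m r"
    and "\<And>f s. length s = out m l \<Longrightarrow> bsum (fps_exp 1) (fps_exp (-1)) l f s = c * bsum (fps_exp 1) (fps_exp (-1)) r f s"
  shows "jet (u @ sh i l @ v) = c * jet (u @ sh i r @ v)"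
  unfolding jet_def
  by (rule bracket_context[OF assms(1,2)]) (rule bsum_local[OF assms(4-6,3) _ assms(7)])

lemma jet_cup_commute:
  assumes "ok 0 u" "i + k = out 0 u" "ok k D" "ok (out k D + i + 2) v" "out (out k D + i + 2) v = 0"
  shows "jet (u @ [(i, Cup)] @ sh (i + 2) D @ v) = jet (u @ sh i D @ [(i, Cup)] @ v)"
proof -
  have u: "out 0 u + 2 = k + (i + 2)" using assms(2) by simp
  have ok': "ok (out 0 u + 2) (sh (i + 2) D)" "out (out 0 u + 2) (sh (i + 2) D) = out k D + (i + 2)"
    using ok_sh[of k "i + 2" D] out_sh[OF assms(3), of "i + 2"] assms(3) unfolding u by blast+
  have "jet (u @ ([(i, Cup)] @ sh (i + 2) D) @ v) = 1 * jet (u @ (sh i D @ [(i, Cup)]) @ v)"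
    unfolding jet_def
  proof (rule bracket_context)
    show "bsum (fps_exp 1) (fps_exp (-1)) ([(i, Cup)] @ sh (i + 2) D) f s
        = 1 * bsum (fps_exp 1) (fps_exp (-1)) (sh i D @ [(i, Cup)]) f s"
      if "length s = out (out 0 u) ([(i, Cup)] @ sh (i + 2) D)" for f s
      unfolding mult_1_left by (rule bsum_cup_commute[OF assms(3)]) (use that ok' in simp)
  qed (use assms ok' in \<open>simp_all add: add.assoc\<close>)
  then show ?thesis by simp
qed

text \<open>After the cap-cup smoothing the column falls apart into two zigzags, one below and one
  above \<open>T ps\<close>.\<close>

lemma jet_U_column:
  assumes "ok 0 u" "i + 2 \<le> out 0 u" "ok (out 0 u) v" "out (out 0 u) v = 0"
  shows "jet (u @ [(i + 1, Cup), (i, Cap), (i, Cup)] @ sh (i + 2) (T ps) @ [(i + 1, Cap)] @ v) = jet (u @ sh i (T ps) @ v)"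
proof -
  note zz = bsum_zigzag[OF fps_exp_inv]
  have "jet (u @ sh i [(1, Cup), (0, Cap)] @ [(i, Cup)] @ sh (i + 2) (T ps) @ [(i + 1, Cap)] @ v)
      = 1 * jet (u @ sh i [] @ [(i, Cup)] @ sh (i + 2) (T ps) @ [(i + 1, Cap)] @ v)"
    by (rule jet_local[where m = 1]) (use assms zz in auto)
  also have "jet (u @ sh i [] @ [(i, Cup)] @ sh (i + 2) (T ps) @ [(i + 1, Cap)] @ v)
      = jet (u @ sh i (T ps) @ [(i, Cup)] @ [(i + 1, Cap)] @ v)"
    using jet_cup_commute[of u i "out 0 u - i" "T ps" "[(i + 1, Cap)] @ v"] assms by simp
  also have "jet (u @ sh i (T ps) @ [(i, Cup)] @ [(i + 1, Cap)] @ v)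
      = jet ((u @ sh i (T ps)) @ sh i [(0, Cup), (1, Cap)] @ v)" by simp
  also have "\<dots> = 1 * jet ((u @ sh i (T ps)) @ sh i [] @ v)"
    by (rule jet_local[where m = 1]) (use assms zz in auto)
  finally show ?thesis by simp
qed

lemma jet_id_column:
  assumes "ok 0 u" "i + 2 \<le> out 0 u" "ok (out 0 u) v" "out (out 0 u) v = 0"
  shows "jet (u @ [(i + 1, Cup)] @ [(i + 3, Cup)] @ sh (i + 4) (T ps) @ [(i + 3, Cap)] @ [(i + 1, Cap)] @ v)
    = loop * jet (u @ [(i + 1, Cup)] @ sh (i + 2) (T ps) @ [(i + 1, Cap)] @ v)"
proof -
  define D where "D = [(0, Cup)] @ sh 1 (T ps) @ [(0, Cap)]"
  define k where "k = out 0 u - (i + 1)"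
  have D: "ok k D" "out k D = k" using assms by (auto simp: D_def k_def)
  have "jet (u @ [(i + 1, Cup)] @ sh (i + 1 + 2) D @ [(i + 1, Cap)] @ v)
      = jet (u @ sh (i + 1) D @ [(i + 1, Cup)] @ [(i + 1, Cap)] @ v)"
    by (rule jet_cup_commute[where k = k]) (use assms D in \<open>auto simp: k_def\<close>)
  also have "\<dots> = jet ((u @ sh (i + 1) D) @ sh (i + 1) [(0, Cup), (0, Cap)] @ v)" by simp
  also have "\<dots> = loop * jet ((u @ sh (i + 1) D) @ sh (i + 1) [] @ v)"
  proof (rule jet_local[where m = 0])
    have "fps_exp (- 1) * fps_exp (- 1) = (fps_exp (-2) :: real fps)" "fps_exp 1 * fps_exp 1 = (fps_exp 2 :: real fps)"
      by (simp_all flip: fps_exp_add_mult)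
    then show "bsum (fps_exp 1) (fps_exp (-1)) [(0, Cup), (0, Cap)] f s = loop * bsum (fps_exp 1) (fps_exp (-1)) [] f s"
      if "length s = out 0 [(0, Cup), (0, Cap)]" for f s
      using that by (simp add: bsum_Cons apply_local bcup_def loop_def algebra_simps flip: mult.assoc)
  qed (use assms D in \<open>auto simp: D_def k_def\<close>)
  finally show ?thesis by (simp add: D_def eval_nat_numeral)
qed

lemma jet_loop:
  assumes "ok 0 u" "i \<le> out 0 u" "ok (out 0 u) v" "out (out 0 u) v = 0"
  shows "jet (u @ [(i, Cup), (i, Cap)] @ v) = loop * jet (u @ v)"
proof -
  have "jet (u @ sh i [(0, Cup), (0, Cap)] @ v) = loop * jet (u @ sh i [] @ v)"
  proof (rule jet_local[where m = 0])
    have "fps_exp (- 1) * fps_exp (- 1) = (fps_exp (-2) :: real fps)" "fps_exp 1 * fps_exp 1 = (fps_exp 2 :: real fps)"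
      by (simp_all flip: fps_exp_add_mult)
    then show "bsum (fps_exp 1) (fps_exp (-1)) [(0, Cup), (0, Cap)] f s = loop * bsum (fps_exp 1) (fps_exp (-1)) [] f s"
      if "length s = out 0 [(0, Cup), (0, Cap)]" for f s
      using that by (simp add: bsum_Cons apply_local bcup_def loop_def algebra_simps flip: mult.assoc)
  qed (use assms in auto)
  then show ?thesis by simp
qed

lemma jet_Nil: "jet [] = 1" by (simp add: jet_def bracket_def)

lemma jet_trivial: "jet [(0, Cup), (0, Cap)] = loop"
  using jet_loop[of "[]" 0 "[]"] by (simp add: jet_Nil)

text \<open>The bracket of \<open>W (0 # ps)\<close>: with a column without crossings in front, the
  other columns form a connected sum, and the bracket becomes a product over them.\<close>

definition side :: "int list \<Rightarrow> real fps" where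
  "side ps = jet ([(0, Cup), (1, Cup)] @ sh 2 (T ps) @ [(1, Cap), (0, Cap)])"

lemma jet_W_Nil: "jet (W []) = loop\<^sup>2" and side_Nil: "side [] = loop"
proof -
  show "jet (W []) = loop\<^sup>2"
    using jet_loop[of "[]" 0 "[(0, Cup), (0, Cap)]"] by (simp add: W_def jet_trivial power2_eq_square)
  have "side [] = jet ([(0, Cup)] @ sh 1 [(0, Cup), (1, Cap)] @ [(2, Cup), (1, Cap), (0, Cap)])"
    by (simp add: side_def eval_nat_numeral)
  also have "\<dots> = 1 * jet ([(0, Cup)] @ sh 1 [] @ [(2, Cup), (1, Cap), (0, Cap)])"
    by (rule jet_local[where m = 1]) (use bsum_zigzag[OF fps_exp_inv] in auto)
  also have "jet ([(0, Cup)] @ sh 1 [] @ [(2, Cup), (1, Cap), (0, Cap)])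
      = jet ([(0, Cup)] @ sh 1 [(1, Cup), (0, Cap)] @ [(0, Cap)])" by (simp add: eval_nat_numeral)
  also have "\<dots> = 1 * jet ([(0, Cup)] @ sh 1 [] @ [(0, Cap)])"
    by (rule jet_local[where m = 1]) (use bsum_zigzag[OF fps_exp_inv] in auto)
  finally show "side [] = loop" by (simp add: jet_trivial)
qed

lemma jet_W_Cons:
  fixes p :: int
  shows "\<exists>y. loop * y = (if even p then 1 else -1) * fps_exp (- 3 * of_int p) - fps_exp (of_int p) \<and>
    jet (W (p # ps)) = fps_exp (of_int p) * side ps + y * jet (W ps) \<and>
    side (p # ps) = (fps_exp (of_int p) * loop + y) * side ps"
proof -
  obtain y where y: "loop * y = (if even p then 1 else -1) * fps_exp (- 3 * of_int p) - fps_exp (of_int p)"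
    "\<And>u v i. ok 0 u \<Longrightarrow> i + 2 \<le> out 0 u \<Longrightarrow> ok (out 0 u) v \<Longrightarrow> out (out 0 u) v = 0 \<Longrightarrow>
      jet (u @ pw i p @ v) = fps_exp (of_int p) * jet (u @ v) + y * jet (u @ [(i, Cap), (i, Cup)] @ v)"
    using bracket_column[of p] by blast
  have "jet ([(0, Cup), (1, Cup)] @ pw 0 p @ sh 2 (T ps) @ [(1, Cap), (0, Cap)])
      = fps_exp (of_int p) * side ps
        + y * jet ([(0, Cup), (1, Cup)] @ [(0, Cap), (0, Cup)] @ sh 2 (T ps) @ [(1, Cap), (0, Cap)])"
    unfolding side_def by (rule y(2)) auto
  moreover have "jet ([(0, Cup), (1, Cup)] @ [(0, Cap), (0, Cup)] @ sh 2 (T ps) @ [(1, Cap), (0, Cap)]) = jet (W ps)"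
    using jet_U_column[of "[(0, Cup)]" 0 "[(0, Cap)]" ps] by (simp add: W_def eval_nat_numeral)
  ultimately have 1: "jet (W (p # ps)) = fps_exp (of_int p) * side ps + y * jet (W ps)"
    by (simp add: W_def T.simps(2))
  have "jet ([(0, Cup), (1, Cup), (3, Cup)] @ pw 2 p @ sh 4 (T ps) @ [(3, Cap), (1, Cap), (0, Cap)])
      = fps_exp (of_int p) * jet ([(0, Cup), (1, Cup), (3, Cup)] @ sh 4 (T ps) @ [(3, Cap), (1, Cap), (0, Cap)])
        + y * jet ([(0, Cup), (1, Cup), (3, Cup)] @ [(2, Cap), (2, Cup)] @ sh 4 (T ps) @ [(3, Cap), (1, Cap), (0, Cap)])"
    by (rule y(2)) auto
  moreover have "jet ([(0, Cup), (1, Cup), (3, Cup)] @ sh 4 (T ps) @ [(3, Cap), (1, Cap), (0, Cap)]) = loop * side ps"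
    using jet_id_column[of "[(0, Cup)]" 0 "[(0, Cap)]" ps] by (simp add: side_def eval_nat_numeral)
  moreover have "jet ([(0, Cup), (1, Cup), (3, Cup)] @ [(2, Cap), (2, Cup)] @ sh 4 (T ps) @ [(3, Cap), (1, Cap), (0, Cap)]) = side ps"
    using jet_U_column[of "[(0, Cup), (1, Cup)]" 2 "[(1, Cap), (0, Cap)]" ps] by (simp add: side_def eval_nat_numeral)
  ultimately have 2: "side (p # ps) = (fps_exp (of_int p) * loop + y) * side ps"
    by (simp add: side_def T.simps(2) eval_nat_numeral algebra_simps)
  from y(1) 1 2 show ?thesis by blast
qed

section \<open>Second-order expansion for odd columns\<close>

definition sq_sum :: "int list \<Rightarrow> int" where "sq_sum ps = sum_list (map (\<lambda>p. p\<^sup>2) ps)"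

lemma sum_list_square: "(sum_list ps)\<^sup>2 = sq_sum ps + 2 * e2 ps"
  by (induction ps) (auto simp: sq_sum_def power2_eq_square algebra_simps)

lemma column_coefficient:
  fixes y :: "real fps"
  assumes "loop * y = - fps_exp (- 3 * r) - fps_exp r"
  shows "fps_nth y 0 = 1" "fps_nth y 1 = - r" "fps_nth y 2 = 5 * r\<^sup>2 / 2 - 2"
proof -
  have *: "fps_nth (loop * y) n = - fps_nth (fps_exp (- 3 * r)) n - fps_nth (fps_exp r) n" for n
    using assms by simp
  show 0: "fps_nth y 0 = 1" using *[of 0] by (simp only: fps_mult_nth_012 loop_012 fps_exp_012)
  show 1: "fps_nth y 1 = - r" using *[of 1] by (simp only: fps_mult_nth_012 loop_012 fps_exp_012)
  show "fps_nth y 2 = 5 * r\<^sup>2 / 2 - 2"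
    using *[of 2] 0 1 by (simp only: fps_mult_nth_012 loop_012 fps_exp_012) (simp add: power2_eq_square field_simps)
qed

text \<open>The recursion of \<open>jet_W_Cons\<close> for the pair \<open>jet (W ps)\<close>,
  \<open>side ps\<close> is triangular with diagonal entries \<open>y\<close> and
  \<open>x = exp (p h) * loop + y\<close>. The combination chosen here diagonalises it:
  \<open>Y\<close> is the product of the \<open>y\<close> and \<open>B\<close> that of the
  \<open>x\<close>, both starting from 1 because \<open>jet (W [])\<close> is the square of
  \<open>loop\<close>.\<close>

lemma jet_W_expansion:
  assumes "\<And>p. p \<in> set ps \<Longrightarrow> odd p"
  defines "e \<equiv> of_int (sum_list ps) :: real" and "q \<equiv> of_int (sq_sum ps) :: real" and "n \<equiv> real (length ps)"
  shows "\<exists>B Y. jet (W ps) = B + (loop\<^sup>2 - 1) * Y \<and> side ps = loop * B \<and>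
    fps_nth Y 0 = 1 \<and> fps_nth Y 1 = - e \<and> fps_nth Y 2 = 2 * q - 2 * n + e\<^sup>2 / 2 \<and>
    fps_nth B 0 = (-1) ^ length ps \<and> fps_nth B 1 = (-1) ^ length ps * (3 * e) \<and>
    fps_nth B 2 = (-1) ^ length ps * (6 * n - 6 * q + 9 * e\<^sup>2 / 2)"
  using assms(1) unfolding e_def q_def n_def
proof (induction ps)
  case Nil
  show ?case by (intro exI[of _ 1]) (simp add: jet_W_Nil side_Nil sq_sum_def)
next
  case (Cons p ps)
  then obtain B Y where IH: "jet (W ps) = B + (loop\<^sup>2 - 1) * Y" "side ps = loop * B"
    "fps_nth Y 0 = 1" "fps_nth Y 1 = - of_int (sum_list ps)"
    "fps_nth Y 2 = 2 * of_int (sq_sum ps) - 2 * real (length ps) + (of_int (sum_list ps))\<^sup>2 / 2"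
    "fps_nth B 0 = (-1) ^ length ps" "fps_nth B 1 = (-1) ^ length ps * (3 * of_int (sum_list ps))"
    "fps_nth B 2 = (-1) ^ length ps * (6 * real (length ps) - 6 * of_int (sq_sum ps) + 9 * (of_int (sum_list ps))\<^sup>2 / 2)"
    by auto
  define r where "r = (of_int p :: real)"
  have "odd p" using Cons.prems by simp
  then obtain y where y: "loop * y = - fps_exp (- 3 * r) - fps_exp r"
    "jet (W (p # ps)) = fps_exp r * side ps + y * jet (W ps)" "side (p # ps) = (fps_exp r * loop + y) * side ps"
    using jet_W_Cons[of p ps] by (auto simp: r_def)
  note yc = column_coefficient[OF y(1)]
  define x where "x = fps_exp r * loop + y"
  have xc: "fps_nth x 0 = -1" "fps_nth x 1 = - 3 * r" "fps_nth x 2 = 3 * r\<^sup>2 / 2 - 6"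
    unfolding x_def fps_add_nth fps_mult_nth_012 loop_012 fps_exp_012 yc by simp_all
  show ?case
  proof (intro exI conjI)
    show "jet (W (p # ps)) = x * B + (loop\<^sup>2 - 1) * (y * Y)"
      unfolding y(2) IH(1,2) x_def by (simp add: algebra_simps)
    show "side (p # ps) = loop * (x * B)" unfolding y(3) IH(2) x_def by (simp add: algebra_simps)
  qed (unfold fps_mult_nth_012 IH yc xc, simp_all add: r_def sq_sum_def power2_eq_square field_simps)
qed

theorem J_W:
  assumes "\<And>p. p \<in> set ps \<Longrightarrow> odd p" "odd (length ps)"
  shows "fps_nth (jet (W ps)) 0 = 2"
    "J (jet (W ps)) = - 12 * of_int (e2 ps) - 6 * real (length ps) + 8"
proof -
  define e where "e = (of_int (sum_list ps) :: real)"
  define q where "q = (of_int (sq_sum ps) :: real)"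
  define n where "n = real (length ps)"
  obtain B Y where *: "jet (W ps) = B + (loop\<^sup>2 - 1) * Y"
    "fps_nth Y 0 = 1" "fps_nth Y 1 = - e" "fps_nth Y 2 = 2 * q - 2 * n + e\<^sup>2 / 2"
    "fps_nth B 0 = - 1" "fps_nth B 1 = - 1 * (3 * e)" "fps_nth B 2 = - 1 * (6 * n - 6 * q + 9 * e\<^sup>2 / 2)"
  proof -
    have "(-1 :: real) ^ length ps = -1" using assms(2) by simp
    then show ?thesis
      using jet_W_expansion[of ps, OF assms(1)] that unfolding e_def q_def n_def by metis
  qed
  have l: "fps_nth (loop\<^sup>2 - 1) 0 = 3" "fps_nth (loop\<^sup>2 - 1) 1 = 0" "fps_nth (loop\<^sup>2 - 1) 2 = 16"
    unfolding power2_eq_square fps_sub_nth fps_mult_nth_012 loop_012 by simp_all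
  have F: "fps_nth (jet (W ps)) 0 = 2" "fps_nth (jet (W ps)) 1 = - 6 * e"
    "fps_nth (jet (W ps)) 2 = 12 * q - 12 * n - 3 * e\<^sup>2 + 16"
    unfolding *(1) fps_add_nth fps_mult_nth_012 l *(2-) by (simp_all add: field_simps)
  show "fps_nth (jet (W ps)) 0 = 2" by (rule F)
  \<comment> \<open>\<open>J\<close> contains \<open>6 * q\<close> minus 6 times the square of
    \<open>e\<close>, which by this identity is \<open>- 12 * e2 ps\<close>; the squares of the
    columns drop out.\<close>
  have "e\<^sup>2 = q + 2 * of_int (e2 ps)"
    using sum_list_square[of ps] by (simp add: e_def q_def flip: of_int_power)
  then show "J (jet (W ps)) = - 12 * of_int (e2 ps) - 6 * real (length ps) + 8"
    unfolding J_def F by (simp add: n_def power2_eq_square field_simps)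
qed

lemma J_trivial: "J (jet trivial_knot) = 2"
  unfolding trivial_knot_def jet_trivial J_def loop_012 by simp

lemma J_pretzel:
  assumes "\<And>p. p \<in> set ps \<Longrightarrow> odd p" "odd (length ps)"
  shows "link_diagram (pretzel ps)" "\<bar>fps_nth (jet (pretzel ps)) 0\<bar> = 2"
    "J (jet (pretzel ps)) = - 12 * of_int (e2 ps) - 6 * real (length ps) + 8"
proof -
  have "ps \<noteq> []" using assms(2) by auto
  then have m: "moves 0 0 (pretzel ps) (W ps)" by (rule pretzel_W)
  show link: "link_diagram (pretzel ps)" using moves_ok[OF m] by (simp add: link_diagram_def tangle_iff)
  have "link_diagram (W ps)" by (simp add: link_diagram_def tangle_iff)
  from moves_delta_related[OF moves_sym[OF m] this] have "isotopic (W ps) (pretzel ps)"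
    by (auto simp: delta_related_def relcompp.simps)
  from jet_isotopic[OF this \<open>link_diagram (W ps)\<close>] J_W[OF assms]
  show "\<bar>fps_nth (jet (pretzel ps)) 0\<bar> = 2"
    "J (jet (pretzel ps)) = - 12 * of_int (e2 ps) - 6 * real (length ps) + 8" by auto
qed

theorem delta_unknotting_number_pretzel:
  assumes "even (length ps)" "\<And>p. p \<in> set ps \<Longrightarrow> odd p \<and> p > 0"
  shows "8 * int (delta_unknotting_number (pretzel (-1 # ps))) = 2 * (e2 ps - sum_list ps) + int (length ps)"
proof -
  obtain k where k: "8 * int k = 2 * (e2 ps - sum_list ps) + int (length ps)"
    "moves 0 k (W (-1 # ps)) trivial_knot"
    using unknotting_sequence[OF assms] by blast
  have odd: "odd p" if "p \<in> set (-1 # ps)" for p using that assms(2) by auto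
  have len: "odd (length (-1 # ps))" using assms(1) by simp
  note P = J_pretzel[OF odd len]
  have "moves 0 k (pretzel (-1 # ps)) trivial_knot"
    using pretzel_W[of "-1 # ps"] k(2) by (blast intro: moves_trans0)
  then have rel: "delta_related k (pretzel (-1 # ps)) trivial_knot" using moves_delta_related P(1) by blast
  have low: "k \<le> j" if "delta_related j (pretzel (-1 # ps)) trivial_knot" for j
  proof -
    have "8 * real k = 2 * (of_int (e2 ps) - of_int (sum_list ps)) + real (length ps)"
      using arg_cong[OF k(1), of real_of_int] by simp
    then have "- 12 * of_int (e2 (-1 # ps)) - 6 * real (length (-1 # ps)) + 8 = 2 - 48 * real k" by simp
    then have "J (jet (pretzel (-1 # ps))) = 2 - 48 * real k" using P(3) by metis
    with jet_delta_related[OF that P(1,2)] have "48 * real k \<le> 48 * real j" unfolding J_trivial by simp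
    then show ?thesis by simp
  qed
  have "delta_unknotting_number (pretzel (-1 # ps)) = k"
    unfolding delta_unknotting_number_def delta_gordian_distance_def
    by (rule Least_equality) (use rel low in auto)
  then show ?thesis using k(1) by simp
qed

section \<open>Oriented tangles\<close>

lemma flow_iff:
  "flow Cup p q \<longleftrightarrow> p = [] \<and> (\<exists>a. q = [a, \<not> a])"
  "flow Cap p q \<longleftrightarrow> q = [] \<and> (\<exists>a. p = [a, \<not> a])"
  "flow (Cross b) p q \<longleftrightarrow> (\<exists>a c. p = [a, c] \<and> q = [c, a])"
  by (auto elim: flow.cases intro: flow.intros)

lemma flow_length: "flow g p q \<Longrightarrow> length p = ins g \<and> length q = outs g"
  by (cases g) (auto simp: flow_iff)

text \<open>The splitting of the strand list demanded by \<open>oriented_tangle\<close> is unique;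
  in terms of \<open>take\<close> and \<open>drop\<close> it can be computed.\<close>

lemma oriented_tangle_Cons:
  "oriented_tangle s ((s', i, g) # E) t \<longleftrightarrow> s' = s \<and> i + ins g \<le> length s \<and>
    (\<exists>q. flow g (take (ins g) (drop i s)) q \<and> oriented_tangle (take i s @ q @ drop (i + ins g) s) E t)"
proof
  assume "oriented_tangle s ((s', i, g) # E) t"
  then obtain x p q y where *: "s' = s" "s = x @ p @ y" "length x = i" "flow g p q" "oriented_tangle (x @ q @ y) E t"
    by auto
  then show "s' = s \<and> i + ins g \<le> length s \<and>
    (\<exists>q. flow g (take (ins g) (drop i s)) q \<and> oriented_tangle (take i s @ q @ drop (i + ins g) s) E t)"
    using flow_length[OF *(4)] by auto
next
  assume *: "s' = s \<and> i + ins g \<le> length s \<and>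
    (\<exists>q. flow g (take (ins g) (drop i s)) q \<and> oriented_tangle (take i s @ q @ drop (i + ins g) s) E t)"
  have "s = take i s @ take (ins g) (drop i s) @ drop (i + ins g) s"
    by (metis add.commute append_take_drop_id drop_drop)
  moreover have "length (take i s) = i" using * by simp
  ultimately show "oriented_tangle s ((s', i, g) # E) t"
    unfolding oriented_tangle.simps(2) using * by blast
qed

declare oriented_tangle.simps(2) [simp del]

lemmas oriented_simps = oriented_tangle_Cons flow_iff map_eq_Cons_conv

lemma oriented_tangle_append:
  "oriented_tangle s (E @ F) t \<longleftrightarrow> (\<exists>r. oriented_tangle s E r \<and> oriented_tangle r F t)"
proof (induction E arbitrary: s)
  case (Cons l E)
  obtain s' i g where l: "l = (s', i, g)" by (metis prod_cases3)
  show ?case unfolding l append_Cons oriented_tangle_Cons Cons.IH by blast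
qed simp

lemma oriented_tangle_append_map:
  assumes "oriented_tangle s E t" "map snd E = D1 @ D2"
  obtains E1 E2 r where "E = E1 @ E2" "oriented_tangle s E1 r" "oriented_tangle r E2 t" "map snd E1 = D1" "map snd E2 = D2"
proof -
  obtain E1 E2 where E: "E = E1 @ E2" "map snd E1 = D1" "map snd E2 = D2"
    using assms(2) by (auto simp: map_eq_append_conv)
  from assms(1) obtain r where "oriented_tangle s E1 r" "oriented_tangle r E2 t"
    unfolding E(1) oriented_tangle_append by blast
  then show ?thesis by (rule that[OF E(1) _ _ E(2,3)])
qed

lemma oriented_tangle_ok:
  "oriented_tangle s E t \<Longrightarrow> ok (length s) (map snd E) \<and> out (length s) (map snd E) = length t"
proof (induction E arbitrary: s)
  case (Cons l E)
  obtain s' i g where l: "l = (s', i, g)" by (metis prod_cases3)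
  from Cons.prems obtain q where q: "i + ins g \<le> length s" "flow g (take (ins g) (drop i s)) q"
    "oriented_tangle (take i s @ q @ drop (i + ins g) s) E t"
    by (auto simp: l oriented_tangle_Cons)
  have "length (take i s @ q @ drop (i + ins g) s)
      = (case g of Cup \<Rightarrow> length s + 2 | Cap \<Rightarrow> length s - 2 | Cross b \<Rightarrow> length s)"
    using q(1) flow_length[OF q(2)] by (cases g) auto
  with Cons.IH[OF q(3)] q(1) show ?case by (cases g) (auto simp: l)
qed auto

text \<open>Counterpart of \<open>sh\<close>: here the directions of the idle strands on both sides
  must be written into every layer.\<close>

definition pad :: "bool list \<Rightarrow> bool list \<Rightarrow> oriented_diagram \<Rightarrow> oriented_diagram" where
  "pad x y E = map (\<lambda>(s, j, g). (x @ s @ y, j + length x, g)) E"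

lemma pad_simps [simp]: "pad x y [] = []" "pad x y ((s, j, g) # E) = (x @ s @ y, j + length x, g) # pad x y E"
  "pad x y (E @ F) = pad x y E @ pad x y F"
  by (simp_all add: pad_def)

lemma map_snd_pad: "map snd (pad x y E) = sh (length x) (map snd E)"
  by (auto simp: pad_def sh_def)

lemma oriented_tangle_pad: "oriented_tangle s E t \<Longrightarrow> oriented_tangle (x @ s @ y) (pad x y E) (x @ t @ y)"
proof (induction E arbitrary: s)
  case (Cons l E)
  obtain s' i g where l: "l = (s', i, g)" by (metis prod_cases3)
  from Cons.prems obtain q where q: "s' = s" "i + ins g \<le> length s" "flow g (take (ins g) (drop i s)) q"
    "oriented_tangle (take i s @ q @ drop (i + ins g) s) E t"
    by (auto simp: l oriented_tangle_Cons)
  have "take (ins g) (drop (i + length x) (x @ s @ y)) = take (ins g) (drop i s)"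
    "take (i + length x) (x @ s @ y) @ q @ drop (i + length x + ins g) (x @ s @ y)
      = x @ (take i s @ q @ drop (i + ins g) s) @ y"
    using q(2) by auto
  then show ?case unfolding l pad_simps oriented_tangle_Cons using q Cons.IH[OF q(4)] by auto
qed auto

text \<open>Pieces shifted by \<open>length x\<close> cannot touch \<open>x\<close>, and
  \<open>ok (length s) D\<close> keeps them away from \<open>y\<close>. Thus oriented rules may be
  verified on the fewest strands.\<close>

lemma oriented_tangle_unpad:
  assumes "oriented_tangle (x @ s @ y) E t" "map snd E = sh (length x) D" "ok (length s) D"
  obtains E0 t0 where "E = pad x y E0" "t = x @ t0 @ y" "oriented_tangle s E0 t0" "map snd E0 = D"
proof -
  have "\<exists>E0 t0. E = pad x y E0 \<and> t = x @ t0 @ y \<and> oriented_tangle s E0 t0 \<and> map snd E0 = D"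
    using assms
  proof (induction D arbitrary: s E)
    case Nil
    then show ?case by (intro exI[of _ "[]"] exI[of _ s]) auto
  next
    case (Cons ig D)
    obtain i g where ig: "ig = (i, g)" by fastforce
    obtain s' E' where E: "E = (s', i + length x, g) # E'" "map snd E' = sh (length x) D"
      using Cons.prems(2) by (auto simp: ig Cons_eq_map_conv)
    have i: "i + ins g \<le> length s" using Cons.prems(3) by (cases g) (auto simp: ig)
    from Cons.prems(1) obtain q where q: "s' = x @ s @ y"
      "flow g (take (ins g) (drop (i + length x) (x @ s @ y))) q"
      "oriented_tangle (take (i + length x) (x @ s @ y) @ q @ drop (i + length x + ins g) (x @ s @ y)) E' t"
      by (auto simp: E oriented_tangle_Cons)
    have e: "take (ins g) (drop (i + length x) (x @ s @ y)) = take (ins g) (drop i s)"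
      "take (i + length x) (x @ s @ y) @ q @ drop (i + length x + ins g) (x @ s @ y)
        = x @ (take i s @ q @ drop (i + ins g) s) @ y"
      using i by auto
    define s1 where "s1 = take i s @ q @ drop (i + ins g) s"
    have "length s1 = (case g of Cup \<Rightarrow> length s + 2 | Cap \<Rightarrow> length s - 2 | Cross b \<Rightarrow> length s)"
      using i flow_length[OF q(2)] by (cases g) (auto simp: s1_def)
    then have "ok (length s1) D" using Cons.prems(3) by (cases g) (auto simp: ig)
    then obtain E0 t0 where "E' = pad x y E0" "t = x @ t0 @ y" "oriented_tangle s1 E0 t0" "map snd E0 = D"
      using Cons.IH[of s1 E'] q(3) E(2) unfolding e s1_def by auto
    then show ?case using i q(1,2) unfolding e
      by (intro exI[of _ "(s, i, g) # E0"] exI[of _ t0]) (auto simp: E(1) ig oriented_tangle_Cons s1_def)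
  qed
  then show ?thesis using that by blast
qed

section \<open>The R-matrix\<close>

locale rmatrix =
  fixes q :: real and N :: nat
  assumes q_gt_1: "q > 1"
begin

definition zz :: real where "zz = q - 1 / q"
text \<open>The pivotal weight, \<open>q\<close> to the power \<open>2 k + 1 - N\<close>; a
  quotient, since this exponent may be negative.\<close>

definition mu :: "nat \<Rightarrow> real" where "mu k = q ^ (2 * k) * q / q ^ N"

definition al :: "bool \<Rightarrow> nat \<Rightarrow> nat \<Rightarrow> real" where
  "al s x y = (if x = y then if s then q else 1 / q else 1)"
definition be :: "bool \<Rightarrow> nat \<Rightarrow> nat \<Rightarrow> real" where
  "be s x y = (if s then if y < x then zz else 0 else if x < y then - zz else 0)"

text \<open>The weight of a crossing of two upward strands of sign \<open>s\<close>: labels \<open>x, y\<close> below and \<open>z, w\<close> above.\<close>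

definition R :: "bool \<Rightarrow> nat \<Rightarrow> nat \<Rightarrow> nat \<Rightarrow> nat \<Rightarrow> real" where
  "R s x y z w = (if z = y \<and> w = x then al s x y else 0) + (if z = x \<and> w = y then be s x y else 0)"

text \<open>\<open>R\<close> satisfies Reidemeister I only up to this factor. Scaling by it gives
  full invariance and puts the powers of \<open>q^N\<close> into the skein relation.\<close>

definition framing :: "bool \<Rightarrow> real" where "framing s = (if s then 1 / q ^ N else q ^ N)"

definition X :: "bool \<Rightarrow> nat \<Rightarrow> nat \<Rightarrow> nat \<Rightarrow> nat \<Rightarrow> real" where
  "X s x y z w = framing s * R s x y z w"

lemma q_pos [simp]: "q > 0" "q \<noteq> 0" using q_gt_1 by auto
lemma mu_pos [simp]: "mu k > 0" "mu k \<noteq> 0" by (simp_all add: mu_def)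
lemma framing_inv: "framing s * framing (\<not> s) = 1" by (simp add: framing_def)

lemma sum_inv_mu: "(\<Sum>k<x. zz / mu k) = q ^ N - q ^ N / q ^ (2 * x)"
proof (induction x)
  case (Suc x)
  have "zz / mu x = q ^ N / q ^ (2 * x) - q ^ N / q ^ (2 * Suc x)"
    by (simp add: zz_def mu_def field_simps power2_eq_square)
  with Suc show ?case by simp
qed simp

lemma sum_mu: "(\<Sum>k<x. zz * mu k) = q ^ (2 * x) / q ^ N - 1 / q ^ N"
proof (induction x)
  case (Suc x)
  have "zz * mu x = q ^ (2 * Suc x) / q ^ N - q ^ (2 * x) / q ^ N"
    by (simp add: zz_def mu_def field_simps power2_eq_square)
  with Suc show ?case by simp
qed simp

lemma sum_between:
  fixes g :: "nat \<Rightarrow> real"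
  assumes "x < y" "y \<le> N"
  shows "(\<Sum>k<N. if x < k \<and> k < y then g k else 0) = (\<Sum>k<y. g k) - (\<Sum>k<Suc x. g k)"
proof -
  have "(\<Sum>k<N. if x < k \<and> k < y then g k else 0) = (\<Sum>k\<in>{Suc x..<y}. g k)"
    by (rule sum.mono_neutral_cong_right) (use assms in auto)
  also have "\<dots> = (\<Sum>k\<in>{0..<y}. g k) - (\<Sum>k\<in>{0..<Suc x}. g k)"
    using sum_diff_nat_ivl[of 0 "Suc x" y g] assms by simp
  finally show ?thesis by (simp add: atLeast0LessThan)
qed

lemma sum_below: "y \<le> N \<Longrightarrow> (\<Sum>k<N. if k < y then g k else 0) = (\<Sum>k<y. g k)" for g :: "nat \<Rightarrow> real"
  by (rule sum.mono_neutral_cong_right) auto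

lemma sum_above: "x < N \<Longrightarrow> (\<Sum>k<N. if x < k then g k else 0) = (\<Sum>k<N. g k) - (\<Sum>k<Suc x. g k)" for g :: "nat \<Rightarrow> real"
proof -
  assume "x < N"
  then have "(\<Sum>k<N. if x < k \<and> k < N then g k else 0) = (\<Sum>k<N. g k) - (\<Sum>k<Suc x. g k)" by (rule sum_between) simp
  moreover have "(\<Sum>k<N. if x < k \<and> k < N then g k else 0) = (\<Sum>k<N. if x < k then g k else 0)"
    by (rule sum.cong) auto
  ultimately show ?thesis by simp
qed

text \<open>A curl with its loop on the right. By \<open>sum_inv_mu\<close> the off-diagonal part
  telescopes, and together with the diagonal term it gives a value independent of the label.\<close>

lemma R_partial_right:
  assumes "x < N" "y < N"
  shows "(\<Sum>k<N. R s x k y k / mu k) = (if x = y then 1 / framing s else 0)"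
proof (cases "x = y")
  case False
  then show ?thesis by (auto simp: R_def intro!: sum.neutral)
next
  case True
  have "(\<Sum>k<N. R s x k y k / mu k) = (\<Sum>k<N. if x = k then al s x k / mu k else 0) + (\<Sum>k<N. be s x k / mu k)"
    unfolding sum.distrib[symmetric] by (rule sum.cong) (auto simp: R_def True add_divide_distrib)
  also have "(\<Sum>k<N. if x = k then al s x k / mu k else 0) = al s x x / mu x" using assms by simp
  also have "(\<Sum>k<N. be s x k / mu k) = (if s then \<Sum>k<N. if k < x then zz / mu k else 0
      else - (\<Sum>k<N. if x < k then zz / mu k else 0))"
    unfolding sum_negf[symmetric] by (cases s) (auto simp: be_def intro!: sum.cong)
  also have "\<dots> = (if s then q ^ N - q ^ N / q ^ (2 * x) else q ^ N / q ^ (2 * N) - q ^ N / q ^ (2 * Suc x))"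
    unfolding sum_above[OF assms(1)] sum_below[OF less_imp_le[OF assms(1)]] sum_inv_mu by simp
  also have "al s x x / mu x + \<dots> = 1 / framing s"
    by (cases s) (simp_all add: al_def mu_def framing_def field_simps mult_2 mult_2_right power_add)
  finally show ?thesis using True by simp
qed

lemma R_partial_left:
  assumes "x < N" "y < N"
  shows "(\<Sum>k<N. mu k * R s k x k y) = (if x = y then 1 / framing s else 0)"
proof (cases "x = y")
  case False
  then show ?thesis by (auto simp: R_def intro!: sum.neutral)
next
  case True
  have "(\<Sum>k<N. mu k * R s k x k y) = (\<Sum>k<N. if x = k then mu k * al s k x else 0) + (\<Sum>k<N. mu k * be s k x)"
    unfolding sum.distrib[symmetric] by (rule sum.cong) (auto simp: R_def True algebra_simps)
  also have "(\<Sum>k<N. if x = k then mu k * al s k x else 0) = mu x * al s x x" using assms by simp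
  also have "(\<Sum>k<N. mu k * be s k x) = (if s then \<Sum>k<N. if x < k then zz * mu k else 0
      else - (\<Sum>k<N. if k < x then zz * mu k else 0))"
    unfolding sum_negf[symmetric] by (cases s) (auto simp: be_def intro!: sum.cong)
  also have "\<dots> = (if s then q ^ (2 * N) / q ^ N - q ^ (2 * Suc x) / q ^ N else 1 / q ^ N - q ^ (2 * x) / q ^ N)"
    unfolding sum_above[OF assms(1)] sum_below[OF less_imp_le[OF assms(1)]] sum_mu by simp
  also have "mu x * al s x x + \<dots> = 1 / framing s"
    by (cases s) (simp_all add: al_def mu_def framing_def field_simps mult_2 mult_2_right power_add)
  finally show ?thesis using True by simp
qed

section \<open>Inverses of the R-matrix for all directions\<close>

lemma sum_R_out1:
  assumes "x < N" "y < N"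
  shows "(\<Sum>z<N. R s x y z w * g z) = (if w = x then al s x y * g y else 0) + (if w = y then be s x y * g x else 0)"
proof -
  have "(\<Sum>z<N. R s x y z w * g z) = (\<Sum>z<N. if z = y then if w = x then al s x y * g z else 0 else 0)
      + (\<Sum>z<N. if z = x then if w = y then be s x y * g z else 0 else 0)"
    unfolding sum.distrib[symmetric] by (rule sum.cong) (auto simp: R_def algebra_simps)
  then show ?thesis using assms by simp
qed

lemma sum_R_out2:
  assumes "x < N" "y < N"
  shows "(\<Sum>w<N. R s x y z w * g w) = (if z = y then al s x y * g x else 0) + (if z = x then be s x y * g y else 0)"
proof -
  have "(\<Sum>w<N. R s x y z w * g w) = (\<Sum>w<N. if w = x then if z = y then al s x y * g w else 0 else 0)
      + (\<Sum>w<N. if w = y then if z = x then be s x y * g w else 0 else 0)"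
    unfolding sum.distrib[symmetric] by (rule sum.cong) (auto simp: R_def algebra_simps)
  then show ?thesis using assms by simp
qed

lemma R_inverse:
  assumes "x < N" "y < N"
  shows "(\<Sum>z<N. \<Sum>w<N. R s x y z w * R (\<not> s) z w x' y') = (if x = x' \<and> y = y' then 1 else 0)"
proof -
  have "(\<Sum>z<N. \<Sum>w<N. R s x y z w * R (\<not> s) z w x' y')
     = (\<Sum>z<N. (if z = y then al s x y * R (\<not> s) z x x' y' else 0) + (if z = x then be s x y * R (\<not> s) z y x' y' else 0))"
    using assms by (intro sum.cong refl sum_R_out2)
  also have "\<dots> = al s x y * R (\<not> s) y x x' y' + be s x y * R (\<not> s) x y x' y'"
    using assms by (simp add: sum.distrib)
  also have "\<dots> = (if x = x' \<and> y = y' then 1 else 0)"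
    by (cases s; cases x y rule: linorder_cases) (auto simp: R_def al_def be_def)
  finally show ?thesis .
qed

text \<open>Reidemeister II for antiparallel strands. It concerns the inverse of a partial
  transpose, so it does not follow from \<open>R_inverse\<close>; the weights \<open>mu\<close> let
  the sum over the labels strictly between two given ones telescope and cancel the remaining
  terms.\<close>

lemma R_inverse_up_down:
  assumes "x < N" "y < N" "x' < N" "y' < N"
  shows "(\<Sum>z<N. \<Sum>w<N. mu z * R s z x w y * R (\<not> s) w y' z x') = (if x = x' \<and> y = y' then mu y else 0)"
proof -
  have "(\<Sum>z<N. \<Sum>w<N. mu z * R s z x w y * R (\<not> s) w y' z x')
     = (\<Sum>z<N. mu z * (\<Sum>w<N. R s z x w y * R (\<not> s) w y' z x'))"
    by (simp add: sum_distrib_left mult.assoc)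
  also have "\<dots> = (\<Sum>z<N. mu z * ((if y = z then al s z x * R (\<not> s) x y' z x' else 0)
       + (if y = x then be s z x * R (\<not> s) z y' z x' else 0)))"
    using assms by (intro sum.cong refl arg_cong2[where f = "(*)"] sum_R_out1) auto
  also have "\<dots> = (\<Sum>z<N. if y = z then mu z * (al s z x * R (\<not> s) x y' z x') else 0)
      + (\<Sum>z<N. if y = x then mu z * (be s z x * R (\<not> s) z y' z x') else 0)"
    unfolding sum.distrib[symmetric] by (rule sum.cong) (auto simp: algebra_simps)
  also have "(\<Sum>z<N. if y = x then mu z * (be s z x * R (\<not> s) z y' z x') else 0)
      = (if y = x then \<Sum>z<N. mu z * (be s z x * R (\<not> s) z y' z x') else 0)" by simp
  also have "(\<Sum>z<N. if y = z then mu z * (al s z x * R (\<not> s) x y' z x') else 0) = mu y * (al s y x * R (\<not> s) x y' y x')"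
    using assms by simp
  also have "(\<Sum>z<N. mu z * (be s z x * R (\<not> s) z y' z x'))
      = (if x' = y' then mu x' * be s x' x * al (\<not> s) x' x' + (\<Sum>z<N. mu z * be s z x * be (\<not> s) z x') else 0)"
  proof (cases "x' = y'")
    case True
    have "(\<Sum>z<N. mu z * (be s z x * R (\<not> s) z y' z x'))
        = (\<Sum>z<N. if z = x' then mu z * be s z x * al (\<not> s) z x' else 0) + (\<Sum>z<N. mu z * be s z x * be (\<not> s) z x')"
      unfolding sum.distrib[symmetric] by (rule sum.cong) (auto simp: R_def True algebra_simps)
    then show ?thesis using True assms by simp
  next
    case False
    then show ?thesis by (auto simp: R_def intro!: sum.neutral)
  qed
  also have "(\<Sum>z<N. mu z * be s z x * be (\<not> s) z x') =
     - zz * (if s then \<Sum>z<N. if x < z \<and> z < x' then zz * mu z else 0 else \<Sum>z<N. if x' < z \<and> z < x then zz * mu z else 0)"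
    by (cases s) (auto simp: be_def sum_distrib_left intro!: sum.cong)
  also have "mu y * (al s y x * R (\<not> s) x y' y x') + (if y = x then if x' = y' then mu x' * be s x' x * al (\<not> s) x' x'
      + - zz * (if s then \<Sum>z<N. if x < z \<and> z < x' then zz * mu z else 0 else \<Sum>z<N. if x' < z \<and> z < x then zz * mu z else 0)
      else 0 else 0) = (if x = x' \<and> y = y' then mu y else 0)"
  proof -
    have 1: "(\<Sum>z<N. if x < z \<and> z < x' then zz * mu z else 0) = (if x < x' then mu x' / q - q * mu x else 0)"
      if "x < N" "x' < N" for x x'
    proof (cases "x < x'")
      case True
      then show ?thesis using sum_between[OF True, of "\<lambda>k. zz * mu k"] that
        by (simp only: sum_mu) (simp add: mu_def field_simps power2_eq_square)
    qed (auto intro!: sum.neutral)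
    show ?thesis unfolding 1[OF assms(1,3)] 1[OF assms(3,1)]
      by (cases s; cases x x' rule: linorder_cases) (auto simp: R_def al_def be_def right_diff_distrib)
  qed
  finally show ?thesis .
qed

lemma R_inverse_down_up:
  assumes "x < N" "y < N" "x' < N" "y' < N"
  shows "(\<Sum>z<N. \<Sum>w<N. R s y w x z * R (\<not> s) x' z y' w / mu w) = (if x = x' \<and> y = y' then 1 / mu x else 0)"
proof -
  have "(\<Sum>z<N. \<Sum>w<N. R s y w x z * R (\<not> s) x' z y' w / mu w)
     = (\<Sum>w<N. (\<Sum>z<N. R s y w x z * R (\<not> s) x' z y' w) / mu w)"
    by (subst sum.swap) (simp add: sum_divide_distrib)
  also have "\<dots> = (\<Sum>w<N. ((if x = w then al s y w * R (\<not> s) x' y y' w else 0)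
       + (if x = y then be s y w * R (\<not> s) x' w y' w else 0)) / mu w)"
    using assms by (intro sum.cong refl arg_cong2[where f = "(/)"] sum_R_out2) auto
  also have "\<dots> = (\<Sum>w<N. if x = w then al s y w * R (\<not> s) x' y y' w / mu w else 0)
      + (\<Sum>w<N. if x = y then be s y w * R (\<not> s) x' w y' w / mu w else 0)"
    unfolding sum.distrib[symmetric] by (rule sum.cong) (auto simp: add_divide_distrib)
  also have "(\<Sum>w<N. if x = y then be s y w * R (\<not> s) x' w y' w / mu w else 0)
      = (if x = y then \<Sum>w<N. be s y w * R (\<not> s) x' w y' w / mu w else 0)" by simp
  also have "(\<Sum>w<N. if x = w then al s y w * R (\<not> s) x' y y' w / mu w else 0) = al s y x * R (\<not> s) x' y y' x / mu x"
    using assms by simp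
  also have "(\<Sum>w<N. be s y w * R (\<not> s) x' w y' w / mu w)
      = (if x' = y' then be s y x' * al (\<not> s) x' x' / mu x' + (\<Sum>w<N. be s y w * be (\<not> s) x' w / mu w) else 0)"
  proof (cases "x' = y'")
    case True
    have "(\<Sum>w<N. be s y w * R (\<not> s) x' w y' w / mu w)
        = (\<Sum>w<N. if w = x' then be s y w * al (\<not> s) x' w / mu w else 0) + (\<Sum>w<N. be s y w * be (\<not> s) x' w / mu w)"
      unfolding sum.distrib[symmetric] by (rule sum.cong) (auto simp: R_def True add_divide_distrib distrib_left)
    then show ?thesis using True assms by simp
  next
    case False
    then show ?thesis by (auto simp: R_def intro!: sum.neutral)
  qed
  also have "(\<Sum>w<N. be s y w * be (\<not> s) x' w / mu w) =
     - zz * (if s then \<Sum>w<N. if x' < w \<and> w < y then zz / mu w else 0 else \<Sum>w<N. if y < w \<and> w < x' then zz / mu w else 0)"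
    by (cases s) (auto simp: be_def sum_distrib_left intro!: sum.cong)
  also have "al s y x * R (\<not> s) x' y y' x / mu x + (if x = y then if x' = y' then be s y x' * al (\<not> s) x' x' / mu x'
      + - zz * (if s then \<Sum>w<N. if x' < w \<and> w < y then zz / mu w else 0 else \<Sum>w<N. if y < w \<and> w < x' then zz / mu w else 0)
      else 0 else 0) = (if x = x' \<and> y = y' then 1 / mu x else 0)"
  proof -
    have 1: "(\<Sum>z<N. if x < z \<and> z < x' then zz / mu z else 0) = (if x < x' then 1 / (q * mu x) - q / mu x' else 0)"
      if "x < N" "x' < N" for x x'
    proof (cases "x < x'")
      case True
      then show ?thesis using sum_between[OF True, of "\<lambda>k. zz / mu k"] that
        by (simp only: sum_inv_mu) (simp add: mu_def field_simps power2_eq_square)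
    qed (auto intro!: sum.neutral)
    show ?thesis unfolding 1[OF assms(2,3)] 1[OF assms(3,2)]
      by (cases s; cases y x' rule: linorder_cases) (auto simp: R_def al_def be_def right_diff_distrib)
  qed
  finally show ?thesis .
qed

text \<open>A crossing keeps or exchanges its labels, so products of weights \<open>mu\<close> can
  be moved through it.\<close>

lemma R_conserve: "R s x y z w \<noteq> 0 \<Longrightarrow> mu x * mu y = mu z * mu w"
  by (auto simp: R_def split: if_splits)

section \<open>The Yang-Baxter equation\<close>

definition RL :: "bool \<Rightarrow> bool \<Rightarrow> bool \<Rightarrow> nat \<Rightarrow> nat \<Rightarrow> nat \<Rightarrow> nat \<Rightarrow> nat \<Rightarrow> nat \<Rightarrow> real" where
  "RL a b c x y w d e f = (\<Sum>i<N. \<Sum>j<N. \<Sum>k<N. R a x y i j * R b j w k f * R c i k d e)"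
definition RR :: "bool \<Rightarrow> bool \<Rightarrow> bool \<Rightarrow> nat \<Rightarrow> nat \<Rightarrow> nat \<Rightarrow> nat \<Rightarrow> nat \<Rightarrow> nat \<Rightarrow> real" where
  "RR a b c x y w d e f = (\<Sum>i<N. \<Sum>j<N. \<Sum>k<N. R c y w i j * R b x i d k * R a k j e f)"

text \<open>The action of a crossing on functions of three labels has only two terms. In this form
  the Yang-Baxter equation contains no sums and is checked over the possible orders of three
  labels.\<close>

definition op1 :: "bool \<Rightarrow> (nat \<Rightarrow> nat \<Rightarrow> nat \<Rightarrow> real) \<Rightarrow> nat \<Rightarrow> nat \<Rightarrow> nat \<Rightarrow> real" where
  "op1 s F x y z = al s y x * F y x z + be s x y * F x y z"
definition op2 :: "bool \<Rightarrow> (nat \<Rightarrow> nat \<Rightarrow> nat \<Rightarrow> real) \<Rightarrow> nat \<Rightarrow> nat \<Rightarrow> nat \<Rightarrow> real" where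
  "op2 s F x y z = al s z y * F x z y + be s y z * F x y z"

lemma sum_R_in1:
  assumes "w < N" "z < N" "y < N"
  shows "(\<Sum>x<N. R s x y z w * g x) = (if z = y then al s w z * g w else 0) + (if w = y then be s z w * g z else 0)"
proof -
  have "(\<Sum>x<N. R s x y z w * g x) = (\<Sum>x<N. if x = w then if z = y then al s w z * g x else 0 else 0)
      + (\<Sum>x<N. if x = z then if w = y then be s z w * g x else 0 else 0)"
    unfolding sum.distrib[symmetric] by (rule sum.cong) (auto simp: R_def algebra_simps)
  then show ?thesis using assms by simp
qed

lemma sum_R_in2:
  assumes "w < N" "z < N" "x < N"
  shows "(\<Sum>y<N. R s x y z w * g y) = (if w = x then al s w z * g z else 0) + (if z = x then be s z w * g w else 0)"
proof -
  have "(\<Sum>y<N. R s x y z w * g y) = (\<Sum>y<N. if y = z then if w = x then al s w z * g y else 0 else 0)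
      + (\<Sum>y<N. if y = w then if z = x then be s z w * g y else 0 else 0)"
    unfolding sum.distrib[symmetric] by (rule sum.cong) (auto simp: R_def algebra_simps)
  then show ?thesis using assms by simp
qed

lemma op_yang_baxter:
  assumes "\<not> (a = c \<and> b \<noteq> a)"
  shows "op1 c (op2 b (op1 a F)) x y z = op2 a (op1 b (op2 c F)) x y z"
  using assms
  by (cases a; cases b; cases c; cases x y rule: linorder_cases; cases x z rule: linorder_cases;
      cases y z rule: linorder_cases; (simp; fail)?;
      simp add: op1_def op2_def al_def be_def algebra_simps; (simp add: zz_def field_simps; fail)?)

lemma sum_R_in:
  assumes "z < N" "w < N"
  shows "(\<Sum>x<N. \<Sum>y<N. R s x y z w * g x y) = al s w z * g w z + be s z w * g z w"
proof -
  have "(\<Sum>x<N. \<Sum>y<N. R s x y z w * g x y)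
      = (\<Sum>x<N. (if w = x then al s w z * g x z else 0) + (if z = x then be s z w * g x w else 0))"
    using assms by (intro sum.cong refl sum_R_in2) auto
  then show ?thesis using assms by (simp add: sum.distrib)
qed

lemma sum3_swap12: "(\<Sum>i<N. \<Sum>j<N. \<Sum>k<N. g i j k) = (\<Sum>j<N. \<Sum>i<N. \<Sum>k<N. (g i j k :: real))"
  by (rule sum.swap)

lemma sum3_swap23: "(\<Sum>i<N. \<Sum>j<N. \<Sum>k<N. g i j k) = (\<Sum>i<N. \<Sum>k<N. \<Sum>j<N. (g i j k :: real))"
  by (intro sum.cong refl sum.swap)

text \<open>Applied to the indicator of \<open>(x, y, w)\<close> the operators produce the entries
  of \<open>R\<close>, so the triple sums over inner labels reduce to
  \<open>op_yang_baxter\<close>.\<close>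

lemma R_yang_baxter:
  assumes "\<not> (a = c \<and> b \<noteq> a)" "x < N" "y < N" "w < N" "d < N" "e < N" "f < N"
  shows "RL a b c x y w d e f = RR a b c x y w d e f"
proof -
  define \<delta> :: "nat \<Rightarrow> nat \<Rightarrow> nat \<Rightarrow> real" where "\<delta> i j k = (if i = x \<and> j = y \<and> k = w then 1 else 0)" for i j k
  have d1: "op1 s \<delta> i j v = (if v = w then R s x y i j else 0)" for s i j v
    by (cases "i = x"; cases "j = x"; cases "i = y"; cases "j = y"; cases "v = w")
      (simp_all add: op1_def \<delta>_def R_def)
  have d2: "op2 s \<delta> u i j = (if u = x then R s y w i j else 0)" for s i j u
    by (cases "i = y"; cases "j = y"; cases "i = w"; cases "j = w"; cases "u = x")
      (simp_all add: op2_def \<delta>_def R_def)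
  have "RL a b c x y w d e f = (\<Sum>i<N. \<Sum>k<N. R c i k d e * (\<Sum>j<N. R b j w k f * R a x y i j))"
    unfolding RL_def sum_distrib_left by (subst sum3_swap23) (simp add: ac_simps)
  also have "\<dots> = (\<Sum>i<N. \<Sum>k<N. R c i k d e * op2 b (op1 a \<delta>) i k f)"
    by (intro sum.cong refl, subst sum_R_in1) (use assms in \<open>auto simp: op2_def d1\<close>)
  also have "\<dots> = op1 c (op2 b (op1 a \<delta>)) d e f"
    by (subst sum_R_in) (use assms in \<open>auto simp: op1_def\<close>)
  finally have L: "RL a b c x y w d e f = op1 c (op2 b (op1 a \<delta>)) d e f" .
  have "RR a b c x y w d e f = (\<Sum>i<N. \<Sum>k<N. \<Sum>j<N. R c y w i j * R b x i d k * R a k j e f)"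
    unfolding RR_def by (rule sum3_swap23)
  also have "\<dots> = (\<Sum>k<N. \<Sum>i<N. \<Sum>j<N. R c y w i j * R b x i d k * R a k j e f)"
    by (rule sum.swap)
  also have "\<dots> = (\<Sum>k<N. \<Sum>j<N. R a k j e f * (\<Sum>i<N. R b x i d k * R c y w i j))"
    unfolding sum_distrib_left by (subst sum3_swap23) (simp add: ac_simps)
  also have "\<dots> = (\<Sum>k<N. \<Sum>j<N. R a k j e f * op1 b (op2 c \<delta>) d k j)"
    by (intro sum.cong refl, subst sum_R_in2) (use assms in \<open>auto simp: op1_def d2\<close>)
  also have "\<dots> = op2 a (op1 b (op2 c \<delta>)) d e f"
    by (subst sum_R_in) (use assms in \<open>auto simp: op2_def\<close>)
  finally have "RR a b c x y w d e f = op2 a (op1 b (op2 c \<delta>)) d e f" .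
  with L op_yang_baxter[OF assms(1)] show ?thesis by simp
qed

text \<open>The weight of a crossing with directions \<open>d1, d2\<close> below, obtained from the crossing of two
  upward strands by rotation.\<close>

definition wt :: "bool \<Rightarrow> bool \<Rightarrow> bool \<Rightarrow> nat \<Rightarrow> nat \<Rightarrow> nat \<Rightarrow> nat \<Rightarrow> real" where
  "wt b d1 d2 x y z w = (if d1 then if d2 then X b x y z w else X (\<not> b) z x w y * mu z / mu y
     else if d2 then X (\<not> b) y w x z else X b w z y x)"

text \<open>With \<open>WR\<close> the two sides of Reidemeister III for strands directed
  \<open>d1\<close>, \<open>d2\<close>, \<open>d3\<close> at the bottom; \<open>x\<close>,
  \<open>y\<close>, \<open>w\<close> are the labels below, \<open>d\<close>, \<open>e\<close>,
  \<open>f\<close> those above.\<close>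

definition WL where
  "WL a b c d1 d2 d3 x y w d e f =
    (\<Sum>i<N. \<Sum>j<N. \<Sum>k<N. wt a d1 d2 x y i j * wt b d1 d3 j w k f * wt c d2 d3 i k d e)"
definition WR where
  "WR a b c d1 d2 d3 x y w d e f =
    (\<Sum>i<N. \<Sum>j<N. \<Sum>k<N. wt c d2 d3 y w i j * wt b d1 d3 x i d k * wt a d1 d2 k j e f)"

definition XL :: "bool \<Rightarrow> bool \<Rightarrow> bool \<Rightarrow> nat \<Rightarrow> nat \<Rightarrow> nat \<Rightarrow> nat \<Rightarrow> nat \<Rightarrow> nat \<Rightarrow> real" where
  "XL a b c x y w d e f = (\<Sum>i<N. \<Sum>j<N. \<Sum>k<N. X a x y i j * X b j w k f * X c i k d e)"
definition XR :: "bool \<Rightarrow> bool \<Rightarrow> bool \<Rightarrow> nat \<Rightarrow> nat \<Rightarrow> nat \<Rightarrow> nat \<Rightarrow> nat \<Rightarrow> nat \<Rightarrow> real" where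
  "XR a b c x y w d e f = (\<Sum>i<N. \<Sum>j<N. \<Sum>k<N. X c y w i j * X b x i d k * X a k j e f)"

lemma X_yang_baxter:
  assumes "\<not> (a = c \<and> b \<noteq> a)" "x < N" "y < N" "w < N" "d < N" "e < N" "f < N"
  shows "XL a b c x y w d e f = XR a b c x y w d e f"
proof -
  have "XL a b c x y w d e f = framing a * framing b * framing c * RL a b c x y w d e f"
    by (simp add: XL_def RL_def X_def sum_distrib_left ac_simps)
  moreover have "XR a b c x y w d e f = framing a * framing b * framing c * RR a b c x y w d e f"
    by (simp add: XR_def RR_def X_def sum_distrib_left ac_simps)
  ultimately show ?thesis using R_yang_baxter[OF assms] by simp
qed

lemma sum3_rotA: "(\<Sum>i<N. \<Sum>j<N. \<Sum>k<N. g i j k) = (\<Sum>k<N. \<Sum>i<N. \<Sum>j<N. (g i j k :: real))"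
  using sum3_swap23[of g] sum3_swap12[of "\<lambda>i k j. g i j k"] by simp

lemma sum3_rotB: "(\<Sum>i<N. \<Sum>j<N. \<Sum>k<N. g i j k) = (\<Sum>j<N. \<Sum>k<N. \<Sum>i<N. (g i j k :: real))"
  using sum3_swap12[of g] sum3_swap23[of "\<lambda>j i k. g i j k"] by simp

lemma X_conserve: "X s x y z w \<noteq> 0 \<Longrightarrow> mu x * mu y = mu z * mu w"
  using R_conserve by (auto simp: X_def)

lemma X_conserve': "X s x y z w * (mu x * mu y) = X s x y z w * (mu z * mu w)"
  using X_conserve by (cases "X s x y z w = 0") auto

text \<open>A rotation of the triangle makes all strands run upwards; it permutes the strands, may
  exchange the two sides of the move and collects the weights at outer labels. The patterns with the
  middle strand against both others are absent: there inward and outward ends alternate round the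
  triangle, and no rotation helps.\<close>

lemma WL_eq:
  "WL a b c True True True x y w d e f = XL a b c x y w d e f"
  "WL a b c True True False x y w d e f = (mu d / mu w) * XR (\<not> b) (\<not> c) a d x y e f w"
  "WL a b c False True True x y w d e f = XR c (\<not> a) (\<not> b) y w f x d e"
  "WL a b c True False False x y w d e f = (mu e * mu d / (mu y * mu w)) * XL c (\<not> a) (\<not> b) e d x f w y"
  "WL a b c False False True x y w d e f = XL (\<not> b) (\<not> c) a w f e y x d"
  "WL a b c False False False x y w d e f = XR a b c f e d w y x"
proof -
  show "WL a b c True True True x y w d e f = XL a b c x y w d e f"
    by (simp add: WL_def XL_def wt_def)
  show "WL a b c True True False x y w d e f = (mu d / mu w) * XR (\<not> b) (\<not> c) a d x y e f w"
    by (simp add: WL_def XR_def wt_def sum_distrib_left ac_simps)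
  show "WL a b c False True True x y w d e f = XR c (\<not> a) (\<not> b) y w f x d e"
    unfolding WL_def XR_def by (subst sum3_rotB) (simp add: wt_def ac_simps)
  show "WL a b c True False False x y w d e f = (mu e * mu d / (mu y * mu w)) * XL c (\<not> a) (\<not> b) e d x f w y"
  proof -
    \<comment> \<open>Conservation of labels at one crossing trades the weights of inner labels for
      those of outer ones.\<close>
    have "wt a True False x y i j * wt b True False j w k f * wt c False False i k d e
        = mu e * mu d / (mu y * mu w) * (X c e d k i * X (\<not> a) i x j y * X (\<not> b) k j f w)" for i j k
      using X_conserve'[of c e d k i] by (auto simp: wt_def field_simps)
    then show ?thesis unfolding WL_def XL_def by (subst sum3_rotA) (simp add: sum_distrib_left)
  qed
  show "WL a b c False False True x y w d e f = XL (\<not> b) (\<not> c) a w f e y x d"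
    unfolding WL_def XL_def by (subst sum3_rotB) (simp add: wt_def ac_simps)
  show "WL a b c False False False x y w d e f = XR a b c f e d w y x"
    unfolding WL_def XR_def by (subst sum3_rotA) (simp add: wt_def ac_simps)
qed

lemma WR_eq:
  "WR a b c True True True x y w d e f = XR a b c x y w d e f"
  "WR a b c True True False x y w d e f = (mu d / mu w) * XL (\<not> b) (\<not> c) a d x y e f w"
  "WR a b c False True True x y w d e f = XL c (\<not> a) (\<not> b) y w f x d e"
  "WR a b c True False False x y w d e f = (mu e * mu d / (mu y * mu w)) * XR c (\<not> a) (\<not> b) e d x f w y"
  "WR a b c False False True x y w d e f = XR (\<not> b) (\<not> c) a w f e y x d"
  "WR a b c False False False x y w d e f = XL a b c f e d w y x"
proof -
  show "WR a b c True True True x y w d e f = XR a b c x y w d e f"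
    by (simp add: WR_def XR_def wt_def)
  show "WR a b c True True False x y w d e f = (mu d / mu w) * XL (\<not> b) (\<not> c) a d x y e f w"
    unfolding WR_def XL_def by (subst sum3_rotA) (simp add: wt_def sum_distrib_left ac_simps)
  show "WR a b c False True True x y w d e f = XL c (\<not> a) (\<not> b) y w f x d e"
    by (simp add: WR_def XL_def wt_def ac_simps)
  show "WR a b c True False False x y w d e f = (mu e * mu d / (mu y * mu w)) * XR c (\<not> a) (\<not> b) e d x f w y"
  proof -
    have "wt c False False y w i j * wt b True False x i d k * wt a True False k j e f
        = mu e * mu d / (mu y * mu w) * (X (\<not> b) d x k i * X (\<not> a) e k f j * X c j i w y)" for i j k
      using X_conserve'[of c j i w y] by (auto simp: wt_def field_simps)
    then show ?thesis unfolding WR_def XR_def by (subst sum3_rotA) (simp add: sum_distrib_left)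
  qed
  show "WR a b c False False True x y w d e f = XR (\<not> b) (\<not> c) a w f e y x d"
    unfolding WR_def XR_def by (subst sum3_rotB) (simp add: wt_def ac_simps)
  show "WR a b c False False False x y w d e f = XL a b c f e d w y x"
    unfolding WR_def XL_def by (subst sum3_rotB) (simp add: wt_def ac_simps)
qed

lemma wt_yang_baxter0:
  assumes "\<not> (a = c \<and> b \<noteq> a)" "x < N" "y < N" "w < N" "d < N" "e < N" "f < N" "d1 = d2 \<or> d2 = d3"
  shows "WL a b c d1 d2 d3 x y w d e f = WR a b c d1 d2 d3 x y w d e f"
  using assms(8,1) X_yang_baxter assms(2-7)
  by (cases d1; cases d2; cases d3) (simp_all add: WL_eq WR_eq, auto)

lemma X_partial_right: "x < N \<Longrightarrow> y < N \<Longrightarrow> (\<Sum>k<N. X s x k y k / mu k) = (if x = y then 1 else 0)"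
proof -
  assume *: "x < N" "y < N"
  have "(\<Sum>k<N. X s x k y k / mu k) = framing s * (\<Sum>k<N. R s x k y k / mu k)"
    by (simp add: X_def sum_distrib_left)
  then show ?thesis using R_partial_right[OF *, of s] by (simp add: framing_def)
qed

lemma X_partial_left: "x < N \<Longrightarrow> y < N \<Longrightarrow> (\<Sum>k<N. mu k * X s k x k y) = (if x = y then 1 else 0)"
proof -
  assume *: "x < N" "y < N"
  have "(\<Sum>k<N. mu k * X s k x k y) = framing s * (\<Sum>k<N. mu k * R s k x k y)"
    by (simp add: X_def sum_distrib_left ac_simps)
  then show ?thesis using R_partial_left[OF *, of s] by (simp add: framing_def)
qed

lemma wt_inverse:
  assumes "x < N" "y < N" "x' < N" "y' < N"
  shows "(\<Sum>z<N. \<Sum>w<N. wt b d1 d2 x y z w * wt (\<not> b) d2 d1 z w x' y') = (if x = x' \<and> y = y' then 1 else 0)"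
proof -
  have XX: "X s a b c d * X (\<not> s) e f g h = R s a b c d * R (\<not> s) e f g h" for s a b c d e f g h
  proof -
    have "X s a b c d * X (\<not> s) e f g h = (framing s * framing (\<not> s)) * (R s a b c d * R (\<not> s) e f g h)"
      by (simp only: X_def ac_simps)
    then show ?thesis by (simp only: framing_inv mult_1)
  qed
  consider "d1" "d2" | "d1" "\<not> d2" | "\<not> d1" "d2" | "\<not> d1" "\<not> d2" by blast
  then show ?thesis
  proof cases
    case 1
    then show ?thesis using R_inverse[OF assms(1,2), of b x' y'] by (simp add: wt_def XX)
  next
    case 2
    have "(\<Sum>z<N. \<Sum>w<N. wt b d1 d2 x y z w * wt (\<not> b) d2 d1 z w x' y')
        = (\<Sum>z<N. \<Sum>w<N. mu z * R (\<not> b) z x w y * R b w y' z x') / mu y"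
      using 2 XX[of "\<not> b"] by (simp add: wt_def sum_divide_distrib ac_simps)
    then show ?thesis using R_inverse_up_down[OF assms, of "\<not> b"] by simp
  next
    case 3
    have "(\<Sum>z<N. \<Sum>w<N. wt b d1 d2 x y z w * wt (\<not> b) d2 d1 z w x' y')
        = mu x' * (\<Sum>z<N. \<Sum>w<N. R (\<not> b) y w x z * R b x' z y' w / mu w)"
      using 3 XX[of "\<not> b"] by (simp add: wt_def sum_distrib_left ac_simps)
    then show ?thesis using R_inverse_down_up[OF assms, of "\<not> b"] by simp
  next
    case 4
    have "(\<Sum>z<N. \<Sum>w<N. wt b d1 d2 x y z w * wt (\<not> b) d2 d1 z w x' y')
        = (\<Sum>w<N. \<Sum>z<N. R (\<not> b) y' x' w z * R b w z y x)"
      using 4 XX[of "\<not> b"] by (subst sum.swap) (simp add: wt_def ac_simps XX)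
    then show ?thesis using R_inverse[of y' x' "\<not> b" y x] assms by auto
  qed
qed

end

section \<open>Oriented state sums\<close>

text \<open>The directions above a layer are recorded in the following layer, or are the final ones
  if there is none. The weight of a minimum depends on them.\<close>

definition nxt :: "oriented_diagram \<Rightarrow> bool list \<Rightarrow> bool list" where
  "nxt E t = (case E of [] \<Rightarrow> t | l # _ \<Rightarrow> fst l)"

lemma nxt_eq: "oriented_tangle s E t \<Longrightarrow> nxt E t = s"
  by (cases E) (auto simp: nxt_def oriented_tangle_Cons)

lemma nxt_append: "oriented_tangle r F t \<Longrightarrow> nxt (E @ F) t = nxt E r"
  using nxt_eq[of r F t] by (cases E) (auto simp: nxt_def)

definition pieces_equiv :: "'l set \<Rightarrow> nat \<Rightarrow> nat \<Rightarrow> ('l, 'r::comm_ring_1) piece list \<Rightarrow> ('l, 'r) piece list \<Rightarrow> bool" where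
  "pieces_equiv L n m D E \<longleftrightarrow> pieces_ok n D \<and> pieces_ok n E \<and> pieces_out n D = m \<and> pieces_out n E = m \<and>
     (\<forall>f. \<forall>w\<in>words L m. state_sum L D f w = state_sum L E f w)"

lemma pieces_equiv_refl: "pieces_ok n D \<Longrightarrow> pieces_out n D = m \<Longrightarrow> pieces_equiv L n m D D"
  by (simp add: pieces_equiv_def)

lemma pieces_equiv_sym: "pieces_equiv L n m D E \<Longrightarrow> pieces_equiv L n m E D"
  by (simp add: pieces_equiv_def)

lemma pieces_equiv_trans: "pieces_equiv L n m D E \<Longrightarrow> pieces_equiv L n m E F \<Longrightarrow> pieces_equiv L n m D F"
  by (simp add: pieces_equiv_def)

lemma pieces_equiv_append:
  assumes "pieces_equiv L n m D D'" "pieces_equiv L m k E E'"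
  shows "pieces_equiv L n k (D @ E) (D' @ E')"
proof -
  have "state_sum L (D @ E) f w = state_sum L (D' @ E') f w" if "w \<in> words L k" for f w
  proof -
    have "state_sum L E (state_sum L D f) w = state_sum L E (state_sum L D' f) w"
      by (rule state_sum_cong[where k = m]) (use assms that in \<open>auto simp: pieces_equiv_def\<close>)
    then show ?thesis using assms that by (simp add: state_sum_append pieces_equiv_def)
  qed
  then show ?thesis using assms by (simp add: pieces_equiv_def pieces_ok_append pieces_out_append)
qed

lemma words_appendE:
  assumes "w \<in> words L (i + m + j)"
  obtains x v y where "w = x @ v @ y" "x \<in> words L i" "v \<in> words L m" "y \<in> words L j"
proof -
  from assms have "i + m \<le> length w" by (simp add: words_def)
  then obtain x v y where "w = x @ v @ y" "length x = i" "length v = m" by (rule split_list3)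
  with assms show ?thesis by (intro that[of x v y]) (auto simp: words_def)
qed

lemma pieces_shift:
  "pieces_ok n D \<Longrightarrow> pieces_ok (i + n + j) (map (shift_piece i) D) \<and>
    pieces_out (i + n + j) (map (shift_piece i) D) = i + pieces_out n D + j"
proof (induction n D rule: pieces_ok.induct)
  case (2 k w i' m n D)
  have ok: "i' + m \<le> k" "pieces_ok (k - m + n) D" using 2(2) by (simp_all only: pieces_ok.simps)
  have e: "i + k + j - m + n = i + (k - m + n) + j" using ok(1) by simp
  show ?case using 2(1)[OF ok(2)] ok(1) unfolding list.map shift_piece_def prod.case pieces_ok.simps pieces_out.simps e
    by auto
qed simp

lemma pieces_equiv_shift:
  assumes "pieces_equiv L n m D E"
  shows "pieces_equiv L (i + n + j) (i + m + j) (map (shift_piece i) D) (map (shift_piece i) E)"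
proof -
  have "state_sum L (map (shift_piece i) D) f w = state_sum L (map (shift_piece i) E) f w"
    if w: "w \<in> words L (i + m + j)" for f w
  proof -
    obtain x v y where v: "w = x @ v @ y" "x \<in> words L i" "v \<in> words L m" "y \<in> words L j"
      using words_appendE[OF w] .
    have "length x = i" using v(2) by (simp add: words_def)
    then have "state_sum L (map (shift_piece i) D) f w = state_sum L D (\<lambda>t. f (x @ t @ y)) v"
      "state_sum L (map (shift_piece i) E) f w = state_sum L E (\<lambda>t. f (x @ t @ y)) v"
      unfolding v(1) by (intro state_sum_shift[where k = n]; use assms v in \<open>simp add: pieces_equiv_def\<close>)+
    then show ?thesis using assms v(3) by (simp add: pieces_equiv_def)
  qed
  then show ?thesis using assms
    by (simp add: pieces_equiv_def pieces_shift)
qed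

lemma finite_words: "finite L \<Longrightarrow> finite (words L m)"
  unfolding words_def by (rule finite_lists_length_eq)

definition delta :: "'l list \<Rightarrow> 'l list \<Rightarrow> 'r::comm_ring_1" where
  "delta t u = (if u = t then 1 else 0)"

lemma apply_piece_sum:
  assumes "finite U"
  shows "apply_piece L p (\<lambda>u. \<Sum>t\<in>U. g t * h t u) s = (\<Sum>t\<in>U. g t * apply_piece L p (h t) s)"
  using assms
proof (induction U)
  case empty
  show ?case by (cases p) (simp add: apply_piece_def)
next
  case (insert a U)
  then show ?case using apply_piece_lin[of L p "g a" "h a" 1 "\<lambda>u. \<Sum>t\<in>U. g t * h t u" s] by simp
qed

lemma state_sum_sum:
  assumes "finite U"
  shows "state_sum L D (\<lambda>u. \<Sum>t\<in>U. g t * h t u) s = (\<Sum>t\<in>U. g t * state_sum L D (h t) s)"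
proof (induction D arbitrary: h)
  case (Cons p D)
  have "apply_piece L p (\<lambda>u. \<Sum>t\<in>U. g t * h t u) = (\<lambda>s. \<Sum>t\<in>U. g t * apply_piece L p (h t) s)"
    by (rule ext) (rule apply_piece_sum[OF assms])
  then show ?case using Cons by simp
qed simp

text \<open>By linearity the basis vectors \<open>delta t\<close> suffice, so each rule becomes an
  identity between matrix entries.\<close>

lemma pieces_equivI:
  assumes "finite L" "pieces_ok n D" "pieces_ok n E" "pieces_out n D = m" "pieces_out n E = m"
    "\<And>t w. t \<in> words L n \<Longrightarrow> w \<in> words L m \<Longrightarrow> state_sum L D (delta t) w = state_sum L E (delta t) w"
  shows "pieces_equiv L n m D E"
proof -
  have kernel: "state_sum L D f w = (\<Sum>t\<in>words L n. f t * state_sum L D (delta t) w)"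
    if "pieces_ok n D" "pieces_out n D = m" "w \<in> words L m" for D f w
  proof -
    have "state_sum L D f w = state_sum L D (\<lambda>u. \<Sum>t\<in>words L n. f t * delta t u) w"
      by (rule state_sum_cong[where k = n])
        (use that assms(1) in \<open>auto simp: delta_def finite_words if_distrib[of "\<lambda>x. _ * x"] cong: if_cong\<close>)
    then show ?thesis by (simp add: state_sum_sum finite_words assms(1))
  qed
  have "state_sum L D f w = state_sum L E f w" if "w \<in> words L m" for f w
    by (rule trans[OF kernel[OF assms(2,4) that] trans[OF _ kernel[OF assms(3,5) that, symmetric]]], rule sum.cong)
      (simp_all only: assms(6) that)
  then show ?thesis using assms(2-5) by (simp add: pieces_equiv_def)
qed

context rmatrix
begin

section \<open>Weights of oriented diagrams and their invariance\<close>

text \<open>Only turns traversed from left to right carry a weight, \<open>mu\<close> at a minimum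
  and \<open>1 / mu\<close> at a maximum; in a zigzag the two cancel.\<close>

definition hweight :: "gen \<Rightarrow> bool list \<Rightarrow> bool list \<Rightarrow> nat list \<Rightarrow> nat list \<Rightarrow> real" where
  "hweight g p p' t r = (case g of
     Cup \<Rightarrow> if r ! 0 = r ! 1 then if p' ! 0 then 1 else mu (r ! 0) else 0
   | Cap \<Rightarrow> if t ! 0 = t ! 1 then if p ! 0 then 1 / mu (t ! 0) else 1 else 0
   | Cross b \<Rightarrow> wt b (p ! 0) (p ! 1) (t ! 0) (t ! 1) (r ! 0) (r ! 1))"

fun hp :: "oriented_diagram \<Rightarrow> bool list \<Rightarrow> (nat, real) piece list" where
  "hp [] t = []"
| "hp ((s, i, g) # E) t =
    (hweight g (take (ins g) (drop i s)) (take (outs g) (drop i (nxt E t))), i, ins g, outs g) # hp E t"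

lemma hp_append: "oriented_tangle r F t \<Longrightarrow> hp (E @ F) t = hp E r @ hp F t"
  by (induction E r rule: hp.induct) (auto simp: nxt_append)

lemma hp_ok:
  "oriented_tangle s E t \<Longrightarrow> pieces_ok (length s) (hp E t) \<and> pieces_out (length s) (hp E t) = length t"
proof (induction E arbitrary: s)
  case (Cons l E)
  obtain s' i g where l: "l = (s', i, g)" by (metis prod_cases3)
  from Cons.prems obtain q where q: "i + ins g \<le> length s" "flow g (take (ins g) (drop i s)) q"
    "oriented_tangle (take i s @ q @ drop (i + ins g) s) E t"
    by (auto simp: l oriented_tangle_Cons)
  have "length (take i s @ q @ drop (i + ins g) s) = length s - ins g + outs g"
    using q(1) flow_length[OF q(2)] by simp
  with Cons.IH[OF q(3)] q(1) show ?case by (simp add: l)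
qed simp

lemma hp_pad:
  assumes "oriented_tangle s E t"
  shows "hp (pad x y E) (x @ t @ y) = map (shift_piece (length x)) (hp E t)"
  using assms
proof (induction E arbitrary: s)
  case (Cons l E)
  obtain s' i g where l: "l = (s', i, g)" by (metis prod_cases3)
  from Cons.prems obtain q where q: "s' = s" "i + ins g \<le> length s" "flow g (take (ins g) (drop i s)) q"
    "oriented_tangle (take i s @ q @ drop (i + ins g) s) E t"
    by (auto simp: l oriented_tangle_Cons)
  define r where "r = take i s @ q @ drop (i + ins g) s"
  have n: "nxt E t = r" using nxt_eq[OF q(4)] by (simp add: r_def)
  have n': "nxt (pad x y E) (x @ t @ y) = x @ r @ y"
    using nxt_eq[OF oriented_tangle_pad[OF q(4)]] by (simp add: r_def)
  have "i + outs g \<le> length r" using q(2) flow_length[OF q(3)] by (simp add: r_def)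
  then show ?case using q(1,2) Cons.IH[OF q(4)] by (simp add: l n n' shift_piece_def)
qed simp

abbreviation "eqv \<equiv> pieces_equiv {..<N}"

definition sound_rule :: "diagram \<Rightarrow> diagram \<Rightarrow> bool" where
  "sound_rule D D' \<longleftrightarrow> (\<forall>l r s t. oriented_tangle s l t \<longrightarrow> oriented_tangle s r t \<longrightarrow>
     map snd l = D \<longrightarrow> map snd r = D' \<longrightarrow> eqv (length s) (length t) (hp l t) (hp r t))"

text \<open>Unpadding leaves exactly the \<open>k\<close> strands on which the rule acts. The last
  hypothesis guarantees that there are that many to the right of position \<open>i\<close>.\<close>

lemma sound_rule_sh:
  assumes "\<And>l r s t. length s = k \<Longrightarrow> oriented_tangle s l t \<Longrightarrow> oriented_tangle s r t \<Longrightarrow>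
      map snd l = D \<Longrightarrow> map snd r = D' \<Longrightarrow> eqv (length s) (length t) (hp l t) (hp r t)"
    "ok k D" "ok k D'" "\<And>n. ok n (sh i D) \<Longrightarrow> ok n (sh i D') \<Longrightarrow> i + k \<le> n"
  shows "sound_rule (sh i D) (sh i D')"
  unfolding sound_rule_def
proof (intro allI impI)
  fix l r s t
  assume *: "oriented_tangle s l t" "oriented_tangle s r t" "map snd l = sh i D" "map snd r = sh i D'"
  have "i + k \<le> length s"
    using assms(4) oriented_tangle_ok[OF *(1)] oriented_tangle_ok[OF *(2)] *(3,4) by simp
  then obtain x s0 y where s: "s = x @ s0 @ y" "length x = i" "length s0 = k" by (rule split_list3)
  obtain l0 t0 where l: "l = pad x y l0" "t = x @ t0 @ y" "oriented_tangle s0 l0 t0" "map snd l0 = D"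
    using oriented_tangle_unpad[of x s0 y l t D] * s assms(2) by auto
  obtain r0 t0' where r: "r = pad x y r0" "t = x @ t0' @ y" "oriented_tangle s0 r0 t0'" "map snd r0 = D'"
    using oriented_tangle_unpad[of x s0 y r t D'] * s assms(3) by auto
  have t: "t0' = t0" using l(2) r(2) by simp
  have "eqv (length s0) (length t0) (hp l0 t0) (hp r0 t0)"
    using assms(1)[OF s(3) l(3) _ l(4) r(4)] r(3) t by simp
  from pieces_equiv_shift[OF this, of i "length y"]
  show "eqv (length s) (length t) (hp l t) (hp r t)"
    using hp_pad[OF l(3), of x y] hp_pad[of s0 r0 t0 x y] r(3) s t by (simp add: l(1,2) r(1) add.assoc)
qed

end

lemma words_Suc_iff: "t \<in> words L (Suc n) \<longleftrightarrow> (\<exists>x u. t = x # u \<and> x \<in> L \<and> u \<in> words L n)"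
  by (auto simp: words_def length_Suc_conv)

lemma length_2E: "length s = 2 \<Longrightarrow> (\<And>a b. s = [a, b] \<Longrightarrow> thesis) \<Longrightarrow> thesis"
  by (auto simp: numeral_2_eq_2 length_Suc_conv)
lemma length_3E: "length s = 3 \<Longrightarrow> (\<And>a b c. s = [a, b, c] \<Longrightarrow> thesis) \<Longrightarrow> thesis"
  by (auto simp: numeral_3_eq_3 length_Suc_conv)

lemma words_iff:
  "t \<in> words L (Suc 0) \<longleftrightarrow> (\<exists>x\<in>L. t = [x])"
  "t \<in> words L 2 \<longleftrightarrow> (\<exists>x\<in>L. \<exists>y\<in>L. t = [x, y])"
  "t \<in> words L 3 \<longleftrightarrow> (\<exists>x\<in>L. \<exists>y\<in>L. \<exists>z\<in>L. t = [x, y, z])"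
  by (auto simp: eval_nat_numeral words_Suc_iff)

lemmas if_mult = if_distrib[of "\<lambda>x. _ * x"] if_distrib[of "\<lambda>x. x * _"] if_distrib[of "\<lambda>x. x / _"]

context rmatrix
begin

lemma sum_if2:
  assumes "x < N" "y < N"
  shows "(\<Sum>i<N. \<Sum>j<N. if i = x then if j = y then g i j else 0 else 0) = (g x y :: real)"
proof -
  have "(\<Sum>j<N. if i = x then if j = y then g i j else 0 else 0) = (if i = x then g i y else 0)" for i
    using assms by simp
  then show ?thesis using assms by simp
qed

lemma sum_delta:
  assumes "x < N" "y < N"
  shows "(\<Sum>i<N. \<Sum>j<N. g i j * delta [x, y] [i, j]) = (g x y :: real)"
    "(\<Sum>i<N. \<Sum>j<N. g i j * delta [x, y, w] [i, j, k]) = (if k = w then g x y else 0 :: real)"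
    "(\<Sum>i<N. \<Sum>j<N. g i j * delta [w, x, y] [k, i, j]) = (if k = w then g x y else 0 :: real)"
proof -
  show "(\<Sum>i<N. \<Sum>j<N. g i j * delta [x, y] [i, j]) = (g x y :: real)"
    by (subst (2) sum_if2[OF assms, symmetric]) (auto simp: delta_def intro!: sum.cong)
  show "(\<Sum>i<N. \<Sum>j<N. g i j * delta [x, y, w] [i, j, k]) = (if k = w then g x y else 0 :: real)"
    by (subst (2) sum_if2[OF assms, symmetric]) (auto simp: delta_def intro!: sum.cong sum.neutral)
  show "(\<Sum>i<N. \<Sum>j<N. g i j * delta [w, x, y] [k, i, j]) = (if k = w then g x y else 0 :: real)"
    by (subst (2) sum_if2[OF assms, symmetric]) (auto simp: delta_def intro!: sum.cong sum.neutral)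
qed

lemma hweight_simps:
  "hweight Cup p [a, b] t [x, y] = (if x = y then if a then 1 else mu x else 0)"
  "hweight Cap [a, b] p' [x, y] r = (if x = y then if a then 1 / mu x else 1 else 0)"
  "hweight (Cross c) [a, b] p' [x, y] [z, w] = wt c a b x y z w"
  by (simp_all add: hweight_def)

lemma sound_reidemeister2: "sound_rule (sh i [(0, Cross b), (0, Cross (\<not> b))]) (sh i [])"
proof (rule sound_rule_sh[where k = 2])
  fix l r s t
  assume *: "length s = 2" "oriented_tangle s l t" "oriented_tangle s r t"
    "map snd l = [(0, Cross b), (0, Cross (\<not> b))]" "map snd r = []"
  obtain d1 d2 where s: "s = [d1, d2]" using *(1) by (rule length_2E)
  have l: "l = [([d1, d2], 0, Cross b), ([d2, d1], 0, Cross (\<not> b))]" "r = []" "t = [d1, d2]"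
    using * by (auto simp: oriented_simps s)
  have "eqv 2 2 (hp l t) (hp r t)"
  proof (rule pieces_equivI)
    fix u w assume "u \<in> words {..<N} 2" "w \<in> words {..<N} 2"
    then obtain x y x' y' where u: "u = [x, y]" "x < N" "y < N" "w = [x', y']" "x' < N" "y' < N"
      by (auto simp: words_iff)
    have "state_sum {..<N} (hp l t) (delta u) w = (\<Sum>i<N. \<Sum>j<N. wt (\<not> b) d2 d1 i j x' y' * wt b d1 d2 x y i j)"
      by (simp add: l u apply_piece_def sum_words_2 hweight_simps nxt_def sum_delta)
    then show "state_sum {..<N} (hp l t) (delta u) w = state_sum {..<N} (hp r t) (delta u) w"
      using wt_inverse[OF u(2,3,5,6), of b d1 d2] by (auto simp: l u delta_def mult.commute)
  qed (simp_all add: l)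
  then show "eqv (length s) (length t) (hp l t) (hp r t)" by (simp add: s l numeral_2_eq_2)
qed (auto simp: sh_def)

lemma sum_cup:
  assumes "k < N" "v < N"
  shows "(\<Sum>i<N. \<Sum>j<N. g i j * ((if k = i then c else 0) * delta [v] [j])) = (g k v * c :: real)"
    "(\<Sum>i<N. \<Sum>j<N. g i j * ((if j = k then c' j else 0) * delta [v] [i])) = (g v k * c' k :: real)"
proof -
  have "g i j * ((if k = i then c else 0) * delta [v] [j]) = (if i = k then if j = v then g i j * c else 0 else 0)"
    "g i j * ((if j = k then c' j else 0) * delta [v] [i]) = (if i = v then if j = k then g i j * c' j else 0 else 0)" for i j
    by (simp_all add: delta_def)
  then show "(\<Sum>i<N. \<Sum>j<N. g i j * ((if k = i then c else 0) * delta [v] [j])) = (g k v * c :: real)"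
    "(\<Sum>i<N. \<Sum>j<N. g i j * ((if j = k then c' j else 0) * delta [v] [i])) = (g v k * c' k :: real)"
    by (simp_all only: sum_if2[OF assms] sum_if2[OF assms(2,1)])
qed

lemma sound_slide_cup: "sound_rule (sh i [(0, Cup), (1, Cross b)]) (sh i [(1, Cup), (0, Cross (\<not> b))])"
proof (rule sound_rule_sh[where k = 1])
  fix l r s t
  assume *: "length s = 1" "oriented_tangle s l t" "oriented_tangle s r t"
    "map snd l = [(0, Cup), (1, Cross b)]" "map snd r = [(1, Cup), (0, Cross (\<not> b))]"
  obtain d where s: "s = [d]" using *(1) by (auto simp: length_Suc_conv)
  obtain e where l: "l = [([d], 0, Cup), ([e, \<not> e, d], 1, Cross b)]"
    "r = [([d], 1, Cup), ([d, e, \<not> e], 0, Cross (\<not> b))]" "t = [e, d, \<not> e]"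
    using * by (auto simp: oriented_simps s)
  have "eqv 1 3 (hp l t) (hp r t)"
  proof (rule pieces_equivI)
    fix u w assume "u \<in> words {..<N} 1" "w \<in> words {..<N} 3"
    then obtain v k r' p where u: "u = [v]" "v < N" "w = [k, r', p]" "k < N" "r' < N" "p < N"
      by (auto simp: words_iff)
    have L: "state_sum {..<N} (hp l t) (delta u) w = wt b (\<not> e) d k v r' p * (if e then 1 else mu k)"
      using u by (simp add: l apply_piece_def sum_words_2 hweight_simps nxt_def sum_cup)
    have R: "state_sum {..<N} (hp r t) (delta u) w = wt (\<not> b) d e v p k r' * (if e then 1 else mu p)"
      using u by (simp add: l apply_piece_def sum_words_2 hweight_simps nxt_def sum_cup)
    show "state_sum {..<N} (hp l t) (delta u) w = state_sum {..<N} (hp r t) (delta u) w"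
      unfolding L R using X_conserve'[of b p r' v k] X_conserve'[of "\<not> b" v p k r'] X_conserve'[of b k v r' p]
        X_conserve'[of "\<not> b" r' k p v]
      by (cases e; cases d) (auto simp: wt_def field_simps)
  qed (simp_all add: l)
  then show "eqv (length s) (length t) (hp l t) (hp r t)" by (simp add: s l eval_nat_numeral)
qed (auto simp: sh_def)

lemma sound_slide_cap: "sound_rule (sh i [(1, Cross b), (0, Cap)]) (sh i [(0, Cross (\<not> b)), (1, Cap)])"
proof (rule sound_rule_sh[where k = 3])
  fix l r s t
  assume *: "length s = 3" "oriented_tangle s l t" "oriented_tangle s r t"
    "map snd l = [(1, Cross b), (0, Cap)]" "map snd r = [(0, Cross (\<not> b)), (1, Cap)]"
  obtain e d f where s: "s = [e, d, f]" using *(1) by (rule length_3E)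
  have l: "l = [([e, d, \<not> e], 1, Cross b), ([e, \<not> e, d], 0, Cap)]"
    "r = [([e, d, \<not> e], 0, Cross (\<not> b)), ([d, e, \<not> e], 1, Cap)]" "t = [d]" "f = (\<not> e)"
    using * by (auto simp: oriented_simps s)
  have "eqv 3 1 (hp l t) (hp r t)"
  proof (rule pieces_equivI)
    fix u w assume "u \<in> words {..<N} 3" "w \<in> words {..<N} 1"
    then obtain x y w' p where u: "u = [x, y, w']" "x < N" "y < N" "w' < N" "w = [p]" "p < N"
      by (auto simp: words_iff)
    have L: "state_sum {..<N} (hp l t) (delta u) w = (if e then 1 / mu x else 1) * wt b d (\<not> e) y w' x p"
      using u by (simp add: l apply_piece_def sum_words_2 hweight_simps nxt_def sum_delta if_mult cong: if_cong)
    have R: "state_sum {..<N} (hp r t) (delta u) w = (if e then 1 / mu w' else 1) * wt (\<not> b) e d x y p w'"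
      using u by (simp add: l apply_piece_def sum_words_2 hweight_simps nxt_def sum_delta if_mult cong: if_cong)
    show "state_sum {..<N} (hp l t) (delta u) w = state_sum {..<N} (hp r t) (delta u) w"
      unfolding L R using X_conserve'[of b p x w' y] X_conserve'[of "\<not> b" x y p w'] X_conserve'[of b y w' x p]
        X_conserve'[of "\<not> b" w' p y x]
      by (cases e; cases d) (auto simp: wt_def field_simps)
  qed (simp_all add: l)
  then show "eqv (length s) (length t) (hp l t) (hp r t)" by (simp add: s l eval_nat_numeral)
qed (auto simp: sh_def)

text \<open>A curl at a minimum is a partial trace of a crossing, over its left or right strand
  according to the direction; \<open>framing\<close> was chosen to make both equal to the
  identity.\<close>

lemma sound_reidemeister1_cup: "sound_rule (sh i [(0, Cup), (0, Cross b)]) (sh i [(0, Cup)])"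
proof (rule sound_rule_sh[where k = 0])
  fix l r s t
  assume *: "length s = 0" "oriented_tangle s l t" "oriented_tangle s r t"
    "map snd l = [(0, Cup), (0, Cross b)]" "map snd r = [(0, Cup)]"
  obtain e where l: "l = [([], 0, Cup), ([\<not> e, e], 0, Cross b)]" "r = [([], 0, Cup)]" "t = [e, \<not> e]"
    using * by (auto simp: oriented_simps)
  have "eqv 0 2 (hp l t) (hp r t)"
  proof (rule pieces_equivI)
    fix u w assume "u \<in> words {..<N} 0" "w \<in> words {..<N} 2"
    then obtain z v where u: "u = []" "w = [z, v]" "z < N" "v < N"
      by (auto simp: words_iff)
    have L: "state_sum {..<N} (hp l t) (delta u) w = (\<Sum>k<N. wt b (\<not> e) e k k z v * (if e then mu k else 1))"
      using u by (cases e) (simp_all add: l apply_piece_def sum_words_2 hweight_simps nxt_def delta_def if_mult cong: if_cong)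
    have R: "state_sum {..<N} (hp r t) (delta u) w = (if z = v then if e then 1 else mu z else 0)"
      using u by (simp add: l apply_piece_def hweight_simps nxt_def delta_def)
    show "state_sum {..<N} (hp l t) (delta u) w = state_sum {..<N} (hp r t) (delta u) w"
    proof (cases e)
      case True
      then show ?thesis unfolding L R using X_partial_left[OF u(4,3), of "\<not> b"] by (auto simp: wt_def ac_simps)
    next
      case False
      then have "(\<Sum>k<N. wt b (\<not> e) e k k z v) = mu z * (\<Sum>k<N. X (\<not> b) z k v k / mu k)"
        by (simp add: wt_def sum_distrib_left ac_simps)
      then show ?thesis unfolding L R using False X_partial_right[OF u(3,4), of "\<not> b"] by auto
    qed
  qed (simp_all add: l)
  then show "eqv (length s) (length t) (hp l t) (hp r t)" using * by (simp add: l eval_nat_numeral)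
qed (auto simp: sh_def)

lemma sound_reidemeister1_cap: "sound_rule (sh i [(0, Cross b), (0, Cap)]) (sh i [(0, Cap)])"
proof (rule sound_rule_sh[where k = 2])
  fix l r s t
  assume *: "length s = 2" "oriented_tangle s l t" "oriented_tangle s r t"
    "map snd l = [(0, Cross b), (0, Cap)]" "map snd r = [(0, Cap)]"
  obtain e d where s: "s = [e, d]" using *(1) by (rule length_2E)
  have l: "l = [([e, \<not> e], 0, Cross b), ([\<not> e, e], 0, Cap)]" "r = [([e, \<not> e], 0, Cap)]" "t = []" "d = (\<not> e)"
    using * by (auto simp: oriented_simps s)
  have "eqv 2 0 (hp l t) (hp r t)"
  proof (rule pieces_equivI)
    fix u w assume "u \<in> words {..<N} 2" "w \<in> words {..<N} 0"
    then obtain x y where u: "w = []" "u = [x, y]" "x < N" "y < N"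
      by (auto simp: words_iff)
    have L: "state_sum {..<N} (hp l t) (delta u) w = (\<Sum>k<N. (if e then 1 else 1 / mu k) * wt b e (\<not> e) x y k k)"
      using u by (cases e) (simp_all add: l apply_piece_def sum_words_2 hweight_simps nxt_def sum_delta if_mult cong: if_cong)
    have R: "state_sum {..<N} (hp r t) (delta u) w = (if x = y then if e then 1 / mu x else 1 else 0)"
      using u sum_delta(1)[OF u(3,4), of "\<lambda>i j. if i = j then if e then 1 / mu i else 1 else 0"]
      by (simp add: l apply_piece_def sum_words_2 hweight_simps nxt_def)
    show "state_sum {..<N} (hp l t) (delta u) w = state_sum {..<N} (hp r t) (delta u) w"
    proof (cases e)
      case True
      then have "(\<Sum>k<N. wt b e (\<not> e) x y k k) = (\<Sum>k<N. mu k * X (\<not> b) k x k y) / mu y"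
        by (simp add: wt_def sum_divide_distrib ac_simps)
      then show ?thesis unfolding L R using True X_partial_left[OF u(3,4), of "\<not> b"] by auto
    next
      case False
      then show ?thesis unfolding L R using X_partial_right[OF u(4,3), of "\<not> b"] by (auto simp: wt_def)
    qed
  qed (simp_all add: l)
  then show "eqv (length s) (length t) (hp l t) (hp r t)" by (simp add: s l eval_nat_numeral)
qed (auto simp: sh_def)

lemma sound_zigzag_left: "sound_rule (sh i [(0, Cup), (1, Cap)]) (sh i [])"
proof (rule sound_rule_sh[where k = 1])
  fix l r s t
  assume *: "length s = 1" "oriented_tangle s l t" "oriented_tangle s r t"
    "map snd l = [(0, Cup), (1, Cap)]" "map snd r = []"
  obtain d where s: "s = [d]" using *(1) by (auto simp: length_Suc_conv)
  have l: "l = [([d], 0, Cup), ([d, \<not> d, d], 1, Cap)]" "r = []" "t = [d]"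
    using * by (auto simp: oriented_simps s)
  have "eqv 1 1 (hp l t) (hp r t)"
  proof (rule pieces_equivI)
    fix u w assume "u \<in> words {..<N} 1" "w \<in> words {..<N} 1"
    then obtain x y where u: "w = [y]" "u = [x]" "x < N" "y < N"
      by (auto simp: words_iff)
    have L: "state_sum {..<N} (hp l t) (delta u) w
        = (\<Sum>i<N. \<Sum>j<N. (if i = j then if \<not> d then 1 / mu i else 1 else 0) *
            ((if y = i then if d then 1 else mu y else 0) * delta [x] [j]))"
      by (simp add: l u apply_piece_def sum_words_2 hweight_simps nxt_def)
    show "state_sum {..<N} (hp l t) (delta u) w = state_sum {..<N} (hp r t) (delta u) w"
      unfolding L sum_cup(1)[OF u(4,3)] using u by (auto simp: l delta_def)
  qed (simp_all add: l)
  then show "eqv (length s) (length t) (hp l t) (hp r t)" by (simp add: s l)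
qed (auto simp: sh_def)

lemma sound_zigzag_right: "sound_rule (sh i [(1, Cup), (0, Cap)]) (sh i [])"
proof (rule sound_rule_sh[where k = 1])
  fix l r s t
  assume *: "length s = 1" "oriented_tangle s l t" "oriented_tangle s r t"
    "map snd l = [(1, Cup), (0, Cap)]" "map snd r = []"
  obtain d where s: "s = [d]" using *(1) by (auto simp: length_Suc_conv)
  have l: "l = [([d], 1, Cup), ([d, \<not> d, d], 0, Cap)]" "r = []" "t = [d]"
    using * by (auto simp: oriented_simps s)
  have "eqv 1 1 (hp l t) (hp r t)"
  proof (rule pieces_equivI)
    fix u w assume "u \<in> words {..<N} 1" "w \<in> words {..<N} 1"
    then obtain x y where u: "w = [y]" "u = [x]" "x < N" "y < N"
      by (auto simp: words_iff)
    have L: "state_sum {..<N} (hp l t) (delta u) w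
        = (\<Sum>i<N. \<Sum>j<N. (if i = j then if d then 1 / mu i else 1 else 0) *
            ((if j = y then if \<not> d then 1 else mu j else 0) * delta [x] [i]))"
      by (simp add: l u apply_piece_def sum_words_2 hweight_simps nxt_def)
    show "state_sum {..<N} (hp l t) (delta u) w = state_sum {..<N} (hp r t) (delta u) w"
      unfolding L sum_cup(2)[OF u(4,3)] using u by (auto simp: l delta_def)
  qed (simp_all add: l)
  then show "eqv (length s) (length t) (hp l t) (hp r t)" by (simp add: s l)
qed (auto simp: sh_def)

section \<open>The triangle move for all directions\<close>

definition crossing :: "nat \<Rightarrow> bool \<Rightarrow> bool \<Rightarrow> bool \<Rightarrow> (nat, real) piece" where
  "crossing j b d d' = (hweight (Cross b) [d, d'] [d', d], j, 2, 2)"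

lemma crossing_inverse:
  "j + 2 \<le> n \<Longrightarrow> eqv n n [crossing j b d d', crossing j (\<not> b) d' d] []"
proof -
  assume j: "j + 2 \<le> n"
  have "eqv 2 2 [crossing 0 b d d', crossing 0 (\<not> b) d' d] []"
  proof -
    have "sound_rule [(0, Cross b), (0, Cross (\<not> b))] []"
      using sound_reidemeister2[of 0 b] by simp
    moreover have "oriented_tangle [d, d'] [([d, d'], 0, Cross b), ([d', d], 0, Cross (\<not> b))] [d, d']"
      by (simp add: oriented_simps)
    ultimately show ?thesis
      unfolding sound_rule_def
      by (force simp: crossing_def nxt_def numeral_2_eq_2)
  qed
  note s = pieces_equiv_shift[OF this, of j "n - j - 2"]
  have "j + 2 + (n - j - 2) = n" using j by simp
  from s[unfolded this] show ?thesis by (simp add: shift_piece_def crossing_def)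
qed

lemma sum_if1:
  "x < N \<Longrightarrow> (\<Sum>i<N. \<Sum>j<N. if i = x then g i j else 0) = (\<Sum>j<N. g x j :: real)"
  by (subst sum.swap) simp

lemma triangle_sum:
  assumes "d1 = d2 \<or> d2 = d3" "\<not> (a = c \<and> b \<noteq> a)"
  shows "eqv 3 3 [crossing 0 a d1 d2, crossing 1 b d1 d3, crossing 0 c d2 d3]
    [crossing 1 c d2 d3, crossing 0 b d1 d3, crossing 1 a d1 d2]"
proof (rule pieces_equivI)
  fix u v assume "u \<in> words {..<N} 3" "v \<in> words {..<N} 3"
  then obtain x y w d e f where u: "u = [x, y, w]" "x < N" "y < N" "w < N" "v = [d, e, f]" "d < N" "e < N" "f < N"
    by (auto simp: words_iff)
  have "state_sum {..<N} [crossing 0 a d1 d2, crossing 1 b d1 d3, crossing 0 c d2 d3] (delta u) v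
      = (\<Sum>i<N. \<Sum>k<N. \<Sum>j<N. wt c d2 d3 i k d e * (wt b d1 d3 j w k f * wt a d1 d2 x y i j))"
    unfolding sum_distrib_left[symmetric] using u
    by (simp add: crossing_def apply_piece_def sum_words_2 hweight_simps sum_delta sum_if1 if_mult cong: if_cong)
  also have "\<dots> = WL a b c d1 d2 d3 x y w d e f"
    unfolding WL_def by (subst sum3_swap23) (simp add: ac_simps)
  also have "\<dots> = WR a b c d1 d2 d3 x y w d e f"
    by (rule wt_yang_baxter0) (use assms u in auto)
  also have "\<dots> = (\<Sum>k<N. \<Sum>j<N. \<Sum>i<N. wt a d1 d2 k j e f * (wt b d1 d3 x i d k * wt c d2 d3 y w i j))"
    unfolding WR_def by (rule trans[OF sum3_rotB trans[OF sum3_swap12]]) (simp add: ac_simps)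
  also have "\<dots> = state_sum {..<N} [crossing 1 c d2 d3, crossing 0 b d1 d3, crossing 1 a d1 d2] (delta u) v"
    unfolding sum_distrib_left[symmetric] using u
    by (simp add: crossing_def apply_piece_def sum_words_2 hweight_simps sum_delta sum_if1 if_mult cong: if_cong)
  finally show "state_sum {..<N} [crossing 0 a d1 d2, crossing 1 b d1 d3, crossing 0 c d2 d3] (delta u) v
    = state_sum {..<N} [crossing 1 c d2 d3, crossing 0 b d1 d3, crossing 1 a d1 d2] (delta u) v" .
qed (simp_all add: crossing_def)

text \<open>If the middle strand runs against the two others, conjugating with its crossing with the first
  strand reduces the triangle to one where it does not lie in the middle.\<close>

lemma triangle:
  assumes "\<not> (a = c \<and> b \<noteq> a)"
  shows "eqv 3 3 [crossing 0 a d1 d2, crossing 1 b d1 d3, crossing 0 c d2 d3]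
    [crossing 1 c d2 d3, crossing 0 b d1 d3, crossing 1 a d1 d2]"
proof (cases "d1 = d2 \<or> d2 = d3")
  case True
  then show ?thesis using assms by (rule triangle_sum)
next
  case False
  have t: "eqv 3 3 [crossing 0 (\<not> a) d2 d1, crossing 1 c d2 d3, crossing 0 b d1 d3]
    [crossing 1 b d1 d3, crossing 0 c d2 d3, crossing 1 (\<not> a) d2 d1]"
    by (rule triangle_sum) (use False assms in auto)
  define X1 where "X1 = [crossing 1 b d1 d3, crossing 0 c d2 d3]"
  define X2 where "X2 = [crossing 1 c d2 d3, crossing 0 b d1 d3, crossing 1 a d1 d2]"
  have X: "eqv 3 3 X1 X1" "eqv 3 3 X2 X2" by (auto simp: X1_def X2_def crossing_def intro!: pieces_equiv_refl)
  have A: "eqv 3 3 [crossing 0 a d1 d2] [crossing 0 a d1 d2]" "eqv 3 3 [crossing 1 a d1 d2] [crossing 1 a d1 d2]"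
    by (auto simp: crossing_def intro!: pieces_equiv_refl)
  have "eqv 3 3 (([crossing 0 a d1 d2] @ X1) @ [])
      (([crossing 0 a d1 d2] @ X1) @ [crossing 1 (\<not> a) d2 d1, crossing 1 a d1 d2])"
    using pieces_equiv_append[OF pieces_equiv_append[OF A(1) X(1)] pieces_equiv_sym[OF crossing_inverse[of 1 3 "\<not> a" d2 d1]]]
    by simp
  also have "pieces_equiv {..<N} 3 3 \<dots> ([crossing 0 a d1 d2] @ [crossing 0 (\<not> a) d2 d1, crossing 1 c d2 d3, crossing 0 b d1 d3] @ [crossing 1 a d1 d2])"
    using pieces_equiv_append[OF A(1) pieces_equiv_append[OF pieces_equiv_sym[OF t] A(2)]] by (simp add: X1_def)
  also (pieces_equiv_trans) have "pieces_equiv {..<N} 3 3 \<dots> ([] @ X2)"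
    using pieces_equiv_append[OF crossing_inverse[of 0 3 a d1 d2] X(2)] by (simp add: X2_def)
  finally (pieces_equiv_trans) show ?thesis by (simp add: X1_def X2_def)
qed

lemma sound_reidemeister3:
  assumes "\<not> (a = c \<and> b \<noteq> a)"
  shows "sound_rule (sh i [(0, Cross a), (1, Cross b), (0, Cross c)]) (sh i [(1, Cross c), (0, Cross b), (1, Cross a)])"
proof (rule sound_rule_sh[where k = 3])
  fix l r s t
  assume *: "length s = 3" "oriented_tangle s l t" "oriented_tangle s r t"
    "map snd l = [(0, Cross a), (1, Cross b), (0, Cross c)]" "map snd r = [(1, Cross c), (0, Cross b), (1, Cross a)]"
  obtain d1 d2 d3 where s: "s = [d1, d2, d3]" using *(1) by (rule length_3E)
  have l: "l = [([d1, d2, d3], 0, Cross a), ([d2, d1, d3], 1, Cross b), ([d2, d3, d1], 0, Cross c)]"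
    "r = [([d1, d2, d3], 1, Cross c), ([d1, d3, d2], 0, Cross b), ([d3, d1, d2], 1, Cross a)]" "t = [d3, d2, d1]"
    using * by (auto simp: oriented_simps s)
  show "eqv (length s) (length t) (hp l t) (hp r t)"
    using triangle[OF assms, of d1 d2 d3] by (simp add: l s nxt_def crossing_def numeral_3_eq_3)
qed (auto simp: sh_def)

lemma sound_exchange: "sound_rule (sh i [(0, g), (outs g + k, h)]) (sh i [(ins g + k, h), (0, g)])"
proof (rule sound_rule_sh[where k = "ins g + k + ins h"])
  fix l r s t
  assume *: "length s = ins g + k + ins h" "oriented_tangle s l t" "oriented_tangle s r t"
    "map snd l = [(0, g), (outs g + k, h)]" "map snd r = [(ins g + k, h), (0, g)]"
  define p where "p = take (ins g) s"
  define m where "m = take k (drop (ins g) s)"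
  define p' where "p' = drop (ins g + k) s"
  have s: "s = p @ m @ p'" "length p = ins g" "length m = k" "length p' = ins h"
    using *(1) by (auto simp: p_def m_def p'_def) (metis add.commute append_take_drop_id drop_drop)
  obtain q q' where l: "l = [(p @ m @ p', 0, g), (q @ m @ p', outs g + k, h)]" "t = q @ m @ q'"
    "length q = outs g" "length q' = outs h"
  proof -
    obtain s1 s2 where l: "l = [(s1, 0, g), (s2, outs g + k, h)]" using *(4) by (auto simp: map_eq_Cons_conv)
    obtain q where q: "s1 = s" "flow g p q" "oriented_tangle (q @ m @ p') [(s2, outs g + k, h)] t"
      using *(2) s by (auto simp: l oriented_tangle_Cons)
    have lq: "length q = outs g" using flow_length[OF q(2)] by simp
    obtain q' where q': "s2 = q @ m @ p'" "flow h p' q'" "t = q @ m @ q'"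
      using q(3) lq s(3,4) by (auto simp: oriented_tangle_Cons)
    then show ?thesis using l q(1) lq s(1) flow_length[OF q'(2)] by (intro that[of q q']) auto
  qed
  have r: "r = [(p @ m @ p', ins g + k, h), (p @ m @ q', 0, g)]"
  proof -
    obtain s1 s2 where r: "r = [(s1, ins g + k, h), (s2, 0, g)]" using *(5) by (auto simp: map_eq_Cons_conv)
    obtain u where u: "s1 = s" "flow h p' u" "oriented_tangle (p @ m @ u) [(s2, 0, g)] t"
      using *(3) s by (auto simp: r oriented_tangle_Cons)
    have lu: "length u = outs h" using flow_length[OF u(2)] by simp
    obtain v where v: "s2 = p @ m @ u" "flow g p v" "t = v @ m @ u"
      using u(3) s(2) by (auto simp: oriented_tangle_Cons)
    have "u = q'" using v(3) l(2,3,4) flow_length[OF v(2)] lu by simp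
    then show ?thesis using r u(1) v(1) s(1) by simp
  qed
  have ok: "pieces_ok (length s) (hp l t) \<and> pieces_out (length s) (hp l t) = length t"
    "pieces_ok (length s) (hp r t) \<and> pieces_out (length s) (hp r t) = length t"
    using hp_ok *(2,3) by blast+
  have "state_sum {..<N} (hp l t) f w = state_sum {..<N} (hp r t) f w" if "w \<in> words {..<N} (length t)" for f w
    using apply_piece_exchange[of 0 "outs g" k "outs h" w] that s l
    by (simp add: l(1) r nxt_def words_def)
  then show "eqv (length s) (length t) (hp l t) (hp r t)"
    using ok by (simp add: pieces_equiv_def)
next
  show "ok (ins g + k + ins h) [(0, g), (outs g + k, h)]" by (cases g; cases h) auto
  show "ok (ins g + k + ins h) [(ins g + k, h), (0, g)]" by (cases g; cases h) auto
next
  fix n assume "ok n (sh i [(ins g + k, h), (0, g)])"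
  then show "i + (ins g + k + ins h) \<le> n" by (cases g; cases h) auto
qed

lemma isotopy_rule_sound: "isotopy_rule D D' \<Longrightarrow> sound_rule D D'"
proof (induction rule: isotopy_rule.induct)
  case (exchange i g k h)
  then show ?case using sound_exchange[of i g k h] by (simp add: ac_simps)
next
  case (zigzag_left i)
  then show ?case using sound_zigzag_left[of i] by (simp add: ac_simps)
next
  case (zigzag_right i)
  then show ?case using sound_zigzag_right[of i] by (simp add: ac_simps)
next
  case (slide_cup i b)
  then show ?case using sound_slide_cup[of i b] by (simp add: ac_simps)
next
  case (slide_cap i b)
  then show ?case using sound_slide_cap[of i b] by (simp add: ac_simps)
next
  case (reidemeister1_cup i b)
  then show ?case using sound_reidemeister1_cup[of i b] by (simp add: ac_simps)
next
  case (reidemeister1_cap i b)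
  then show ?case using sound_reidemeister1_cap[of i b] by (simp add: ac_simps)
next
  case (reidemeister2 i b)
  then show ?case using sound_reidemeister2[of i b] by (simp add: ac_simps)
next
  case (reidemeister3 a c b i)
  then show ?case using sound_reidemeister3[OF reidemeister3, of i] by (simp add: ac_simps)
qed

section \<open>The invariant and its skein relation\<close>

definition Z :: "oriented_diagram \<Rightarrow> real" where
  "Z E = state_sum {..<N} (hp E []) (delta []) []"

lemma hp_refl: "oriented_tangle s E t \<Longrightarrow> eqv (length s) (length t) (hp E t) (hp E t)"
  using hp_ok by (blast intro: pieces_equiv_refl)

lemma Z_isotopy: "oriented_isotopy_step E E' \<Longrightarrow> Z E' = Z E"
proof -
  assume "oriented_isotopy_step E E'"
  then obtain u l r v s t where E: "E = u @ l @ v" "E' = u @ r @ v"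
    and uv: "oriented_tangle [] u s" "oriented_tangle s l t" "oriented_tangle s r t" "oriented_tangle t v []"
    and R: "isotopy_rule (map snd l) (map snd r) \<or> isotopy_rule (map snd r) (map snd l)"
    by (auto simp: oriented_isotopy_step_def)
  have "eqv (length s) (length t) (hp l t) (hp r t)"
    using R isotopy_rule_sound uv(2,3) unfolding sound_rule_def by (blast intro: pieces_equiv_sym)
  from pieces_equiv_append[OF hp_refl[OF uv(1)] pieces_equiv_append[OF this hp_refl[OF uv(4)]]]
  have "eqv 0 0 (hp u s @ hp l t @ hp v []) (hp u s @ hp r t @ hp v [])" by simp
  moreover have "hp E [] = hp u s @ hp l t @ hp v []" "hp E' [] = hp u s @ hp r t @ hp v []"
    unfolding E using uv by (metis hp_append oriented_tangle_append)+
  ultimately show ?thesis by (simp add: Z_def pieces_equiv_def)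
qed

text \<open>The powers of \<open>q^N\<close> undo the framing inside \<open>wt\<close>. What remains
  is the Hecke relation: \<open>R\<close> minus its inverse is \<open>zz\<close> times the
  identity.\<close>

lemma skein_kernel_parallel:
  "q ^ N * wt True a a x y z w - wt False a a x y z w / q ^ N = (if x = z \<and> y = w then zz else 0)"
  by (cases a; cases x y rule: linorder_cases) (auto simp: wt_def X_def framing_def R_def al_def be_def zz_def)

text \<open>Rotation reduces this to parallel strands and turns the identity into a maximum below a
  minimum.\<close>

lemma skein_kernel_antiparallel:
  "q ^ N * wt False a (\<not> a) x y z w - wt True a (\<not> a) x y z w / q ^ N
    = zz * (hweight Cap [a, \<not> a] [] [x, y] [] * hweight Cup [] [\<not> a, a] [] [z, w])"
proof (cases a)
  case True
  have "q ^ N * wt False a (\<not> a) x y z w - wt True a (\<not> a) x y z w / q ^ N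
     = (q ^ N * wt True True True z x w y - wt False True True z x w y / q ^ N) * mu z / mu y"
    using True by (simp add: wt_def field_simps)
  then show ?thesis unfolding skein_kernel_parallel using True by (auto simp: hweight_simps)
next
  case False
  have "q ^ N * wt False a (\<not> a) x y z w - wt True a (\<not> a) x y z w / q ^ N
     = q ^ N * wt True True True y w x z - wt False True True y w x z / q ^ N"
    using False by (simp add: wt_def field_simps)
  then show ?thesis unfolding skein_kernel_parallel using False by (auto simp: hweight_simps)
qed

lemma skein_local_sum:
  assumes "skein_local s t lp lm l0" "w \<in> words {..<N} (length t)"
  shows "q ^ N * state_sum {..<N} (hp lp t) f w - state_sum {..<N} (hp lm t) f w / q ^ N
    = zz * state_sum {..<N} (hp l0 t) f w"
  using assms
proof (induction rule: skein_local.induct)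
  case (parallel s x a y i)
  have wl: "length w = length x + 2 + length y" "set w \<subseteq> {..<N}" using parallel by (auto simp: words_def)
  from wl(1) have "i + 2 \<le> length w" using parallel(2) by simp
  then obtain x' r y' where w: "w = x' @ r @ y'" "length x' = i" "length r = 2" by (rule split_list3)
  obtain z v where r: "r = [z, v]" using w(3) by (rule length_2E)
  have zv: "z < N" "v < N" using \<open>set w \<subseteq> {..<N}\<close> by (auto simp: w r)
  have c: "state_sum {..<N} (hp [(s, i, Cross c)] s) f w
      = (\<Sum>j<N. \<Sum>k<N. wt c a a j k z v * f (x' @ [j, k] @ y'))" for c
    using apply_piece_append[OF w(2,3), of "{..<N}" _ 2 f] parallel(1,2)
    by (simp add: nxt_def w(1) r sum_words_2 hweight_simps)
  have "q ^ N * state_sum {..<N} (hp [(s, i, Cross True)] s) f w - state_sum {..<N} (hp [(s, i, Cross False)] s) f w / q ^ N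
     = (\<Sum>j<N. \<Sum>k<N. (q ^ N * wt True a a j k z v - wt False a a j k z v / q ^ N) * f (x' @ [j, k] @ y'))"
    unfolding c by (simp add: sum_distrib_left sum_divide_distrib sum_subtractf left_diff_distrib mult.assoc)
  also have "\<dots> = (\<Sum>j<N. \<Sum>k<N. if j = z then if k = v then zz * f (x' @ [j, k] @ y') else 0 else 0)"
    unfolding skein_kernel_parallel by (intro sum.cong refl) auto
  also have "\<dots> = zz * f w" using zv by (simp add: sum_if2 w r)
  finally show ?case by simp
next
  case (antiparallel s x a y t i)
  have wl: "length w = length x + 2 + length y" "set w \<subseteq> {..<N}" using antiparallel by (auto simp: words_def)
  from wl(1) have "i + 2 \<le> length w" using antiparallel(3) by simp
  then obtain x' r y' where w: "w = x' @ r @ y'" "length x' = i" "length r = 2" by (rule split_list3)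
  obtain z v where r: "r = [z, v]" using w(3) by (rule length_2E)
  have c: "state_sum {..<N} (hp [(s, i, Cross c)] t) f w
      = (\<Sum>j<N. \<Sum>k<N. wt c a (\<not> a) j k z v * f (x' @ [j, k] @ y'))" for c
    using apply_piece_append[OF w(2,3), of "{..<N}" _ 2 f] antiparallel(1-3)
    by (simp add: nxt_def w(1) r sum_words_2 hweight_simps)
  have h: "state_sum {..<N} (hp [(s, i, Cap), (x @ y, i, Cup)] t) f w
      = hweight Cup [] [\<not> a, a] [] [z, v] * (\<Sum>j<N. \<Sum>k<N. hweight Cap [a, \<not> a] [] [j, k] [] * f (x' @ [j, k] @ y'))"
    using apply_piece_append[OF w(2,3), of "{..<N}" _ 0 "apply_piece {..<N} (hweight Cap [a, \<not> a] [], i, 2, 0) f"] apply_piece_append[OF w(2), of "[]" 0 "{..<N}" _ 2 f y'] antiparallel(1-3)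
    by (simp add: nxt_def w(1) r sum_words_2)
  have "q ^ N * state_sum {..<N} (hp [(s, i, Cross False)] t) f w - state_sum {..<N} (hp [(s, i, Cross True)] t) f w / q ^ N
     = (\<Sum>j<N. \<Sum>k<N. (q ^ N * wt False a (\<not> a) j k z v - wt True a (\<not> a) j k z v / q ^ N) * f (x' @ [j, k] @ y'))"
    unfolding c by (simp add: sum_distrib_left sum_divide_distrib sum_subtractf left_diff_distrib mult.assoc)
  also have "\<dots> = zz * state_sum {..<N} (hp [(s, i, Cap), (x @ y, i, Cup)] t) f w"
    unfolding skein_kernel_antiparallel h sum_distrib_left by (intro sum.cong refl) (simp only: ac_simps)
  finally show ?case .
qed

lemma Z_skein:
  assumes "skein_triple Ep Em Ez"
  shows "q ^ N * Z Ep - Z Em / q ^ N = zz * Z Ez"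
proof -
  obtain u v s t lp lm l0 where E: "Ep = u @ lp @ v" "Em = u @ lm @ v" "Ez = u @ l0 @ v"
    and uv: "oriented_tangle [] u s" "skein_local s t lp lm l0" "oriented_tangle t v []"
    using assms by (auto simp: skein_triple_def)
  have l: "oriented_tangle s lp t" "oriented_tangle s lm t" "oriented_tangle s l0 t"
    using uv(2) by (induction rule: skein_local.induct) (auto simp: oriented_tangle_Cons flow_iff)
  define f where "f = state_sum {..<N} (hp u s) (delta [])"
  have Z: "Z (u @ l @ v) = state_sum {..<N} (hp v []) (state_sum {..<N} (hp l t) f) []"
    if "oriented_tangle s l t" for l
  proof -
    have "hp (u @ l @ v) [] = hp u s @ hp l t @ hp v []"
      using that uv by (metis hp_append oriented_tangle_append)
    then show ?thesis by (simp add: Z_def state_sum_append f_def)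
  qed
  have "q ^ N * Z Ep - Z Em / q ^ N = state_sum {..<N} (hp v [])
      (\<lambda>w. q ^ N * state_sum {..<N} (hp lp t) f w + (- 1 / q ^ N) * state_sum {..<N} (hp lm t) f w) []"
    unfolding state_sum_lin E Z[OF l(1)] Z[OF l(2)] by simp
  also have "\<dots> = state_sum {..<N} (hp v []) (\<lambda>w. zz * state_sum {..<N} (hp l0 t) f w) []"
    by (rule state_sum_cong[where k = "length t"])
      (use skein_local_sum[OF uv(2), of _ f] hp_ok[OF uv(3)] in auto)
  also have "\<dots> = zz * Z Ez" by (simp only: state_sum_scale E Z[OF l(3)])
  finally show ?thesis .
qed

definition qint :: real where "qint = (\<Sum>k<N. mu k)"

lemma Z_trivial: "orientation_of E trivial_knot \<Longrightarrow> Z E = qint"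
proof -
  assume "orientation_of E trivial_knot"
  then obtain a where E: "E = [([], 0, Cup), ([a, \<not> a], 0, Cap)]"
    by (auto simp: orientation_of_def trivial_knot_def oriented_simps)
  \<comment> \<open>Reversing the labels inverts the weights,
    \<open>mu (N - 1 - k) = 1 / mu k\<close>, so both orientations of the circle have the same
    value.\<close>
  have "(\<Sum>k<N. 1 / mu k) = (\<Sum>k<N. mu k)"
    by (rule sum.reindex_bij_witness[where i = "\<lambda>k. N - 1 - k" and j = "\<lambda>k. N - 1 - k"])
      (auto simp: mu_def field_simps simp flip: power_add power_Suc intro!: arg_cong[where f = "\<lambda>m. q ^ m"])
  then show ?thesis
    by (cases a) (simp_all add: E Z_def apply_piece_def nxt_def sum_words_2 hweight_simps delta_def qint_def if_mult cong: if_cong)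
qed

lemma qint_pos: "N > 0 \<Longrightarrow> qint > 0"
  unfolding qint_def by (rule sum_pos) auto

end

section \<open>Uniqueness of the Conway polynomial\<close>

definition rpoly :: "int poly \<Rightarrow> real poly" where "rpoly = map_poly of_int"

lemma coeff_rpoly: "coeff (rpoly P) n = of_int (coeff P n)"
  by (simp add: rpoly_def coeff_map_poly)

lemma rpoly_eq: "rpoly P = rpoly Q \<Longrightarrow> P = Q"
  by (rule poly_eqI) (metis coeff_rpoly of_int_eq_iff)

lemma rpoly_simps: "rpoly 1 = 1" "rpoly (P + Q) = rpoly P + rpoly Q" "rpoly (P - Q) = rpoly P - rpoly Q"
  "rpoly ([:0, 1:] * P) = [:0, 1:] * rpoly P"
  by (rule poly_eqI; simp add: coeff_rpoly coeff_pCons split: nat.split)+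

text \<open>\<open>p\<close> stands for the Laurent polynomial \<open>p(a) / a^k\<close> in \<open>a = q^N\<close>, a specialised HOMFLY polynomial.\<close>

definition interpolates :: "real \<Rightarrow> oriented_diagram \<Rightarrow> int poly \<Rightarrow> bool" where
  "interpolates q E P \<longleftrightarrow> (\<exists>p k. poly p 1 = poly (rpoly P) (q - 1 / q) \<and>
     (\<forall>N. rmatrix.Z q N E * (q ^ N) ^ k = rmatrix.qint q N * poly p (q ^ N)))"

text \<open>That \<open>p\<close> and \<open>k\<close> do not depend on \<open>N\<close> is what
  permits the passage from the points \<open>q^N\<close> to \<open>a = 1\<close>. Each rule acts on
  these pairs through \<open>a * Z Ep - Z Em / a = z * Z Ez\<close>, which at \<open>a = 1\<close>
  is the Conway relation.\<close>

lemma has_conway_interpolates: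
  assumes "has_conway E P" "q > 1"
  shows "interpolates q E P"
proof -
  interpret rmatrix q N for N by unfold_locales (rule assms(2))
  define z where "z = q - 1 / q"
  \<comment> \<open>Allows the division by \<open>z\<close> in the case
    \<open>skein_zero\<close>.\<close>
  have z: "z \<noteq> 0" using assms(2) mult_strict_mono[of 1 q 1 q] by (auto simp: z_def field_simps)
  have zz: "zz = z" by (simp add: zz_def z_def)
  from assms(1) show ?thesis
  proof (induction rule: has_conway.induct)
    case (trivial E)
    then show ?case unfolding interpolates_def
      by (intro exI[of _ 1] exI[of _ 0]) (simp add: Z_trivial rpoly_simps)
  next
    case (isotopy E P E')
    then show ?case by (simp add: interpolates_def Z_isotopy)
  next
    case (skein_plus Ep Em Ez P Q)
    from skein_plus.IH obtain p k p' k' where IH: "poly p 1 = poly (rpoly P) z" "poly p' 1 = poly (rpoly Q) z"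
      "Z N Em * (q ^ N) ^ k = qint N * poly p (q ^ N)" "Z N Ez * (q ^ N) ^ k' = qint N * poly p' (q ^ N)" for N
      unfolding interpolates_def z_def by metis
    \<comment> \<open>Denominators are cleared: \<open>a^2\<close> comes from the skein relation,
      \<open>a^k\<close> and \<open>a^k'\<close> from the two given Laurent polynomials.\<close>
    have "Z N Ep * (q ^ N) ^ (k + k' + 2) = qint N * poly (monom 1 k' * p + smult z (monom 1 (k + 1)) * p') (q ^ N)" for N
    proof -
      define a where "a = q ^ N"
      have a: "a \<noteq> 0" by (simp add: a_def)
      have "Z N Ep * a ^ 2 = Z N Em + z * a * Z N Ez"
        using Z_skein[OF skein_plus.hyps(1), of N] a unfolding a_def[symmetric] zz by (simp add: field_simps power2_eq_square)
      moreover have "Z N Ep * a ^ (k + k' + 2) = (Z N Ep * a ^ 2) * (a ^ k * a ^ k')"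
        by (simp only: power_add ac_simps)
      ultimately have "Z N Ep * a ^ (k + k' + 2) = (Z N Em + z * a * Z N Ez) * (a ^ k * a ^ k')"
        by simp
      also have "\<dots> = a ^ k' * (Z N Em * a ^ k) + z * a ^ (k + 1) * (Z N Ez * a ^ k')"
        by (simp add: algebra_simps)
      finally show ?thesis unfolding a_def[symmetric] IH(3,4)[of N, folded a_def] by (simp add: poly_monom algebra_simps)
    qed
    moreover have "poly (monom 1 k' * p + smult z (monom 1 (k + 1)) * p') 1 = poly (rpoly (P + [:0, 1:] * Q)) z"
      using IH(1,2) by (simp only: rpoly_simps) (simp add: poly_monom)
    ultimately show ?case unfolding interpolates_def z_def by blast
  next
    case (skein_minus Ep Em Ez P Q)
    from skein_minus.IH obtain p k p' k' where IH: "poly p 1 = poly (rpoly P) z" "poly p' 1 = poly (rpoly Q) z"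
      "Z N Ep * (q ^ N) ^ k = qint N * poly p (q ^ N)" "Z N Ez * (q ^ N) ^ k' = qint N * poly p' (q ^ N)" for N
      unfolding interpolates_def z_def by metis
    have "Z N Em * (q ^ N) ^ (k + k') = qint N * poly (monom 1 (k' + 2) * p - smult z (monom 1 (k + 1)) * p') (q ^ N)" for N
    proof -
      define a where "a = q ^ N"
      have a: "a \<noteq> 0" by (simp add: a_def)
      have "Z N Em = Z N Ep * a ^ 2 - z * a * Z N Ez"
        using Z_skein[OF skein_minus.hyps(1), of N] a unfolding a_def[symmetric] zz by (simp add: field_simps power2_eq_square)
      then have "Z N Em * a ^ (k + k') = (Z N Ep * a ^ 2 - z * a * Z N Ez) * (a ^ k * a ^ k')"
        by (simp add: power_add)
      also have "\<dots> = a ^ (k' + 2) * (Z N Ep * a ^ k) - z * a ^ (k + 1) * (Z N Ez * a ^ k')"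
        by (simp add: algebra_simps power2_eq_square)
      finally show ?thesis unfolding a_def[symmetric] IH(3,4)[of N, folded a_def] by (simp add: poly_monom algebra_simps)
    qed
    moreover have "poly (monom 1 (k' + 2) * p - smult z (monom 1 (k + 1)) * p') 1 = poly (rpoly (P - [:0, 1:] * Q)) z"
      using IH(1,2) by (simp only: rpoly_simps) (simp add: poly_monom)
    ultimately show ?case unfolding interpolates_def z_def by blast
  next
    case (skein_zero Ep Em Ez P Q R)
    from skein_zero.IH obtain p k p' k' where IH: "poly p 1 = poly (rpoly P) z" "poly p' 1 = poly (rpoly Q) z"
      "Z N Ep * (q ^ N) ^ k = qint N * poly p (q ^ N)" "Z N Em * (q ^ N) ^ k' = qint N * poly p' (q ^ N)" for N
      unfolding interpolates_def z_def by metis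
    have "Z N Ez * (q ^ N) ^ (k + k' + 1) = qint N * poly (smult (1 / z) (monom 1 (k' + 2) * p - monom 1 k * p')) (q ^ N)" for N
    proof -
      define a where "a = q ^ N"
      have a: "a \<noteq> 0" by (simp add: a_def)
      have "z * (Z N Ez * a) = Z N Ep * a ^ 2 - Z N Em"
        using Z_skein[OF skein_zero.hyps(1), of N] a unfolding a_def[symmetric] zz by (simp add: field_simps power2_eq_square)
      then have "z * (Z N Ez * a) * (a ^ k * a ^ k') = (Z N Ep * a ^ 2 - Z N Em) * (a ^ k * a ^ k')" by (rule arg_cong)
      also have "\<dots> = a ^ (k' + 2) * (Z N Ep * a ^ k) - a ^ k * (Z N Em * a ^ k')"
        by (simp add: algebra_simps power2_eq_square)
      finally show ?thesis using z unfolding a_def[symmetric] IH(3,4)[of N, folded a_def]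
        by (simp add: poly_monom power_add field_simps)
    qed
    moreover have "poly (smult (1 / z) (monom 1 (k' + 2) * p - monom 1 k * p')) 1 = poly (rpoly R) z"
    proof -
      have "rpoly P - rpoly Q = [:0, 1:] * rpoly R"
        using skein_zero.hyps(4) by (simp only: rpoly_simps flip: rpoly_simps(3))
      then have "poly (rpoly P) z - poly (rpoly Q) z = z * poly (rpoly R) z"
        by (metis (no_types) poly_diff poly_mult poly_pCons poly_0 add_0 mult_zero_right mult.right_neutral add.right_neutral)
      then show ?thesis using IH(1,2) z by (simp add: poly_monom)
    qed
    ultimately show ?case unfolding interpolates_def z_def by blast
  qed
qed

lemma poly_eq_infinite:
  fixes p p' :: "real poly"
  assumes "infinite A" "\<And>x. x \<in> A \<Longrightarrow> poly p x = poly p' x"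
  shows "p = p'"
proof (rule ccontr)
  assume "p \<noteq> p'"
  then have "finite {x. poly (p - p') x = 0}" by (intro poly_roots_finite) simp
  moreover have "A \<subseteq> {x. poly (p - p') x = 0}" using assms(2) by auto
  ultimately show False using assms(1) finite_subset by blast
qed

text \<open>Two Laurent polynomials that agree at infinitely many points \<open>q^N\<close> also
  agree at 1. The points start with \<open>N = 1\<close>, since \<open>qint\<close> vanishes for
  \<open>N = 0\<close>.\<close>

lemma interpolates_unique:
  assumes "interpolates q E P" "interpolates q E P'" "q > 1"
  shows "poly (rpoly P) (q - 1 / q) = poly (rpoly P') (q - 1 / q)"
proof -
  interpret rmatrix q N for N by unfold_locales (rule assms(3))
  obtain p k p' k' where *: "poly p 1 = poly (rpoly P) (q - 1 / q)" "poly p' 1 = poly (rpoly P') (q - 1 / q)"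
    "Z N E * (q ^ N) ^ k = qint N * poly p (q ^ N)" "Z N E * (q ^ N) ^ k' = qint N * poly p' (q ^ N)" for N
    using assms(1,2) unfolding interpolates_def by metis
  have "monom 1 k' * p = monom 1 k * p'"
  proof (rule poly_eq_infinite)
    have "inj (\<lambda>N. q ^ Suc N)" using assms(3) by (auto simp: inj_def)
    then show "infinite (range (\<lambda>N. q ^ Suc N))" by (rule range_inj_infinite)
    fix a assume "a \<in> range (\<lambda>N. q ^ Suc N)"
    then obtain N where a: "a = q ^ Suc N" by auto
    have "qint (Suc N) * (a ^ k' * poly p a) = qint (Suc N) * (a ^ k * poly p' a)"
      using *(3,4)[of "Suc N"] unfolding a[symmetric] by (metis mult.left_commute mult.commute)
    then show "poly (monom 1 k' * p) a = poly (monom 1 k * p') a"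
      using qint_pos[of "Suc N"] by (simp add: poly_monom)
  qed
  from arg_cong[OF this, of "\<lambda>p. poly p 1"] show ?thesis using *(1,2) by (simp add: poly_monom)
qed

text \<open>\<open>q - 1 / q\<close> is strictly increasing for \<open>q > 1\<close>, so the two
  polynomials agree at infinitely many points.\<close>

lemma has_conway_unique:
  assumes "has_conway E P" "has_conway E P'"
  shows "P = P'"
proof (rule rpoly_eq, rule poly_eq_infinite)
  have "strict_mono_on {1<..} (\<lambda>q::real. q - 1 / q)"
    by (rule strict_mono_onI) (auto simp: divide_strict_left_mono intro!: diff_strict_mono)
  then have "inj_on (\<lambda>q::real. q - 1 / q) {1<..}" by (rule strict_mono_on_imp_inj_on)
  then show "infinite ((\<lambda>q::real. q - 1 / q) ` {1<..})"
    by (simp add: finite_image_iff infinite_Ioi)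
  fix x assume "x \<in> (\<lambda>q::real. q - 1 / q) ` {1<..}"
  then obtain q where q: "x = q - 1 / q" "q > 1" by auto
  show "poly (rpoly P) x = poly (rpoly P') x" unfolding q(1)
    using has_conway_interpolates[OF assms(1) q(2)] has_conway_interpolates[OF assms(2) q(2)] q(2)
    by (rule interpolates_unique)
qed

lemma conway_eq: "has_conway E P \<Longrightarrow> conway E = P"
  unfolding conway_def by (blast intro: has_conway_unique)

section \<open>The Conway polynomial of pretzel links\<close>

definition orientable :: "bool list \<Rightarrow> diagram \<Rightarrow> bool list \<Rightarrow> bool" where
  "orientable s D t \<longleftrightarrow> (\<exists>L. oriented_tangle s L t \<and> map snd L = D)"

lemma orientable_Nil [simp]: "orientable s [] t \<longleftrightarrow> s = t"
  by (auto simp: orientable_def)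

lemma orientable_Cons:
  "orientable s ((i, g) # D) t \<longleftrightarrow> i + ins g \<le> length s \<and>
    (\<exists>q. flow g (take (ins g) (drop i s)) q \<and> orientable (take i s @ q @ drop (i + ins g) s) D t)"
proof
  assume "orientable s ((i, g) # D) t"
  then show "i + ins g \<le> length s \<and>
    (\<exists>q. flow g (take (ins g) (drop i s)) q \<and> orientable (take i s @ q @ drop (i + ins g) s) D t)"
    by (auto simp: orientable_def map_eq_Cons_conv oriented_tangle_Cons) blast
next
  assume "i + ins g \<le> length s \<and>
    (\<exists>q. flow g (take (ins g) (drop i s)) q \<and> orientable (take i s @ q @ drop (i + ins g) s) D t)"
  then obtain q L where *: "i + ins g \<le> length s" "flow g (take (ins g) (drop i s)) q"
    "oriented_tangle (take i s @ q @ drop (i + ins g) s) L t" "map snd L = D"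
    by (auto simp: orientable_def)
  then show "orientable s ((i, g) # D) t"
    unfolding orientable_def by (intro exI[of _ "(s, i, g) # L"]) (auto simp: oriented_tangle_Cons)
qed

lemma orientable_append: "orientable s (D @ E) t \<longleftrightarrow> (\<exists>r. orientable s D r \<and> orientable r E t)"
  by (induction D arbitrary: s) (auto simp: orientable_Cons split_paired_all)

lemma orientable_length: "orientable s D t \<Longrightarrow> ok (length s) D \<and> length t = out (length s) D"
  using oriented_tangle_ok by (auto simp: orientable_def)

lemma orientable_sh:
  assumes "ok (length s) D"
  shows "orientable (x @ s @ y) (sh (length x) D) t \<longleftrightarrow> (\<exists>t0. t = x @ t0 @ y \<and> orientable s D t0)"
proof
  assume "orientable (x @ s @ y) (sh (length x) D) t"
  then obtain L where L: "oriented_tangle (x @ s @ y) L t" "map snd L = sh (length x) D"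
    by (auto simp: orientable_def)
  obtain L0 t0 where "L = pad x y L0" "t = x @ t0 @ y" "oriented_tangle s L0 t0" "map snd L0 = D"
    by (rule oriented_tangle_unpad[OF L assms])
  then show "\<exists>t0. t = x @ t0 @ y \<and> orientable s D t0" by (auto simp: orientable_def)
next
  assume "\<exists>t0. t = x @ t0 @ y \<and> orientable s D t0"
  then show "orientable (x @ s @ y) (sh (length x) D) t"
    unfolding orientable_def using oriented_tangle_pad map_snd_pad by blast
qed

definition same_ends :: "nat \<Rightarrow> diagram \<Rightarrow> diagram \<Rightarrow> bool" where
  "same_ends n D D' \<longleftrightarrow> (\<forall>s t. length s = n \<longrightarrow> (orientable s D t \<longleftrightarrow> orientable s D' t))"

lemma same_ends_sh:
  assumes "same_ends k D D'" "ok k D" "ok k D'" "i + k \<le> n"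
  shows "same_ends n (sh i D) (sh i D')"
  unfolding same_ends_def
proof (intro allI impI)
  fix s t :: "bool list" assume n: "length s = n"
  have "i + k \<le> length s" using n assms(4) by simp
  then obtain x s0 y where s: "s = x @ s0 @ y" "length x = i" "length s0 = k" by (rule split_list3)
  then show "orientable s (sh i D) t \<longleftrightarrow> orientable s (sh i D') t"
    using orientable_sh[of s0 D x y t] orientable_sh[of s0 D' x y t] assms by (auto simp: same_ends_def)
qed

lemma take2_drop: "i + 2 \<le> length s \<Longrightarrow> take 2 (drop i s) = [s ! i, s ! (i + 1)]"
  by (simp add: take_Suc_conv_app_nth numeral_2_eq_2)

lemma orientable_simps:
  "orientable s ((i, Cup) # D) t \<longleftrightarrow> i \<le> length s \<and> (\<exists>a. orientable (take i s @ [a, \<not> a] @ drop i s) D t)"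
  "orientable s ((i, Cap) # D) t \<longleftrightarrow> i + 2 \<le> length s \<and> s ! (i + 1) = (\<not> s ! i) \<and>
    orientable (take i s @ drop (i + 2) s) D t"
  "orientable s ((i, Cross b) # D) t \<longleftrightarrow> i + 2 \<le> length s \<and>
    orientable (take i s @ [s ! (i + 1), s ! i] @ drop (i + 2) s) D t"
  by (auto simp: orientable_Cons flow_iff take2_drop)

text \<open>Both sides of a rule join the same pairs of ends, and an arc transports its direction.
  This is what lets an unoriented move be performed on an oriented diagram.\<close>

lemma isotopy_rule_same_ends:
  assumes "isotopy_rule D D'" "ok n D" "ok n D'"
  shows "same_ends n D D'"
  using assms
proof (induction rule: isotopy_rule.induct)
  case (exchange i g k h)
  have n: "i + (ins g + k + ins h) \<le> n" using exchange(2) by (cases g; cases h) auto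
  have "same_ends (ins g + k + ins h) [(0, g), (outs g + k, h)] [(ins g + k, h), (0, g)]"
    unfolding same_ends_def
  proof (intro allI impI)
    fix s t :: "bool list" assume l: "length s = ins g + k + ins h"
    have "0 + ins g \<le> length s" using l by simp
    then obtain x p z where 1: "s = x @ p @ z" "length x = 0" "length p = ins g" by (rule split_list3)
    define m where "m = take k z"
    define p' where "p' = drop k z"
    have s: "s = p @ m @ p'" "length p = ins g" "length m = k" "length p' = ins h"
      using 1 l by (auto simp: m_def p'_def)
    have "orientable s [(0, g), (outs g + k, h)] t \<longleftrightarrow> (\<exists>q q'. flow g p q \<and> flow h p' q' \<and> t = q @ m @ q')"
    proof -
      have "orientable s [(0, g), (outs g + k, h)] t \<longleftrightarrow> (\<exists>q. flow g p q \<and> orientable (q @ m @ p') [(outs g + k, h)] t)"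
        using s by (simp add: orientable_Cons)
      also have "\<dots> \<longleftrightarrow> (\<exists>q q'. flow g p q \<and> flow h p' q' \<and> t = q @ m @ q')"
      proof -
        have "orientable (q @ m @ p') [(outs g + k, h)] t \<longleftrightarrow> (\<exists>q'. flow h p' q' \<and> t = q @ m @ q')" if "flow g p q" for q
          using s flow_length[OF that] by (auto simp: orientable_Cons)
        then show ?thesis by blast
      qed
      finally show ?thesis .
    qed
    moreover have "orientable s [(ins g + k, h), (0, g)] t \<longleftrightarrow> (\<exists>q q'. flow g p q \<and> flow h p' q' \<and> t = q @ m @ q')"
      using s by (auto simp: orientable_Cons)
    ultimately show "orientable s [(0, g), (outs g + k, h)] t \<longleftrightarrow> orientable s [(ins g + k, h), (0, g)] t" by blast
  qed
  then have "same_ends n (sh i [(0, g), (outs g + k, h)]) (sh i [(ins g + k, h), (0, g)])"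
    by (rule same_ends_sh) (use n in \<open>cases g; cases h; auto\<close>)+
  then show ?case by (simp add: ac_simps)
next
  case (zigzag_left i)
  have "same_ends n (sh i [(0, Cup), (1, Cap)]) (sh i [])"
    by (rule same_ends_sh[where k = 1])
      (use zigzag_left in \<open>auto simp: same_ends_def length_Suc_conv orientable_simps ex_bool_eq\<close>)
  then show ?case by simp
next
  case (zigzag_right i)
  have "same_ends n (sh i [(1, Cup), (0, Cap)]) (sh i [])"
    by (rule same_ends_sh[where k = 1])
      (use zigzag_right in \<open>auto simp: same_ends_def length_Suc_conv orientable_simps ex_bool_eq\<close>)
  then show ?case by simp
next
  case (slide_cup i b)
  have "same_ends n (sh i [(0, Cup), (1, Cross b)]) (sh i [(1, Cup), (0, Cross (\<not> b))])"
    by (rule same_ends_sh[where k = 1])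
      (use slide_cup in \<open>auto simp: same_ends_def length_Suc_conv orientable_simps ex_bool_eq\<close>)
  then show ?case by simp
next
  case (slide_cap i b)
  have "same_ends n (sh i [(1, Cross b), (0, Cap)]) (sh i [(0, Cross (\<not> b)), (1, Cap)])"
    by (rule same_ends_sh[where k = 3])
      (use slide_cap in \<open>auto simp: same_ends_def numeral_3_eq_3 length_Suc_conv orientable_simps\<close>)
  then show ?case by simp
next
  case (reidemeister1_cup i b)
  have "same_ends n (sh i [(0, Cup), (0, Cross b)]) (sh i [(0, Cup)])"
    by (rule same_ends_sh[where k = 0])
      (use reidemeister1_cup in \<open>auto simp: same_ends_def orientable_simps ex_bool_eq\<close>)
  then show ?case by simp
next
  case (reidemeister1_cap i b)
  have "same_ends n (sh i [(0, Cross b), (0, Cap)]) (sh i [(0, Cap)])"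
    by (rule same_ends_sh[where k = 2])
      (use reidemeister1_cap in \<open>auto simp: same_ends_def numeral_2_eq_2 length_Suc_conv orientable_simps\<close>)
  then show ?case by simp
next
  case (reidemeister2 i b)
  have "same_ends n (sh i [(0, Cross b), (0, Cross (\<not> b))]) (sh i [])"
    by (rule same_ends_sh[where k = 2])
      (use reidemeister2 in \<open>auto simp: same_ends_def numeral_2_eq_2 length_Suc_conv orientable_simps\<close>)
  then show ?case by simp
next
  case (reidemeister3 a c b i)
  have "same_ends n (sh i [(0, Cross a), (1, Cross b), (0, Cross c)]) (sh i [(1, Cross c), (0, Cross b), (1, Cross a)])"
    by (rule same_ends_sh[where k = 3])
      (use reidemeister3 in \<open>auto simp: same_ends_def numeral_3_eq_3 length_Suc_conv orientable_simps\<close>)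
  then show ?case by simp
qed

lemma lift_change:
  assumes "tangle_change isotopy_rule (length s) D D'" "oriented_tangle [] u s" "oriented_tangle t v []"
    "oriented_tangle s L t" "map snd L = D'"
  shows "\<exists>L0. oriented_tangle s L0 t \<and> map snd L0 = D \<and>
    (\<forall>P. has_conway (u @ L0 @ v) P \<longrightarrow> has_conway (u @ L @ v) P)"
proof -
  obtain w l r w' where D: "D = w @ l @ w'" "D' = w @ r @ w'" "isotopy_rule l r \<or> isotopy_rule r l"
    "ok (length s) D" "ok (length s) D'"
    using assms(1) by (auto simp: tangle_change_def)
  obtain A L' x where 1: "L = A @ L'" "oriented_tangle s A x" "oriented_tangle x L' t" "map snd A = w" "map snd L' = r @ w'"
    using oriented_tangle_append_map[OF assms(4), of w "r @ w'"] assms(5) D(2) by auto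
  obtain R B y where 2: "L' = R @ B" "oriented_tangle x R y" "oriented_tangle y B t" "map snd R = r" "map snd B = w'"
    using oriented_tangle_append_map[OF 1(3,5)] .
  have "length x = out (length s) w" using oriented_tangle_ok[OF 1(2)] 1(4) by simp
  then have "ok (length x) l" "ok (length x) r" using D(4,5) by (simp_all add: D(1,2))
  then have "same_ends (length x) l r \<or> same_ends (length x) r l" using D(3) isotopy_rule_same_ends by blast
  then have "orientable x l y" using 2(2,4) unfolding same_ends_def orientable_def by blast
  then obtain R0 where R0: "oriented_tangle x R0 y" "map snd R0 = l" by (auto simp: orientable_def)
  have "oriented_isotopy_step (u @ (A @ R0 @ B) @ v) (u @ L @ v)"
    unfolding oriented_isotopy_step_def
  proof (intro exI conjI)
    show "u @ (A @ R0 @ B) @ v = (u @ A) @ R0 @ (B @ v)" "u @ L @ v = (u @ A) @ R @ (B @ v)"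
      by (simp_all add: 1(1) 2(1))
    show "oriented_tangle [] (u @ A) x" "oriented_tangle y (B @ v) []"
      using assms(2,3) 1(2) 2(3) by (auto simp: oriented_tangle_append)
  qed (use R0 2 D(3) in simp_all)
  then have "\<forall>P. has_conway (u @ (A @ R0 @ B) @ v) P \<longrightarrow> has_conway (u @ L @ v) P"
    by (blast intro: has_conway.isotopy)
  moreover have "oriented_tangle s (A @ R0 @ B) t" using 1 2 R0 by (auto simp: oriented_tangle_append)
  moreover have "map snd (A @ R0 @ B) = D" using 1 2 R0 D(1) by simp
  ultimately show ?thesis by blast
qed

text \<open>The orientation of the target is given and one of the source is constructed, because
  \<open>val\<close> quantifies over all orientations: \<open>val_moves\<close> has to start from an
  arbitrary orientation of the target.\<close>

lemma lift_moves:
  assumes "moves (length s) 0 D D'" "oriented_tangle [] u s" "oriented_tangle t v []"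
    "oriented_tangle s L t" "map snd L = D'"
  shows "\<exists>L0. oriented_tangle s L0 t \<and> map snd L0 = D \<and>
    (\<forall>P. has_conway (u @ L0 @ v) P \<longrightarrow> has_conway (u @ L @ v) P)"
proof -
  have "moves (length s) k D D' \<Longrightarrow> k = 0 \<Longrightarrow> oriented_tangle s L t \<Longrightarrow> map snd L = D' \<Longrightarrow> ?thesis" for k
  proof (induction arbitrary: L rule: moves.induct)
    case (moves_iso k D E F)
    from lift_change[OF moves_iso.hyps(2) assms(2,3) moves_iso.prems(2,3)] obtain L1 where
      "oriented_tangle s L1 t" "map snd L1 = E" "\<forall>P. has_conway (u @ L1 @ v) P \<longrightarrow> has_conway (u @ L @ v) P" by blast
    with moves_iso.IH[OF moves_iso.prems(1)] show ?case by metis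
  qed auto
  then show ?thesis using assms by blast
qed

text \<open>Quantifying over all orientations spares an argument that the orientation with given ends is unique.\<close>

definition val :: "oriented_diagram \<Rightarrow> bool list \<Rightarrow> oriented_diagram \<Rightarrow> bool list \<Rightarrow> diagram \<Rightarrow> int poly \<Rightarrow> bool" where
  "val u s v t D P \<longleftrightarrow> oriented_tangle [] u s \<and> oriented_tangle t v [] \<and>
    (\<forall>L. oriented_tangle s L t \<longrightarrow> map snd L = D \<longrightarrow> has_conway (u @ L @ v) P)"

lemma val_moves:
  assumes "moves (length s) 0 D D'" "val u s v t D P"
  shows "val u s v t D' P"
  unfolding val_def
proof (intro conjI allI impI)
  fix L assume L: "oriented_tangle s L t" "map snd L = D'"
  obtain L0 where L0: "oriented_tangle s L0 t" "map snd L0 = D" "has_conway (u @ L0 @ v) P \<Longrightarrow> has_conway (u @ L @ v) P"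
    using lift_moves[OF assms(1) _ _ L, of u v] assms(2) by (auto simp: val_def)
  then show "has_conway (u @ L @ v) P" using assms(2) by (simp add: val_def)
qed (use assms(2) in \<open>auto simp: val_def\<close>)

lemma valD: "val u s v t D P \<Longrightarrow> oriented_tangle s L t \<Longrightarrow> map snd L = D \<Longrightarrow> has_conway (u @ L @ v) P"
  by (simp add: val_def)

text \<open>Between antiparallel strands \<open>Cross False\<close> is the positive crossing, hence
  the signs. The smoothing is then cap below cup whichever strand runs upwards, so all three terms
  are values of unoriented diagrams.\<close>

lemma val_skein:
  assumes anti: "\<And>r. orientable s A r \<Longrightarrow> orientable r ((i, Cross b) # B) t \<Longrightarrow> r ! (i + 1) = (\<not> r ! i)"
    and V: "val u s v t (A @ [(i, Cross (\<not> b))] @ B) P" "val u s v t (A @ [(i, Cap), (i, Cup)] @ B) Q"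
  shows "val u s v t (A @ [(i, Cross b)] @ B) (if b then P - [:0, 1:] * Q else P + [:0, 1:] * Q)"
  unfolding val_def
proof (intro conjI allI impI)
  fix L assume L: "oriented_tangle s L t" "map snd L = A @ [(i, Cross b)] @ B"
  obtain LA L' r where 1: "L = LA @ L'" "oriented_tangle s LA r" "oriented_tangle r L' t" "map snd LA = A"
    "map snd L' = [(i, Cross b)] @ B" by (rule oriented_tangle_append_map[OF L])
  have "orientable r ((i, Cross b) # B) t" "orientable s A r" using 1 by (auto simp: orientable_def)
  then have "r ! (i + 1) = (\<not> r ! i)" using anti by blast
  obtain LB where 2: "L' = (r, i, Cross b) # LB" "map snd LB = B" using 1(3,5)
    by (cases L') (auto simp: oriented_tangle_Cons)
  from 1(3) have i: "i + 2 \<le> length r" by (simp add: 2 oriented_tangle_Cons)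
  define x where "x = take i r"
  define y where "y = drop (i + 2) r"
  define a where "a = r ! i"
  have "r = take i r @ take 2 (drop i r) @ drop (i + 2) r" by (metis append_take_drop_id drop_drop add.commute)
  then have r: "r = x @ [a, \<not> a] @ y" "length x = i"
    using i unfolding take2_drop[OF i] \<open>r ! (i + 1) = (\<not> r ! i)\<close> x_def y_def a_def by simp_all
  have B: "oriented_tangle (x @ [\<not> a, a] @ y) LB t"
    using 1(3) r by (simp add: 2 oriented_tangle_Cons flow_iff)
  have uv: "oriented_tangle [] u s" "oriented_tangle t v []" using V(1) by (auto simp: val_def)
  have "oriented_tangle r [(r, i, Cross c)] (x @ [\<not> a, a] @ y)" for c
    using r by (simp add: oriented_tangle_Cons flow_iff)
  then have c: "oriented_tangle s (LA @ [(r, i, Cross c)] @ LB) t" for c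
    unfolding oriented_tangle_append using 1(2) B by blast
  have "oriented_tangle r [(r, i, Cap), (x @ y, i, Cup)] (x @ [\<not> a, a] @ y)"
    using r by (auto simp: oriented_tangle_Cons flow_iff)
  then have z: "oriented_tangle s (LA @ [(r, i, Cap), (x @ y, i, Cup)] @ LB) t"
    unfolding oriented_tangle_append using 1(2) B by blast
  have P: "has_conway (u @ (LA @ [(r, i, Cross (\<not> b))] @ LB) @ v) P"
    by (rule valD[OF V(1) c]) (simp add: 1 2)
  have Q: "has_conway (u @ (LA @ [(r, i, Cap), (x @ y, i, Cup)] @ LB) @ v) Q"
    by (rule valD[OF V(2) z]) (simp add: 1 2)
  have T: "skein_triple (u @ (LA @ [(r, i, Cross False)] @ LB) @ v) (u @ (LA @ [(r, i, Cross True)] @ LB) @ v)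
     (u @ (LA @ [(r, i, Cap), (x @ y, i, Cup)] @ LB) @ v)"
    unfolding skein_triple_def
  proof (intro exI conjI)
    show "skein_local r (x @ [\<not> a, a] @ y) [(r, i, Cross False)] [(r, i, Cross True)] [(r, i, Cap), (x @ y, i, Cup)]"
      using r by (intro skein_local.antiparallel) auto
    show "oriented_tangle [] (u @ LA) r" "oriented_tangle (x @ [\<not> a, a] @ y) (LB @ v) []"
      using uv 1(2) B by (auto simp: oriented_tangle_append)
  qed simp_all
  show "has_conway (u @ L @ v) (if b then P - [:0, 1:] * Q else P + [:0, 1:] * Q)"
    using has_conway.skein_plus[OF T _ Q, of P] has_conway.skein_minus[OF T _ Q, of P] P
    by (cases b) (simp_all add: 1(1) 2(1))
qed (use V in \<open>auto simp: val_def\<close>)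

lemma orientable_pw:
  "orientable (x @ [d, e] @ y) (pw (length x) k @ D) t \<longleftrightarrow>
    orientable (x @ (if odd k then [e, d] else [d, e]) @ y) D t"
proof -
  have "orientable (x @ [d, e] @ y) (replicate n (length x, Cross b) @ D) t \<longleftrightarrow>
    orientable (x @ (if odd n then [e, d] else [d, e]) @ y) D t" for n b
    by (induction n arbitrary: d e) (auto simp: orientable_simps nth_append)
  then show ?thesis by (simp add: pw_def even_nat_iff)
qed

lemma orientable_T:
  "orientable (x @ [d, e] @ y) (sh (length x) (T ps) @ D) t \<longleftrightarrow>
    (\<exists>f g. orientable [d, e] (T ps) [f, g] \<and> orientable (x @ [f, g] @ y) D t)"
proof -
  have "orientable (x @ [d, e] @ y) (sh (length x) (T ps) @ D) t
    \<longleftrightarrow> (\<exists>t0. orientable [d, e] (T ps) t0 \<and> orientable (x @ t0 @ y) D t)"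
    unfolding orientable_append using orientable_sh[of "[d, e]" "T ps" x y] by auto
  also have "\<dots> \<longleftrightarrow> (\<exists>f g. orientable [d, e] (T ps) [f, g] \<and> orientable (x @ [f, g] @ y) D t)"
  proof -
    have "\<exists>f g. t0 = [f, g]" if "orientable [d, e] (T ps) t0" for t0
      using orientable_length[OF that] by (auto simp: length_Suc_conv)
    then show ?thesis by blast
  qed
  finally show ?thesis .
qed

lemmas orientable_pw' = orientable_pw[of "[]", simplified] orientable_pw[of "[_, _]", simplified, folded numeral_2_eq_2]
lemmas orientable_T' = orientable_T[of "[]", simplified] orientable_T[of "[_, _]", simplified, folded numeral_2_eq_2]
  orientable_T[of "[_, _, _, _]", simplified]

lemma orientable_T_Cons:
  assumes "odd p"
  shows "orientable [d, e] (T (p # ps)) t \<longleftrightarrow>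
    (\<exists>b f g. orientable [\<not> b, e] (T ps) [f, g] \<and> f = (\<not> d) \<and> t = [b, g])"
  using assms by (simp add: T.simps(2) orientable_simps orientable_pw' orientable_T' ) blast

text \<open>Used for an odd number of columns: the directions below \<open>T ps\<close> then fix
  those above it, so \<open>valW\<close> covers every orientation of the closure.\<close>

lemma orientable_T_ends:
  assumes "\<And>p. p \<in> set ps \<Longrightarrow> odd p" "orientable [d, e] (T ps) [f, g]"
  shows "if even (length ps) then e = (\<not> d) \<and> g = (\<not> f) else f = e \<and> g = d"
  using assms
proof (induction ps arbitrary: d e f g)
  case Nil
  then show ?case by (auto simp: orientable_simps)
next
  case (Cons p ps)
  obtain h k where "orientable [\<not> f, e] (T ps) [h, k]" "h = (\<not> d)" "k = g"
    using Cons.prems by (auto simp: orientable_T_Cons)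
  with Cons.IH[of "\<not> f" e h k] Cons.prems(1) show ?case by (auto split: if_splits)
qed

lemma orientable_T_exists:
  assumes "\<And>p. p \<in> set ps \<Longrightarrow> odd p" shows "orientable [a, \<not> a] (T ps) [\<not> a, a]"
  using assms
proof (induction ps)
  case Nil
  then show ?case by (auto simp: orientable_simps)
next
  case (Cons p ps)
  then show ?case by (auto simp: orientable_T_Cons)
qed

section \<open>The skein relation in the first and second column\<close>

lemma untwist_cup: "moves 0 0 ([(0, Cup)] @ pw 0 k) [(0, Cup)]"
proof -
  have "moves 0 0 ([(0, Cup)] @ replicate n (0, Cross b)) [(0, Cup)]" for n b
  proof (induction n)
    case (Suc n)
    have "moves 0 0 ([] @ sh 0 ([(0, Cup)] @ pw 0 (if b then 1 else -1)) @ replicate n (0, Cross b))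
        ([] @ sh 0 [(0, Cup)] @ replicate n (0, Cross b))"
      by (rule moves_context[OF r1_cup_pw1]) (use moves_ok1[OF Suc.IH] in \<open>auto simp: pw_sgn\<close>)
    then have "moves 0 0 ([(0, Cup)] @ replicate (Suc n) (0, Cross b)) ([(0, Cup)] @ replicate n (0, Cross b))"
      by (simp add: pw_sgn)
    from moves_trans0(1)[OF this Suc.IH] show ?case .
  qed (simp add: moves_refl)
  then show ?thesis by (simp add: pw_def)
qed

text \<open>The smoothing leaves the other \<open>k\<close> crossings as curls on a minimum; once
  they are removed, the column opens into zigzags.\<close>

lemma smooth_column:
  "moves 2 0 ([(1, Cup)] @ [(0, Cap), (0, Cup)] @ pw 0 k @ sh 2 (T ps) @ [(1, Cap)]) (T ps)"
proof -
  have "moves 2 0 ([(1, Cup)] @ [(0, Cap), (0, Cup)] @ pw 0 k @ sh 2 (T ps) @ [(1, Cap)])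
      ([(0, Cup)] @ pw 0 k @ sh 2 (T ps) @ [(1, Cap)])"
    by (rule moves_subst[OF zigzag2, where u = "[]" and j = 0 and v = "[(0, Cup)] @ pw 0 k @ sh 2 (T ps) @ [(1, Cap)]"])
      (simp_all add: eval_nat_numeral)
  also have "moves 2 0 \<dots> ([(0, Cup)] @ sh 2 (T ps) @ [(1, Cap)])"
    by (rule moves_subst[OF untwist_cup[of k], where u = "[]" and j = 0 and v = "sh 2 (T ps) @ [(1, Cap)]"])
      (simp_all add: eval_nat_numeral)
  also have "moves 2 0 \<dots> (T ps @ [(0, Cup)] @ [(1, Cap)])"
    using moves_context[OF exchange_lists[of 0 "[(0, Cup)]" 0 2 "T ps"], of 2 "[]" 0 "[(1, Cap)]"]
    by (simp add: eval_nat_numeral)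
  also have "moves 2 0 \<dots> (T ps)"
    by (rule moves_subst[OF zigzag1, where u = "T ps" and j = 0 and v = "[]"]) (simp_all add: eval_nat_numeral)
  finally show ?thesis .
qed

lemma merge_column:
  assumes "p = k + (if b then 1 else -1)"
  shows "moves 2 0 ([(1, Cup)] @ [(0, Cross b)] @ pw 0 k @ sh 2 (T ps) @ [(1, Cap)]) (T (p # ps))"
  by (rule moves_subst[OF pwA[of p "if b then 1 else -1" k], where u = "[(1, Cup)]" and j = 0 and v = "sh 2 (T ps) @ [(1, Cap)]"])
    (use assms in \<open>auto simp: pw_sgn T.simps(2) eval_nat_numeral\<close>)

lemma in_second_column:
  assumes "moves 2 0 ([(1, Cup)] @ M @ pw 0 k @ sh 2 (T ps) @ [(1, Cap)]) D" "ok 4 M" "out 4 M = 4"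
  shows "moves 2 0 ([(1, Cup)] @ pw 0 c @ [(3, Cup)] @ sh 2 M @ pw 2 k @ sh 4 (T ps) @ [(3, Cap)] @ [(1, Cap)])
    ([(1, Cup)] @ pw 0 c @ sh 2 D @ [(1, Cap)])"
proof -
  have "ok 6 (sh 2 M) \<and> out 6 (sh 2 M) = 6" using assms(2,3) out_sh[of 4 M 2] ok_sh[of 4 2 M] by simp
  then show ?thesis
    by (intro moves_subst[OF assms(1), where u = "[(1, Cup)] @ pw 0 c" and j = 2 and v = "[(1, Cap)]"])
      (simp_all add: eval_nat_numeral)
qed

text \<open>The crossing \<open>b\<close> and the even rest \<open>k\<close> form an odd column, so
  its right strand ends at the outer left corner. The direction prescribed there is
  \<open>\<not> a\<close>, opposite to that of the left strand.\<close>

lemma orientable_first_column: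
  assumes "orientable [a, \<not> a] [(1, Cup)] r" "even k"
    "orientable r ((0, Cross b) # pw 0 k @ sh 2 (T ps) @ [(1, Cap)]) [\<not> a, a]"
  shows "r ! 1 = (\<not> r ! 0)"
  using assms by (auto simp: orientable_simps orientable_pw' orientable_T')

lemma orientable_second_column:
  assumes "orientable [a, \<not> a] ([(1, Cup)] @ pw 0 c @ [(3, Cup)]) r" "even k" "odd c"
    "orientable r ((2, Cross b) # pw 2 k @ sh 4 (T ps) @ [(3, Cap)] @ [(1, Cap)]) [\<not> a, a]"
  shows "r ! 3 = (\<not> r ! 2)"
  using assms by (auto simp: orientable_simps orientable_pw[of "[]", simplified] orientable_pw[of "[_, _]", simplified]
      orientable_T[of "[_, _, _, _]", simplified] eval_nat_numeral)

abbreviation "valT u v a \<equiv> (\<lambda>ps. val u [a, \<not> a] v [\<not> a, a] (T ps))"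

lemma val_first_column:
  assumes "odd p" "valT u v a (p # ps) P" "valT u v a ps Q"
  shows "valT u v a ((p + 2) # ps) (P - [:0, 1:] * Q)" "valT u v a ((p - 2) # ps) (P + [:0, 1:] * Q)"
proof -
  have *: "valT u v a ((p + (if b then 2 else -2)) # ps) (if b then P - [:0, 1:] * Q else P + [:0, 1:] * Q)" for b
  proof -
    define k where "k = p + (if b then 1 else -1)"
    have k: "even k" using assms(1) by (simp add: k_def)
    define B where "B = pw 0 k @ sh 2 (T ps) @ [(1, Cap)]"
    have "val u [a, \<not> a] v [\<not> a, a] ([(1, Cup)] @ [(0, Cross b)] @ B) (if b then P - [:0, 1:] * Q else P + [:0, 1:] * Q)"
    proof (rule val_skein)
      show "r ! (0 + 1) = (\<not> r ! 0)" if "orientable [a, \<not> a] [(1, Cup)] r"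
        "orientable r ((0, Cross b) # B) [\<not> a, a]" for r
        using orientable_first_column[OF that(1) k] that(2) by (simp add: B_def)
      show "val u [a, \<not> a] v [\<not> a, a] ([(1, Cup)] @ [(0, Cross (\<not> b))] @ B) P"
        by (rule val_moves[OF _ assms(2)], rule moves_sym)
          (use merge_column[of p k "\<not> b" ps] in \<open>auto simp: B_def k_def eval_nat_numeral\<close>)
      show "val u [a, \<not> a] v [\<not> a, a] ([(1, Cup)] @ [(0, Cap), (0, Cup)] @ B) Q"
        by (rule val_moves[OF _ assms(3)], rule moves_sym)
          (use smooth_column[of k ps] in \<open>auto simp: B_def eval_nat_numeral\<close>)
    qed
    then show ?thesis
      by (rule val_moves[rotated]) (use merge_column[of "p + (if b then 2 else -2)" k b ps] in
          \<open>auto simp: B_def k_def eval_nat_numeral\<close>)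
  qed
  show "valT u v a ((p + 2) # ps) (P - [:0, 1:] * Q)" "valT u v a ((p - 2) # ps) (P + [:0, 1:] * Q)"
    using *[of True] *[of False] by simp_all
qed

lemma val_second_column:
  assumes "odd c" "odd p" "valT u v a (c # p # ps) P" "valT u v a (c # ps) Q"
  shows "valT u v a (c # (p + 2) # ps) (P - [:0, 1:] * Q)" "valT u v a (c # (p - 2) # ps) (P + [:0, 1:] * Q)"
proof -
  have *: "valT u v a (c # (p + (if b then 2 else -2)) # ps) (if b then P - [:0, 1:] * Q else P + [:0, 1:] * Q)" for b
  proof -
    define k where "k = p + (if b then 1 else -1)"
    have k: "even k" using assms(2) by (simp add: k_def)
    define A where "A = [(1, Cup)] @ pw 0 c @ [(3, Cup)]"
    define B where "B = pw 2 k @ sh 4 (T ps) @ [(3, Cap)] @ [(1, Cap)]"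
    have "val u [a, \<not> a] v [\<not> a, a] (A @ [(2, Cross b)] @ B) (if b then P - [:0, 1:] * Q else P + [:0, 1:] * Q)"
    proof (rule val_skein)
      show "r ! (2 + 1) = (\<not> r ! 2)" if "orientable [a, \<not> a] A r"
        "orientable r ((2, Cross b) # B) [\<not> a, a]" for r
        using orientable_second_column[OF that(1)[unfolded A_def] k assms(1)] that(2) by (simp add: B_def)
      show "val u [a, \<not> a] v [\<not> a, a] (A @ [(2, Cross (\<not> b))] @ B) P"
        by (rule val_moves[OF _ assms(3)], rule moves_sym)
          (use in_second_column[OF merge_column[of p k "\<not> b" ps], of c] in
            \<open>auto simp: A_def B_def k_def T.simps(2)[of c] eval_nat_numeral\<close>)
      show "val u [a, \<not> a] v [\<not> a, a] (A @ [(2, Cap), (2, Cup)] @ B) Q"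
        by (rule val_moves[OF _ assms(4)], rule moves_sym)
          (use in_second_column[OF smooth_column[of k ps], of c] in
            \<open>auto simp: A_def B_def T.simps(2)[of c] eval_nat_numeral\<close>)
    qed
    then show ?thesis
      by (rule val_moves[rotated]) (use in_second_column[OF merge_column[of "p + (if b then 2 else -2)" k b ps], of c] in
          \<open>auto simp: A_def B_def k_def T.simps(2)[of c] eval_nat_numeral\<close>)
  qed
  show "valT u v a (c # (p + 2) # ps) (P - [:0, 1:] * Q)" "valT u v a (c # (p - 2) # ps) (P + [:0, 1:] * Q)"
    using *[of True] *[of False] by simp_all
qed

text \<open>For odd \<open>n\<close> the closure is a knot. For even \<open>n\<close> it has two
  components, with linking number \<open>- s / 2\<close> as linear coefficient. These data suffice
  to run the skein recursion up to degree 2.\<close>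

definition conway_coeffs :: "nat \<Rightarrow> int \<Rightarrow> int \<Rightarrow> int poly \<Rightarrow> bool" where
  "conway_coeffs n s e P \<longleftrightarrow> (if odd n
     then coeff P 0 = 1 \<and> coeff P 1 = 0 \<and> 8 * coeff P 2 = 2 * e + int n - 1
     else coeff P 0 = 0 \<and> 2 * coeff P 1 = - s \<and> coeff P 2 = 0)"

text \<open>Changing one column by 2 changes \<open>e2\<close> by twice the sum \<open>s'\<close> of
  the others, in accordance with the linear coefficient of the link without that column.\<close>

lemma conway_coeffs_step:
  assumes "conway_coeffs (Suc n) s e P" "conway_coeffs n s' e' Q"
  shows "conway_coeffs (Suc n) (s + 2) (e + 2 * s') (P - [:0, 1:] * Q)"
    "conway_coeffs (Suc n) (s - 2) (e - 2 * s') (P + [:0, 1:] * Q)"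
proof -
  have "coeff ([:0, 1:] * Q) 0 = 0" "coeff ([:0, 1:] * Q) 1 = coeff Q 0" "coeff ([:0, 1:] * Q) 2 = coeff Q 1"
    by (simp_all add: numeral_2_eq_2)
  then show "conway_coeffs (Suc n) (s + 2) (e + 2 * s') (P - [:0, 1:] * Q)"
    "conway_coeffs (Suc n) (s - 2) (e - 2 * s') (P + [:0, 1:] * Q)"
    using assms unfolding conway_coeffs_def coeff_diff coeff_add by (auto simp del: mult_pCons_left)
qed

lemma odd_int_induct:
  fixes p c :: int
  assumes "R c" "odd c" "odd p"
    "\<And>p. odd p \<Longrightarrow> R p \<Longrightarrow> R (p + 2)" "\<And>p. odd p \<Longrightarrow> R p \<Longrightarrow> R (p - 2)"
  shows "R p"
proof -
  have up: "R (c + 2 * int m)" for m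
  proof (induction m)
    case (Suc m)
    have "odd (c + 2 * int m)" using assms(2) by simp
    from assms(4)[OF this Suc] show ?case by (simp add: algebra_simps)
  qed (simp add: assms)
  have down: "R (c - 2 * int m)" for m
  proof (induction m)
    case (Suc m)
    have "odd (c - 2 * int m)" using assms(2) by simp
    from assms(5)[OF this Suc] show ?case by (simp add: algebra_simps)
  qed (simp add: assms)
  have "even (p - c)" using assms(2,3) by simp
  then obtain k where "p - c = 2 * k" by (rule evenE)
  then have k: "p = c + 2 * k" by simp
  show ?thesis using up[of "nat k"] down[of "nat (- k)"] by (cases "k \<ge> 0") (auto simp: k)
qed

abbreviation "valW a \<equiv> valT [([], 0, Cup)] [([\<not> a, a], 0, Cap)] a"

lemma val_trivial: "val [] [] [] [] [(0, Cup), (0, Cap)] 1"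
  by (auto simp: val_def orientation_of_def trivial_knot_def intro!: has_conway.trivial)

lemma has_conway_curl:
  "has_conway [([], 0, Cup), ([a, \<not> a], 0, Cross b), ([\<not> a, a], 0, Cap)] 1"
proof -
  have "moves 0 0 [(0, Cup), (0, Cap)] ([(0, Cup)] @ [(0, Cross b)] @ [(0, Cap)])"
    by (rule moves_subst_rev[OF untwist_cup[of "if b then 1 else -1"], where u = "[]" and j = 0 and v = "[(0, Cap)]"])
      (auto simp: pw_sgn numeral_2_eq_2)
  then have "val [] [] [] [] [(0, Cup), (0, Cross b), (0, Cap)] 1"
    using val_moves[OF _ val_trivial] by simp
  from valD[OF this, of "[([], 0, Cup), ([a, \<not> a], 0, Cross b), ([\<not> a, a], 0, Cap)]"]
  show ?thesis by (simp add: oriented_simps)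
qed

text \<open>A positive and a negative curl are both trivial, so \<open>skein_zero\<close> is applied
  to the difference 1 - 1.\<close>

lemma val_unlink: "valW a [] 0"
proof -
  have "has_conway ([([], 0, Cup)] @ L @ [([\<not> a, a], 0, Cap)]) 0"
    if "oriented_tangle [a, \<not> a] L [\<not> a, a]" "map snd L = T []" for L
  proof -
    have L: "L = [([a, \<not> a], 0, Cap), ([], 0, Cup)]" using that by (auto simp: oriented_simps)
    have "skein_triple ([([], 0, Cup)] @ [([a, \<not> a], 0, Cross False)] @ [([\<not> a, a], 0, Cap)])
       ([([], 0, Cup)] @ [([a, \<not> a], 0, Cross True)] @ [([\<not> a, a], 0, Cap)]) ([([], 0, Cup)] @ L @ [([\<not> a, a], 0, Cap)])"
      unfolding skein_triple_def L
    proof (intro exI conjI)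
      show "skein_local [a, \<not> a] [\<not> a, a] [([a, \<not> a], 0, Cross False)] [([a, \<not> a], 0, Cross True)]
        [([a, \<not> a], 0, Cap), ([], 0, Cup)]"
        using skein_local.antiparallel[of "[a, \<not> a]" "[]" a "[]" "[\<not> a, a]" 0] by simp
      show "oriented_tangle [] [([], 0, Cup)] [a, \<not> a]" "oriented_tangle [\<not> a, a] [([\<not> a, a], 0, Cap)] []"
        by (auto simp: oriented_simps)
    qed (rule refl)+
    from has_conway.skein_zero[OF this, of 1 1 0] show ?thesis
      using has_conway_curl[of a] by simp
  qed
  then show ?thesis by (auto simp: val_def oriented_simps)
qed

lemma val_single: "valW a [1] 1"
proof -
  have "val [([], 0, Cup)] [a, \<not> a] [([\<not> a, a], 0, Cap)] [\<not> a, a] (pw 0 1) 1"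
    unfolding val_def using has_conway_curl[of a True] by (auto simp: oriented_simps pw_sgn)
  then show ?thesis
    by (rule val_moves[rotated]) (use moves_sym[OF T_single[of 1]] in \<open>simp add: numeral_2_eq_2\<close>)
qed

text \<open>The skein relation in the first column reduces it to 1; the relation in the second
  column then reduces that one to -1, where it cancels the first. All other links involved have
  fewer columns.\<close>

lemma val_T:
  assumes "\<And>p. p \<in> set ps \<Longrightarrow> odd p"
  shows "\<exists>P. valW a ps P \<and> conway_coeffs (length ps) (sum_list ps) (e2 ps) P"
  using assms
proof (induction ps rule: length_induct)
  case (1 ps)
  have IH: "\<exists>P. valW a qs P \<and> conway_coeffs (length qs) (sum_list qs) (e2 qs) P"
    if "length qs < length ps" "set qs \<subseteq> {p. odd p}" for qs
    using 1(1) that by blast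
  define R where "R = (\<lambda>ps. \<exists>P. valW a ps P \<and> conway_coeffs (length ps) (sum_list ps) (e2 ps) P)"
  have first: "R ((p + 2) # qs) \<and> R ((p - 2) # qs)" if H: "R qs" "odd p" "R (p # qs)" for p qs
  proof -
    obtain P Q where P: "valW a (p # qs) P" "conway_coeffs (Suc (length qs)) (sum_list (p # qs)) (e2 (p # qs)) P"
      and Q: "valW a qs Q" "conway_coeffs (length qs) (sum_list qs) (e2 qs) Q"
      using H(1,3) by (auto simp: R_def)
    have "conway_coeffs (length ((p + 2) # qs)) (sum_list ((p + 2) # qs)) (e2 ((p + 2) # qs)) (P - [:0, 1:] * Q)"
      "conway_coeffs (length ((p - 2) # qs)) (sum_list ((p - 2) # qs)) (e2 ((p - 2) # qs)) (P + [:0, 1:] * Q)"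
      using conway_coeffs_step[OF P(2) Q(2)] by (simp_all add: algebra_simps)
    then show ?thesis unfolding R_def using val_first_column[OF H(2) P(1) Q(1)] by blast
  qed
  have reduce: "R (p # qs)" if "R qs" "R (1 # qs)" "odd p" for p qs
    by (rule odd_int_induct[where c = 1 and R = "\<lambda>p. R (p # qs)"]) (use that first in auto)
  have second: "R (c # (p + 2) # qs) \<and> R (c # (p - 2) # qs)"
    if H: "R (c # qs)" "odd c" "odd p" "R (c # p # qs)" for c p qs
  proof -
    obtain P Q where P: "valW a (c # p # qs) P" "conway_coeffs (Suc (length (c # qs))) (sum_list (c # p # qs)) (e2 (c # p # qs)) P"
      and Q: "valW a (c # qs) Q" "conway_coeffs (length (c # qs)) (sum_list (c # qs)) (e2 (c # qs)) Q"
      using H(1,4) by (auto simp: R_def)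
    have "conway_coeffs (length (c # (p + 2) # qs)) (sum_list (c # (p + 2) # qs)) (e2 (c # (p + 2) # qs)) (P - [:0, 1:] * Q)"
      "conway_coeffs (length (c # (p - 2) # qs)) (sum_list (c # (p - 2) # qs)) (e2 (c # (p - 2) # qs)) (P + [:0, 1:] * Q)"
      using conway_coeffs_step[OF P(2) Q(2)] by (simp_all add: algebra_simps)
    then show ?thesis unfolding R_def using val_second_column[OF H(2,3) P(1) Q(1)] by blast
  qed
  have R0: "R []" using val_unlink by (auto simp: R_def conway_coeffs_def intro!: exI[of _ 0])
  have "R ps"
  proof (cases ps)
    case Nil
    then show ?thesis using R0 by simp
  next
    case (Cons p qs)
    note ps = this
    have qs: "R qs" using IH[of qs] 1(2) ps by (auto simp: R_def)
    have "R (1 # qs)"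
    proof (cases qs)
      case Nil
      then show ?thesis using val_single by (auto simp: R_def conway_coeffs_def intro!: exI[of _ 1])
    next
      case (Cons r rs)
      have B: "R (1 # rs)" using IH[of "1 # rs"] 1(2) ps Cons by (auto simp: R_def)
      have M: "R (1 # (-1) # rs)"
      proof -
        obtain P where P: "valW a rs P" "conway_coeffs (length rs) (sum_list rs) (e2 rs) P"
          using IH[of rs] 1(2) ps Cons by auto
        have "valW a (1 # (-1) # rs) P"
          by (rule val_moves[OF _ P(1)]) (use moves_sym[OF T_cancel[of 1 rs]] in \<open>simp add: numeral_2_eq_2\<close>)
        \<comment> \<open>Cancelling the pair raises \<open>e2\<close> by 1 and lowers the number of
          columns by 2, which balances in \<open>2 * e + int n - 1\<close>.\<close>
        moreover have "conway_coeffs (length (1 # (-1) # rs)) (sum_list (1 # (-1) # rs)) (e2 (1 # (-1) # rs)) P"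
          using P(2) by (auto simp: conway_coeffs_def algebra_simps split: if_splits)
        ultimately show ?thesis by (auto simp: R_def)
      qed
      have r: "odd r" using 1(2) ps Cons by simp
      have "R (1 # r # rs)"
        by (rule odd_int_induct[where c = "-1" and p = r and R = "\<lambda>r. R (1 # r # rs)"])
          (use M r second[OF B, of _] in simp_all)
      then show ?thesis using Cons by simp
    qed
    then show ?thesis using reduce[OF qs] 1(2) ps by simp
  qed
  then show ?case by (simp add: R_def)
qed

lemma conway_pretzel:
  assumes "odd (length ps)" "\<And>p. p \<in> set ps \<Longrightarrow> odd p" "orientation_of E (pretzel ps)"
  shows "8 * coeff (conway E) 2 = 2 * e2 ps + int (length ps) - 1"
proof -
  have ps: "ps \<noteq> []" using assms(1) by auto
  \<comment> \<open>The polynomial might depend on the direction \<open>a\<close> of the outer arc,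
    so a function of \<open>a\<close> is chosen; its coefficients up to degree 2 do not depend on
    \<open>a\<close>.\<close>
  obtain P where P: "\<And>a. valW a ps (P a) \<and> conway_coeffs (length ps) (sum_list ps) (e2 ps) (P a)"
    using val_T[OF assms(2)] by metis
  have end_dirs: "e = (\<not> a) \<and> L = [\<not> a, a]"
    if H: "orientable [a, e] (T ps) L" "e = (\<not> a)" for a e L
  proof -
    obtain f g where "L = [f, g]" using orientable_length[OF H(1)] by (auto simp: length_Suc_conv)
    then show ?thesis using orientable_T_ends[OF assms(2), of ps a e f g] H assms(1) by simp
  qed
  have W: "has_conway F (P (hd (fst (F ! 1))))" if F: "orientation_of F (W ps)" for F
  proof -
    have "oriented_tangle [] F []" "map snd F = [(0, Cup)] @ (T ps @ [(0, Cap)])"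
      using F by (auto simp: orientation_of_def W_def)
    then obtain F1 F' r where 1: "F = F1 @ F'" "oriented_tangle [] F1 r" "oriented_tangle r F' []"
      "map snd F1 = [(0, Cup)]" "map snd F' = T ps @ [(0, Cap)]"
      by (rule oriented_tangle_append_map)
    obtain L C s where 2: "F' = L @ C" "oriented_tangle r L s" "oriented_tangle s C []" "map snd L = T ps" "map snd C = [(0, Cap)]"
      by (rule oriented_tangle_append_map[OF 1(3,5)])
    obtain a where a: "F1 = [([], 0, Cup)]" "r = [a, \<not> a]" using 1(2,4) by (auto simp: oriented_simps)
    have s: "s = [\<not> a, a]" using end_dirs[of a "\<not> a" s] 2(2,4) by (auto simp: orientable_def a)
    have C: "C = [([\<not> a, a], 0, Cap)]" using 2(3,5) by (auto simp: oriented_simps s)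
    have "L \<noteq> []" using 2(4) by (cases ps) (auto simp: T.simps(2))
    then have "hd (fst (F ! 1)) = a" using 2(2) by (cases L) (auto simp: 1(1) 2(1) a oriented_tangle_Cons split_paired_all)
    then show ?thesis using valD[OF conjunct1[OF P[of a]], of L] 2 a s C by (simp add: 1(1))
  qed
  obtain F where F: "orientation_of F (W ps)" "\<And>P. has_conway F P \<Longrightarrow> has_conway E P"
    using lift_moves[of "[]" "W ps" "pretzel ps" "[]" "[]" "[]" E] moves_sym[OF pretzel_W[OF ps]] assms(3)
    by (auto simp: orientation_of_def)
  obtain a where "has_conway E (P a)" using W[OF F(1)] F(2) by blast
  then have "conway E = P a" by (rule conway_eq)
  then show ?thesis using P[of a] assms(1) by (simp add: conway_coeffs_def)
qed

lemma pretzel_orientable: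
  assumes "ps \<noteq> []" "\<And>p. p \<in> set ps \<Longrightarrow> odd p"
  shows "\<exists>E. orientation_of E (pretzel ps)"
proof -
  obtain L where "oriented_tangle [True, False] L [False, True]" "map snd L = T ps"
    using orientable_T_exists[OF assms(2), of ps True] by (auto simp: orientable_def)
  moreover have "oriented_tangle [] [([], 0, Cup)] [True, False]" "oriented_tangle [False, True] [([False, True], 0, Cap)] []"
    by (auto simp: oriented_simps)
  ultimately have "oriented_tangle [] ([([], 0, Cup)] @ L @ [([False, True], 0, Cap)]) []"
    "map snd ([([], 0, Cup)] @ L @ [([False, True], 0, Cap)]) = W ps"
    unfolding oriented_tangle_append by (blast, simp add: W_def)
  from lift_moves[OF _ _ _ this, of "pretzel ps" "[]" "[]"] show ?thesis
    using pretzel_W[OF assms(1)] by (auto simp: orientation_of_def)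
qed

lemma a2_pretzel:
  assumes "odd (length ps)" "\<And>p. p \<in> set ps \<Longrightarrow> odd p"
  shows "8 * a2 (pretzel ps) = 2 * e2 ps + int (length ps) - 1"
  unfolding a2_def
  by (rule conway_pretzel[OF assms someI_ex[OF pretzel_orientable]]) (use assms in auto)

section \<open>From lists of columns to indexed sums\<close>

lemma sum_list_upt: "sum_list (map f [m..<n]) = (\<Sum>i\<in>{m..<n}. f i)" for f :: "nat \<Rightarrow> int"
  by (simp only: interv_sum_list_conv_sum_set_nat set_upt)

lemma e2_upt: "e2 (map f [m..<m + n]) = (\<Sum>j\<in>{m..<m + n}. \<Sum>i\<in>{m..<j}. f i * f j)"
proof (induction n)
  case (Suc n)
  have "[m..<m + Suc n] = [m..<m + n] @ [m + n]" by simp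
  then have "e2 (map f [m..<m + Suc n]) = e2 (map f [m..<m + n]) + f (m + n) * sum_list (map f [m..<m + n])"
    by (simp only: map_append list.map e2_snoc)
  then show ?case by (simp add: Suc sum_list_upt sum_distrib_left ac_simps)
qed simp

theorem theorem1p5:
  fixes n :: nat and p :: "nat \<Rightarrow> int" and P :: diagram
  assumes "n > 0" and "odd n"
    and "\<And>i. i \<in> {2..n} \<Longrightarrow> p i > 0 \<and> odd (p i)"
    and "P = pretzel (-1 # map p [2..<n + 1])"
  shows "real (delta_unknotting_number P) =
           - (1 / 4) * (\<Sum>i\<in>{2..n}. real_of_int (p i))
           + (1 / 4) * (\<Sum>j\<in>{2..n}. \<Sum>i\<in>{2..<j}. real_of_int (p i) * real_of_int (p j))
           + (1 / 8) * (real n - 1)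
         \<and> real (delta_unknotting_number P) = real_of_int (a2 P)"
proof -
  obtain m where n: "n = m + 1" "even m" using assms(1,2) by (cases n) auto
  have n1: "n + 1 = 2 + m" using n(1) by simp
  define ps where "ps = map p [2..<2 + m]"
  have len: "length ps = m" by (simp only: ps_def length_map length_upt diff_add_inverse)
  have ps: "odd r \<and> r > 0" if "r \<in> set ps" for r
    using that assms(3) n(1) by (auto simp: ps_def)
  have P: "P = pretzel (-1 # ps)" by (simp only: assms(4) ps_def n1)
  have u: "8 * int (delta_unknotting_number P) = 2 * (e2 ps - sum_list ps) + int m"
    using delta_unknotting_number_pretzel[OF _ ps] len n(2) P by simp
  have a: "8 * a2 P = 2 * (e2 ps - sum_list ps) + int m"
  proof -
    have "odd r" if "r \<in> set (-1 # ps)" for r using that ps by auto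
    from a2_pretzel[of "-1 # ps", OF _ this] show ?thesis using len n(2) by (simp add: P)
  qed
  have "e2 ps = (\<Sum>j\<in>{2..n}. \<Sum>i\<in>{2..<j}. p i * p j)" "sum_list ps = (\<Sum>i\<in>{2..n}. p i)"
  proof -
    have "{2..n} = {2..<2 + m}" using n(1) by auto
    then show "e2 ps = (\<Sum>j\<in>{2..n}. \<Sum>i\<in>{2..<j}. p i * p j)" "sum_list ps = (\<Sum>i\<in>{2..n}. p i)"
      by (simp_all only: ps_def e2_upt sum_list_upt)
  qed
  then have s: "real_of_int (e2 ps) = (\<Sum>j\<in>{2..n}. \<Sum>i\<in>{2..<j}. real_of_int (p i) * real_of_int (p j))"
    "real_of_int (sum_list ps) = (\<Sum>i\<in>{2..n}. real_of_int (p i))" by simp_all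
  have "8 * real (delta_unknotting_number P) = 2 * (real_of_int (e2 ps) - real_of_int (sum_list ps)) + real m"
    using arg_cong[OF u, of real_of_int] by simp
  moreover have "int (delta_unknotting_number P) = a2 P" using u a by simp
  then have "real (delta_unknotting_number P) = real_of_int (a2 P)" by (metis of_int_of_nat_eq)
  ultimately show ?thesis unfolding s using n(1) by simp
qed

end
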